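(* Let $\alpha,\epsilon>0$, $\beta=\alpha\epsilon$, $T>0$, $d\in\{1,2,3\}$, $\Omega=(0,1)^d$, and let $C_1,C_2>0$ be constants. Let $\boldsymbol\Phi:\overline\Omega\times[0,T]\to\mathbb S^2\subset\mathbb R^3$ be a sufficiently smooth exact solution (i.e. of class $C^r$ for a suitable fixed integer $r$) of $$\boldsymbol m_t=-\alpha\,\boldsymbol m\times\big(\boldsymbol m\times(\epsilon\Delta\boldsymbol m+\boldsymbol f)\big)\ \text{in }\Omega,\qquad \frac{\partial\boldsymbol m}{\partial\boldsymbol\nu}=0\ \text{on }\partial\Omega .$$ Let $\boldsymbol m^n$ ($n\ge 0$) be the numerical solution, with time step $k$ and mesh size $h$, generated by the third-order IMEX Runge-Kutta scheme described in the context, with initial data satisfying $$\|P_h\boldsymbol\Phi(\cdot,t_0)-\boldsymbol m^0\|_2+\big(k\|\nabla_h(P_h\boldsymbol\Phi(\cdot,t_0)-\boldsymbol m^0)\|_2^2\big)^{1/2}=O(h^4).$$ Then there is a constant $C'>0$, independent of $k$ and $h$ and depending only on the constant $\tilde M$ defined in the context, such that, under the linear refinement assumption $C_1h\le k\le C_2h$ and the condition $k\le C'h$, as $k,h\to0$ (i.e. for all sufficiently small such $k,h$) one has, for all $1\le n\le\lfloor T/k\rfloor$, $$\|\boldsymbol\Phi(\cdot,t_n)-\boldsymbol m^n\|_2+\big(k\|\nabla_h(\boldsymbol\Phi(\cdot,t_n)-\boldsymbol m^n)\|_2^2\big)^{1/2}\le C(k^3+h^2),$$ where $C>0$ is independent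 of $k$ and $h$ (and $\boldsymbol\Phi(\cdot,t_n)$ is identified with its grid values).
   Context: Grid. $h=1/N$; the grid points in each coordinate direction are $(i-\tfrac12)h$, $i=1,\dots,N$, with ghost points $i=0,N+1$. Grid functions are $\mathbb R^3$-valued and satisfy the discrete homogeneous Neumann condition: in each direction the value at index $0$ equals that at index $1$ and the value at index $N+1$ equals that at index $N$. $\Delta_h$ is the standard $(2d+1)$-point centered difference Laplacian. $\nabla_h$ is the discrete gradient whose entries are the one-step differences $(\boldsymbol m_{i+1}-\boldsymbol m_i)/h$ in each coordinate direction (located at midpoints), so that $\langle-\Delta_h\boldsymbol f_h,\boldsymbol g_h\rangle=\langle\nabla_h\boldsymbol f_h,\nabla_h\boldsymbol g_h\rangle$. $A_h\nabla_h$ is the second-order averaged gradient at grid points: the average of the two neighbouring one-step differences in each direction, i.e. $(\boldsymbol m_{i+1}-\boldsymbol m_{i-1})/(2h)$. $\langle\boldsymbol f_h,\boldsymbol g_h\rangle=h^d\sum_I\boldsymbol f_I\cdot\boldsymbol g_I$, $\|\boldsymbol f_h\|_2=\langle\boldsymbol f_h,\boldsymbol f_h\rangle^{1/2}$ (and analogously for $\nabla_h\boldsymbol f_h$), $\|\boldsymbol f_h\|_\infty=\max_I\|\boldsymbol f_I\|_\infty$. $P_h$ denotes evaluation at the grid points. $t_n=nk$. Scheme. $\boldsymbol f$ is a given bounded, smooth external force field ($\|\boldsymbol f\|_\infty\le C_0$), and $$N_h(\boldsymbol m)=\beta|A_h\nabla_h\boldsymbol m|^2\boldsymbol m-\alpha\,\boldsymbol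 m\times(\boldsymbol m\times\boldsymbol f),\qquad L_h(\boldsymbol m)=\beta\Delta_h\boldsymbol m .$$ Given $\boldsymbol m_n=\boldsymbol m^n$, one step of the scheme defines $\tilde{\boldsymbol m}_1=\boldsymbol m_n$ and $$\tilde{\boldsymbol m}_2=\tilde{\boldsymbol m}_1+0.6250kN_h(\tilde{\boldsymbol m}_1)+0.6250kL_h(\tilde{\boldsymbol m}_2),$$ $$\tilde{\boldsymbol m}_3=\tilde{\boldsymbol m}_1+0.1706kN_h(\tilde{\boldsymbol m}_1)+0.1429kN_h(\tilde{\boldsymbol m}_2)-0.2359kL_h(\tilde{\boldsymbol m}_2)+0.5494kL_h(\tilde{\boldsymbol m}_3),$$ $$\tilde{\boldsymbol m}_4=\tilde{\boldsymbol m}_1+0.4500kN_h(\tilde{\boldsymbol m}_2)+0.5500kN_h(\tilde{\boldsymbol m}_3)+0.0850kL_h(\tilde{\boldsymbol m}_2)+0.6819kL_h(\tilde{\boldsymbol m}_3)+0.2331kL_h(\tilde{\boldsymbol m}_4),$$ $$\boldsymbol m_{n+1}=\tilde{\boldsymbol m}_1+0.0850kN_h(\tilde{\boldsymbol m}_2)+0.6819kN_h(\tilde{\boldsymbol m}_3)+0.2331kN_h(\tilde{\boldsymbol m}_4)+0.0850kL_h(\tilde{\boldsymbol m}_2)+0.6819kL_h(\tilde{\boldsymbol m}_3)+0.2331kL_h(\tilde{\boldsymbol m}_4).$$ The four-digit coefficients are the paper's abbreviation, for convenience, of the coefficients $0.62500000$; $0.17055712$, $0.14291640$, $-0.23587004$,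 $0.54934357$; $0.45000000$, $0.55000000$; $0.08500000$, $0.68187464$, $0.23312535$, which were chosen to satisfy the third-order IMEX Runge-Kutta order conditions. The constant $\tilde M$. Write $\boldsymbol\Phi_t=\beta|A_h\nabla_h\boldsymbol\Phi|^2\boldsymbol\Phi-\alpha\boldsymbol\Phi\times(\boldsymbol\Phi\times\boldsymbol f)+\beta\Delta_h\boldsymbol\Phi+h^2\boldsymbol g^{(2)}+O(h^4)$ (Taylor expansion, $\boldsymbol g^{(2)}$ smooth and depending only on derivatives of $\boldsymbol\Phi$). Let $\boldsymbol\Phi^{(1)}$ solve, with zero initial data and homogeneous Neumann boundary condition, the linear parabolic problem $$\partial_t\boldsymbol\Phi^{(1)}=\beta\Delta\boldsymbol\Phi^{(1)}+\beta\big(|\nabla\boldsymbol\Phi|^2\boldsymbol\Phi^{(1)}+2(\nabla\boldsymbol\Phi\cdot\nabla\boldsymbol\Phi^{(1)})\boldsymbol\Phi\big)-\alpha\big(\boldsymbol\Phi\times(\boldsymbol\Phi^{(1)}\times\boldsymbol f)+\boldsymbol\Phi^{(1)}\times(\boldsymbol\Phi\times\boldsymbol f)\big)-\boldsymbol g^{(2)},$$ and put $\underline{\boldsymbol\Phi}=\boldsymbol\Phi+h^2\boldsymbol\Phi^{(1)}$, $\underline{\boldsymbol\Phi}^n=\underline{\boldsymbol\Phi}(\cdot,t_n)$. Let $\tilde{\boldsymbol\Phi}^{n,(j)}$, $j=2,3,4$, be obtained from $\underline{\boldsymbol\Phi}^n$ by the same formulas by which $\tilde{\boldsymbol m}_j$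 is obtained from $\boldsymbol m_n$. Let $C^*$ be a constant bounding $\|\nabla_h\underline{\boldsymbol\Phi}^n\|_\infty$ and $\|\nabla_h\tilde{\boldsymbol\Phi}^{n,(j)}\|_\infty$ (while $\|\underline{\boldsymbol\Phi}^n\|_\infty,\|\tilde{\boldsymbol\Phi}^{n,(j)}\|_\infty\le\frac98$), and $\tilde C=C^*+1$. Then $\tilde M$ is a constant depending only on $\alpha,\beta,C^*,\tilde C,\boldsymbol f$ such that, with $\tilde{\boldsymbol\Phi}^{n,(1)}=\underline{\boldsymbol\Phi}^n$, whenever $\|\tilde{\boldsymbol m}_j\|_\infty\le\frac54$ and $\|\nabla_h\tilde{\boldsymbol m}_j\|_\infty\le\tilde C$ one has $\|N_h(\tilde{\boldsymbol\Phi}^{n,(j)})-N_h(\tilde{\boldsymbol m}_j)\|_2\le\tilde M(\|\tilde{\boldsymbol\Phi}^{n,(j)}-\tilde{\boldsymbol m}_j\|_2+\|\nabla_h(\tilde{\boldsymbol\Phi}^{n,(j)}-\tilde{\boldsymbol m}_j)\|_2)$, $j=1,\dots,4$.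
   Formalization: The printed eight-digit coefficients do not satisfy the order conditions (the weights sum to 0.99999999, so the scheme would be inconsistent); the coefficients are instead any reals that satisfy the third-order conditions exactly and lie within 10^-8 of the printed decimals. *)

theory Defs
  imports "HOL-Analysis.Analysis" "HOL-Analysis.Cross3"
begin

section \<open>Smooth functions and derivatives on a closed domain\<close>

text \<open>
  \<open>Ck_on r S u\<close>: class \<open>C\<^sup>r\<close> on \<open>S\<close>, derivatives taken within \<open>S\<close>.  It is used for closed boxes only,
  where it says that the partial derivatives up to order \<open>r\<close> extend continuously to the boundary.
  The function \<open>u' b\<close> is the partial derivative in the direction of the basis vector \<open>b\<close>.
\<close>

primrec Ck_on :: "nat \<Rightarrow> 'a::euclidean_space set \<Rightarrow> ('a \<Rightarrow> 'b::real_normed_vector) \<Rightarrow> bool" where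
  "Ck_on 0 S u \<longleftrightarrow> continuous_on S u"
| "Ck_on (Suc r) S u \<longleftrightarrow>
     (\<exists>u'. (\<forall>b\<in>Basis. Ck_on r S (u' b)) \<and>
           (\<forall>x\<in>S. (u has_derivative (\<lambda>v. \<Sum>b\<in>Basis. (v \<bullet> b) *\<^sub>R u' b x)) (at x within S)))"

abbreviation Omega :: "(real^'d) set" where "Omega \<equiv> box 0 One"

abbreviation Omega_bar :: "(real^'d) set" where "Omega_bar \<equiv> cbox 0 One"

text \<open>Derivatives within \<open>Omega_bar\<close>; at boundary points they are one-sided.\<close>

definition pd :: "'d::finite \<Rightarrow> (real^'d \<Rightarrow> real^3) \<Rightarrow> real^'d \<Rightarrow> real^3" where
  "pd i u x = frechet_derivative u (at x within Omega_bar) (axis i 1)"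

definition lap :: "(real^'d::finite \<Rightarrow> real^3) \<Rightarrow> real^'d \<Rightarrow> real^3" where
  "lap u x = (\<Sum>i\<in>UNIV. pd i (pd i u) x)"

definition dt :: "real \<Rightarrow> (real^'d \<Rightarrow> real \<Rightarrow> real^3) \<Rightarrow> real^'d \<Rightarrow> real \<Rightarrow> real^3" where
  "dt T u x t = vector_derivative (u x) (at t within {0..T})"

definition neumann :: "(real^'d::finite \<Rightarrow> real^3) \<Rightarrow> bool" where
  "neumann u \<longleftrightarrow> (\<forall>x\<in>Omega_bar. \<forall>i. x $ i = 0 \<or> x $ i = 1 \<longrightarrow> pd i u x = 0)"


section \<open>The continuous problems\<close>

definition external_field :: "(real^'d::finite \<Rightarrow> real^3) \<Rightarrow> bool" where
  "external_field f \<longleftrightarrow> (\<forall>r. Ck_on r Omega_bar f) \<and> (\<exists>C0. \<forall>x\<in>Omega_bar. infnorm (f x) \<le> C0)"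

definition exact_solution ::
  "nat \<Rightarrow> real \<Rightarrow> real \<Rightarrow> (real^'d::finite \<Rightarrow> real^3) \<Rightarrow> real \<Rightarrow> (real^'d \<Rightarrow> real \<Rightarrow> real^3) \<Rightarrow> bool" where
  "exact_solution r \<alpha> \<epsilon> f T \<Phi> \<longleftrightarrow>
     Ck_on r (Omega_bar \<times> {0..T}) (\<lambda>(x, t). \<Phi> x t) \<and>
     (\<forall>x\<in>Omega_bar. \<forall>t\<in>{0..T}. norm (\<Phi> x t) = 1) \<and>
     (\<forall>x\<in>Omega. \<forall>t\<in>{0..T}.
        dt T \<Phi> x t =
          - \<alpha> *\<^sub>R cross3 (\<Phi> x t) (cross3 (\<Phi> x t) (\<epsilon> *\<^sub>R lap (\<lambda>y. \<Phi> y t) x + f x))) \<and>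
     (\<forall>t\<in>{0..T}. neumann (\<lambda>y. \<Phi> y t))"

text \<open>
  The \<open>h\<^sup>2\<close> coefficient in the expansion of
  \<open>\<Phi>\<^sub>t - \<beta>|A\<^sub>h\<nabla>\<^sub>h\<Phi>|\<^sup>2\<Phi> + \<alpha>\<Phi>\<times>(\<Phi>\<times>f) - \<beta>\<Delta>\<^sub>h\<Phi>\<close> for the exact solution.  It results from
  \<open>(u(x+h) - u(x-h))/(2h) = u' + h\<^sup>2/6 u''' + O(h\<^sup>4)\<close> and
  \<open>(u(x+h) - 2u(x) + u(x-h))/h\<^sup>2 = u'' + h\<^sup>2/12 u'''' + O(h\<^sup>4)\<close> in each direction.
\<close>

definition g2 :: "real \<Rightarrow> (real^'d::finite \<Rightarrow> real^3) \<Rightarrow> real^'d \<Rightarrow> real^3" where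
  "g2 \<beta> u x =
     - (\<beta> / 3) *\<^sub>R ((\<Sum>i\<in>UNIV. pd i u x \<bullet> pd i (pd i (pd i u)) x) *\<^sub>R u x)
     - (\<beta> / 12) *\<^sub>R (\<Sum>i\<in>UNIV. pd i (pd i (pd i (pd i u))) x)"

text \<open>
  The linear problem for \<open>\<Phi>\<^sup>(\<^sup>1\<^sup>)\<close> (\<open>\<Phi>1\<close> in \<open>correction\<close>) is solved in the classical sense:
  two derivatives in space and one in time, continuous on the closed cylinder.
\<close>

definition C21_on_cylinder :: "real \<Rightarrow> (real^'d::finite \<Rightarrow> real \<Rightarrow> real^3) \<Rightarrow> bool" where
  "C21_on_cylinder T u \<longleftrightarrow>
     (\<forall>t\<in>{0..T}. Ck_on 2 Omega_bar (\<lambda>x. u x t)) \<and>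
     (\<forall>x\<in>Omega_bar. u x differentiable_on {0..T}) \<and>
     continuous_on (Omega_bar \<times> {0..T}) (\<lambda>(x, t). u x t) \<and>
     (\<forall>i. continuous_on (Omega_bar \<times> {0..T}) (\<lambda>(x, t). pd i (\<lambda>y. u y t) x)) \<and>
     (\<forall>i j. continuous_on (Omega_bar \<times> {0..T}) (\<lambda>(x, t). pd i (pd j (\<lambda>y. u y t)) x)) \<and>
     continuous_on (Omega_bar \<times> {0..T}) (\<lambda>(x, t). dt T u x t)"

definition correction ::
  "real \<Rightarrow> real \<Rightarrow> (real^'d::finite \<Rightarrow> real^3) \<Rightarrow> real \<Rightarrow> (real^'d \<Rightarrow> real \<Rightarrow> real^3) \<Rightarrow>
   (real^'d \<Rightarrow> real \<Rightarrow> real^3) \<Rightarrow> bool" where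
  "correction \<alpha> \<beta> f T \<Phi> \<Phi>1 \<longleftrightarrow>
     C21_on_cylinder T \<Phi>1 \<and>
     (\<forall>x\<in>Omega_bar. \<Phi>1 x 0 = 0) \<and>
     (\<forall>t\<in>{0..T}. neumann (\<lambda>y. \<Phi>1 y t)) \<and>
     (\<forall>x\<in>Omega. \<forall>t\<in>{0..T}.
        dt T \<Phi>1 x t =
          \<beta> *\<^sub>R lap (\<lambda>y. \<Phi>1 y t) x
          + \<beta> *\<^sub>R ((\<Sum>i\<in>UNIV. (norm (pd i (\<lambda>y. \<Phi> y t) x))\<^sup>2) *\<^sub>R \<Phi>1 x t
                   + (2 * (\<Sum>i\<in>UNIV. pd i (\<lambda>y. \<Phi> y t) x \<bullet> pd i (\<lambda>y. \<Phi>1 y t) x)) *\<^sub>R \<Phi> x t)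
          - \<alpha> *\<^sub>R (cross3 (\<Phi> x t) (cross3 (\<Phi>1 x t) (f x))
                   + cross3 (\<Phi>1 x t) (cross3 (\<Phi> x t) (f x)))
          - g2 \<beta> (\<lambda>y. \<Phi> y t) x)"


section \<open>Grid functions\<close>

text \<open>
  The mesh size is \<open>h = 1/N\<close>.  A multi-index assigns to each coordinate direction an index
  \<open>0,\<dots>,N+1\<close>, where \<open>0\<close> and \<open>N+1\<close> are ghost indices.
\<close>

type_synonym 'd gridfun = "('d \<Rightarrow> nat) \<Rightarrow> real^3"

definition grid :: "nat \<Rightarrow> ('d \<Rightarrow> nat) set" where
  "grid N = {I. \<forall>i. 1 \<le> I i \<and> I i \<le> N}"

definition grid_point :: "nat \<Rightarrow> ('d \<Rightarrow> nat) \<Rightarrow> real^'d" where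
  "grid_point N I = (\<chi> i. (real (I i) - 1/2) / real N)"

definition discrete_neumann :: "nat \<Rightarrow> 'd gridfun \<Rightarrow> bool" where
  "discrete_neumann N u \<longleftrightarrow>
     (\<forall>I i. (\<forall>j. j \<noteq> i \<longrightarrow> 1 \<le> I j \<and> I j \<le> N) \<longrightarrow>
        u (I(i := 0)) = u (I(i := 1)) \<and> u (I(i := N + 1)) = u (I(i := N)))"

text \<open>
  Evaluation at the grid points.  The ghost values are those given by the discrete Neumann
  condition, which is what clamping the indices to \<open>1,\<dots>,N\<close> does.
\<close>

definition P_h :: "nat \<Rightarrow> (real^'d \<Rightarrow> real^3) \<Rightarrow> 'd gridfun" where
  "P_h N u I = u (grid_point N (\<lambda>i. max 1 (min N (I i))))"

text \<open>
  \<open>grad_h N u i I\<close> is located at the midpoint between \<open>I\<close> and its upper neighbour in direction \<open>i\<close>;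
  \<open>midpoints N i\<close> are the midpoints in direction \<open>i\<close>, including those on the boundary.
\<close>

definition grad_h :: "nat \<Rightarrow> 'd gridfun \<Rightarrow> 'd \<Rightarrow> 'd gridfun" where
  "grad_h N u i I = real N *\<^sub>R (u (I(i := I i + 1)) - u I)"

definition midpoints :: "nat \<Rightarrow> 'd \<Rightarrow> ('d \<Rightarrow> nat) set" where
  "midpoints N i = {I. I i \<le> N \<and> (\<forall>j. j \<noteq> i \<longrightarrow> 1 \<le> I j \<and> I j \<le> N)}"

definition avg_grad_h :: "nat \<Rightarrow> 'd gridfun \<Rightarrow> 'd \<Rightarrow> 'd gridfun" where
  "avg_grad_h N u i I = (1/2) *\<^sub>R (grad_h N u i I + grad_h N u i (I(i := I i - 1)))"

definition lap_h :: "nat \<Rightarrow> ('d::finite) gridfun \<Rightarrow> 'd gridfun" where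
  "lap_h N u I =
     (\<Sum>i\<in>UNIV. (real N)\<^sup>2 *\<^sub>R (u (I(i := I i + 1)) - 2 *\<^sub>R u I + u (I(i := I i - 1))))"

definition inner_h :: "nat \<Rightarrow> ('d::finite) gridfun \<Rightarrow> 'd gridfun \<Rightarrow> real" where
  "inner_h N u v = (1 / real N) ^ CARD('d) * (\<Sum>I\<in>grid N. u I \<bullet> v I)"

definition norm2_h :: "nat \<Rightarrow> ('d::finite) gridfun \<Rightarrow> real" where
  "norm2_h N u = sqrt (inner_h N u u)"

definition norm_inf_h :: "nat \<Rightarrow> ('d::finite) gridfun \<Rightarrow> real" where
  "norm_inf_h N u = Max ((\<lambda>I. infnorm (u I)) ` grid N)"

definition grad_inner_h ::
  "nat \<Rightarrow> ('d::finite \<Rightarrow> 'd gridfun) \<Rightarrow> ('d \<Rightarrow> 'd gridfun) \<Rightarrow> real" where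
  "grad_inner_h N p q =
     (1 / real N) ^ CARD('d) * (\<Sum>i\<in>UNIV. \<Sum>I\<in>midpoints N i. p i I \<bullet> q i I)"

definition grad_norm2_h :: "nat \<Rightarrow> ('d::finite \<Rightarrow> 'd gridfun) \<Rightarrow> real" where
  "grad_norm2_h N p = sqrt (grad_inner_h N p p)"

definition grad_norm_inf_h :: "nat \<Rightarrow> ('d::finite \<Rightarrow> 'd gridfun) \<Rightarrow> real" where
  "grad_norm_inf_h N p = Max (\<Union>i. (\<lambda>I. infnorm (p i I)) ` midpoints N i)"

definition energy_norm_h :: "nat \<Rightarrow> real \<Rightarrow> ('d::finite) gridfun \<Rightarrow> real" where
  "energy_norm_h N k u = norm2_h N u + sqrt (k * (grad_norm2_h N (grad_h N u))\<^sup>2)"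


section \<open>The scheme\<close>

text \<open>
  The coefficients are printed to eight digits, but these decimals do not themselves satisfy the
  order conditions (the printed weights sum to \<open>0.99999999\<close>, so the scheme with exactly these
  coefficients would not even be consistent).  The coefficients are therefore real numbers that
  satisfy the order conditions exactly and have the printed decimals as eight-digit
  approximations, by rounding or truncation.
\<close>

record imex_coeffs =
  c_a21 :: real
  c_a31 :: real
  c_a32 :: real
  c_s32 :: real
  c_s33 :: real
  c_a42 :: real
  c_a43 :: real
  c_b2 :: real
  c_b3 :: real
  c_b4 :: real

text \<open>Butcher tableaux, stages numbered from 1: explicit part, implicit part, common weights.\<close>

definition tabE :: "imex_coeffs \<Rightarrow> nat \<Rightarrow> nat \<Rightarrow> real" where
  "tabE c i j =
     [[0,       0,       0,       0],
      [c_a21 c, 0,       0,       0],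
      [c_a31 c, c_a32 c, 0,       0],
      [0,       c_a42 c, c_a43 c, 0]] ! (i - 1) ! (j - 1)"

definition tabI :: "imex_coeffs \<Rightarrow> nat \<Rightarrow> nat \<Rightarrow> real" where
  "tabI c i j =
     [[0, 0,       0,       0],
      [0, c_a21 c, 0,       0],
      [0, c_s32 c, c_s33 c, 0],
      [0, c_b2 c,  c_b3 c,  c_b4 c]] ! (i - 1) ! (j - 1)"

definition wt :: "imex_coeffs \<Rightarrow> nat \<Rightarrow> real" where
  "wt c j = [0, c_b2 c, c_b3 c, c_b4 c] ! (j - 1)"

definition abscissa :: "(nat \<Rightarrow> nat \<Rightarrow> real) \<Rightarrow> nat \<Rightarrow> real" where
  "abscissa A i = (\<Sum>j=1..4. A i j)"

definition third_order_conditions :: "imex_coeffs \<Rightarrow> bool" where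
  "third_order_conditions c \<longleftrightarrow>
     (\<Sum>i=1..4. wt c i) = 1 \<and>
     (\<forall>A\<in>{tabE c, tabI c}. (\<Sum>i=1..4. wt c i * abscissa A i) = 1/2) \<and>
     (\<forall>A\<in>{tabE c, tabI c}. \<forall>B\<in>{tabE c, tabI c}.
        (\<Sum>i=1..4. wt c i * abscissa A i * abscissa B i) = 1/3 \<and>
        (\<Sum>i=1..4. \<Sum>j=1..4. wt c i * A i j * abscissa B j) = 1/6)"

definition printed_as :: "real \<Rightarrow> real \<Rightarrow> bool" where
  "printed_as x p \<longleftrightarrow> \<bar>x - p\<bar> < 1 / 10^8"

definition scheme_coeffs :: "imex_coeffs \<Rightarrow> bool" where
  "scheme_coeffs c \<longleftrightarrow>
     third_order_conditions c \<and>
     printed_as (c_a21 c) 0.62500000 \<and>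
     printed_as (c_a31 c) 0.17055712 \<and> printed_as (c_a32 c) 0.14291640 \<and>
     printed_as (c_s32 c) (- 0.23587004) \<and> printed_as (c_s33 c) 0.54934357 \<and>
     printed_as (c_a42 c) 0.45000000 \<and> printed_as (c_a43 c) 0.55000000 \<and>
     printed_as (c_b2 c) 0.08500000 \<and> printed_as (c_b3 c) 0.68187464 \<and>
     printed_as (c_b4 c) 0.23312535"

text \<open>
  Such coefficients exist: if \<open>0.625\<close>, \<open>0.45\<close>, \<open>0.55\<close> and \<open>0.085\<close> are taken as exact, then the order
  conditions determine the others.
\<close>

lemma scheme_coeffs_exact:
  "scheme_coeffs
     \<lparr>c_a21 = 5/8, c_a31 = 105305665/617421672, c_a32 = 11029960/77177709,
      c_s32 = - 530/2247, c_s33 = 9875/17976, c_a42 = 9/20, c_a43 = 11/20,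
      c_b2 = 17/200, c_b3 = 240429/352600, c_b4 = 411/1763\<rparr>"
  by (simp add: scheme_coeffs_def third_order_conditions_def printed_as_def abscissa_def
      tabE_def tabI_def wt_def sum.atLeast_Suc_atMost eval_nat_numeral(2-3) abs_if)

definition N_h ::
  "real \<Rightarrow> real \<Rightarrow> (real^'d \<Rightarrow> real^3) \<Rightarrow> nat \<Rightarrow> ('d::finite) gridfun \<Rightarrow> 'd gridfun" where
  "N_h \<alpha> \<beta> f N u I =
     \<beta> *\<^sub>R ((\<Sum>i\<in>UNIV. (norm (avg_grad_h N u i I))\<^sup>2) *\<^sub>R u I)
     - \<alpha> *\<^sub>R cross3 (u I) (cross3 (u I) (f (grid_point N I)))"

definition L_h :: "real \<Rightarrow> nat \<Rightarrow> ('d::finite) gridfun \<Rightarrow> 'd gridfun" where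
  "L_h \<beta> N u I = \<beta> *\<^sub>R lap_h N u I"

text \<open>\<open>s 1, \<dots>, s 4\<close> are the stages of one step of size \<open>k\<close> starting from \<open>u\<close>.\<close>

definition imex_stages ::
  "imex_coeffs \<Rightarrow> real \<Rightarrow> real \<Rightarrow> (real^'d \<Rightarrow> real^3) \<Rightarrow> nat \<Rightarrow> real \<Rightarrow>
   ('d::finite) gridfun \<Rightarrow> (nat \<Rightarrow> 'd gridfun) \<Rightarrow> bool" where
  "imex_stages c \<alpha> \<beta> f N k u s \<longleftrightarrow>
     s 1 = u \<and>
     (\<forall>j\<in>{1..4}. discrete_neumann N (s j)) \<and>
     (\<forall>i\<in>{2..4}. \<forall>I\<in>grid N.
        s i I = s 1 I + (\<Sum>j=1..4. (tabE c i j * k) *\<^sub>R N_h \<alpha> \<beta> f N (s j) I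
                                 + (tabI c i j * k) *\<^sub>R L_h \<beta> N (s j) I))"

definition imex_step ::
  "imex_coeffs \<Rightarrow> real \<Rightarrow> real \<Rightarrow> (real^'d \<Rightarrow> real^3) \<Rightarrow> nat \<Rightarrow> real \<Rightarrow>
   ('d::finite) gridfun \<Rightarrow> 'd gridfun \<Rightarrow> bool" where
  "imex_step c \<alpha> \<beta> f N k u v \<longleftrightarrow>
     discrete_neumann N v \<and>
     (\<exists>s. imex_stages c \<alpha> \<beta> f N k u s \<and>
        (\<forall>I\<in>grid N.
           v I = s 1 I + (\<Sum>j=1..4. (wt c j * k) *\<^sub>R N_h \<alpha> \<beta> f N (s j) I
                                  + (wt c j * k) *\<^sub>R L_h \<beta> N (s j) I)))"

text \<open>Numerical solutions for all \<open>N\<close> and \<open>k\<close>: \<open>m N k n\<close> is \<open>m\<^sup>n\<close> on the grid with \<open>h = 1/N\<close>.\<close>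

definition numerical_solution ::
  "imex_coeffs \<Rightarrow> real \<Rightarrow> real \<Rightarrow> (real^'d \<Rightarrow> real^3) \<Rightarrow>
   (nat \<Rightarrow> real \<Rightarrow> nat \<Rightarrow> ('d::finite) gridfun) \<Rightarrow> bool" where
  "numerical_solution c \<alpha> \<beta> f m \<longleftrightarrow>
     (\<forall>N k. N \<ge> 1 \<longrightarrow> k > 0 \<longrightarrow>
        discrete_neumann N (m N k 0) \<and>
        (\<forall>n. imex_step c \<alpha> \<beta> f N k (m N k n) (m N k (Suc n))))"

text \<open>
  \<open>P N k\<close> holds for all sufficiently small \<open>k\<close> and \<open>h = 1/N\<close> with \<open>C1 h \<le> k \<le> C2 h\<close>.
\<close>

definition for_small :: "real \<Rightarrow> real \<Rightarrow> (nat \<Rightarrow> real \<Rightarrow> bool) \<Rightarrow> bool" where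
  "for_small C1 C2 P \<longleftrightarrow>
     (\<exists>\<delta>>0. \<forall>N k. N \<ge> 1 \<longrightarrow> 1 / real N < \<delta> \<longrightarrow> 0 < k \<longrightarrow> k < \<delta> \<longrightarrow>
        C1 * (1 / real N) \<le> k \<longrightarrow> k \<le> C2 * (1 / real N) \<longrightarrow> P N k)"

definition error_h ::
  "(real^'d::finite \<Rightarrow> real \<Rightarrow> real^3) \<Rightarrow> (nat \<Rightarrow> real \<Rightarrow> nat \<Rightarrow> 'd gridfun) \<Rightarrow>
   nat \<Rightarrow> real \<Rightarrow> nat \<Rightarrow> real" where
  "error_h \<Phi> m N k n =
     energy_norm_h N k (\<lambda>I. P_h N (\<lambda>x. \<Phi> x (real n * k)) I - m N k n I)"

definition initial_error_h4 ::
  "real \<Rightarrow> real \<Rightarrow> (real^'d::finite \<Rightarrow> real \<Rightarrow> real^3) \<Rightarrow>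
   (nat \<Rightarrow> real \<Rightarrow> nat \<Rightarrow> 'd gridfun) \<Rightarrow> bool" where
  "initial_error_h4 C1 C2 \<Phi> m \<longleftrightarrow>
     (\<exists>K. for_small C1 C2 (\<lambda>N k. error_h \<Phi> m N k 0 \<le> K * (1 / real N)^4))"


section \<open>The constants C* and \<open>M~\<close>\<close>

definition Phi_under ::
  "(real^'d \<Rightarrow> real \<Rightarrow> real^3) \<Rightarrow> (real^'d \<Rightarrow> real \<Rightarrow> real^3) \<Rightarrow>
   nat \<Rightarrow> real \<Rightarrow> nat \<Rightarrow> ('d::finite) gridfun" where
  "Phi_under \<Phi> \<Phi>1 N k n =
     P_h N (\<lambda>x. \<Phi> x (real n * k) + (1 / real N)\<^sup>2 *\<^sub>R \<Phi>1 x (real n * k))"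

definition stage_gradient_bound ::
  "imex_coeffs \<Rightarrow> real \<Rightarrow> real \<Rightarrow> (real^'d::finite \<Rightarrow> real^3) \<Rightarrow> real \<Rightarrow> real \<Rightarrow> real \<Rightarrow>
   (real^'d \<Rightarrow> real \<Rightarrow> real^3) \<Rightarrow> (real^'d \<Rightarrow> real \<Rightarrow> real^3) \<Rightarrow> real \<Rightarrow> bool" where
  "stage_gradient_bound c \<alpha> \<beta> f T C1 C2 \<Phi> \<Phi>1 Cs \<longleftrightarrow>
     for_small C1 C2 (\<lambda>N k. \<forall>n\<le>nat \<lfloor>T / k\<rfloor>. \<forall>s.
       imex_stages c \<alpha> \<beta> f N k (Phi_under \<Phi> \<Phi>1 N k n) s \<longrightarrow>
       (\<forall>j\<in>{1..4}. norm_inf_h N (s j) \<le> 9/8 \<and> grad_norm_inf_h N (grad_h N (s j)) \<le> Cs))"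

text \<open>
  \<open>M\<close> is an admissible value of the constant \<open>M~\<close>.  That it depends on \<open>\<alpha>\<close>, \<open>\<beta> = \<alpha> \<epsilon>\<close>, \<open>Cs = C*\<close>,
  \<open>Ct = C~\<close> and \<open>f\<close> only is expressed by the position of \<open>M\<close>: the same \<open>M\<close> serves all exact
  solutions and all numerical solutions for these parameters.
\<close>

definition lipschitz_constant ::
  "nat \<Rightarrow> imex_coeffs \<Rightarrow> real \<Rightarrow> real \<Rightarrow> (real^'d::finite \<Rightarrow> real^3) \<Rightarrow> real \<Rightarrow> real \<Rightarrow> real \<Rightarrow> bool" where
  "lipschitz_constant r c \<alpha> \<epsilon> f Cs Ct M \<longleftrightarrow>
     M > 0 \<and>
     (\<forall>T C1 C2 \<Phi> \<Phi>1 m.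
        T > 0 \<longrightarrow> C1 > 0 \<longrightarrow> C2 > 0 \<longrightarrow>
        exact_solution r \<alpha> \<epsilon> f T \<Phi> \<longrightarrow>
        correction \<alpha> (\<alpha> * \<epsilon>) f T \<Phi> \<Phi>1 \<longrightarrow>
        stage_gradient_bound c \<alpha> (\<alpha> * \<epsilon>) f T C1 C2 \<Phi> \<Phi>1 Cs \<longrightarrow>
        numerical_solution c \<alpha> (\<alpha> * \<epsilon>) f m \<longrightarrow>
        initial_error_h4 C1 C2 \<Phi> m \<longrightarrow>
        for_small C1 C2 (\<lambda>N k. \<forall>n\<le>nat \<lfloor>T / k\<rfloor>. \<forall>s w.
          imex_stages c \<alpha> (\<alpha> * \<epsilon>) f N k (Phi_under \<Phi> \<Phi>1 N k n) s \<longrightarrow>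
          imex_stages c \<alpha> (\<alpha> * \<epsilon>) f N k (m N k n) w \<longrightarrow>
          (\<forall>j\<in>{1..4}.
             norm_inf_h N (w j) \<le> 5/4 \<longrightarrow>
             grad_norm_inf_h N (grad_h N (w j)) \<le> Ct \<longrightarrow>
             norm2_h N (\<lambda>I. N_h \<alpha> (\<alpha> * \<epsilon>) f N (s j) I - N_h \<alpha> (\<alpha> * \<epsilon>) f N (w j) I)
               \<le> M * (norm2_h N (\<lambda>I. s j I - w j I)
                       + grad_norm2_h N (grad_h N (\<lambda>I. s j I - w j I))))))"

end

theory Submission
  imports Defs "HOL-Library.Function_Algebras"
begin

text \<open>
  Since \<open>C\<^sub>1 h \<le> k \<le> C\<^sub>2 h\<close>, it suffices to prove an error of order \<open>h\<^sup>2\<close>.  The numerical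
  solution is compared with \<open>\<Phi>\<close> itself, not with its correction, by means of stages built
  from the Taylor expansion of \<open>\<Phi>\<close>; their residuals are of order \<open>k h\<^sup>2\<close> in the norm dual to
  \<open>\<parallel>g\<parallel>\<^sub>2 + \<parallel>\<nabla>\<^sub>h g\<parallel>\<^sub>2\<close>.  The stage polynomials of the implicit tableau have an algebraic positivity
  property that makes the diffusion of every stage dissipate energy, so that the nonlinear terms, of
  first order in the gradient, can be absorbed by Young's inequality.  This gives
  \<open>E\<^sub>n\<^sub>+\<^sub>1 \<le> (1 + \<Lambda>k) E\<^sub>n + \<Lambda> k h\<^sup>4\<close> for \<open>E = \<parallel>e\<parallel>\<^sub>2\<^sup>2 + \<theta> k \<parallel>\<nabla>\<^sub>h e\<parallel>\<^sub>2\<^sup>2\<close>, as long as the numerical stages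
  and their gradients stay bounded.  The bounds are propagated together with the estimate: elliptic
  regularity of the implicit stages, \<open>\<parallel>D\<^sub>i\<^sup>2 u\<parallel>\<^sub>2 \<le> \<parallel>\<Delta>\<^sub>h u\<parallel>\<^sub>2\<close>, and a discrete trace inequality on grid lines
  bound the sup norm of the gradient of an error of order \<open>h\<^sup>2\<close> by a positive power of \<open>h\<close>, which is where
  \<open>d \<le> 3\<close> enters.
\<close>


section \<open>Semi-inner products and dissipative operators\<close>

text \<open>At the order \<open>k h^2\<close> a residual is controlled only against grid functions
  satisfying the discrete Neumann condition, so in the energy balance it may be paired with stages
  but not with Laplacians or other residuals. The explicit terms contain the gradient of the
  starting error, which the current step does not damp; the gradient term of \<open>E\<close>
  reserves part of the dissipation of the previous step to pay for it. This closes because the last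
  implicit row consists of the weights, while the weight of stage 1 and its entry in the last
  explicit row are 0: the end value differs from stage 4 by explicit terms of stages 2 to 4 only.
  That difference has no implicit smoothing; its gradient is bounded through
  \<open>k / h \<le> C2\<close> and the smallness of stages 2 to 4. Exponents: errors of order
  \<open>h^2\<close> and \<open>k \<ge> C1 h\<close> give gradients of order \<open>h^(3/2)\<close>
  and Laplacians of order \<open>h\<close> in the discrete \<open>L^2\<close> norm, hence a squared
  maximal gradient of order \<open>h^(1-d) h^(5/2) = h^(7/2-d)\<close>, which for integer
  \<open>d\<close> tends to 0 exactly when \<open>d \<le> 3\<close>.\<close>

instantiation "fun" :: (type, real_vector) real_vector
begin

definition scaleR_fun :: "real \<Rightarrow> ('a \<Rightarrow> 'b) \<Rightarrow> 'a \<Rightarrow> 'b" where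
  "scaleR_fun r u = (\<lambda>x. r *\<^sub>R u x)"

instance
  by standard (simp_all add: scaleR_fun_def fun_eq_iff algebra_simps)

end

lemma scaleR_fun_apply [simp]: "(r *\<^sub>R u) x = r *\<^sub>R u x"
  by (simp add: scaleR_fun_def)

lemma fun_diff_apply [simp]: "((u - v) :: 'a \<Rightarrow> 'b::ab_group_add) x = u x - v x"
  by simp

text \<open>Only semidefinite: the discrete inner product sums over interior indices, so it vanishes
  on nonzero functions supported at ghost indices.\<close>

locale semi_inner =
  fixes ip :: "'v::real_vector \<Rightarrow> 'v \<Rightarrow> real"
  assumes ip_add_left: "ip (u + v) w = ip u w + ip v w"
    and ip_scale_left: "ip (r *\<^sub>R u) w = r * ip u w"
    and ip_commute: "ip u w = ip w u"
    and ip_nonneg: "0 \<le> ip u u"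
begin

lemma ip_add_right: "ip w (u + v) = ip w u + ip w v"
  by (metis ip_add_left ip_commute)

lemma ip_scale_right: "ip w (r *\<^sub>R u) = r * ip w u"
  by (metis ip_scale_left ip_commute)

lemma ip_minus_left: "ip (- u) w = - ip u w"
  using ip_scale_left[of "-1" u w] by simp

lemma ip_minus_right: "ip w (- u) = - ip w u"
  using ip_scale_right[of w "-1" u] by simp

lemma ip_diff_left: "ip (u - v) w = ip u w - ip v w"
  using ip_add_left[of u "- v" w] by (simp add: ip_minus_left)

lemma ip_diff_right: "ip w (u - v) = ip w u - ip w v"
  using ip_add_right[of w u "- v"] by (simp add: ip_minus_right)

lemmas ip_expand = ip_add_left ip_add_right ip_scale_left ip_scale_right
  ip_minus_left ip_minus_right ip_diff_left ip_diff_right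

definition nrm :: "'v \<Rightarrow> real" where "nrm u = sqrt (ip u u)"

lemma nrm_nonneg [simp]: "0 \<le> nrm u"
  by (simp add: nrm_def ip_nonneg)

lemma nrm_square: "(nrm u)\<^sup>2 = ip u u"
  by (simp add: nrm_def ip_nonneg)

lemma ip_Cauchy_Schwarz: "\<bar>ip u v\<bar> \<le> nrm u * nrm v"
proof -
  have sq: "(ip u v)\<^sup>2 \<le> ip u u * ip v v"
  proof (cases "ip v v = 0")
    case True
    have "ip u v = 0"
    proof (rule ccontr)
      assume nz: "ip u v \<noteq> 0"
      \<comment> \<open>When \<open>v\<close> is a null vector the form is affine in
        \<open>r\<close> along \<open>u + r v\<close>, and this \<open>r\<close> drives it to
        -1.\<close>
      define r where "r = - (ip u u + 1) / (2 * ip u v)"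
      have "0 \<le> ip (u + r *\<^sub>R v) (u + r *\<^sub>R v)" by (rule ip_nonneg)
      also have "\<dots> = ip u u + 2 * r * ip u v"
        using True by (simp add: ip_expand ip_commute[of v u] algebra_simps)
      also have "\<dots> = - 1" using nz by (simp add: r_def field_simps)
      finally show False by simp
    qed
    then show ?thesis using True by simp
  next
    case False
    then have pos: "ip v v > 0" using ip_nonneg[of v] by simp
    define r where "r = - ip u v / ip v v"
    have "0 \<le> ip (u + r *\<^sub>R v) (u + r *\<^sub>R v)" by (rule ip_nonneg)
    also have "\<dots> = ip u u + 2 * r * ip u v + r\<^sup>2 * ip v v"
      by (simp add: ip_expand ip_commute[of v u] algebra_simps power2_eq_square)
    also have "\<dots> = ip u u - (ip u v)\<^sup>2 / ip v v"
      using pos by (simp add: r_def field_simps power2_eq_square)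
    finally show ?thesis using pos by (simp add: field_simps)
  qed
  have "\<bar>ip u v\<bar> = sqrt ((ip u v)\<^sup>2)" by simp
  also have "\<dots> \<le> sqrt (ip u u * ip v v)" using sq by (rule real_sqrt_le_mono)
  finally show ?thesis by (simp add: nrm_def real_sqrt_mult)
qed

lemma nrm_triangle: "nrm (u + v) \<le> nrm u + nrm v"
proof -
  have "(nrm (u + v))\<^sup>2 = ip u u + 2 * ip u v + ip v v"
    by (simp add: nrm_square ip_expand ip_commute[of v u])
  also have "\<dots> \<le> (nrm u + nrm v)\<^sup>2"
    using ip_Cauchy_Schwarz[of u v] by (simp add: nrm_square power2_sum)
  finally show ?thesis by (rule power2_le_imp_le) simp
qed

lemma nrm_scale: "nrm (r *\<^sub>R u) = \<bar>r\<bar> * nrm u"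
  by (simp add: nrm_def ip_expand real_sqrt_mult mult.assoc[symmetric])

lemma nrm_minus: "nrm (- u) = nrm u"
  by (simp add: nrm_def ip_expand)

lemma nrm_diff: "nrm (u - v) \<le> nrm u + nrm v"
  using nrm_triangle[of u "- v"] by (simp add: nrm_minus)

lemma ip_sum3_le: "ip (u + v + w) (u + v + w) \<le> 3 * (ip u u + ip v v + ip w w)"
proof -
  have "0 \<le> ip (u - v) (u - v) + ip (v - w) (v - w) + ip (u - w) (u - w)"
    by (intro add_nonneg_nonneg ip_nonneg)
  then show ?thesis
    by (simp add: ip_expand ip_commute[of v u] ip_commute[of w u] ip_commute[of w v])
qed

end

text \<open>\<open>X\<close> is an unbounded operator; symmetry holds on \<open>S\<close> only, where the boundary condition is met.\<close>

locale dissipative = semi_inner ip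
  for ip :: "'v::real_vector \<Rightarrow> 'v \<Rightarrow> real" +
  fixes X :: "'v \<Rightarrow> 'v" and S :: "'v set"
  assumes X_linear: "linear X"
    and S_subspace: "subspace S"
    and X_sym: "u \<in> S \<Longrightarrow> v \<in> S \<Longrightarrow> ip (X u) v = ip u (X v)"
    and X_nonneg: "u \<in> S \<Longrightarrow> 0 \<le> ip (X u) u"
begin

lemmas X_simps = linear_add[OF X_linear] linear_diff[OF X_linear] linear_scale[OF X_linear]
  linear_neg[OF X_linear]

lemmas S_closed = subspace_add[OF S_subspace] subspace_diff[OF S_subspace]
  subspace_scale[OF S_subspace] subspace_neg[OF S_subspace]

lemma X_form_sum3_le:
  assumes "u \<in> S" "v \<in> S" "w \<in> S"
  shows "ip (X (u + v + w)) (u + v + w) \<le> 3 * (ip (X u) u + ip (X v) v + ip (X w) w)"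
proof -
  have "0 \<le> ip (X (u - v)) (u - v) + ip (X (v - w)) (v - w) + ip (X (u - w)) (u - w)"
    by (intro add_nonneg_nonneg X_nonneg S_closed assms)
  moreover have "ip (X v) u = ip (X u) v" "ip (X w) u = ip (X u) w" "ip (X w) v = ip (X v) w"
    using X_sym[OF assms(1) assms(2)] X_sym[OF assms(1) assms(3)] X_sym[OF assms(2) assms(3)]
    by (simp_all add: ip_commute)
  ultimately show ?thesis by (simp add: ip_expand X_simps)
qed

text \<open>Squaring the equation gives \<open>ip z z\<close> as a sum of three nonnegative terms,
  so each of them is bounded by \<open>ip z z\<close>. The last two bounds are the elliptic
  regularity of an implicit stage: one gains a full power of \<open>X\<close>, the other half a
  power.\<close>

lemma resolvent_bounds:
  assumes u: "u \<in> S" and eq: "u + g *\<^sub>R X u = z" and g: "g > 0"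
  shows "nrm u \<le> nrm z" "nrm (X u) \<le> nrm z / g" "ip (X u) u \<le> (nrm z)\<^sup>2 / g"
proof -
  have "ip z z = ip u u + 2 * g * ip (X u) u + g\<^sup>2 * ip (X u) (X u)"
    unfolding eq[symmetric] using ip_commute[of u "X u"]
    by (simp add: ip_expand algebra_simps power2_eq_square)
  moreover have "0 \<le> g * ip (X u) u" "0 \<le> ip u u" "0 \<le> g\<^sup>2 * ip (X u) (X u)"
    using g X_nonneg[OF u] by (simp_all add: ip_nonneg)
  ultimately have *: "ip u u \<le> ip z z" "g * ip (X u) u \<le> ip z z" "g\<^sup>2 * ip (X u) (X u) \<le> ip z z"
    by linarith+
  show "nrm u \<le> nrm z" unfolding nrm_def using *(1) by simp
  have "sqrt (g\<^sup>2 * ip (X u) (X u)) \<le> sqrt (ip z z)" using *(3) by simp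
  then have "g * nrm (X u) \<le> nrm z" using g by (simp add: nrm_def real_sqrt_mult)
  then show "nrm (X u) \<le> nrm z / g" using g by (simp add: field_simps)
  show "ip (X u) u \<le> (nrm z)\<^sup>2 / g" using *(2) g by (simp add: nrm_square field_simps)
qed

end

text \<open>
  The stage polynomials of the implicit tableau have positive differences and sums, which makes
  the scheme dissipative term by term.  \<open>V\<^sub>i\<close> stands for \<open>X\<^sup>i D(X)\<^sup>-\<^sup>1 e\<^sub>1\<close> with
  \<open>D(x) = (1 + g x) (1 + s x) (1 + b x)\<close>, but it is formed from the stages
  themselves, so that perturbations only occur paired with \<open>V\<^sub>0, V\<^sub>1, V\<^sub>2\<close>.
\<close>

lemma (in dissipative) chain_energy:
  assumes S: "V0 \<in> S" "V1 \<in> S" "V2 \<in> S"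
    and X0: "X V0 = V1 + \<phi>0" and X1: "X V1 = V2 + \<phi>1" and X2: "X V2 = V3 + \<phi>2"
    and e1: "e1 = V0 + d1 *\<^sub>R V1 + d2 *\<^sub>R V2 + d3 *\<^sub>R V3"
    and e4: "e4 = V0 + a1 *\<^sub>R V1 + a2 *\<^sub>R V2"
    and pos: "\<gamma> > 0" "d1 - a1 \<ge> \<gamma>" "d2 - a2 \<ge> \<gamma>" "d3 \<ge> \<gamma>" "d1 + a1 \<ge> \<gamma>" "d2 + a2 \<ge> \<gamma>"
    and one: "\<gamma> \<le> 1"
    and R: "\<And>v w. v \<in> {V0, V1, V2} \<Longrightarrow> w \<in> {\<phi>0, \<phi>1, \<phi>2} \<Longrightarrow> \<bar>ip v w\<bar> \<le> R"
  shows "ip e4 e4 + \<gamma>\<^sup>2 * (ip (X V0) V0 + ip (X V1) V1 + ip (X V2) V2 + ip V1 V1 + ip V2 V2 + ip V3 V3)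
    \<le> ip e1 e1 + (2 + \<bar>d1\<bar> + \<bar>d2\<bar> + \<bar>d3\<bar> + \<bar>a1\<bar> + \<bar>a2\<bar>)\<^sup>2 * (3 * R)"
proof -
  define p1 p2 p3 where "p1 = d1 - a1" and "p2 = d2 - a2" and "p3 = d3"
  define s1 s2 s3 where "s1 = d1 + a1" and "s2 = d2 + a2" and "s3 = d3"
  have V1: "V1 = X V0 - \<phi>0" and V2: "V2 = X V1 - \<phi>1" and V3: "V3 = X V2 - \<phi>2"
    using X0 X1 X2 by simp_all
  let ?q0 = "ip (X V0) V0" and ?q1 = "ip (X V1) V1" and ?q2 = "ip (X V2) V2"
  have v01: "ip V0 V1 = ?q0 - ip V0 \<phi>0"
    by (subst V1) (simp add: ip_expand ip_commute[of V0 "X V0"])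
  have v12: "ip V1 V2 = ?q1 - ip V1 \<phi>1"
    by (subst V2) (simp add: ip_expand ip_commute[of V1 "X V1"])
  have v23: "ip V2 V3 = ?q2 - ip V2 \<phi>2"
    by (subst V3) (simp add: ip_expand ip_commute[of V2 "X V2"])
  \<comment> \<open>Symmetry moves \<open>X\<close> from one factor to the other, so up to
    perturbations \<open>ip Vi Vj\<close> depends on \<open>i + j\<close> only and is nonnegative.
    \<open>X\<close> is applied to \<open>V0\<close>, \<open>V1\<close>, \<open>V2\<close> alone,
    the members known to lie in \<open>S\<close>.\<close>
  have "ip V0 V2 = ip V0 (X V1) - ip V0 \<phi>1"
    by (subst V2) (simp add: ip_expand)
  also have "ip V0 (X V1) = ip (X V0) V1" using X_sym[OF S(1,2)] by simp
  also have "\<dots> = ip V1 V1 + ip V1 \<phi>0"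
    by (subst X0) (simp add: ip_expand ip_commute[of \<phi>0])
  finally have v02: "ip V0 V2 = ip V1 V1 + ip V1 \<phi>0 - ip V0 \<phi>1" .
  have "ip V0 V3 = ip V0 (X V2) - ip V0 \<phi>2"
    by (subst V3) (simp add: ip_expand)
  also have "ip V0 (X V2) = ip (X V0) V2" using X_sym[OF S(1,3)] by simp
  also have "\<dots> = ip V1 V2 + ip V2 \<phi>0"
    by (subst X0) (simp add: ip_expand ip_commute[of \<phi>0])
  finally have v03: "ip V0 V3 = ?q1 - ip V1 \<phi>1 + ip V2 \<phi>0 - ip V0 \<phi>2" by (simp add: v12)
  have "ip V1 V3 = ip V1 (X V2) - ip V1 \<phi>2"
    by (subst V3) (simp add: ip_expand)
  also have "ip V1 (X V2) = ip (X V1) V2" using X_sym[OF S(2,3)] by simp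
  also have "\<dots> = ip V2 V2 + ip V2 \<phi>1"
    by (subst X1) (simp add: ip_expand ip_commute[of \<phi>1])
  finally have v13: "ip V1 V3 = ip V2 V2 + ip V2 \<phi>1 - ip V1 \<phi>2" .
  have q: "?q0 \<ge> 0" "?q1 \<ge> 0" "?q2 \<ge> 0" using S X_nonneg by simp_all
  have n: "ip V1 V1 \<ge> 0" "ip V2 V2 \<ge> 0" "ip V3 V3 \<ge> 0" by (simp_all add: ip_nonneg)
  have r: "\<bar>ip V0 \<phi>0\<bar> \<le> R" "\<bar>ip V0 \<phi>1\<bar> \<le> R" "\<bar>ip V0 \<phi>2\<bar> \<le> R" "\<bar>ip V1 \<phi>0\<bar> \<le> R"
    "\<bar>ip V1 \<phi>1\<bar> \<le> R" "\<bar>ip V1 \<phi>2\<bar> \<le> R" "\<bar>ip V2 \<phi>0\<bar> \<le> R" "\<bar>ip V2 \<phi>1\<bar> \<le> R" "\<bar>ip V2 \<phi>2\<bar> \<le> R"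
    using R by simp_all
  \<comment> \<open>Three perturbations occur in \<open>ip V0 V3\<close>, at most two in each of the
    other products.\<close>
  define Q where "Q = 3 * R"
  have Q0: "Q \<ge> 0" using r(1) by (simp add: Q_def)
  have lo: "ip V0 V1 \<ge> ?q0 - Q" "ip V1 V2 \<ge> ?q1 - Q" "ip V2 V3 \<ge> ?q2 - Q"
    "ip V0 V2 \<ge> - Q" "ip V0 V3 \<ge> - Q" "ip V1 V3 \<ge> - Q"
    unfolding v01 v12 v23 v02 v03 v13 Q_def using r[unfolded abs_le_iff] q n Q0[unfolded Q_def] by linarith+
  have p: "p1 \<ge> \<gamma>" "p2 \<ge> \<gamma>" "p3 \<ge> \<gamma>" "s1 \<ge> \<gamma>" "s2 \<ge> \<gamma>" "s3 \<ge> \<gamma>"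
    using pos by (simp_all add: p1_def p2_def p3_def s1_def s2_def s3_def)
  have p0: "p1 \<ge> 0" "p2 \<ge> 0" "p3 \<ge> 0" "s1 \<ge> 0" "s2 \<ge> 0" "s3 \<ge> 0" using p pos(1) by linarith+
  have prod: "p * s \<ge> \<gamma>\<^sup>2" if "p \<ge> \<gamma>" "s \<ge> \<gamma>" for p s :: real
    using that pos(1) by (simp add: power2_eq_square mult_mono)
  have g2: "\<gamma>\<^sup>2 \<le> 2 * p1" using mult_left_mono[OF one, of \<gamma>] p(1) pos(1)
    unfolding power2_eq_square by linarith
  \<comment> \<open>A difference of squares: \<open>V0\<close> cancels in \<open>e1 - e4\<close>,
    and the remaining coefficients of \<open>e1 - e4\<close> and of \<open>e1 + e4\<close> are all
    at least \<open>\<gamma>\<close>, so no product in the expansion has an unfavourable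
    sign.\<close>
  have comb: "ip e1 e1 - ip e4 e4 = ip (p1 *\<^sub>R V1 + p2 *\<^sub>R V2 + p3 *\<^sub>R V3)
      (2 *\<^sub>R V0 + s1 *\<^sub>R V1 + s2 *\<^sub>R V2 + s3 *\<^sub>R V3)"
  proof -
    have "ip e1 e1 - ip e4 e4 = ip (e1 - e4) (e1 + e4)"
      by (simp add: ip_expand ip_commute[of e4 e1])
    moreover have "e1 - e4 = p1 *\<^sub>R V1 + p2 *\<^sub>R V2 + p3 *\<^sub>R V3"
      by (simp add: e1 e4 p1_def p2_def p3_def algebra_simps)
    moreover have "e1 + e4 = 2 *\<^sub>R V0 + s1 *\<^sub>R V1 + s2 *\<^sub>R V2 + s3 *\<^sub>R V3"
      by (simp add: e1 e4 s1_def s2_def s3_def algebra_simps scaleR_2)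
    ultimately show ?thesis by simp
  qed
  also have "\<dots> = 2 * p1 * ip V0 V1 + 2 * p2 * ip V0 V2 + 2 * p3 * ip V0 V3
      + (p1 * s2 + p2 * s1) * ip V1 V2 + (p1 * s3 + p3 * s1) * ip V1 V3 + (p2 * s3 + p3 * s2) * ip V2 V3
      + p1 * s1 * ip V1 V1 + p2 * s2 * ip V2 V2 + p3 * s3 * ip V3 V3"
    by (simp add: ip_expand ip_commute[of V1 V0] ip_commute[of V2 V0] ip_commute[of V3 V0]
        ip_commute[of V2 V1] ip_commute[of V3 V1] ip_commute[of V3 V2] algebra_simps)
  also have "\<dots> \<ge> 2 * p1 * (?q0 - Q) + 2 * p2 * (- Q) + 2 * p3 * (- Q)
      + (p1 * s2 + p2 * s1) * (?q1 - Q) + (p1 * s3 + p3 * s1) * (- Q) + (p2 * s3 + p3 * s2) * (?q2 - Q)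
      + \<gamma>\<^sup>2 * ip V1 V1 + \<gamma>\<^sup>2 * ip V2 V2 + \<gamma>\<^sup>2 * ip V3 V3"
    by (intro add_mono mult_left_mono mult_right_mono lo n prod p)
      (use p0 in \<open>simp_all\<close>)
  finally have 1: "ip e1 e1 - ip e4 e4 \<ge> 2 * p1 * ?q0 + (p1 * s2 + p2 * s1) * ?q1 + (p2 * s3 + p3 * s2) * ?q2
      + \<gamma>\<^sup>2 * ip V1 V1 + \<gamma>\<^sup>2 * ip V2 V2 + \<gamma>\<^sup>2 * ip V3 V3
      - (2 * p1 + 2 * p2 + 2 * p3 + (p1 * s2 + p2 * s1) + (p1 * s3 + p3 * s1) + (p2 * s3 + p3 * s2)) * Q"
    by (simp add: algebra_simps)
  have c1: "\<gamma>\<^sup>2 * ?q0 \<le> 2 * p1 * ?q0" by (intro mult_right_mono g2 q)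
  have "\<gamma>\<^sup>2 \<le> p1 * s2 + p2 * s1" using prod[OF p(1) p(5)] mult_nonneg_nonneg[OF p0(2) p0(4)] by linarith
  then have c2: "\<gamma>\<^sup>2 * ?q1 \<le> (p1 * s2 + p2 * s1) * ?q1" by (intro mult_right_mono q)
  have "\<gamma>\<^sup>2 \<le> p2 * s3 + p3 * s2" using prod[OF p(2) p(6)] mult_nonneg_nonneg[OF p0(3) p0(5)] by linarith
  then have c3: "\<gamma>\<^sup>2 * ?q2 \<le> (p2 * s3 + p3 * s2) * ?q2" by (intro mult_right_mono q)
  let ?A = "\<bar>d1\<bar> + \<bar>d2\<bar> + \<bar>d3\<bar> + \<bar>a1\<bar> + \<bar>a2\<bar>"
  have "2 * p1 + 2 * p2 + 2 * p3 + (p1 * s2 + p2 * s1) + (p1 * s3 + p3 * s1) + (p2 * s3 + p3 * s2)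
      \<le> (p1 + p2 + p3) * (2 + s1 + s2 + s3)"
    using p0 by (simp add: algebra_simps)
  also have "\<dots> \<le> (2 + ?A) * (2 + ?A)"
    by (intro mult_mono) (use p0 in \<open>simp_all add: p1_def p2_def p3_def s1_def s2_def s3_def\<close>)
  finally have c4: "(2 * p1 + 2 * p2 + 2 * p3 + (p1 * s2 + p2 * s1) + (p1 * s3 + p3 * s1) + (p2 * s3 + p3 * s2)) * Q
      \<le> (2 + ?A)\<^sup>2 * Q"
    by (intro mult_right_mono Q0) (simp add: power2_eq_square)
  have "2 + ?A = 2 + \<bar>d1\<bar> + \<bar>d2\<bar> + \<bar>d3\<bar> + \<bar>a1\<bar> + \<bar>a2\<bar>" by simp
  then show ?thesis using 1 c1 c2 c3 c4 unfolding Q_def distrib_left by (simp only:)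
qed

text \<open>Without perturbations, eliminating the stages one after another gives
  \<open>e1 = D(X) V0\<close>, \<open>e2 = (1 + s X)(1 + b X) V0\<close>,
  \<open>e3 = (1 + b X)(1 + (g - s') X) V0\<close> and \<open>e4 = (1 + a1 X + a2 X^2) V0\<close>;
  \<open>d1\<close> and \<open>d2\<close> are coefficients of \<open>D\<close>. Both nonvanishing
  conditions say that \<open>V0\<close>, \<open>V1\<close>, \<open>V2\<close> can be recovered from
  the stages: \<open>\<kappa>\<close> separates \<open>e2\<close> from \<open>e3\<close>, and the
  second expression is \<open>b^2\<close> times the polynomial of \<open>e4\<close> at
  \<open>-1/b\<close>. \<open>c0\<close> and \<open>C\<close> depend on the tableau alone, hence are
  uniform in the mesh and the time step. Multiset sums count coinciding stages with their
  multiplicity.\<close>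

lemma stage_energy_estimate:
  fixes g s s' b b2 b3 :: real
  defines "\<kappa> \<equiv> s - g + s'" and "a1 \<equiv> s + g - b2 - b3" and "a2 \<equiv> s * (g - b2) - b3 * (g - s')"
  defines "d1 \<equiv> g + s + b" and "d2 \<equiv> g * s + g * b + s * b"
  assumes pos: "g > 0" "s > 0" "b > 0" and \<kappa>0: "\<kappa> \<noteq> 0" and \<sigma>0: "b\<^sup>2 - a1 * b + a2 \<noteq> 0"
    and coef: "d1 > \<bar>a1\<bar>" "d2 > \<bar>a2\<bar>"
  shows "\<exists>c0>0. \<exists>C\<ge>0. \<forall>(ip :: 'v::real_vector \<Rightarrow> 'v \<Rightarrow> real) X S e1 e2 e3 e4 f2 f3 f4 F.
    dissipative ip X S \<longrightarrow> e2 \<in> S \<longrightarrow> e3 \<in> S \<longrightarrow> e4 \<in> S \<longrightarrow>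
    e2 + g *\<^sub>R X e2 = e1 + f2 \<longrightarrow>
    e3 + s' *\<^sub>R X e2 + s *\<^sub>R X e3 = e1 + f3 \<longrightarrow>
    e4 + b2 *\<^sub>R X e2 + b3 *\<^sub>R X e3 + b *\<^sub>R X e4 = e1 + f4 \<longrightarrow>
    (\<forall>e\<in>{e2, e3, e4}. \<forall>f\<in>{f2, f3, f4}. \<bar>ip e f\<bar> \<le> F) \<longrightarrow>
    ip e4 e4 + c0 * ((\<Sum>e\<in>#{#e2, e3, e4#}. ip (X e) e) + (\<Sum>e\<in>#{#e2, e3, e4#}. ip (e - e1) (e - e1)))
      \<le> ip e1 e1 + C * F"
proof -
  define \<sigma> where "\<sigma> = b\<^sup>2 - a1 * b + a2"
  define d3 where "d3 = g * s * b"
  have d3: "d3 > 0" using pos by (simp add: d3_def)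
  define \<gamma> where "\<gamma> = Min {1, d1 - a1, d2 - a2, d3, d1 + a1, d2 + a2}"
  have \<gamma>: "\<gamma> > 0" using coef d3 by (auto simp: \<gamma>_def)
  have \<gamma>_le: "\<gamma> \<le> 1" "d1 - a1 \<ge> \<gamma>" "d2 - a2 \<ge> \<gamma>" "d3 \<ge> \<gamma>" "d1 + a1 \<ge> \<gamma>" "d2 + a2 \<ge> \<gamma>"
    by (auto simp: \<gamma>_def)
  \<comment> \<open>The \<open>k\<close> constants are the factors by which pairings grow when the
    stages are replaced by \<open>Z\<close>, \<open>B\<close>, \<open>V2\<close>, \<open>V1\<close>,
    \<open>V0\<close>; the \<open>l\<close> constants are those for replacing \<open>f2\<close>,
    \<open>f3\<close>, \<open>f4\<close> by \<open>\<Psi>\<close>, \<open>\<psi>2\<close>,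
    \<open>\<phi>0\<close>, \<open>\<phi>2\<close>.\<close>
  define kZ kB k2 k1 k0 where "kZ = 2 / \<bar>\<kappa>\<bar>" and "kB = 1 + s * kZ"
    and "k2 = (1 + kB + \<bar>a1 - b\<bar> * kZ) / \<bar>\<sigma>\<bar>" and "k1 = kZ + b * k2" and "k0 = kB + b * k1"
  define l\<Psi> l2 l0 lX where "l\<Psi> = 2 + \<bar>g - b2 - b3\<bar> * kZ" and "l2 = (b * kZ + l\<Psi>) / \<bar>\<sigma>\<bar>"
    and "l0 = kZ + b * l2" and "lX = (g * (kZ + s * l2) + 1) / d3"
  have kpos: "kZ \<ge> 0" "kB \<ge> 0" "k2 \<ge> 0" "k1 \<ge> 0" "k0 \<ge> 0" "l\<Psi> \<ge> 0" "l2 \<ge> 0" "l0 \<ge> 0" "lX \<ge> 0"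
    using pos d3 by (simp_all add: kZ_def kB_def k2_def k1_def k0_def l\<Psi>_def l2_def l0_def lX_def)
  define C where "C = (2 + \<bar>d1\<bar> + \<bar>d2\<bar> + \<bar>d3\<bar> + \<bar>a1\<bar> + \<bar>a2\<bar>)\<^sup>2 * (3 * ((k0 + k1 + k2) * (l0 + l2 + lX)))"
  \<comment> \<open>Dominates the squares of all coefficients with which the stages and their
    deviations from \<open>e1\<close> are combined from the \<open>Vi\<close>. The 9 in the
    resulting \<open>c0\<close> is 3 for sums of three terms times 3 for the number of
    stages.\<close>
  define D where "D = 1 + d1\<^sup>2 + d2\<^sup>2 + d3\<^sup>2 + (s + b)\<^sup>2 + (s * b)\<^sup>2 + (b + g - s')\<^sup>2 + (b * (g - s'))\<^sup>2 + a1\<^sup>2 + a2\<^sup>2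
    + (d1 - (s + b))\<^sup>2 + (d2 - s * b)\<^sup>2 + (d1 - (b + g - s'))\<^sup>2 + (d2 - b * (g - s'))\<^sup>2 + (d1 - a1)\<^sup>2 + (d2 - a2)\<^sup>2"
  have D: "D \<ge> 1" by (simp add: D_def add_nonneg_nonneg)
  show ?thesis
  proof (rule exI[of _ "\<gamma>\<^sup>2 / (9 * D)"], intro exI[of _ C] conjI allI impI)
    show "0 < \<gamma>\<^sup>2 / (9 * D)" using \<gamma> D by simp
    show "0 \<le> C" using kpos by (simp add: C_def)
  next
    fix ip :: "'v \<Rightarrow> 'v \<Rightarrow> real" and X S and e1 e2 e3 e4 f2 f3 f4 :: 'v and F :: real
    assume "dissipative ip X S" and eS: "e2 \<in> S" "e3 \<in> S" "e4 \<in> S"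
      and eq2: "e2 + g *\<^sub>R X e2 = e1 + f2"
      and eq3: "e3 + s' *\<^sub>R X e2 + s *\<^sub>R X e3 = e1 + f3"
      and eq4: "e4 + b2 *\<^sub>R X e2 + b3 *\<^sub>R X e3 + b *\<^sub>R X e4 = e1 + f4"
      and F: "\<forall>e\<in>{e2, e3, e4}. \<forall>f\<in>{f2, f3, f4}. \<bar>ip e f\<bar> \<le> F"
    interpret dissipative ip X S by fact
    \<comment> \<open>Triangular inversion: ideally \<open>B = (1 + b X) V0\<close> and
      \<open>Z = (1 + b X) V1\<close>, so that \<open>e2 - e3 = \<kappa> Z\<close> and
      \<open>e4 - B - (a1 - b) Z = \<sigma> V2\<close>.\<close>
    define Z where "Z = (1 / \<kappa>) *\<^sub>R (e2 - e3)"
    define B where "B = e2 - s *\<^sub>R Z"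
    define V2 where "V2 = (1 / \<sigma>) *\<^sub>R (e4 - B - (a1 - b) *\<^sub>R Z)"
    define V1 where "V1 = Z - b *\<^sub>R V2"
    define V0 where "V0 = B - b *\<^sub>R V1"
    define \<psi>1 where "\<psi>1 = (1 / \<kappa>) *\<^sub>R (f3 - f2)"
    define \<Psi> where "\<Psi> = f4 - f2 + (g - b2 - b3) *\<^sub>R \<psi>1"
    define \<psi>2 where "\<psi>2 = (1 / \<sigma>) *\<^sub>R (b *\<^sub>R \<psi>1 - \<Psi>)"
    define \<phi>0 where "\<phi>0 = \<psi>1 - b *\<^sub>R \<psi>2"
    define \<phi>2 where "\<phi>2 = (1 / d3) *\<^sub>R (f2 - g *\<^sub>R (\<psi>1 + s *\<^sub>R \<psi>2))"
    \<comment> \<open>\<open>\<phi>2\<close> is chosen such that subtracting it here makes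
      \<open>e1\<close> an exact combination of \<open>V0\<close> to \<open>V3\<close>, with no
      trace of \<open>f2\<close> left over.\<close>
    define V3 where "V3 = X V2 - \<phi>2"
    have S: "Z \<in> S" "B \<in> S" "V2 \<in> S" "V1 \<in> S" "V0 \<in> S"
      unfolding Z_def B_def V2_def V1_def V0_def by (intro S_closed eS)+
    have e2: "e2 = B + s *\<^sub>R Z" by (simp add: B_def)
    have e3: "e3 = B + (g - s') *\<^sub>R Z"
    proof -
      have "e3 = e2 - \<kappa> *\<^sub>R Z" using \<kappa>0 by (simp add: Z_def)
      then show ?thesis by (simp add: e2 \<kappa>_def algebra_simps)
    qed
    have \<sigma>V2: "e4 = B + (a1 - b) *\<^sub>R Z + \<sigma> *\<^sub>R V2" using \<sigma>0 by (simp add: V2_def \<sigma>_def)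
    have \<kappa>\<psi>: "\<kappa> *\<^sub>R \<psi>1 = f3 - f2" using \<kappa>0 by (simp add: \<psi>1_def)
    have \<sigma>\<psi>: "\<sigma> *\<^sub>R \<psi>2 = b *\<^sub>R \<psi>1 - \<Psi>" using \<sigma>0 by (simp add: \<psi>2_def \<sigma>_def)
    \<comment> \<open>Subtracting the second stage equation from the third removes
      \<open>e1\<close>.\<close>
    have XB: "X B = Z + \<psi>1"
    proof -
      have "\<kappa> *\<^sub>R X B = (s' *\<^sub>R X e2 + s *\<^sub>R X e3) - g *\<^sub>R X e2"
        unfolding e2 e3 by (simp add: X_simps \<kappa>_def algebra_simps)
      also have "\<dots> = (e2 - e3) + (f3 - f2)"
      proof -
        have "s' *\<^sub>R X e2 + s *\<^sub>R X e3 = e1 + f3 - e3" using eq3 by (simp add: algebra_simps)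
        moreover have "g *\<^sub>R X e2 = e1 + f2 - e2" using eq2 by (simp add: algebra_simps)
        ultimately show ?thesis by simp
      qed
      also have "\<dots> = \<kappa> *\<^sub>R (Z + \<psi>1)" using \<kappa>0 \<kappa>\<psi> by (simp add: Z_def scaleR_add_right)
      finally show ?thesis using \<kappa>0 by simp
    qed
    have e1: "e1 = e2 + g *\<^sub>R X e2 - f2" using eq2 by (simp add: algebra_simps)
    have Xe2: "X e2 = Z + \<psi>1 + s *\<^sub>R X Z" by (simp add: e2 X_simps XB)
    have Xe3: "X e3 = Z + \<psi>1 + (g - s') *\<^sub>R X Z" by (simp add: e3 X_simps XB)
    have e4': "e4 + b *\<^sub>R X e4 = B + a1 *\<^sub>R Z + a2 *\<^sub>R X Z + \<Psi>"
    proof -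
      have "e4 + b *\<^sub>R X e4 = e1 + f4 - b2 *\<^sub>R X e2 - b3 *\<^sub>R X e3"
        using eq4 by (simp add: algebra_simps)
      also have "\<dots> = B + a1 *\<^sub>R Z + a2 *\<^sub>R X Z + \<Psi>"
        unfolding e1 Xe2 Xe3 by (simp add: e2 \<Psi>_def a1_def a2_def algebra_simps)
      finally show ?thesis .
    qed
    have XV1: "X V1 = V2 + \<psi>2"
    proof -
      have P: "b *\<^sub>R X e4 = b *\<^sub>R (Z + \<psi>1) + (b * (a1 - b)) *\<^sub>R X Z + (b * \<sigma>) *\<^sub>R X V2"
        by (subst \<sigma>V2) (simp add: X_simps XB scaleR_add_right)
      have "\<sigma> *\<^sub>R V2 = e4 - B - (a1 - b) *\<^sub>R Z" by (subst \<sigma>V2) simp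
      also have "e4 = B + a1 *\<^sub>R Z + a2 *\<^sub>R X Z + \<Psi> - b *\<^sub>R X e4" using e4' by (simp add: algebra_simps)
      finally have "\<sigma> *\<^sub>R V2 + \<sigma> *\<^sub>R \<psi>2 = (a2 - b * (a1 - b)) *\<^sub>R X Z - (b * \<sigma>) *\<^sub>R X V2"
        unfolding P \<sigma>\<psi> by (simp add: algebra_simps)
      also have "a2 - b * (a1 - b) = \<sigma>" by (simp add: \<sigma>_def algebra_simps power2_eq_square)
      finally have "\<sigma> *\<^sub>R (V2 + \<psi>2) = \<sigma> *\<^sub>R X V1"
        by (simp add: V1_def X_simps scaleR_add_right scaleR_diff_right)
      then show ?thesis using \<sigma>0 by (simp add: \<sigma>_def)
    qed
    have XV0: "X V0 = V1 + \<phi>0"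
      by (simp add: V0_def X_simps XB XV1 \<phi>0_def) (simp add: V1_def algebra_simps)
    have XV2: "X V2 = V3 + \<phi>2" by (simp add: V3_def)
    have ZV: "Z = V1 + b *\<^sub>R V2" and BV: "B = V0 + b *\<^sub>R V1" by (simp_all add: V1_def V0_def)
    have e2V: "e2 = V0 + (s + b) *\<^sub>R V1 + (s * b) *\<^sub>R V2"
      unfolding e2 by (simp add: ZV BV algebra_simps)
    have e3V: "e3 = V0 + (b + g - s') *\<^sub>R V1 + (b * (g - s')) *\<^sub>R V2"
      unfolding e3 by (simp add: ZV BV algebra_simps)
    have e4V: "e4 = V0 + a1 *\<^sub>R V1 + a2 *\<^sub>R V2"
      by (subst \<sigma>V2) (simp add: ZV BV \<sigma>_def algebra_simps power2_eq_square)
    have e1V: "e1 = V0 + d1 *\<^sub>R V1 + d2 *\<^sub>R V2 + d3 *\<^sub>R V3"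
    proof -
      have XZ: "X Z = V2 + \<psi>2 + b *\<^sub>R V3 + b *\<^sub>R \<phi>2" by (simp add: ZV X_simps XV1 XV2 scaleR_add_right)
      have "d3 *\<^sub>R \<phi>2 = f2 - g *\<^sub>R (\<psi>1 + s *\<^sub>R \<psi>2)" using d3 by (simp add: \<phi>2_def)
      then have "f2 = d3 *\<^sub>R \<phi>2 + g *\<^sub>R (\<psi>1 + s *\<^sub>R \<psi>2)" by simp
      then show ?thesis
        unfolding e1 Xe2 XZ by (simp add: e2V ZV d1_def d2_def d3_def algebra_simps)
    qed
    have F0: "F \<ge> 0" using F by force
    have small: "\<bar>ip v w\<bar> \<le> ((k0 + k1 + k2) * (l0 + l2 + lX)) * F"
      if "v \<in> {V0, V1, V2}" "w \<in> {\<phi>0, \<psi>2, \<phi>2}" for v w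
    proof -
      have v: "\<bar>ip v f\<bar> \<le> (k0 + k1 + k2) * F" if f: "f \<in> {f2, f3, f4}" for f
      proof -
        have e: "\<bar>ip e2 f\<bar> \<le> F" "\<bar>ip e3 f\<bar> \<le> F" "\<bar>ip e4 f\<bar> \<le> F" using F f by auto
        have bZ: "\<bar>ip Z f\<bar> \<le> kZ * F"
          using e \<kappa>0 by (simp add: Z_def ip_expand kZ_def field_simps abs_mult)
        have bB: "\<bar>ip B f\<bar> \<le> kB * F"
        proof -
          have "\<bar>ip B f\<bar> \<le> \<bar>ip e2 f\<bar> + s * \<bar>ip Z f\<bar>"
            using pos by (simp add: B_def ip_expand) (metis abs_mult abs_of_pos abs_triangle_ineq4)
          also have "\<dots> \<le> F + s * (kZ * F)" using e bZ pos by (intro add_mono mult_left_mono) auto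
          finally show ?thesis by (simp add: kB_def algebra_simps)
        qed
        have b2: "\<bar>ip V2 f\<bar> \<le> k2 * F"
        proof -
          have "\<bar>ip e4 f - ip B f - (a1 - b) * ip Z f\<bar> \<le> \<bar>ip e4 f\<bar> + \<bar>ip B f\<bar> + \<bar>a1 - b\<bar> * \<bar>ip Z f\<bar>"
            unfolding abs_mult[symmetric] by linarith
          also have "\<dots> \<le> F + kB * F + \<bar>a1 - b\<bar> * (kZ * F)" using e bZ bB by (intro add_mono mult_left_mono) auto
          also have "\<dots> = (1 + kB + \<bar>a1 - b\<bar> * kZ) * F" by (simp add: algebra_simps)
          finally have "\<bar>ip e4 f - ip B f - (a1 - b) * ip Z f\<bar> / \<bar>\<sigma>\<bar> \<le> (1 + kB + \<bar>a1 - b\<bar> * kZ) * F / \<bar>\<sigma>\<bar>"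
            by (rule divide_right_mono) simp
          then show ?thesis by (simp add: V2_def ip_expand k2_def abs_mult)
        qed
        have b1: "\<bar>ip V1 f\<bar> \<le> k1 * F"
        proof -
          have "\<bar>ip V1 f\<bar> \<le> \<bar>ip Z f\<bar> + b * \<bar>ip V2 f\<bar>"
            using pos by (simp add: V1_def ip_expand) (metis abs_mult abs_of_pos abs_triangle_ineq4)
          also have "\<dots> \<le> kZ * F + b * (k2 * F)" using b2 bZ pos by (intro add_mono mult_left_mono) auto
          finally show ?thesis by (simp add: k1_def algebra_simps)
        qed
        have b0: "\<bar>ip V0 f\<bar> \<le> k0 * F"
        proof -
          have "\<bar>ip V0 f\<bar> \<le> \<bar>ip B f\<bar> + b * \<bar>ip V1 f\<bar>"
            using pos by (simp add: V0_def ip_expand) (metis abs_mult abs_of_pos abs_triangle_ineq4)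
          also have "\<dots> \<le> kB * F + b * (k1 * F)" using b1 bB pos by (intro add_mono mult_left_mono) auto
          finally show ?thesis by (simp add: k0_def algebra_simps)
        qed
        have "0 \<le> k0 * F" "0 \<le> k1 * F" "0 \<le> k2 * F" using kpos F0 by simp_all
        then show ?thesis using b0 b1 b2 that(1) \<open>v \<in> {V0, V1, V2}\<close> by (auto simp: distrib_right)
      qed
      define G where "G = (k0 + k1 + k2) * F"
      have G0: "G \<ge> 0" using kpos F0 by (simp add: G_def)
      have f: "\<bar>ip v f2\<bar> \<le> G" "\<bar>ip v f3\<bar> \<le> G" "\<bar>ip v f4\<bar> \<le> G" using v by (auto simp: G_def)
      have c1: "\<bar>ip v \<psi>1\<bar> \<le> kZ * G"
        using f \<kappa>0 by (simp add: \<psi>1_def ip_expand kZ_def field_simps abs_mult)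
      have cP: "\<bar>ip v \<Psi>\<bar> \<le> l\<Psi> * G"
      proof -
        have "\<bar>ip v \<Psi>\<bar> \<le> \<bar>ip v f4\<bar> + \<bar>ip v f2\<bar> + \<bar>g - b2 - b3\<bar> * \<bar>ip v \<psi>1\<bar>"
          unfolding abs_mult[symmetric] \<Psi>_def ip_expand by linarith
        also have "\<dots> \<le> G + G + \<bar>g - b2 - b3\<bar> * (kZ * G)" using f c1 by (intro add_mono mult_left_mono) auto
        finally show ?thesis by (simp add: l\<Psi>_def algebra_simps)
      qed
      have c2: "\<bar>ip v \<psi>2\<bar> \<le> l2 * G"
      proof -
        have "\<bar>b * ip v \<psi>1 - ip v \<Psi>\<bar> \<le> b * \<bar>ip v \<psi>1\<bar> + \<bar>ip v \<Psi>\<bar>"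
          using pos by (metis abs_mult abs_of_pos abs_triangle_ineq4)
        also have "\<dots> \<le> b * (kZ * G) + l\<Psi> * G" using c1 cP pos by (intro add_mono mult_left_mono) auto
        also have "\<dots> = (b * kZ + l\<Psi>) * G" by (simp add: algebra_simps)
        finally have "\<bar>b * ip v \<psi>1 - ip v \<Psi>\<bar> / \<bar>\<sigma>\<bar> \<le> (b * kZ + l\<Psi>) * G / \<bar>\<sigma>\<bar>" by (rule divide_right_mono) simp
        then show ?thesis by (simp add: \<psi>2_def ip_expand l2_def abs_mult)
      qed
      have c0: "\<bar>ip v \<phi>0\<bar> \<le> l0 * G"
      proof -
        have "\<bar>ip v \<phi>0\<bar> \<le> \<bar>ip v \<psi>1\<bar> + b * \<bar>ip v \<psi>2\<bar>"
          using pos by (simp add: \<phi>0_def ip_expand) (metis abs_mult abs_of_pos abs_triangle_ineq4)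
        also have "\<dots> \<le> kZ * G + b * (l2 * G)" using c1 c2 pos by (intro add_mono mult_left_mono) auto
        finally show ?thesis by (simp add: l0_def algebra_simps)
      qed
      have cX: "\<bar>ip v \<phi>2\<bar> \<le> lX * G"
      proof -
        have "\<bar>ip v f2 - g * (ip v \<psi>1 + s * ip v \<psi>2)\<bar> \<le> \<bar>ip v f2\<bar> + g * (\<bar>ip v \<psi>1\<bar> + s * \<bar>ip v \<psi>2\<bar>)"
        proof -
          have "\<bar>g * (ip v \<psi>1 + s * ip v \<psi>2)\<bar> = g * \<bar>ip v \<psi>1 + s * ip v \<psi>2\<bar>" using pos by (simp add: abs_mult)
          also have "\<dots> \<le> g * (\<bar>ip v \<psi>1\<bar> + \<bar>s * ip v \<psi>2\<bar>)" using pos by (intro mult_left_mono abs_triangle_ineq) auto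
          also have "\<dots> = g * (\<bar>ip v \<psi>1\<bar> + s * \<bar>ip v \<psi>2\<bar>)" using pos by (simp add: abs_mult)
          finally show ?thesis by linarith
        qed
        also have "\<dots> \<le> G + g * (kZ * G + s * (l2 * G))" using c1 c2 f pos by (intro add_mono mult_left_mono) auto
        also have "\<dots> = (g * (kZ + s * l2) + 1) * G" by (simp add: algebra_simps)
        finally have "\<bar>ip v f2 - g * (ip v \<psi>1 + s * ip v \<psi>2)\<bar> / d3 \<le> (g * (kZ + s * l2) + 1) * G / d3"
          using d3 by (intro divide_right_mono) auto
        then show ?thesis using d3 by (simp add: \<phi>2_def ip_expand lX_def abs_mult)
      qed
      have "0 \<le> l0 * G" "0 \<le> l2 * G" "0 \<le> lX * G" using kpos G0 by simp_all
      then have "\<bar>ip v w\<bar> \<le> (l0 + l2 + lX) * G" using c0 c2 cX that(2) by (auto simp: distrib_right)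
      then show ?thesis by (simp add: G_def mult_ac)
    qed
    define q n where "q = ip (X V0) V0 + ip (X V1) V1 + ip (X V2) V2" and "n = ip V1 V1 + ip V2 V2 + ip V3 V3"
    have qi: "0 \<le> ip (X V0) V0" "0 \<le> ip (X V1) V1" "0 \<le> ip (X V2) V2" using S X_nonneg by simp_all
    have ni: "0 \<le> ip V1 V1" "0 \<le> ip V2 V2" "0 \<le> ip V3 V3" by (simp_all add: ip_nonneg)
    have en: "ip e4 e4 + \<gamma>\<^sup>2 * (q + n) \<le> ip e1 e1 + C * F"
      using chain_energy[OF S(5,4,3) XV0 XV1 XV2 e1V e4V \<gamma> \<gamma>_le(2-6) \<gamma>_le(1) small]
      by (simp add: C_def q_def n_def mult_ac add_ac)
    have Dq: "ip (X (V0 + x *\<^sub>R V1 + y *\<^sub>R V2)) (V0 + x *\<^sub>R V1 + y *\<^sub>R V2) \<le> 3 * D * q" if "x\<^sup>2 \<le> D" "y\<^sup>2 \<le> D" for x y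
    proof -
      have "ip (X (V0 + x *\<^sub>R V1 + y *\<^sub>R V2)) (V0 + x *\<^sub>R V1 + y *\<^sub>R V2)
          \<le> 3 * (ip (X V0) V0 + ip (X (x *\<^sub>R V1)) (x *\<^sub>R V1) + ip (X (y *\<^sub>R V2)) (y *\<^sub>R V2))"
        by (intro X_form_sum3_le S S_closed)
      also have "\<dots> = 3 * (ip (X V0) V0 + x\<^sup>2 * ip (X V1) V1 + y\<^sup>2 * ip (X V2) V2)"
        by (simp add: X_simps ip_expand power2_eq_square mult_ac)
      also have "\<dots> \<le> 3 * (D * ip (X V0) V0 + D * ip (X V1) V1 + D * ip (X V2) V2)"
        using D mult_right_mono[OF D qi(1)] by (intro mult_left_mono add_mono mult_right_mono that qi) auto
      finally show ?thesis by (simp add: q_def algebra_simps)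
    qed
    have Dn: "ip (x *\<^sub>R V1 + y *\<^sub>R V2 + z *\<^sub>R V3) (x *\<^sub>R V1 + y *\<^sub>R V2 + z *\<^sub>R V3) \<le> 3 * D * n"
      if "x\<^sup>2 \<le> D" "y\<^sup>2 \<le> D" "z\<^sup>2 \<le> D" for x y z
    proof -
      have "ip (x *\<^sub>R V1 + y *\<^sub>R V2 + z *\<^sub>R V3) (x *\<^sub>R V1 + y *\<^sub>R V2 + z *\<^sub>R V3)
          \<le> 3 * (ip (x *\<^sub>R V1) (x *\<^sub>R V1) + ip (y *\<^sub>R V2) (y *\<^sub>R V2) + ip (z *\<^sub>R V3) (z *\<^sub>R V3))"
        by (rule ip_sum3_le)
      also have "\<dots> = 3 * (x\<^sup>2 * ip V1 V1 + y\<^sup>2 * ip V2 V2 + z\<^sup>2 * ip V3 V3)"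
        by (simp add: ip_expand power2_eq_square mult_ac)
      also have "\<dots> \<le> 3 * (D * ip V1 V1 + D * ip V2 V2 + D * ip V3 V3)"
        by (intro mult_left_mono add_mono mult_right_mono that ni) auto
      finally show ?thesis by (simp add: n_def algebra_simps)
    qed
    have q2: "ip (X e2) e2 \<le> 3 * D * q" unfolding e2V by (rule Dq; simp add: D_def)
    have q3: "ip (X e3) e3 \<le> 3 * D * q" unfolding e3V by (rule Dq; simp add: D_def)
    have q4: "ip (X e4) e4 \<le> 3 * D * q" unfolding e4V by (rule Dq; simp add: D_def)
    have n_gen: "ip (e - e1) (e - e1) \<le> 3 * D * n"
      if "e = V0 + x *\<^sub>R V1 + y *\<^sub>R V2" "(d1 - x)\<^sup>2 \<le> D" "(d2 - y)\<^sup>2 \<le> D" for e x y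
    proof -
      have "ip (e - e1) (e - e1) = ip (e1 - e) (e1 - e)" by (simp add: ip_expand)
      also have "e1 - e = (d1 - x) *\<^sub>R V1 + (d2 - y) *\<^sub>R V2 + d3 *\<^sub>R V3"
        by (simp add: that e1V algebra_simps)
      finally show ?thesis using Dn[OF that(2,3), of d3] by (simp add: D_def)
    qed
    have n2: "ip (e2 - e1) (e2 - e1) \<le> 3 * D * n" by (rule n_gen[OF e2V]; simp add: D_def)
    have n3: "ip (e3 - e1) (e3 - e1) \<le> 3 * D * n" by (rule n_gen[OF e3V]; simp add: D_def)
    have n4: "ip (e4 - e1) (e4 - e1) \<le> 3 * D * n" by (rule n_gen[OF e4V]; simp add: D_def)
    let ?E = "(\<Sum>e\<in>#{#e2, e3, e4#}. ip (X e) e) + (\<Sum>e\<in>#{#e2, e3, e4#}. ip (e - e1) (e - e1))"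
    have "?E \<le> 9 * D * (q + n)" using q2 q3 q4 n2 n3 n4 by (simp add: distrib_left)
    then have "\<gamma>\<^sup>2 / (9 * D) * ?E \<le> \<gamma>\<^sup>2 / (9 * D) * (9 * D * (q + n))"
      using D by (intro mult_left_mono) auto
    also have "\<dots> = \<gamma>\<^sup>2 * (q + n)" using D by simp
    finally show "ip e4 e4 + \<gamma>\<^sup>2 / (9 * D) * ?E \<le> ip e1 e1 + C * F" using en by linarith
  qed
qed


section \<open>Discrete calculus\<close>

lemma finite_grid [simp]: "finite (grid N :: ('d::finite \<Rightarrow> nat) set)"
proof -
  have "grid N = (PiE UNIV (\<lambda>_. {1..N}) :: ('d \<Rightarrow> nat) set)"
    by (auto simp: grid_def PiE_def Pi_def)
  then show ?thesis by (simp add: finite_PiE)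
qed

lemma finite_midpoints [simp]: "finite (midpoints N i :: ('d::finite \<Rightarrow> nat) set)"
proof -
  have "midpoints N i \<subseteq> (PiE UNIV (\<lambda>_. {0..N}) :: ('d \<Rightarrow> nat) set)"
    by (auto simp: midpoints_def PiE_def Pi_def)
  then show ?thesis by (rule finite_subset) (simp add: finite_PiE)
qed

lemma grid_subset_midpoints: "grid N \<subseteq> midpoints N i"
  by (auto simp: grid_def midpoints_def)

lemma grid_upd: "I \<in> grid N \<Longrightarrow> 1 \<le> l \<Longrightarrow> l \<le> N \<Longrightarrow> I(i := l) \<in> grid N"
  by (auto simp: grid_def)

lemma midpoints_upd: "I \<in> midpoints N i \<Longrightarrow> l \<le> N \<Longrightarrow> I(i := l) \<in> midpoints N i"
  by (auto simp: midpoints_def)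

lemma midpoints_cases:
  assumes "I \<in> midpoints N i"
  obtains "I i = 0" | "I \<in> grid N"
  using assms by (cases "I i = 0") (auto simp: midpoints_def grid_def, metis One_nat_def Suc_leI)

lemma midpoints_grid: "I \<in> midpoints N i \<Longrightarrow> I i \<noteq> 0 \<Longrightarrow> I \<in> grid N"
  by (auto elim: midpoints_cases)

lemma grid_lower_midpoint: "I \<in> grid N \<Longrightarrow> I(i := I i - 1) \<in> midpoints N i"
  by (auto simp: grid_def midpoints_def intro: le_trans[OF diff_le_self])

section \<open>The discrete inner product and summation by parts\<close>

lemma semi_inner_h: "semi_inner (inner_h N :: ('d::finite) gridfun \<Rightarrow> 'd gridfun \<Rightarrow> real)"
proof
  show "inner_h N (u + v) w = inner_h N u w + inner_h N v w" for u v w :: "'d gridfun"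
    by (simp add: inner_h_def inner_add_left sum.distrib distrib_left)
  show "inner_h N (r *\<^sub>R u) w = r * inner_h N u w" for r and u w :: "'d gridfun"
    by (simp add: inner_h_def sum_distrib_left mult_ac)
  show "inner_h N u w = inner_h N w u" for u w :: "'d gridfun"
    by (simp add: inner_h_def inner_commute)
  show "0 \<le> inner_h N u u" for u :: "'d gridfun"
    by (simp add: inner_h_def sum_nonneg)
qed

lemma nrm_inner_h: "semi_inner.nrm (inner_h N) = norm2_h N"
  by (simp add: semi_inner.nrm_def[OF semi_inner_h] norm2_h_def fun_eq_iff)

text \<open>No boundary terms remain because \<open>p\<close> vanishes at both ends of every grid
  line in direction \<open>i\<close>. Allowing a general flux \<open>p\<close> rather than a
  difference quotient makes the rule available for truncation errors of fluxes as well.\<close>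

lemma sum_by_parts:
  fixes p g :: "('d::finite) gridfun"
  assumes p0: "\<And>I. I \<in> midpoints N i \<Longrightarrow> I i = 0 \<or> I i = N \<Longrightarrow> p I = 0"
  shows "(\<Sum>I\<in>grid N. (p I - p (I(i := I i - 1))) \<bullet> g I)
    = - (\<Sum>I\<in>midpoints N i. p I \<bullet> (g (I(i := I i + 1)) - g I))"
proof -
  have 1: "(\<Sum>I\<in>grid N. p I \<bullet> g I) = (\<Sum>I\<in>midpoints N i. p I \<bullet> g I)"
  proof (rule sum.mono_neutral_left)
    show "\<forall>I\<in>midpoints N i - grid N. p I \<bullet> g I = 0"
      using midpoints_cases p0 by (metis DiffE inner_zero_left)
  qed (simp_all add: grid_subset_midpoints)
  let ?M = "{I \<in> midpoints N i. I i < N}"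
  have "(\<Sum>I\<in>grid N. p (I(i := I i - 1)) \<bullet> g I) = (\<Sum>I\<in>?M. p I \<bullet> g (I(i := I i + 1)))"
  proof (rule sum.reindex_bij_witness[where i = "\<lambda>I. I(i := I i + 1)" and j = "\<lambda>I. I(i := I i - 1)"])
    fix I :: "'d \<Rightarrow> nat" assume I: "I \<in> grid N"
    then have "I i \<ge> 1" "I i \<le> N" by (auto simp: grid_def)
    then show "(I(i := I i - 1))(i := (I(i := I i - 1)) i + 1) = I" by auto
    show "I(i := I i - 1) \<in> ?M"
      using grid_lower_midpoint[OF I, of i] \<open>I i \<ge> 1\<close> \<open>I i \<le> N\<close> by auto
    show "p (I(i := I i - 1)) \<bullet> g ((I(i := I i - 1))(i := (I(i := I i - 1)) i + 1))
        = p (I(i := I i - 1)) \<bullet> g I"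
      using \<open>I i \<ge> 1\<close> by simp
  next
    fix I :: "'d \<Rightarrow> nat" assume I: "I \<in> ?M"
    show "(I(i := I i + 1))(i := (I(i := I i + 1)) i - 1) = I" by auto
    show "I(i := I i + 1) \<in> grid N" using I by (auto simp: grid_def midpoints_def)
  qed
  also have "\<dots> = (\<Sum>I\<in>midpoints N i. p I \<bullet> g (I(i := I i + 1)))"
  proof (rule sum.mono_neutral_left)
    show "\<forall>I\<in>midpoints N i - ?M. p I \<bullet> g (I(i := I i + 1)) = 0"
    proof
      fix I assume "I \<in> midpoints N i - ?M"
      then have "I \<in> midpoints N i" "I i = N" by (auto simp: midpoints_def)
      then show "p I \<bullet> g (I(i := I i + 1)) = 0" using p0 by simp
    qed
  qed auto
  finally show ?thesis
    by (simp add: inner_diff_left inner_diff_right sum_subtractf 1)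
qed

lemma neumann_grad_zero:
  assumes "discrete_neumann N u" "I \<in> midpoints N i" "I i = 0 \<or> I i = N"
  shows "grad_h N u i I = 0"
proof -
  have *: "\<forall>j. j \<noteq> i \<longrightarrow> 1 \<le> I j \<and> I j \<le> N" using assms(2) by (simp add: midpoints_def)
  have "u (I(i := 0)) = u (I(i := 1))" "u (I(i := N + 1)) = u (I(i := N))"
    using assms(1) * unfolding discrete_neumann_def by blast+
  moreover have "I(i := I i) = I" by simp
  ultimately have "u (I(i := I i + 1)) = u I" using assms(3) by (metis add_0)
  then show ?thesis by (simp add: grad_h_def)
qed

lemma grad_sum_midpoints_grid:
  fixes u :: "('d::finite) gridfun"
  assumes "discrete_neumann N u"
  shows "(\<Sum>I\<in>midpoints N i. (norm (grad_h N u i I))\<^sup>2) = (\<Sum>I\<in>grid N. (norm (grad_h N u i I))\<^sup>2)"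
proof (rule sum.mono_neutral_right)
  show "\<forall>I\<in>midpoints N i - grid N. (norm (grad_h N u i I))\<^sup>2 = 0"
    using midpoints_cases neumann_grad_zero[OF assms]
    by (metis DiffE norm_zero power_zero_numeral)
qed (simp_all add: grid_subset_midpoints)

text \<open>Written as a difference of two fluxes to fit summation by parts. The index
  \<open>I i - 1\<close> is truncated subtraction, so the value is meaningful for
  \<open>I i \<ge> 1\<close> only.\<close>

definition second_diff :: "nat \<Rightarrow> 'd gridfun \<Rightarrow> 'd \<Rightarrow> 'd gridfun" where
  "second_diff N u i I = real N *\<^sub>R (grad_h N u i I - grad_h N u i (I(i := I i - 1)))"

lemma second_diff_eq:
  assumes "I \<in> grid N"
  shows "second_diff N u i I = (real N)\<^sup>2 *\<^sub>R (u (I(i := I i + 1)) - 2 *\<^sub>R u I + u (I(i := I i - 1)))"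
proof -
  have "I i \<ge> 1" using assms by (simp add: grid_def)
  then have "(I(i := I i - 1))(i := (I(i := I i - 1)) i + 1) = I" by simp
  then show ?thesis
    by (simp add: second_diff_def grad_h_def power2_eq_square scaleR_diff_right scaleR_add_right scaleR_2
        flip: scaleR_scaleR)
qed

lemma lap_h_eq_sum: "I \<in> grid N \<Longrightarrow> lap_h N u I = (\<Sum>i\<in>UNIV. second_diff N u i I)"
  by (simp add: lap_h_def second_diff_eq)

lemma second_diff_by_parts:
  fixes u g :: "('d::finite) gridfun"
  assumes "\<And>I. I \<in> midpoints N i \<Longrightarrow> I i = 0 \<or> I i = N \<Longrightarrow> grad_h N u i I = 0"
  shows "(\<Sum>I\<in>grid N. second_diff N u i I \<bullet> g I) = - (\<Sum>I\<in>midpoints N i. grad_h N u i I \<bullet> grad_h N g i I)"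
proof -
  have "(\<Sum>I\<in>grid N. second_diff N u i I \<bullet> g I)
      = (\<Sum>I\<in>grid N. (real N *\<^sub>R grad_h N u i I - real N *\<^sub>R grad_h N u i (I(i := I i - 1))) \<bullet> g I)"
    by (simp add: second_diff_def scaleR_diff_right)
  also have "\<dots> = - (\<Sum>I\<in>midpoints N i. (real N *\<^sub>R grad_h N u i I) \<bullet> (g (I(i := I i + 1)) - g I))"
    by (rule sum_by_parts) (simp add: assms)
  finally show ?thesis by (simp add: grad_h_def mult.assoc)
qed

text \<open>The boundary fluxes of \<open>u\<close> vanish, so ghost values of \<open>g\<close> are
  multiplied by 0 and \<open>g\<close> may be arbitrary.\<close>

lemma inner_lap_h:
  fixes u g :: "('d::finite) gridfun"
  assumes "discrete_neumann N u"
  shows "inner_h N (lap_h N u) g = - grad_inner_h N (grad_h N u) (grad_h N g)"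
proof -
  have "(\<Sum>I\<in>grid N. lap_h N u I \<bullet> g I) = (\<Sum>I\<in>grid N. \<Sum>i\<in>UNIV. second_diff N u i I \<bullet> g I)"
    by (rule sum.cong) (simp_all add: lap_h_eq_sum inner_sum_left)
  also have "\<dots> = (\<Sum>i\<in>UNIV. \<Sum>I\<in>grid N. second_diff N u i I \<bullet> g I)" by (rule sum.swap)
  also have "\<dots> = - (\<Sum>i\<in>UNIV. \<Sum>I\<in>midpoints N i. grad_h N u i I \<bullet> grad_h N g i I)"
    by (simp add: second_diff_by_parts[OF neumann_grad_zero[OF assms]] sum_negf)
  finally show ?thesis by (simp add: inner_h_def grad_inner_h_def)
qed

lemma grad_inner_h_commute: "grad_inner_h N p q = grad_inner_h N q p"
  by (simp add: grad_inner_h_def inner_commute)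

lemma grad_inner_h_nonneg: "0 \<le> grad_inner_h N p p"
  by (simp add: grad_inner_h_def sum_nonneg)

lemma grad_norm2_h_square: "(grad_norm2_h N p)\<^sup>2 = grad_inner_h N p p"
  by (simp add: grad_norm2_h_def grad_inner_h_nonneg)

lemma grad_norm2_h_nonneg [simp]: "0 \<le> grad_norm2_h N p"
  by (simp add: grad_norm2_h_def grad_inner_h_nonneg)

lemma norm2_h_square: "(norm2_h N u)\<^sup>2 = inner_h N u u"
  using semi_inner.nrm_square[OF semi_inner_h] by (simp add: nrm_inner_h)

lemma norm2_h_nonneg [simp]: "0 \<le> norm2_h N u"
  using semi_inner.nrm_nonneg[OF semi_inner_h] by (simp add: nrm_inner_h)

lemma subspace_neumann: "subspace {u :: ('d::finite) gridfun. discrete_neumann N u}"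
proof (rule subspaceI)
  show "0 \<in> {u :: 'd gridfun. discrete_neumann N u}" by (simp add: discrete_neumann_def)
qed (simp_all add: discrete_neumann_def)

lemma linear_lap_h: "linear (\<lambda>u. c *\<^sub>R lap_h N u)"
proof (rule linearI)
  show "c *\<^sub>R lap_h N (u + v) = c *\<^sub>R lap_h N u + c *\<^sub>R lap_h N v" for u v
    by (simp add: fun_eq_iff lap_h_def sum.distrib[symmetric] scaleR_add_right[symmetric] algebra_simps
        del: scaleR_add_right)
  show "c *\<^sub>R lap_h N (r *\<^sub>R u) = r *\<^sub>R c *\<^sub>R lap_h N u" for r u
    by (simp add: fun_eq_iff lap_h_def scaleR_sum_right algebra_simps)
qed

lemma dissipative_h:
  assumes "c \<ge> 0"
  shows "dissipative (inner_h N :: ('d::finite) gridfun \<Rightarrow> 'd gridfun \<Rightarrow> real)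
    (\<lambda>u. (- c) *\<^sub>R lap_h N u) {u. discrete_neumann N u}"
proof -
  interpret semi_inner "inner_h N :: 'd gridfun \<Rightarrow> 'd gridfun \<Rightarrow> real" by (rule semi_inner_h)
  show ?thesis
  proof (intro dissipative.intro semi_inner_h dissipative_axioms.intro)
    show "linear (\<lambda>u :: 'd gridfun. (- c) *\<^sub>R lap_h N u)" by (rule linear_lap_h)
    show "subspace {u :: 'd gridfun. discrete_neumann N u}" by (rule subspace_neumann)
    fix u v :: "'d gridfun"
    assume u: "u \<in> {u. discrete_neumann N u}"
    show "0 \<le> inner_h N ((- c) *\<^sub>R lap_h N u) u"
      using u assms by (simp add: ip_expand inner_lap_h grad_inner_h_nonneg)
    assume v: "v \<in> {u. discrete_neumann N u}"
    show "inner_h N ((- c) *\<^sub>R lap_h N u) v = inner_h N u ((- c) *\<^sub>R lap_h N v)"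
      using u v by (simp add: ip_expand inner_lap_h ip_commute[of u "lap_h N v"] grad_inner_h_commute[of N "grad_h N v"])
  qed
qed

text \<open>
  In each direction the second difference is controlled by the discrete Laplacian, because the
  mixed products are, after two summations by parts, squares of mixed differences.
\<close>

lemma second_diff_le_lap_h:
  fixes u :: "('d::finite) gridfun"
  assumes u: "discrete_neumann N u"
  shows "norm2_h N (second_diff N u i) \<le> norm2_h N (lap_h N u)"
proof -
  have mixed: "0 \<le> (\<Sum>I\<in>grid N. second_diff N u i I \<bullet> second_diff N u j I)" if ij: "i \<noteq> j" for i j
  proof -
    \<comment> \<open>The difference quotient of \<open>u\<close>, cut off at the upper boundary. In
      the second summation by parts the index \<open>j\<close> becomes a ghost index; at
      \<open>I i = N\<close> the quotient would then involve a corner ghost value, about which the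
      discrete Neumann condition says nothing.\<close>
    define v where "v I = (if I i = N then 0 else grad_h N u i I)" for I
    have v: "grad_h N v j I = 0" if I: "I \<in> midpoints N j" and Ij: "I j = 0 \<or> I j = N" for I
    proof (cases "I i = N")
      case True
      then show ?thesis using ij by (simp add: grad_h_def v_def)
    next
      case False
      have "I i < N" using I False ij by (auto simp: midpoints_def less_le)
      then have I': "I(i := I i + 1) \<in> midpoints N j" using I by (auto simp: midpoints_def)
      have "grad_h N u j (I(i := I i + 1)) = 0" "grad_h N u j I = 0"
        using neumann_grad_zero[OF u I'] neumann_grad_zero[OF u I] Ij ij by auto
      moreover have "grad_h N v j I = real N *\<^sub>R (grad_h N u j (I(i := I i + 1)) - grad_h N u j I)"
        using False ij by (simp add: grad_h_def v_def fun_upd_twist[OF ij] algebra_simps)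
      ultimately show ?thesis by simp
    qed
    have "(\<Sum>I\<in>grid N. second_diff N u i I \<bullet> second_diff N u j I)
        = - (\<Sum>I\<in>midpoints N i. grad_h N u i I \<bullet> grad_h N (second_diff N u j) i I)"
      by (rule second_diff_by_parts[OF neumann_grad_zero[OF u]])
    also have "(\<Sum>I\<in>midpoints N i. grad_h N u i I \<bullet> grad_h N (second_diff N u j) i I)
        = (\<Sum>I\<in>grid N. v I \<bullet> second_diff N v j I)"
    proof (rule sum.mono_neutral_cong_right)
      show "\<forall>I\<in>midpoints N i - grid N. grad_h N u i I \<bullet> grad_h N (second_diff N u j) i I = 0"
        using midpoints_cases neumann_grad_zero[OF u] by (metis DiffE inner_zero_left)
      fix I :: "'d \<Rightarrow> nat" assume I: "I \<in> grid N"
      show "grad_h N u i I \<bullet> grad_h N (second_diff N u j) i I = v I \<bullet> second_diff N v j I"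
      proof (cases "I i = N")
        case True
        then have "grad_h N u i I = 0"
          using neumann_grad_zero[OF u subsetD[OF grid_subset_midpoints I]] by simp
        then show ?thesis by (simp add: v_def True)
      next
        case False
        have "grad_h N (second_diff N u j) i I = second_diff N v j I"
        proof -
          have v': "v (I(j := x)) = real N *\<^sub>R (u (I(i := I i + 1, j := x)) - u (I(j := x)))" for x
            using False ij by (simp add: v_def grad_h_def fun_upd_twist[OF ij])
          have vI: "v I = real N *\<^sub>R (u (I(i := I i + 1)) - u I)"
            using False by (simp add: v_def grad_h_def)
          show ?thesis
            using ij by (simp add: second_diff_def grad_h_def v' vI scaleR_diff_right)
        qed
        then show ?thesis using False by (simp add: v_def)
      qed
    qed (simp_all add: grid_subset_midpoints)
    also have "\<dots> = (\<Sum>I\<in>grid N. second_diff N v j I \<bullet> v I)" by (simp add: inner_commute)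
    also have "\<dots> = - (\<Sum>I\<in>midpoints N j. grad_h N v j I \<bullet> grad_h N v j I)"
      by (rule second_diff_by_parts[OF v])
    finally show ?thesis by (simp add: sum_nonneg)
  qed
  have "(\<Sum>I\<in>grid N. second_diff N u i I \<bullet> second_diff N u i I)
      \<le> (\<Sum>k\<in>UNIV. \<Sum>l\<in>UNIV. \<Sum>I\<in>grid N. second_diff N u k I \<bullet> second_diff N u l I)"
  proof -
    have nn: "0 \<le> (\<Sum>I\<in>grid N. second_diff N u k I \<bullet> second_diff N u l I)" for k l
      by (cases "k = l") (auto simp: mixed sum_nonneg)
    have "(\<Sum>I\<in>grid N. second_diff N u i I \<bullet> second_diff N u i I)
        \<le> (\<Sum>l\<in>UNIV. \<Sum>I\<in>grid N. second_diff N u i I \<bullet> second_diff N u l I)"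
      by (rule member_le_sum) (simp_all add: nn)
    also have "\<dots> \<le> (\<Sum>k\<in>UNIV. \<Sum>l\<in>UNIV. \<Sum>I\<in>grid N. second_diff N u k I \<bullet> second_diff N u l I)"
      by (rule member_le_sum[where f = "\<lambda>k. \<Sum>l\<in>UNIV. \<Sum>I\<in>grid N. second_diff N u k I \<bullet> second_diff N u l I"])
        (simp_all add: nn sum_nonneg)
    finally show ?thesis .
  qed
  also have "\<dots> = (\<Sum>k\<in>UNIV. \<Sum>I\<in>grid N. \<Sum>l\<in>UNIV. second_diff N u k I \<bullet> second_diff N u l I)"
    by (rule sum.cong[OF refl]) (rule sum.swap)
  also have "\<dots> = (\<Sum>I\<in>grid N. \<Sum>k\<in>UNIV. \<Sum>l\<in>UNIV. second_diff N u k I \<bullet> second_diff N u l I)"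
    by (rule sum.swap)
  also have "\<dots> = (\<Sum>I\<in>grid N. lap_h N u I \<bullet> lap_h N u I)"
    by (rule sum.cong[OF refl], simp add: lap_h_eq_sum inner_sum_left inner_sum_right, rule sum.swap)
  finally show ?thesis
    by (simp add: norm2_h_def inner_h_def mult_left_mono)
qed

text \<open>Along a grid line in direction \<open>i\<close> the difference quotients start from the value 0 at the boundary.\<close>

lemma grad_h_sup_bound:
  fixes u :: "('d::finite) gridfun"
  assumes u: "discrete_neumann N u" and N: "N \<ge> 1" and I: "I \<in> midpoints N i"
  shows "(norm (grad_h N u i I))\<^sup>2
    \<le> 2 * real N ^ (CARD('d) - 1) * grad_norm2_h N (grad_h N u) * norm2_h N (second_diff N u i)"
proof -
  define p where "p l = grad_h N u i (I(i := l))" for l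
  define L where "L = I i"
  have L: "L \<le> N" using I by (simp add: L_def midpoints_def)
  have p0: "p 0 = 0" unfolding p_def by (rule neumann_grad_zero[OF u midpoints_upd[OF I]]) auto
  have inG: "I(i := l) \<in> grid N" if "l \<in> {1..N}" for l using that I by (auto simp: grid_def midpoints_def)
  have line: "(\<Sum>l\<in>{1..N}. F (I(i := l))) \<le> (\<Sum>J\<in>grid N. F J)" if "\<And>J. F J \<ge> 0" for F :: "('d \<Rightarrow> nat) \<Rightarrow> real"
  proof -
    have inj: "inj_on (\<lambda>l. I(i := l)) {1..N}" by (rule inj_onI) (metis fun_upd_same)
    have "(\<Sum>l\<in>{1..N}. F (I(i := l))) = sum F ((\<lambda>l. I(i := l)) ` {1..N})"
      by (subst sum.reindex[OF inj]) (simp add: o_def)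
    also have "\<dots> \<le> sum F (grid N)" by (rule sum_mono2) (use inG that in auto)
    finally show ?thesis .
  qed
  define sd where "sd l = norm (second_diff N u i (I(i := l)))" for l
  have step: "(norm (p (Suc l)))\<^sup>2 - (norm (p l))\<^sup>2 \<le> (sd (Suc l) / real N) * (norm (p (Suc l)) + norm (p l))" for l
  proof -
    have "second_diff N u i (I(i := Suc l)) = real N *\<^sub>R (p (Suc l) - p l)"
      by (simp add: second_diff_def p_def)
    then have "norm (p (Suc l) - p l) = sd (Suc l) / real N" using N by (simp add: sd_def)
    moreover have "norm (p (Suc l)) - norm (p l) \<le> norm (p (Suc l) - p l)" by (rule norm_triangle_ineq2)
    ultimately have "(norm (p (Suc l)) - norm (p l)) * (norm (p (Suc l)) + norm (p l))
        \<le> (sd (Suc l) / real N) * (norm (p (Suc l)) + norm (p l))"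
      by (intro mult_right_mono) auto
    then show ?thesis by (simp add: power2_eq_square algebra_simps)
  qed
  \<comment> \<open>Discrete counterpart of \<open>|p(x)|^2 \<le> 2 \<integral> |p| |p'|\<close> for
    a function with \<open>p(0) = 0\<close>.\<close>
  have "(norm (p L))\<^sup>2 = (\<Sum>l<L. (norm (p (Suc l)))\<^sup>2 - (norm (p l))\<^sup>2)"
    by (subst sum_lessThan_telescope) (simp add: p0)
  also have "\<dots> \<le> (\<Sum>l<L. (sd (Suc l) / real N) * (norm (p (Suc l)) + norm (p l)))"
    by (intro sum_mono step)
  also have "\<dots> \<le> (\<Sum>l<N. (sd (Suc l) / real N) * (norm (p (Suc l)) + norm (p l)))"
    by (rule sum_mono2) (use L in \<open>auto simp: sd_def\<close>)
  also have "\<dots> = ((\<Sum>l<N. sd (Suc l) * norm (p (Suc l))) + (\<Sum>l<N. sd (Suc l) * norm (p l))) / real N"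
    by (simp add: sum_divide_distrib sum.distrib[symmetric] distrib_left add_divide_distrib)
  also have "\<dots> \<le> (2 * (sqrt (\<Sum>J\<in>grid N. (norm (second_diff N u i J))\<^sup>2) * sqrt (\<Sum>J\<in>grid N. (norm (grad_h N u i J))\<^sup>2))) / real N"
  proof -
    let ?A = "sqrt (\<Sum>J\<in>grid N. (norm (second_diff N u i J))\<^sup>2)" and ?B = "sqrt (\<Sum>J\<in>grid N. (norm (grad_h N u i J))\<^sup>2)"
    have shift: "(\<Sum>l<N. F (Suc l)) = (\<Sum>l\<in>{1..N}. F l)" for F :: "nat \<Rightarrow> real"
      by (simp add: sum.shift_bounds_Suc_ivl[symmetric] lessThan_atLeast0 atLeastLessThanSuc_atLeastAtMost)
    have A: "L2_set (\<lambda>l. sd (Suc l)) {..<N} \<le> ?A"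
      using line[of "\<lambda>J. (norm (second_diff N u i J))\<^sup>2"] shift[of "\<lambda>l. (sd l)\<^sup>2"]
      by (simp add: L2_set_def sd_def)
    have B: "L2_set (\<lambda>l. norm (p (Suc l))) {..<N} \<le> ?B"
      using line[of "\<lambda>J. (norm (grad_h N u i J))\<^sup>2"] shift[of "\<lambda>l. (norm (p l))\<^sup>2"]
      by (simp add: L2_set_def p_def)
    have B': "L2_set (\<lambda>l. norm (p l)) {..<N} \<le> ?B"
    proof -
      have "(\<Sum>l<N. (norm (p l))\<^sup>2) \<le> (\<Sum>l<Suc N. (norm (p l))\<^sup>2)" by simp
      also have "\<dots> = (\<Sum>l<N. (norm (p (Suc l)))\<^sup>2)" by (subst sum.lessThan_Suc_shift) (simp add: p0)
      finally have "L2_set (\<lambda>l. norm (p l)) {..<N} \<le> L2_set (\<lambda>l. norm (p (Suc l))) {..<N}"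
        unfolding L2_set_def by (rule real_sqrt_le_mono)
      then show ?thesis using B by linarith
    qed
    have "(\<Sum>l<N. sd (Suc l) * norm (p (Suc l))) \<le> L2_set (\<lambda>l. sd (Suc l)) {..<N} * L2_set (\<lambda>l. norm (p (Suc l))) {..<N}"
      using L2_set_mult_ineq[of "\<lambda>l. sd (Suc l)" "\<lambda>l. norm (p (Suc l))" "{..<N}"] by (simp add: sd_def)
    also have "\<dots> \<le> ?A * ?B" by (intro mult_mono A B) (simp_all add: L2_set_nonneg sum_nonneg)
    finally have 1: "(\<Sum>l<N. sd (Suc l) * norm (p (Suc l))) \<le> ?A * ?B" .
    have "(\<Sum>l<N. sd (Suc l) * norm (p l)) \<le> L2_set (\<lambda>l. sd (Suc l)) {..<N} * L2_set (\<lambda>l. norm (p l)) {..<N}"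
      using L2_set_mult_ineq[of "\<lambda>l. sd (Suc l)" "\<lambda>l. norm (p l)" "{..<N}"] by (simp add: sd_def)
    also have "\<dots> \<le> ?A * ?B" by (intro mult_mono A B') (simp_all add: L2_set_nonneg sum_nonneg)
    finally have 2: "(\<Sum>l<N. sd (Suc l) * norm (p l)) \<le> ?A * ?B" .
    show ?thesis using 1 2 by (intro divide_right_mono) auto
  qed
  also have "\<dots> \<le> 2 * real N ^ (CARD('d) - 1) * grad_norm2_h N (grad_h N u) * norm2_h N (second_diff N u i)"
  proof -
    let ?d = "CARD('d)"
    have A: "sqrt (\<Sum>J\<in>grid N. (norm (second_diff N u i J))\<^sup>2) = sqrt (real N ^ ?d) * norm2_h N (second_diff N u i)"
      using N by (simp add: norm2_h_def inner_h_def power2_norm_eq_inner real_sqrt_mult[symmetric] power_one_over)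
    have "(\<Sum>J\<in>grid N. (norm (grad_h N u i J))\<^sup>2) = (\<Sum>J\<in>midpoints N i. (norm (grad_h N u i J))\<^sup>2)"
      by (rule grad_sum_midpoints_grid[OF u, symmetric])
    also have "\<dots> \<le> (\<Sum>j\<in>UNIV. \<Sum>J\<in>midpoints N j. (norm (grad_h N u j J))\<^sup>2)"
      by (rule member_le_sum[where f = "\<lambda>j. \<Sum>J\<in>midpoints N j. (norm (grad_h N u j J))\<^sup>2"]) (simp_all add: sum_nonneg)
    also have "\<dots> = real N ^ ?d * grad_inner_h N (grad_h N u) (grad_h N u)"
      using N by (simp add: grad_inner_h_def power2_norm_eq_inner power_one_over)
    finally have B: "sqrt (\<Sum>J\<in>grid N. (norm (grad_h N u i J))\<^sup>2) \<le> sqrt (real N ^ ?d) * grad_norm2_h N (grad_h N u)"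
      unfolding grad_norm2_h_def real_sqrt_mult[symmetric] by (rule real_sqrt_le_mono)
    have "sqrt (\<Sum>J\<in>grid N. (norm (second_diff N u i J))\<^sup>2) * sqrt (\<Sum>J\<in>grid N. (norm (grad_h N u i J))\<^sup>2)
        \<le> (sqrt (real N ^ ?d) * norm2_h N (second_diff N u i)) * (sqrt (real N ^ ?d) * grad_norm2_h N (grad_h N u))"
      unfolding A by (intro mult_left_mono B) simp
    also have "\<dots> = real N ^ ?d * (norm2_h N (second_diff N u i) * grad_norm2_h N (grad_h N u))"
      by (simp add: mult_ac)
    \<comment> \<open>Embedding one grid line into the whole grid costs the full cell weight
      \<open>N^d\<close>; the step length \<open>1/N\<close> of the telescoped sum takes back one
      factor.\<close>
    also have "real N ^ ?d = real N * real N ^ (?d - 1)"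
      by (metis One_nat_def Suc_pred zero_less_card_finite power_Suc)
    finally show ?thesis using N by (simp add: field_simps)
  qed
  finally show ?thesis by (simp add: p_def L_def)
qed

section \<open>Inverse inequalities and comparison of discrete norms\<close>

lemma sup_le_norm2_h:
  fixes u :: "('d::finite) gridfun"
  assumes N: "N \<ge> 1" and I: "I \<in> grid N"
  shows "(norm (u I))\<^sup>2 \<le> real N ^ CARD('d) * (norm2_h N u)\<^sup>2"
proof -
  have "(norm (u I))\<^sup>2 \<le> (\<Sum>J\<in>grid N. (norm (u J))\<^sup>2)" by (rule member_le_sum[where f = "\<lambda>J. (norm (u J))\<^sup>2"]) (use I in auto)
  then show ?thesis using N by (simp add: norm2_h_square inner_h_def power2_norm_eq_inner power_one_over)
qed

lemma norm2_h_le_sup: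
  fixes u :: "('d::finite) gridfun"
  assumes N: "N \<ge> 1" and "\<And>I. I \<in> grid N \<Longrightarrow> norm (u I) \<le> M" and M: "M \<ge> 0"
  shows "norm2_h N u \<le> M"
proof -
  have card: "card (grid N :: ('d \<Rightarrow> nat) set) = N ^ CARD('d)"
  proof -
    have "grid N = (PiE UNIV (\<lambda>_. {1..N}) :: ('d \<Rightarrow> nat) set)"
      by (auto simp: grid_def PiE_def Pi_def)
    then show ?thesis by (simp add: card_PiE)
  qed
  have "(\<Sum>I\<in>grid N. u I \<bullet> u I) \<le> (\<Sum>I\<in>(grid N :: ('d \<Rightarrow> nat) set). M\<^sup>2)"
    by (intro sum_mono) (metis assms(2) norm_ge_zero power2_norm_eq_inner power_mono)
  also have "\<dots> = real N ^ CARD('d) * M\<^sup>2" by (simp add: card)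
  finally have "inner_h N u u \<le> (1 / real N) ^ CARD('d) * (real N ^ CARD('d) * M\<^sup>2)"
    unfolding inner_h_def by (intro mult_left_mono) auto
  also have "\<dots> = M\<^sup>2" using N by (simp add: power_one_over)
  finally have "sqrt (inner_h N u u) \<le> sqrt (M\<^sup>2)" by (rule real_sqrt_le_mono)
  then show ?thesis using M by (simp add: norm2_h_def)
qed

lemma norm2_h_cong:
  assumes "\<And>I. I \<in> grid N \<Longrightarrow> u I = v I"
  shows "norm2_h N u = norm2_h N v"
  unfolding norm2_h_def inner_h_def using assms by simp

lemma inner_h_cong:
  assumes "\<And>I. I \<in> grid N \<Longrightarrow> u I = v I"
  shows "inner_h N w u = inner_h N w v"
  unfolding inner_h_def using assms by simp

text \<open>A squared quotient is at most \<open>2 N^2\<close> times the sum of two neighbouring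
  squares, and in each direction a grid point is a neighbour at most twice; boundary midpoints
  contribute 0.\<close>

lemma inverse_inequality:
  fixes u :: "('d::finite) gridfun"
  assumes u: "discrete_neumann N u"
  shows "(grad_norm2_h N (grad_h N u))\<^sup>2 \<le> 4 * real CARD('d) * (real N)\<^sup>2 * (norm2_h N u)\<^sup>2"
proof -
  have *: "(\<Sum>I\<in>midpoints N i. (norm (grad_h N u i I))\<^sup>2) \<le> 4 * (real N)\<^sup>2 * (\<Sum>I\<in>grid N. (norm (u I))\<^sup>2)" for i
  proof -
    let ?M = "{I \<in> midpoints N i. I i \<noteq> 0 \<and> I i \<noteq> N}"
    have "(\<Sum>I\<in>midpoints N i. (norm (grad_h N u i I))\<^sup>2) = (\<Sum>I\<in>?M. (norm (grad_h N u i I))\<^sup>2)"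
      by (rule sum.mono_neutral_right) (use neumann_grad_zero[OF u] in auto)
    also have "\<dots> \<le> (\<Sum>I\<in>?M. 2 * (real N)\<^sup>2 * ((norm (u (I(i := I i + 1))))\<^sup>2 + (norm (u I))\<^sup>2))"
    proof (rule sum_mono)
      fix I
      have "(norm (u (I(i := I i + 1)) - u I))\<^sup>2 \<le> (norm (u (I(i := I i + 1))) + norm (u I))\<^sup>2"
        by (intro power_mono norm_triangle_ineq4) simp
      also have "\<dots> \<le> 2 * ((norm (u (I(i := I i + 1))))\<^sup>2 + (norm (u I))\<^sup>2)"
        using sum_squares_bound[of "norm (u (I(i := I i + 1)))" "norm (u I)"] by (simp add: power2_sum)
      finally have "(real N)\<^sup>2 * (norm (u (I(i := I i + 1)) - u I))\<^sup>2
          \<le> (real N)\<^sup>2 * (2 * ((norm (u (I(i := I i + 1))))\<^sup>2 + (norm (u I))\<^sup>2))"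
        by (intro mult_left_mono) auto
      moreover have "(norm (grad_h N u i I))\<^sup>2 = (real N)\<^sup>2 * (norm (u (I(i := I i + 1)) - u I))\<^sup>2"
        by (simp add: grad_h_def power_mult_distrib)
      ultimately have "(norm (grad_h N u i I))\<^sup>2
          \<le> (real N)\<^sup>2 * (2 * ((norm (u (I(i := I i + 1))))\<^sup>2 + (norm (u I))\<^sup>2))" by (simp only:)
      then show "(norm (grad_h N u i I))\<^sup>2 \<le> 2 * (real N)\<^sup>2 * ((norm (u (I(i := I i + 1))))\<^sup>2 + (norm (u I))\<^sup>2)"
        by (simp only: mult_ac)
    qed
    also have "\<dots> = 2 * (real N)\<^sup>2 * ((\<Sum>I\<in>?M. (norm (u (I(i := I i + 1))))\<^sup>2) + (\<Sum>I\<in>?M. (norm (u I))\<^sup>2))"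
      by (simp only: sum_distrib_left[symmetric] sum.distrib)
    also have "\<dots> \<le> 2 * (real N)\<^sup>2 * ((\<Sum>I\<in>grid N. (norm (u I))\<^sup>2) + (\<Sum>I\<in>grid N. (norm (u I))\<^sup>2))"
    proof (intro mult_left_mono add_mono)
      have sub: "?M \<subseteq> grid N" using midpoints_grid by auto
      have sub': "(\<lambda>I. I(i := I i + 1)) ` ?M \<subseteq> grid N"
      proof (rule image_subsetI)
        fix I assume "I \<in> ?M"
        then show "I(i := I i + 1) \<in> grid N" using sub by (intro grid_upd) (auto simp: midpoints_def)
      qed
      have inj: "inj_on (\<lambda>I. I(i := I i + 1)) ?M"
        by (rule inj_onI) (metis add_right_cancel fun_upd_same fun_upd_triv fun_upd_upd)
      have "(\<Sum>I\<in>?M. (norm (u (I(i := I i + 1))))\<^sup>2) = (\<Sum>I\<in>(\<lambda>I. I(i := I i + 1)) ` ?M. (norm (u I))\<^sup>2)"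
        by (subst sum.reindex[OF inj]) (simp add: o_def)
      also have "\<dots> \<le> (\<Sum>I\<in>grid N. (norm (u I))\<^sup>2)"
        by (rule sum_mono2) (use sub' in auto)
      finally show "(\<Sum>I\<in>?M. (norm (u (I(i := I i + 1))))\<^sup>2) \<le> (\<Sum>I\<in>grid N. (norm (u I))\<^sup>2)" .
      show "(\<Sum>I\<in>?M. (norm (u I))\<^sup>2) \<le> (\<Sum>I\<in>grid N. (norm (u I))\<^sup>2)"
        by (rule sum_mono2) (use sub in auto)
    qed simp
    finally show ?thesis by simp
  qed
  have "(\<Sum>i\<in>UNIV. \<Sum>I\<in>midpoints N i. (norm (grad_h N u i I))\<^sup>2)
      \<le> (\<Sum>i\<in>(UNIV :: 'd set). 4 * (real N)\<^sup>2 * (\<Sum>I\<in>grid N. (norm (u I))\<^sup>2))"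
    by (intro sum_mono *)
  also have "\<dots> = 4 * real CARD('d) * (real N)\<^sup>2 * (\<Sum>I\<in>grid N. (norm (u I))\<^sup>2)" by simp
  finally have "(1 / real N) ^ CARD('d) * (\<Sum>i\<in>UNIV. \<Sum>I\<in>midpoints N i. (norm (grad_h N u i I))\<^sup>2)
      \<le> (1 / real N) ^ CARD('d) * (4 * real CARD('d) * (real N)\<^sup>2 * (\<Sum>I\<in>grid N. (norm (u I))\<^sup>2))"
    by (intro mult_left_mono) auto
  then show ?thesis
    by (simp add: grad_norm2_h_square grad_inner_h_def norm2_h_square inner_h_def power2_norm_eq_inner mult_ac)
qed

lemma grad_h_le_sup:
  assumes u: "discrete_neumann N u" and I: "I \<in> midpoints N i"
    and M: "\<And>J. J \<in> grid N \<Longrightarrow> norm (u J) \<le> M" and M0: "M \<ge> 0"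
  shows "norm (grad_h N u i I) \<le> 2 * real N * M"
proof (cases "I i = 0 \<or> I i = N")
  case True
  then show ?thesis using neumann_grad_zero[OF u I] M0 by simp
next
  case False
  then have IG: "I \<in> grid N" using midpoints_grid[OF I] by auto
  have "I(i := I i + 1) \<in> grid N" using False I by (intro grid_upd[OF IG]) (auto simp: midpoints_def)
  from this IG have "norm (u (I(i := I i + 1)) - u I) \<le> M + M"
    by (intro order_trans[OF norm_triangle_ineq4] add_mono M)
  then have "real N * norm (u (I(i := I i + 1)) - u I) \<le> real N * (2 * M)"
    by (intro mult_left_mono) auto
  then show ?thesis by (simp add: grad_h_def)
qed

lemma avg_grad_norm2_le:
  fixes u :: "('d::finite) gridfun"
  shows "norm2_h N (avg_grad_h N u i) \<le> grad_norm2_h N (grad_h N u)"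
proof -
  have "(\<Sum>I\<in>grid N. (norm (avg_grad_h N u i I))\<^sup>2)
      \<le> (\<Sum>I\<in>grid N. ((norm (grad_h N u i I))\<^sup>2 + (norm (grad_h N u i (I(i := I i - 1))))\<^sup>2) / 2)"
  proof (rule sum_mono)
    fix I
    have "norm (avg_grad_h N u i I) \<le> (norm (grad_h N u i I) + norm (grad_h N u i (I(i := I i - 1)))) / 2"
      unfolding avg_grad_h_def norm_scaleR using norm_triangle_ineq[of "grad_h N u i I" "grad_h N u i (I(i := I i - 1))"] by simp
    then have "(norm (avg_grad_h N u i I))\<^sup>2 \<le> ((norm (grad_h N u i I) + norm (grad_h N u i (I(i := I i - 1)))) / 2)\<^sup>2"
      by (intro power_mono) auto
    also have "\<dots> \<le> ((norm (grad_h N u i I))\<^sup>2 + (norm (grad_h N u i (I(i := I i - 1))))\<^sup>2) / 2"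
      using sum_squares_bound[of "norm (grad_h N u i I)" "norm (grad_h N u i (I(i := I i - 1)))"]
      by (simp add: power2_sum power_divide)
    finally show "(norm (avg_grad_h N u i I))\<^sup>2 \<le> ((norm (grad_h N u i I))\<^sup>2 + (norm (grad_h N u i (I(i := I i - 1))))\<^sup>2) / 2" .
  qed
  also have "\<dots> = ((\<Sum>I\<in>grid N. (norm (grad_h N u i I))\<^sup>2) + (\<Sum>I\<in>grid N. (norm (grad_h N u i (I(i := I i - 1))))\<^sup>2)) / 2"
    by (simp add: sum_divide_distrib[symmetric] sum.distrib)
  also have "\<dots> \<le> ((\<Sum>I\<in>midpoints N i. (norm (grad_h N u i I))\<^sup>2) + (\<Sum>I\<in>midpoints N i. (norm (grad_h N u i I))\<^sup>2)) / 2"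
  proof (intro divide_right_mono add_mono)
    show "(\<Sum>I\<in>grid N. (norm (grad_h N u i I))\<^sup>2) \<le> (\<Sum>I\<in>midpoints N i. (norm (grad_h N u i I))\<^sup>2)"
      by (rule sum_mono2) (simp_all add: grid_subset_midpoints)
    have inj: "inj_on (\<lambda>I. I(i := I i - 1)) (grid N)"
    proof (rule inj_onI)
      fix I J assume *: "I \<in> grid N" "J \<in> grid N" and eq: "I(i := I i - 1) = J(i := J i - 1)"
      have "I i - 1 = J i - 1" using eq by (metis fun_upd_same)
      moreover have "I i \<ge> 1" "J i \<ge> 1" using * by (auto simp: grid_def)
      ultimately have "I i = J i" by linarith
      then show "I = J" using eq by (metis fun_upd_triv fun_upd_upd)
    qed
    have "(\<Sum>I\<in>grid N. (norm (grad_h N u i (I(i := I i - 1))))\<^sup>2) = (\<Sum>I\<in>(\<lambda>I. I(i := I i - 1)) ` grid N. (norm (grad_h N u i I))\<^sup>2)"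
      by (subst sum.reindex[OF inj]) (simp add: o_def)
    also have "\<dots> \<le> (\<Sum>I\<in>midpoints N i. (norm (grad_h N u i I))\<^sup>2)"
      by (rule sum_mono2) (auto intro: grid_lower_midpoint[simplified])
    finally show "(\<Sum>I\<in>grid N. (norm (grad_h N u i (I(i := I i - 1))))\<^sup>2) \<le> (\<Sum>I\<in>midpoints N i. (norm (grad_h N u i I))\<^sup>2)" .
  qed simp
  also have "\<dots> \<le> (\<Sum>j\<in>UNIV. \<Sum>I\<in>midpoints N j. (norm (grad_h N u j I))\<^sup>2)"
    using member_le_sum[of i UNIV "\<lambda>j. \<Sum>J\<in>midpoints N j. (norm (grad_h N u j J))\<^sup>2"] by (simp add: sum_nonneg)
  finally have "inner_h N (avg_grad_h N u i) (avg_grad_h N u i) \<le> grad_inner_h N (grad_h N u) (grad_h N u)"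
    unfolding inner_h_def grad_inner_h_def power2_norm_eq_inner by (intro mult_left_mono) auto
  then show ?thesis by (simp add: norm2_h_def grad_norm2_h_def)
qed

section \<open>Lipschitz estimates for the nonlinear term\<close>

lemma norm_cross3_le: "norm (cross3 x y) \<le> norm x * norm y"
proof -
  have "(norm (cross3 x y))\<^sup>2 \<le> (norm x * norm y)\<^sup>2"
    by (simp add: norm_cross power_mult_distrib)
  then show ?thesis by (rule power2_le_imp_le) simp
qed

lemma cross3_double_diff:
  "norm (cross3 u (cross3 u f) - cross3 v (cross3 v f)) \<le> (norm u + norm v) * norm f * norm (u - v)"
proof -
  have "cross3 u (cross3 u f) - cross3 v (cross3 v f) = cross3 (u - v) (cross3 u f) + cross3 v (cross3 (u - v) f)"
    by (simp add: cross_components vec_eq_iff forall_3 algebra_simps)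
  also have "norm \<dots> \<le> norm (u - v) * (norm u * norm f) + norm v * (norm (u - v) * norm f)"
    by (intro norm_triangle_le add_mono order_trans[OF norm_cross3_le] mult_left_mono norm_cross3_le) auto
  finally show ?thesis by (simp add: algebra_simps)
qed

lemma avg_grad_h_diff: "avg_grad_h N (u - v) i I = avg_grad_h N u i I - avg_grad_h N v i I"
  by (simp add: avg_grad_h_def grad_h_def algebra_simps)

lemma grad_h_diff: "grad_h N (u - v) i I = grad_h N u i I - grad_h N v i I"
  by (simp add: grad_h_def algebra_simps)

lemma grad_h_add: "grad_h N (u + v) i I = grad_h N u i I + grad_h N v i I"
  by (simp add: grad_h_def algebra_simps)

lemma avg_grad_le:
  assumes "\<And>J. J \<in> midpoints N i \<Longrightarrow> norm (grad_h N u i J) \<le> R" "I \<in> grid N"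
  shows "norm (avg_grad_h N u i I) \<le> R"
proof -
  have "norm (grad_h N u i I) \<le> R" "norm (grad_h N u i (I(i := I i - 1))) \<le> R"
    using assms(1)[OF subsetD[OF grid_subset_midpoints assms(2)]]
      assms(1)[OF grid_lower_midpoint[OF assms(2)]] by auto
  then show ?thesis
    using norm_triangle_ineq[of "grad_h N u i I" "grad_h N u i (I(i := I i - 1))"]
    by (simp add: avg_grad_h_def)
qed

text \<open>With \<open>a\<close>, \<open>b\<close> the squared averaged gradients, the first term
  is split as \<open>a (u - v) + (a - b) v\<close>. The bound is pointwise with an explicit constant
  because it serves twice: for the numerical error, and for the effect of the second-order
  corrections in the comparison stages.\<close>

lemma N_h_lipschitz:
  fixes u v :: "('d::finite) gridfun"
  assumes "\<alpha> \<ge> 0" "\<beta> \<ge> 0" and f: "norm (f (grid_point N I)) \<le> F"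
    and u: "norm (u I) \<le> R" and v: "norm (v I) \<le> R"
    and gu: "\<And>i. norm (avg_grad_h N u i I) \<le> R" and gv: "\<And>i. norm (avg_grad_h N v i I) \<le> R"
  shows "norm (N_h \<alpha> \<beta> f N u I - N_h \<alpha> \<beta> f N v I)
    \<le> (\<beta> * (real CARD('d) * R\<^sup>2 + 2 * R\<^sup>2) + 2 * \<alpha> * R * F)
      * (norm (u I - v I) + (\<Sum>i\<in>UNIV. norm (avg_grad_h N (u - v) i I)))"
proof -
  have R0: "R \<ge> 0" using u norm_ge_zero order_trans by blast
  have F0: "F \<ge> 0" using f norm_ge_zero order_trans by blast
  define a b where "a = (\<Sum>i\<in>UNIV. (norm (avg_grad_h N u i I))\<^sup>2)" and "b = (\<Sum>i\<in>UNIV. (norm (avg_grad_h N v i I))\<^sup>2)"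
  define s where "s = (\<Sum>i\<in>UNIV. norm (avg_grad_h N (u - v) i I))"
  define e where "e = norm (u I - v I)"
  have s0: "s \<ge> 0" by (simp add: s_def sum_nonneg)
  have e0: "e \<ge> 0" by (simp add: e_def)
  have a: "\<bar>a\<bar> \<le> real CARD('d) * R\<^sup>2"
  proof -
    have "a \<le> (\<Sum>i\<in>(UNIV :: 'd set). R\<^sup>2)" unfolding a_def by (intro sum_mono power_mono gu) auto
    moreover have "0 \<le> a" by (simp add: a_def sum_nonneg)
    ultimately show ?thesis by simp
  qed
  have ab: "\<bar>a - b\<bar> \<le> 2 * R * s"
  proof -
    have "\<bar>a - b\<bar> \<le> (\<Sum>i\<in>UNIV. \<bar>(norm (avg_grad_h N u i I))\<^sup>2 - (norm (avg_grad_h N v i I))\<^sup>2\<bar>)"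
      unfolding a_def b_def sum_subtractf[symmetric] by (rule sum_abs)
    also have "\<dots> \<le> (\<Sum>i\<in>UNIV. 2 * R * norm (avg_grad_h N (u - v) i I))"
    proof (rule sum_mono)
      fix i
      let ?x = "norm (avg_grad_h N u i I)" and ?y = "norm (avg_grad_h N v i I)"
      have "\<bar>?x\<^sup>2 - ?y\<^sup>2\<bar> = (?x + ?y) * \<bar>?x - ?y\<bar>"
        by (simp add: power2_eq_square square_diff_square_factored abs_mult)
      also have "\<dots> \<le> (2 * R) * norm (avg_grad_h N (u - v) i I)"
        unfolding avg_grad_h_diff
        by (intro mult_mono norm_triangle_ineq3) (use gu[of i] gv[of i] R0 in auto)
      finally show "\<bar>?x\<^sup>2 - ?y\<^sup>2\<bar> \<le> 2 * R * norm (avg_grad_h N (u - v) i I)" .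
    qed
    finally show ?thesis by (simp add: s_def sum_distrib_left)
  qed
  have "N_h \<alpha> \<beta> f N u I - N_h \<alpha> \<beta> f N v I = \<beta> *\<^sub>R (a *\<^sub>R (u I - v I) + (a - b) *\<^sub>R v I)
      - \<alpha> *\<^sub>R (cross3 (u I) (cross3 (u I) (f (grid_point N I))) - cross3 (v I) (cross3 (v I) (f (grid_point N I))))"
    by (simp add: N_h_def a_def b_def algebra_simps)
  also have "norm \<dots> \<le> \<beta> * norm (a *\<^sub>R (u I - v I) + (a - b) *\<^sub>R v I)
      + \<alpha> * norm (cross3 (u I) (cross3 (u I) (f (grid_point N I))) - cross3 (v I) (cross3 (v I) (f (grid_point N I))))"
    using assms(1,2) by (intro order_trans[OF norm_triangle_ineq4]) simp
  also have "\<dots> \<le> \<beta> * (real CARD('d) * R\<^sup>2 * e + (2 * R * s) * R) + \<alpha> * ((R + R) * F * e)"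
  proof (intro add_mono mult_left_mono assms(1,2))
    show "norm (a *\<^sub>R (u I - v I) + (a - b) *\<^sub>R v I) \<le> real CARD('d) * R\<^sup>2 * e + (2 * R * s) * R"
      by (intro norm_triangle_le add_mono)
        (simp_all only: norm_scaleR e_def, use a ab v R0 s0 in \<open>auto intro!: mult_mono\<close>)
    show "norm (cross3 (u I) (cross3 (u I) (f (grid_point N I))) - cross3 (v I) (cross3 (v I) (f (grid_point N I)))) \<le> (R + R) * F * e"
      unfolding e_def by (intro order_trans[OF cross3_double_diff] mult_mono add_mono) (use u v f R0 F0 in auto)
  qed
  also have "\<dots> \<le> (\<beta> * (real CARD('d) * R\<^sup>2 + 2 * R\<^sup>2) + 2 * \<alpha> * R * F) * (e + s)"
  proof -
    have "0 \<le> \<beta> * real CARD('d) * R\<^sup>2 * s" "0 \<le> \<beta> * (2 * R\<^sup>2) * e" "0 \<le> 2 * \<alpha> * R * F * s"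
      using assms(1,2) R0 F0 s0 e0 by simp_all
    then show ?thesis by (simp add: algebra_simps power2_eq_square)
  qed
  finally show ?thesis by (simp add: e_def s_def)
qed

text \<open>Cauchy-Schwarz over the \<open>1 + d\<close> summands gives one factor
  \<open>1 + d\<close> for the squares. A second one arises because each of the \<open>d\<close>
  averaged gradients is bounded by the full gradient norm, so that the square root yields
  \<open>1 + d\<close>.\<close>

lemma norm2_h_pointwise_bound:
  fixes e n :: "('d::finite) gridfun"
  assumes n: "\<And>I. I \<in> grid N \<Longrightarrow> norm (n I) \<le> M * (norm (e I) + (\<Sum>i\<in>UNIV. norm (avg_grad_h N e i I)))"
    and M: "M \<ge> 0"
  shows "norm2_h N n \<le> M * (1 + real CARD('d)) * (norm2_h N e + grad_norm2_h N (grad_h N e))"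
proof -
  let ?d = "real CARD('d)"
  let ?s = "\<lambda>I. (norm (e I))\<^sup>2 + (\<Sum>i\<in>UNIV. (norm (avg_grad_h N e i I))\<^sup>2)"
  have pw: "(norm (n I))\<^sup>2 \<le> M\<^sup>2 * (1 + ?d) * ?s I" if I: "I \<in> grid N" for I
  proof -
    define A where "A = (\<Sum>i\<in>UNIV. norm (avg_grad_h N e i I))"
    have "A \<le> L2_set (\<lambda>i. norm (avg_grad_h N e i I)) UNIV * L2_set (\<lambda>i::'d. 1) UNIV"
      using L2_set_mult_ineq[of "\<lambda>i. norm (avg_grad_h N e i I)" "\<lambda>i. 1" UNIV] by (simp add: A_def)
    then have A: "A \<le> sqrt (\<Sum>i\<in>UNIV. (norm (avg_grad_h N e i I))\<^sup>2) * sqrt ?d"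
      by (simp add: L2_set_def)
    define B where "B = (\<Sum>i\<in>UNIV. (norm (avg_grad_h N e i I))\<^sup>2)"
    have B0: "B \<ge> 0" by (simp add: B_def sum_nonneg)
    have A0: "A \<ge> 0" by (simp add: A_def sum_nonneg)
    have A2: "A\<^sup>2 \<le> ?d * B"
    proof -
      have "A\<^sup>2 \<le> (sqrt B * sqrt ?d)\<^sup>2" using A A0 by (intro power_mono) (simp_all add: B_def)
      then show ?thesis using B0 by (simp add: power_mult_distrib mult_ac)
    qed
    let ?x = "norm (e I)"
    have "2 * ?x * A \<le> ?d * ?x\<^sup>2 + B"
    proof -
      have "2 * ?x * A \<le> 2 * ?x * (sqrt B * sqrt ?d)" using A by (intro mult_left_mono) (simp_all add: B_def)
      also have "\<dots> = 2 * (sqrt ?d * ?x) * sqrt B" by simp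
      also have "\<dots> \<le> (sqrt ?d * ?x)\<^sup>2 + (sqrt B)\<^sup>2" by (rule sum_squares_bound)
      finally show ?thesis using B0 by (simp add: power_mult_distrib)
    qed
    then have "(?x + A)\<^sup>2 \<le> (1 + ?d) * (?x\<^sup>2 + B)"
      using A2 B0 by (simp add: power2_sum algebra_simps)
    then have "M\<^sup>2 * (?x + A)\<^sup>2 \<le> M\<^sup>2 * ((1 + ?d) * (?x\<^sup>2 + B))" by (intro mult_left_mono) auto
    moreover have "(norm (n I))\<^sup>2 \<le> (M * (?x + A))\<^sup>2" using n[OF I] by (intro power_mono) (simp_all add: A_def)
    ultimately show ?thesis by (simp add: power_mult_distrib B_def mult.assoc)
  qed
  let ?h = "(1 / real N) ^ CARD('d)"
  have "(norm2_h N n)\<^sup>2 = ?h * (\<Sum>I\<in>grid N. (norm (n I))\<^sup>2)"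
    by (simp add: norm2_h_square inner_h_def power2_norm_eq_inner)
  also have "\<dots> \<le> ?h * (\<Sum>I\<in>grid N. M\<^sup>2 * (1 + ?d) * ?s I)"
    by (intro mult_left_mono sum_mono pw) auto
  also have "\<dots> = M\<^sup>2 * (1 + ?d) * (?h * (\<Sum>I\<in>grid N. (norm (e I))\<^sup>2) + ?h * (\<Sum>I\<in>grid N. \<Sum>i\<in>UNIV. (norm (avg_grad_h N e i I))\<^sup>2))"
    by (simp add: sum_distrib_left sum.distrib distrib_left mult_ac)
  also have "(\<Sum>I\<in>grid N. \<Sum>i\<in>UNIV. (norm (avg_grad_h N e i I))\<^sup>2) = (\<Sum>i\<in>UNIV. \<Sum>I\<in>grid N. (norm (avg_grad_h N e i I))\<^sup>2)"
    by (rule sum.swap)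
  also have "?h * (\<Sum>I\<in>grid N. (norm (e I))\<^sup>2) + ?h * (\<Sum>i\<in>UNIV. \<Sum>I\<in>grid N. (norm (avg_grad_h N e i I))\<^sup>2)
      = (norm2_h N e)\<^sup>2 + (\<Sum>i\<in>UNIV. (norm2_h N (avg_grad_h N e i))\<^sup>2)"
    by (simp add: norm2_h_square inner_h_def power2_norm_eq_inner sum_distrib_left)
  also have "M\<^sup>2 * (1 + ?d) * \<dots> \<le> M\<^sup>2 * (1 + ?d) * ((norm2_h N e)\<^sup>2 + (\<Sum>i\<in>(UNIV::'d set). (grad_norm2_h N (grad_h N e))\<^sup>2))"
    by (intro mult_left_mono add_mono sum_mono power_mono avg_grad_norm2_le) auto
  also have "\<dots> \<le> M\<^sup>2 * (1 + ?d) * ((1 + ?d) * (norm2_h N e + grad_norm2_h N (grad_h N e))\<^sup>2)"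
  proof (intro mult_left_mono)
    let ?x = "norm2_h N e" and ?y = "grad_norm2_h N (grad_h N e)"
    have "0 \<le> ?x * ?y" "0 \<le> ?d * ?x\<^sup>2" "0 \<le> ?d * (?x * ?y)" by simp_all
    then show "?x\<^sup>2 + (\<Sum>i\<in>(UNIV::'d set). ?y\<^sup>2) \<le> (1 + ?d) * (?x + ?y)\<^sup>2"
      by (simp add: power2_sum algebra_simps)
  qed simp_all
  also have "\<dots> = (M * (1 + ?d) * (norm2_h N e + grad_norm2_h N (grad_h N e)))\<^sup>2"
    by (simp add: power_mult_distrib power2_eq_square mult_ac)
  finally show ?thesis by (rule power2_le_imp_le) (simp add: M)
qed

text \<open>Resets the ghost values according to the discrete Neumann condition and keeps the
  interior, which is all that the discrete inner product sees.\<close>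

definition clamp :: "nat \<Rightarrow> 'd gridfun \<Rightarrow> 'd gridfun" where
  "clamp N u I = u (\<lambda>i. max 1 (min N (I i)))"

lemma clamp_grid [simp]: "I \<in> grid N \<Longrightarrow> clamp N u I = u I"
proof -
  assume "I \<in> grid N"
  then have "max 1 (min N (I i)) = I i" for i by (simp add: grid_def)
  then have "(\<lambda>i. max 1 (min N (I i))) = I" by simp
  then show ?thesis by (simp add: clamp_def)
qed

lemma clamp_neumann: "N \<ge> 1 \<Longrightarrow> discrete_neumann N (clamp N u)"
  unfolding discrete_neumann_def clamp_def
  by (intro allI impI conjI arg_cong[where f = u]) (auto simp: fun_eq_iff)

lemma P_h_eq_clamp: "P_h N u = clamp N (\<lambda>I. u (grid_point N I))"
  by (simp add: P_h_def clamp_def fun_eq_iff)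

text \<open>The inverse inequality turns a bound in the dual norm into an \<open>L\<^sup>2\<close> bound, at the price of one power of \<open>h\<close>.\<close>

lemma dual_bound_norm2:
  fixes \<rho> :: "('d::finite) gridfun"
  assumes N: "N \<ge> 1" and A: "A \<ge> 0"
    and dual: "\<And>g. discrete_neumann N g \<Longrightarrow> \<bar>inner_h N \<rho> g\<bar> \<le> A * (norm2_h N g + grad_norm2_h N (grad_h N g))"
  shows "norm2_h N \<rho> \<le> A * (1 + 2 * real CARD('d)) * real N"
proof (cases "norm2_h N \<rho> = 0")
  case True
  then show ?thesis using A by simp
next
  case False
  then have pos: "norm2_h N \<rho> > 0" using norm2_h_nonneg[of N \<rho>] by linarith
  let ?d = "real CARD('d)"
  have d1: "?d \<ge> 1" by (simp add: Suc_le_eq)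
  \<comment> \<open>\<open>\<rho>\<close> itself need not be an admissible test function; resetting
    its ghost values makes it one and leaves the pairing unchanged.\<close>
  define g where "g = clamp N \<rho>"
  have g: "discrete_neumann N g" unfolding g_def by (rule clamp_neumann[OF N])
  have gn: "norm2_h N g = norm2_h N \<rho>" by (rule norm2_h_cong) (simp add: g_def)
  have "(grad_norm2_h N (grad_h N g))\<^sup>2 \<le> (2 * ?d * real N * norm2_h N \<rho>)\<^sup>2"
  proof -
    have "(grad_norm2_h N (grad_h N g))\<^sup>2 \<le> 4 * ?d * (real N)\<^sup>2 * (norm2_h N \<rho>)\<^sup>2"
      using inverse_inequality[OF g] by (simp add: gn)
    also have "\<dots> \<le> 4 * (?d * ?d) * (real N)\<^sup>2 * (norm2_h N \<rho>)\<^sup>2"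
      using d1 by (intro mult_right_mono mult_left_mono) auto
    finally show ?thesis by (simp add: power_mult_distrib power2_eq_square mult_ac)
  qed
  then have inv: "grad_norm2_h N (grad_h N g) \<le> 2 * ?d * real N * norm2_h N \<rho>"
    by (rule power2_le_imp_le) simp
  have "(norm2_h N \<rho>)\<^sup>2 = inner_h N \<rho> g"
    unfolding norm2_h_square by (rule inner_h_cong) (simp add: g_def)
  also have "\<dots> \<le> A * (norm2_h N g + grad_norm2_h N (grad_h N g))" using dual[OF g] by linarith
  also have "\<dots> \<le> A * (real N * norm2_h N \<rho> + 2 * ?d * real N * norm2_h N \<rho>)"
    using inv A N pos by (intro mult_left_mono add_mono) (auto simp: gn)
  also have "\<dots> = (A * (1 + 2 * ?d) * real N) * norm2_h N \<rho>" by (simp add: algebra_simps)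
  finally show ?thesis using pos by (simp add: power2_eq_square)
qed


section \<open>Bounds for one stage\<close>

lemma scheme_coeffs_bounds:
  assumes "scheme_coeffs c"
  shows "\<bar>c_a21 c - 0.625\<bar> < 1 / 10^7" "\<bar>c_a31 c - 0.17055712\<bar> < 1 / 10^7"
    "\<bar>c_a32 c - 0.14291640\<bar> < 1 / 10^7" "\<bar>c_s32 c + 0.23587004\<bar> < 1 / 10^7"
    "\<bar>c_s33 c - 0.54934357\<bar> < 1 / 10^7" "\<bar>c_a42 c - 0.45\<bar> < 1 / 10^7"
    "\<bar>c_a43 c - 0.55\<bar> < 1 / 10^7" "\<bar>c_b2 c - 0.085\<bar> < 1 / 10^7"
    "\<bar>c_b3 c - 0.68187464\<bar> < 1 / 10^7" "\<bar>c_b4 c - 0.23312535\<bar> < 1 / 10^7"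
  using assms by (simp_all add: scheme_coeffs_def printed_as_def)

lemma prod_bounds:
  fixes x y :: real
  assumes "0 \<le> a" "a \<le> x" "x \<le> b" "0 \<le> p" "p \<le> y" "y \<le> q"
  shows "a * p \<le> x * y" "x * y \<le> b * q"
  using assms by (auto intro!: mult_mono)

text \<open>Two-digit enclosures suffice. The coefficient
  \<open>s * (g - b2) - b3 * (g - s')\<close> lies between -0.33 and -0.26, so the fifth expression
  is at most -0.28, and the last claim already holds with \<open>g * s \<ge> 0.334\<close> alone;
  this is the narrowest margin.\<close>

lemma stage_energy_coeffs:
  assumes "scheme_coeffs c"
  defines "g \<equiv> c_a21 c" and "s \<equiv> c_s33 c" and "s' \<equiv> c_s32 c" and "b \<equiv> c_b4 c"
    and "b2 \<equiv> c_b2 c" and "b3 \<equiv> c_b3 c"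
  shows "g > 0" "s > 0" "b > 0" "s - g + s' \<noteq> 0"
    "b\<^sup>2 - (s + g - b2 - b3) * b + (s * (g - b2) - b3 * (g - s')) \<noteq> 0"
    "g + s + b > \<bar>s + g - b2 - b3\<bar>"
    "g * s + g * b + s * b > \<bar>s * (g - b2) - b3 * (g - s')\<bar>"
proof -
  have g: "0.62 \<le> g" "g \<le> 0.63" and s: "0.54 \<le> s" "s \<le> 0.55" and s': "- 0.24 \<le> s'" "s' \<le> - 0.23"
    and b: "0.23 \<le> b" "b \<le> 0.24" and b2: "0.08 \<le> b2" "b2 \<le> 0.09" and b3: "0.68 \<le> b3" "b3 \<le> 0.69"
    using scheme_coeffs_bounds[OF assms(1), unfolded abs_less_iff]
    unfolding g_def s_def s'_def b_def b2_def b3_def by simp_all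
  show "g > 0" "s > 0" "b > 0" "s - g + s' \<noteq> 0" using g s s' b by auto
  have 1: "s * (g - b2) \<ge> 28 / 100" "s * (g - b2) \<le> 31 / 100"
    using prod_bounds[of "0.54" s "0.55" "0.53" "g - b2" "0.55"] g s b2 by auto
  have 2: "b3 * (g - s') \<ge> 57 / 100" "b3 * (g - s') \<le> 61 / 100"
    using prod_bounds[of "0.68" b3 "0.69" "0.85" "g - s'" "0.87"] g s' b3 by auto
  have 3: "b\<^sup>2 \<le> 6 / 100" using prod_bounds(2)[of "0.23" b "0.24" "0.23" b "0.24"] b
    by (simp add: power2_eq_square)
  have 4: "(s + g - b2 - b3) * b \<ge> 8 / 100"
    using prod_bounds(1)[of "0.38" "s + g - b2 - b3" 1 "0.23" b "0.24"] g s b b2 b3 by auto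
  show "b\<^sup>2 - (s + g - b2 - b3) * b + (s * (g - b2) - b3 * (g - s')) \<noteq> 0"
    using 1 2 3 4 by linarith
  show "g + s + b > \<bar>s + g - b2 - b3\<bar>" using g s b b2 b3 by (simp add: abs_less_iff)
  have "g * s \<ge> 334 / 1000" "g * b \<ge> 0" "s * b \<ge> 0"
    using prod_bounds(1)[of "0.62" g "0.63" "0.54" s "0.55"] g s b by auto
  then show "g * s + g * b + s * b > \<bar>s * (g - b2) - b3 * (g - s')\<bar>"
    using 1 2 by linarith
qed

text \<open>A right-hand side of order \<open>h^2\<close> yields, through the resolvent, everything
  the bootstrap requires of a stage. The lower refinement bound enters through \<open>q\<close>, for
  which \<open>q h \<le> \<gamma> \<beta> k\<close>. With at most three dimensions
  \<open>N^d h^4 \<le> h\<close> gives the fourth claim.\<close>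

lemma stage_bounds:
  fixes e z :: "('d::finite) gridfun"
  assumes d: "CARD('d) \<le> 3" and N: "N \<ge> 1" and pos: "\<gamma> > 0" "\<beta> > 0" "C1 > 0" and k: "C1 * (1 / real N) \<le> k"
    and e: "discrete_neumann N e" and eq: "e + \<gamma> *\<^sub>R ((- (k * \<beta>)) *\<^sub>R lap_h N e) = z"
    and z: "norm2_h N z \<le> Z * (1 / real N)\<^sup>2" and Z: "Z \<ge> 0"
  defines "q \<equiv> \<gamma> * \<beta> * C1"
  shows "norm2_h N e \<le> Z * (1 / real N)\<^sup>2"
    and "norm2_h N ((- (k * \<beta>)) *\<^sub>R lap_h N e) \<le> Z / \<gamma> * (1 / real N)\<^sup>2"
    and "sqrt k * grad_norm2_h N (grad_h N e) \<le> Z / sqrt (\<gamma> * \<beta>) * (1 / real N)\<^sup>2"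
    and "\<And>I. I \<in> grid N \<Longrightarrow> (norm (e I))\<^sup>2 \<le> Z\<^sup>2 * (1 / real N)"
    and "\<And>i I. I \<in> midpoints N i \<Longrightarrow> (norm (grad_h N e i I))\<^sup>2 \<le> 2 * Z\<^sup>2 / (q * sqrt q) * sqrt (1 / real N)"
proof -
  define h where "h = 1 / real N"
  have h: "h > 0" "h \<le> 1" using N by (simp_all add: h_def)
  have "0 < C1 * (1 / real N)" using pos(3) N by simp
  then have k0: "k > 0" using k by linarith
  have q: "q > 0" using pos by (simp add: q_def)
  interpret dissipative "inner_h N :: 'd gridfun \<Rightarrow> 'd gridfun \<Rightarrow> real" "\<lambda>u. (- (k * \<beta>)) *\<^sub>R lap_h N u" "{u. discrete_neumann N u}"
    using k0 pos by (intro dissipative_h) simp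
  have eS: "e \<in> {u. discrete_neumann N u}" using e by simp
  note R = resolvent_bounds[OF eS eq pos(1), unfolded nrm_inner_h]
  show x: "norm2_h N e \<le> Z * (1 / real N)\<^sup>2" using R(1) z by linarith
  have "norm2_h N ((- (k * \<beta>)) *\<^sub>R lap_h N e) \<le> norm2_h N z / \<gamma>" by (rule R(2))
  also have "\<dots> \<le> Z * (1 / real N)\<^sup>2 / \<gamma>" using z pos by (intro divide_right_mono) auto
  finally show X: "norm2_h N ((- (k * \<beta>)) *\<^sub>R lap_h N e) \<le> Z / \<gamma> * (1 / real N)\<^sup>2" by simp
  define y where "y = grad_norm2_h N (grad_h N e)"
  have y0: "y \<ge> 0" by (simp add: y_def)
  have "k * \<beta> * y\<^sup>2 = inner_h N ((- (k * \<beta>)) *\<^sub>R lap_h N e) e"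
    by (simp add: y_def grad_norm2_h_square ip_expand inner_lap_h[OF e])
  also have "\<dots> \<le> (norm2_h N z)\<^sup>2 / \<gamma>" by (rule R(3))
  also have "\<dots> \<le> (Z * h\<^sup>2)\<^sup>2 / \<gamma>" using z pos by (intro divide_right_mono power_mono) (simp_all add: h_def)
  finally have kb: "\<gamma> * \<beta> * (k * y\<^sup>2) \<le> (Z * h\<^sup>2)\<^sup>2" using pos by (simp add: field_simps)
  have "(sqrt (\<gamma> * \<beta>) * (sqrt k * y))\<^sup>2 \<le> (Z * h\<^sup>2)\<^sup>2"
    using kb pos k0 by (simp add: power_mult_distrib)
  then have "sqrt (\<gamma> * \<beta>) * (sqrt k * y) \<le> Z * h\<^sup>2" by (rule power2_le_imp_le) (use Z in simp)
  then have ky: "sqrt k * y \<le> Z / sqrt (\<gamma> * \<beta>) * h\<^sup>2" using pos by (simp add: field_simps)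
  then show "sqrt k * grad_norm2_h N (grad_h N e) \<le> Z / sqrt (\<gamma> * \<beta>) * (1 / real N)\<^sup>2"
    by (simp add: y_def h_def)
  have Npow: "real N ^ p \<le> real N ^ m" if "p \<le> m" for p m using that N by (intro power_increasing) auto
  show "(norm (e I))\<^sup>2 \<le> Z\<^sup>2 * (1 / real N)" if I: "I \<in> grid N" for I
  proof -
    have "(norm (e I))\<^sup>2 \<le> real N ^ CARD('d) * (norm2_h N e)\<^sup>2" by (rule sup_le_norm2_h[OF N I])
    also have "\<dots> \<le> real N ^ 3 * (Z * h\<^sup>2)\<^sup>2"
      using x by (intro mult_mono Npow[OF d] power_mono) (simp_all add: h_def)
    also have "\<dots> = Z\<^sup>2 * (1 / real N)" using N by (simp add: h_def power_mult_distrib field_simps eval_nat_numeral)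
    finally show ?thesis .
  qed
  show "(norm (grad_h N e i I))\<^sup>2 \<le> 2 * Z\<^sup>2 / (q * sqrt q) * sqrt (1 / real N)" if I: "I \<in> midpoints N i" for i I
  proof -
    define l where "l = norm2_h N (lap_h N e)"
    have l0: "l \<ge> 0" by (simp add: l_def)
    have "k * \<beta> * l \<le> Z / \<gamma> * h\<^sup>2"
      using X k0 pos unfolding l_def h_def nrm_inner_h[symmetric] nrm_scale by simp
    then have kl: "\<gamma> * \<beta> * k * l \<le> Z * h\<^sup>2" using pos by (simp add: field_simps)
    have qk: "q * h \<le> \<gamma> * \<beta> * k" using k pos mult_left_mono[OF k, of "\<gamma> * \<beta>"]
      by (simp add: q_def h_def mult.assoc)
    have ql: "q * h * l \<le> Z * h\<^sup>2" using mult_right_mono[OF qk l0] kl by linarith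
    have "sqrt (q * h) * y \<le> sqrt (\<gamma> * \<beta> * k) * y" using qk y0 by (intro mult_right_mono real_sqrt_le_mono)
    also have "\<dots> \<le> Z * h\<^sup>2"
      using \<open>sqrt (\<gamma> * \<beta>) * (sqrt k * y) \<le> Z * h\<^sup>2\<close> by (simp add: real_sqrt_mult)
    finally have qy: "sqrt (q * h) * y \<le> Z * h\<^sup>2" .
    \<comment> \<open>The gradient norm \<open>y\<close> carries a factor of order
      \<open>h^(1/2)\<close> and the Laplacian norm \<open>l\<close> one of order \<open>h\<close>,
      so \<open>y l\<close> is of order \<open>h^(5/2)\<close>; the factor \<open>N^2\<close> of the
      trace inequality leaves \<open>sqrt h\<close>.\<close>
    have "(sqrt (q * h) * y) * (q * h * l) \<le> (Z * h\<^sup>2) * (Z * h\<^sup>2)"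
      using mult_mono[OF qy ql] q h y0 l0 Z by simp
    then have "(q * sqrt q) * (h * sqrt h) * (y * l) \<le> Z\<^sup>2 * h ^ 4"
      by (simp add: real_sqrt_mult power2_eq_square eval_nat_numeral mult_ac)
    also have "\<dots> = (Z\<^sup>2 * h\<^sup>2 * sqrt h) * (h * sqrt h)"
      using h by (simp add: power2_eq_square eval_nat_numeral mult_ac)
    finally have "(q * sqrt q) * (y * l) \<le> Z\<^sup>2 * h\<^sup>2 * sqrt h"
      using h by (simp add: mult_ac)
    then have yl: "y * l \<le> Z\<^sup>2 * h\<^sup>2 * sqrt h / (q * sqrt q)" using q by (simp add: field_simps)
    have "(norm (grad_h N e i I))\<^sup>2
      \<le> 2 * real N ^ (CARD('d) - 1) * grad_norm2_h N (grad_h N e) * norm2_h N (second_diff N e i)"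
      by (rule grad_h_sup_bound[OF e N I])
    also have "\<dots> \<le> 2 * real N ^ 2 * y * l"
      unfolding y_def l_def using d by (intro mult_mono second_diff_le_lap_h[OF e] Npow) auto
    also have "\<dots> \<le> 2 * real N ^ 2 * (Z\<^sup>2 * h\<^sup>2 * sqrt h / (q * sqrt q))"
      using mult_left_mono[OF yl, of "2 * real N ^ 2"] by (simp add: mult.assoc)
    also have "\<dots> = 2 * Z\<^sup>2 / (q * sqrt q) * sqrt h"
      using N by (simp add: h_def power2_eq_square)
    finally show ?thesis by (simp add: h_def)
  qed
qed

section \<open>Absorption of perturbations\<close>

lemma young_square: "(\<eta>::real) > 0 \<Longrightarrow> a * b \<le> \<eta> * b\<^sup>2 + a\<^sup>2 / (4 * \<eta>)"
proof -
  assume \<eta>: "\<eta> > 0"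
  have "0 \<le> (2 * \<eta> * b - a)\<^sup>2" by simp
  then have "4 * \<eta> * (a * b) \<le> 4 * \<eta> * (\<eta> * b\<^sup>2 + a\<^sup>2 / (4 * \<eta>))"
    using \<eta> by (simp add: power2_eq_square algebra_simps)
  then show ?thesis using \<eta> by simp
qed

text \<open>\<open>E\<close>, \<open>G\<close>, \<open>H\<close> stand for the error, its gradient
  and \<open>h^2\<close>. Young's inequality leaves the gradient with the coefficient
  \<open>2 \<eta>\<close>, to be made small against the dissipation; the other squares may carry any
  constant because of the prefactor \<open>k\<close>.\<close>

lemma perturbation_young:
  fixes E G H L R \<eta> k :: real
  assumes "\<eta> > 0" "k \<ge> 0" "L \<ge> 0"
  shows "3 * k * L * E * (E + G) + R * k * H * (E + G)
    \<le> k * (2 * \<eta> * G\<^sup>2 + (3 * L + 9 * L\<^sup>2 / (4 * \<eta>) + R\<^sup>2 / (4 * \<eta>) + 1 + R\<^sup>2 / 4) * (E\<^sup>2 + H\<^sup>2))"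
proof -
  have 1: "(3 * L * E) * G \<le> \<eta> * G\<^sup>2 + 9 * L\<^sup>2 / (4 * \<eta>) * E\<^sup>2"
    using young_square[OF assms(1), of "3 * L * E" G] by (simp add: power_mult_distrib)
  have 2: "(R * H) * G \<le> \<eta> * G\<^sup>2 + R\<^sup>2 / (4 * \<eta>) * H\<^sup>2"
    using young_square[OF assms(1), of "R * H" G] by (simp add: power_mult_distrib)
  have 3: "(R * H) * E \<le> E\<^sup>2 + R\<^sup>2 / 4 * H\<^sup>2"
    using young_square[of 1 "R * H" E] by (simp add: power_mult_distrib)
  have 4: "0 \<le> 3 * L * H\<^sup>2" using assms by simp
  have 5: "0 \<le> 9 * L\<^sup>2 / (4 * \<eta>) * H\<^sup>2" "0 \<le> R\<^sup>2 / (4 * \<eta>) * E\<^sup>2" "0 \<le> R\<^sup>2 / 4 * E\<^sup>2" "0 \<le> H\<^sup>2"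
    using assms by simp_all
  have "3 * L * E * (E + G) + R * H * (E + G)
     \<le> 2 * \<eta> * G\<^sup>2 + (3 * L + 9 * L\<^sup>2 / (4 * \<eta>) + R\<^sup>2 / (4 * \<eta>) + 1 + R\<^sup>2 / 4) * (E\<^sup>2 + H\<^sup>2)"
    using 1 2 3 4 5 unfolding distrib_left distrib_right left_diff_distrib power2_eq_square by linarith
  from mult_left_mono[OF this assms(2)] show ?thesis by (simp add: algebra_simps)
qed

text \<open>Here \<open>x1\<close>, \<open>x4\<close>, \<open>x5\<close> are squared errors at the
  start, at stage 4 and at the end; \<open>y1\<close>, \<open>y5\<close> squared gradients at start
  and end; \<open>E\<close> belongs to all four stages, \<open>G\<close> to the gradients of stages
  2 to 4, \<open>D\<close> to the deviations from the start; \<open>H\<close> is \<open>h^4\<close>,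
  \<open>F\<close> bounds the pairings with perturbations, and \<open>\<phi>\<close> is the squared
  difference of end value and stage 4. Three quarters of the dissipation
  \<open>c0 k \<beta> G\<close> are spent: on the Young terms, on \<open>\<phi>\<close> and on
  \<open>\<theta> k y5\<close>; \<open>c0 D\<close> pays for the deviations inside \<open>E\<close>.
  The Young term in \<open>y1\<close>, which no dissipation covers, is what
  \<open>\<theta> k y1\<close> on the right accounts for.\<close>

lemma lyapunov_step:
  fixes x1 x4 x5 y1 y4 y5 E G D H F \<phi> k \<beta> c0 C \<theta> \<eta> \<Lambda>1 \<Lambda>2 P :: real
  assumes nonneg: "D \<ge> 0" "G \<ge> 0" "C \<ge> 0" "k \<ge> 0" "H \<ge> 0" "E \<ge> 0" "y1 \<ge> 0" "\<Lambda>1 \<ge> 0" "\<Lambda>2 \<ge> 0" "P \<ge> 0" "\<theta> \<ge> 0"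
    and E: "E \<le> 7 * x1 + 2 * D"
    and en: "x4 + c0 * (k * \<beta> * G + D) \<le> x1 + C * F"
    and F: "F \<le> k * (2 * \<eta> * (G + y1) + \<Lambda>1 * (E + H))"
    and x5: "x5 \<le> x4 + 2 * F + \<phi>"
    and \<phi>: "\<phi> \<le> \<Lambda>2 * k\<^sup>2 * (E + G + H)"
    and y5: "k * y5 \<le> 2 * k * G + P * \<Lambda>2 * k * (E + G + H)"
    and k1: "k \<le> 1"
    and \<theta>: "\<theta> * (2 + P * \<Lambda>2) \<le> c0 * \<beta> / 4"
    and \<eta>: "2 * (C + 2) * \<eta> \<le> c0 * \<beta> / 4" "2 * (C + 2) * \<eta> \<le> \<theta>" "\<eta> \<ge> 0"
    and k2: "\<Lambda>2 * k \<le> c0 * \<beta> / 4"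
    and k3: "2 * k * ((C + 2) * \<Lambda>1 + \<Lambda>2 + \<theta> * P * \<Lambda>2) \<le> c0"
  defines "\<Lambda>3 \<equiv> (C + 2) * \<Lambda>1 + \<Lambda>2 + \<theta> * P * \<Lambda>2"
  shows "x5 + \<theta> * (k * y5) \<le> (1 + 7 * \<Lambda>3 * k) * x1 + \<theta> * k * y1 + \<Lambda>3 * k * H"
proof -
  have 1: "(C + 2) * F \<le> (C + 2) * (k * (2 * \<eta> * (G + y1) + \<Lambda>1 * (E + H)))"
    using F nonneg by (intro mult_left_mono) auto
  have 2: "\<theta> * (k * y5) \<le> \<theta> * (2 * k * G + P * \<Lambda>2 * k * (E + G + H))"
    using y5 nonneg by (intro mult_left_mono) auto
  have kk: "\<Lambda>2 * k\<^sup>2 * (E + H) \<le> \<Lambda>2 * k * (E + H)"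
    using nonneg k1 by (intro mult_right_mono mult_left_mono) (auto simp: power2_eq_square mult_left_le)
  have kg: "\<Lambda>2 * k\<^sup>2 * G \<le> c0 * \<beta> / 4 * (k * G)"
    using mult_right_mono[OF k2, of "k * G"] nonneg by (simp add: power2_eq_square mult_ac)
  have tg: "\<theta> * (2 + P * \<Lambda>2) * (k * G) \<le> c0 * \<beta> / 4 * (k * G)"
    using nonneg by (intro mult_right_mono \<theta>) auto
  have eg: "2 * (C + 2) * \<eta> * (k * G) \<le> c0 * \<beta> / 4 * (k * G)"
    using nonneg by (intro mult_right_mono \<eta>) auto
  have ey: "2 * (C + 2) * \<eta> * (k * y1) \<le> \<theta> * (k * y1)"
    using nonneg by (intro mult_right_mono \<eta>) auto
  have L30: "\<Lambda>3 \<ge> 0" using nonneg by (simp add: \<Lambda>3_def)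
  have dd: "\<Lambda>3 * k * (2 * D) \<le> c0 * D" using mult_right_mono[OF k3 nonneg(1)] by (simp add: \<Lambda>3_def mult_ac)
  have ee: "\<Lambda>3 * k * E \<le> \<Lambda>3 * k * (7 * x1 + 2 * D)" using E L30 nonneg by (intro mult_left_mono) auto
  have "0 \<le> 2 * (C + 2) * \<eta> * (k * G)" using \<eta>(3) nonneg by simp
  then have "c0 * \<beta> * (k * G) \<ge> 0" using eg by simp
  have s1: "x5 + \<theta> * (k * y5) \<le> x1 + (C + 2) * (k * (2 * \<eta> * (G + y1) + \<Lambda>1 * (E + H)))
      - c0 * (k * \<beta> * G + D) + \<Lambda>2 * k\<^sup>2 * (E + G + H) + \<theta> * (2 * k * G + P * \<Lambda>2 * k * (E + G + H))"
    using x5 en 1 2 \<phi> by (simp add: algebra_simps)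
  also have "\<dots> = x1 + 2 * (C + 2) * \<eta> * (k * G) + 2 * (C + 2) * \<eta> * (k * y1) + \<theta> * (2 + P * \<Lambda>2) * (k * G)
      + \<Lambda>2 * k\<^sup>2 * G + \<Lambda>2 * k\<^sup>2 * (E + H) + ((C + 2) * \<Lambda>1 + \<theta> * P * \<Lambda>2) * k * (E + H) - c0 * \<beta> * (k * G) - c0 * D"
    by (simp add: algebra_simps)
  also have "\<dots> \<le> x1 + \<theta> * (k * y1) + \<Lambda>2 * k * (E + H) + ((C + 2) * \<Lambda>1 + \<theta> * P * \<Lambda>2) * k * (E + H) - c0 * D"
    using kk kg tg eg ey \<open>c0 * \<beta> * (k * G) \<ge> 0\<close> by simp
  also have "\<dots> = x1 + \<theta> * (k * y1) + \<Lambda>3 * k * E + \<Lambda>3 * k * H - c0 * D"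
    by (simp add: \<Lambda>3_def algebra_simps)
  also have "\<dots> \<le> x1 + \<theta> * (k * y1) + \<Lambda>3 * k * (7 * x1) + \<Lambda>3 * k * H"
    using ee dd by (simp add: distrib_left)
  finally show ?thesis by (simp add: algebra_simps)
qed


section \<open>The error of one step\<close>

definition stage_residual ::
  "imex_coeffs \<Rightarrow> real \<Rightarrow> real \<Rightarrow> (real^'d \<Rightarrow> real^3) \<Rightarrow> nat \<Rightarrow> real \<Rightarrow>
   (nat \<Rightarrow> ('d::finite) gridfun) \<Rightarrow> nat \<Rightarrow> 'd gridfun" where
  "stage_residual c \<alpha> \<beta> f N k Y j I = Y j I - Y 1 I
     - (\<Sum>l=1..4. (tabE c j l * k) *\<^sub>R N_h \<alpha> \<beta> f N (Y l) I + (tabI c j l * k) *\<^sub>R L_h \<beta> N (Y l) I)"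

text \<open>
  Stages \<open>Y 1, \<dots>, Y 4\<close> and end value \<open>Y 5\<close> that satisfy the scheme up to a small residual.  In the
  implicit stages the residual is small in the dual norm only: at cells next to the boundary the
  truncation error of the Laplacian is \<open>O(h)\<close>, but it is the divergence of a flux of size \<open>O(h\<^sup>2)\<close>.
\<close>

definition comparison ::
  "imex_coeffs \<Rightarrow> real \<Rightarrow> real \<Rightarrow> (real^'d \<Rightarrow> real^3) \<Rightarrow> nat \<Rightarrow> real \<Rightarrow> real \<Rightarrow> real \<Rightarrow>
   (nat \<Rightarrow> ('d::finite) gridfun) \<Rightarrow> bool" where
  "comparison c \<alpha> \<beta> f N k B R Y \<longleftrightarrow>
     (\<forall>j\<in>{1..5}. discrete_neumann N (Y j)) \<and>
     (\<forall>j\<in>{1..4}. \<forall>I\<in>grid N. norm (Y j I) \<le> B) \<and>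
     (\<forall>j\<in>{1..4}. \<forall>i. \<forall>I\<in>midpoints N i. norm (grad_h N (Y j) i I) \<le> B) \<and>
     (\<forall>j\<in>{2..4}. \<forall>g. discrete_neumann N g \<longrightarrow>
        \<bar>inner_h N (stage_residual c \<alpha> \<beta> f N k Y j) g\<bar>
          \<le> R * k * (1 / real N)\<^sup>2 * (norm2_h N g + grad_norm2_h N (grad_h N g))) \<and>
     (\<forall>I\<in>grid N. norm (Y 5 I - Y 4 I
        - k *\<^sub>R (\<Sum>l=1..4. (wt c l - tabE c 4 l) *\<^sub>R N_h \<alpha> \<beta> f N (Y l) I)) \<le> R * k * (1 / real N)\<^sup>2)"

lemma sum_1_4: "(\<Sum>l=1..4. F l) = F 1 + F 2 + F 3 + (F (4::nat) :: 'a::comm_monoid_add)"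
  by (simp add: sum.atLeast_Suc_atMost eval_nat_numeral(2-3) add.assoc)

lemma tableau_values:
  "tabE c 1 1 = 0" "tabE c 1 2 = 0" "tabE c 1 3 = 0" "tabE c 1 4 = 0"
  "tabE c 2 1 = c_a21 c" "tabE c 2 2 = 0" "tabE c 2 3 = 0" "tabE c 2 4 = 0"
  "tabE c 3 1 = c_a31 c" "tabE c 3 2 = c_a32 c" "tabE c 3 3 = 0" "tabE c 3 4 = 0"
  "tabE c 4 1 = 0" "tabE c 4 2 = c_a42 c" "tabE c 4 3 = c_a43 c" "tabE c 4 4 = 0"
  "tabI c 1 1 = 0" "tabI c 1 2 = 0" "tabI c 1 3 = 0" "tabI c 1 4 = 0"
  "tabI c 2 1 = 0" "tabI c 2 2 = c_a21 c" "tabI c 2 3 = 0" "tabI c 2 4 = 0"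
  "tabI c 3 1 = 0" "tabI c 3 2 = c_s32 c" "tabI c 3 3 = c_s33 c" "tabI c 3 4 = 0"
  "tabI c 4 1 = 0" "tabI c 4 2 = c_b2 c" "tabI c 4 3 = c_b3 c" "tabI c 4 4 = c_b4 c"
  "wt c 1 = 0" "wt c 2 = c_b2 c" "wt c 3 = c_b3 c" "wt c 4 = c_b4 c"
  by (simp_all add: tabE_def tabI_def wt_def eval_nat_numeral)

lemma le_sqrt_self: "0 \<le> x \<Longrightarrow> x \<le> 1 \<Longrightarrow> x \<le> sqrt (x :: real)"
  by (intro real_le_rsqrt) (simp add: power2_eq_square mult_left_le)

locale imex_error_step =
  fixes c :: imex_coeffs and \<alpha> \<beta> :: real and f :: "real^'d::finite \<Rightarrow> real^3" and N :: nat and k B R F C1 C2 :: real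
    and Y w :: "nat \<Rightarrow> 'd gridfun" and v :: "'d gridfun"
  assumes dim: "CARD('d) \<le> 3" and coeffs: "scheme_coeffs c"
    and pos: "\<alpha> > 0" "\<beta> > 0" "C1 > 0" "C2 > 0" "B \<ge> 0" "R \<ge> 0" "F \<ge> 0"
    and N: "N \<ge> 1" and k1: "k \<le> 1" and kC1: "C1 * (1 / real N) \<le> k" and kC2: "k \<le> C2 * (1 / real N)"
    and fF: "\<And>I. I \<in> grid N \<Longrightarrow> norm (f (grid_point N I)) \<le> F"
    and Y: "comparison c \<alpha> \<beta> f N k B R Y"
    and w: "imex_stages c \<alpha> \<beta> f N k (w 1) w"
    and v: "discrete_neumann N v"
    and v_eq: "\<And>I. I \<in> grid N \<Longrightarrow> v I = w 1 I
      + (\<Sum>j=1..4. (wt c j * k) *\<^sub>R N_h \<alpha> \<beta> f N (w j) I + (wt c j * k) *\<^sub>R L_h \<beta> N (w j) I)"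
begin

abbreviation "h \<equiv> 1 / real N"
abbreviation "gn u \<equiv> grad_norm2_h N (grad_h N u)"
definition "e j = Y j - w j"
definition "nl l I = N_h \<alpha> \<beta> f N (Y l) I - N_h \<alpha> \<beta> f N (w l) I"
definition "X (u :: 'd gridfun) = (- (k * \<beta>)) *\<^sub>R lap_h N u"
definition "\<rho> j = stage_residual c \<alpha> \<beta> f N k Y j"
text \<open>The Lipschitz constant of \<open>N_h\<close> for functions and gradients bounded by
  \<open>B + 1\<close>; the numerical stages are shown to stay within distance 1 of the comparison
  stages.\<close>

definition "MM = \<beta> * (real CARD('d) * (B + 1)\<^sup>2 + 2 * (B + 1)\<^sup>2) + 2 * \<alpha> * (B + 1) * F"
definition "LL = MM * (1 + real CARD('d))"
text \<open>Defined as the defect of the linear stage equation, so that the equation holds at all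
  indices, ghost ones included, as the abstract energy estimate demands. Only on the grid is the
  defect identified with nonlinear differences plus residual; this is enough, since pairings see
  nothing else.\<close>

definition "f2 = e 2 + c_a21 c *\<^sub>R X (e 2) - e 1"
definition "f3 = e 3 + c_s32 c *\<^sub>R X (e 2) + c_s33 c *\<^sub>R X (e 3) - e 1"
definition "f4 = e 4 + c_b2 c *\<^sub>R X (e 2) + c_b3 c *\<^sub>R X (e 3) + c_b4 c *\<^sub>R X (e 4) - e 1"
definition "e5 = Y 5 - v"
definition "f5 = e5 - e 4"

lemma h: "h > 0" "h \<le> 1"
  using N by simp_all

lemma k0: "k > 0"
proof -
  have "0 < C1 * h" using pos N by simp
  then show ?thesis using kC1 by linarith
qed

sublocale dissipative "inner_h N :: 'd gridfun \<Rightarrow> 'd gridfun \<Rightarrow> real" X "{u. discrete_neumann N u}"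
  unfolding X_def[abs_def] using k0 pos by (intro dissipative_h) simp

lemma MM0: "MM \<ge> 0" and LL0: "LL \<ge> 0"
proof -
  show "MM \<ge> 0" using pos by (simp add: MM_def)
  then show "LL \<ge> 0" by (simp add: LL_def)
qed

lemma Y_neumann: "j \<in> {1..5} \<Longrightarrow> discrete_neumann N (Y j)"
  and Y_bound: "j \<in> {1..4} \<Longrightarrow> I \<in> grid N \<Longrightarrow> norm (Y j I) \<le> B"
  and Y_grad: "j \<in> {1..4} \<Longrightarrow> I \<in> midpoints N i \<Longrightarrow> norm (grad_h N (Y j) i I) \<le> B"
  and \<rho>_dual: "j \<in> {2..4} \<Longrightarrow> discrete_neumann N g \<Longrightarrow>
        \<bar>inner_h N (\<rho> j) g\<bar> \<le> R * k * h\<^sup>2 * (norm2_h N g + gn g)"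
  and Y5: "I \<in> grid N \<Longrightarrow> norm (Y 5 I - Y 4 I
        - k *\<^sub>R (\<Sum>l=1..4. (wt c l - tabE c 4 l) *\<^sub>R N_h \<alpha> \<beta> f N (Y l) I)) \<le> R * k * h\<^sup>2"
  using Y unfolding comparison_def \<rho>_def by blast+

lemma w_neumann: "j \<in> {1..4} \<Longrightarrow> discrete_neumann N (w j)"
  using w by (simp add: imex_stages_def)

lemma e_neumann: "j \<in> {1..4} \<Longrightarrow> discrete_neumann N (e j)"
  using subspace_diff[OF subspace_neumann, of "Y j" N "w j"] Y_neumann[of j] w_neumann[of j]
  by (auto simp: e_def)

lemma e_S: "e 1 \<in> {u. discrete_neumann N u}" "e 2 \<in> {u. discrete_neumann N u}"
  "e 3 \<in> {u. discrete_neumann N u}" "e 4 \<in> {u. discrete_neumann N u}"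
  by (simp_all add: e_neumann)

lemma e5_neumann: "discrete_neumann N e5"
  using subspace_diff[OF subspace_neumann, of "Y 5" N v] Y_neumann[of 5] v by (auto simp: e5_def)

lemma f5_neumann: "discrete_neumann N f5"
  using subspace_diff[OF subspace_neumann, of e5 N "e 4"] e5_neumann e_neumann[of 4] by (auto simp: f5_def)

lemma X_apply: "X u I = - (k *\<^sub>R L_h \<beta> N u I)"
  by (simp add: X_def L_h_def)

lemma L_h_e: "L_h \<beta> N (e j) I = L_h \<beta> N (Y j) I - L_h \<beta> N (w j) I"
  using linear_diff[OF linear_lap_h[of \<beta> N], of "Y j" "w j"] by (simp add: L_h_def e_def fun_eq_iff)

lemma stage_error:
  assumes "j \<in> {2..4}" "I \<in> grid N"
  shows "e j I = e 1 I + (\<Sum>l=1..4. (tabE c j l * k) *\<^sub>R nl l I - tabI c j l *\<^sub>R X (e l) I) + \<rho> j I"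
proof -
  have "w j I = w 1 I + (\<Sum>l=1..4. (tabE c j l * k) *\<^sub>R N_h \<alpha> \<beta> f N (w l) I + (tabI c j l * k) *\<^sub>R L_h \<beta> N (w l) I)"
    using w assms by (simp add: imex_stages_def)
  note this[unfolded sum_1_4]
  then show ?thesis
    unfolding e_def \<rho>_def stage_residual_def nl_def X_apply sum_1_4
    by (simp add: L_h_e[unfolded e_def] algebra_simps)
qed

lemma f2_grid: "I \<in> grid N \<Longrightarrow> f2 I = (k *\<^sub>R (c_a21 c *\<^sub>R nl 1) + \<rho> 2) I"
  using stage_error[of 2 I, unfolded sum_1_4 tableau_values] by (simp add: f2_def mult.commute)

lemma f3_grid: "I \<in> grid N \<Longrightarrow> f3 I = (k *\<^sub>R (c_a31 c *\<^sub>R nl 1 + c_a32 c *\<^sub>R nl 2) + \<rho> 3) I"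
  using stage_error[of 3 I, unfolded sum_1_4 tableau_values] by (simp add: f3_def mult.commute algebra_simps)

lemma f4_grid: "I \<in> grid N \<Longrightarrow> f4 I = (k *\<^sub>R (c_a42 c *\<^sub>R nl 2 + c_a43 c *\<^sub>R nl 3) + \<rho> 4) I"
  using stage_error[of 4 I, unfolded sum_1_4 tableau_values] by (simp add: f4_def mult.commute algebra_simps)

definition "m5 = (c_b2 c - c_a42 c) *\<^sub>R nl 2 + (c_b3 c - c_a43 c) *\<^sub>R nl 3 + c_b4 c *\<^sub>R nl 4"

text \<open>The Laplacians in \<open>v\<close> and in \<open>w 4\<close> carry the same coefficients
  and cancel, so stage 4 and the end value differ by explicit terms and a defect that is small
  pointwise, not merely in the dual norm.\<close>

lemma f5_grid:
  assumes I: "I \<in> grid N"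
  shows "norm (f5 I - k *\<^sub>R m5 I) \<le> R * k * h\<^sup>2"
proof -
  have "w 4 I = w 1 I + (\<Sum>l=1..4. (tabE c 4 l * k) *\<^sub>R N_h \<alpha> \<beta> f N (w l) I + (tabI c 4 l * k) *\<^sub>R L_h \<beta> N (w l) I)"
    using w I by (simp add: imex_stages_def)
  then have "f5 I - k *\<^sub>R m5 I = Y 5 I - Y 4 I
        - k *\<^sub>R (\<Sum>l=1..4. (wt c l - tabE c 4 l) *\<^sub>R N_h \<alpha> \<beta> f N (Y l) I)"
    using v_eq[OF I] unfolding sum_1_4 tableau_values
    by (simp add: f5_def e5_def e_def m5_def nl_def algebra_simps)
  then show ?thesis using Y5[OF I] by simp
qed

lemma nl_pointwise:
  assumes l: "l \<in> {1..4}" and e1: "\<And>I. I \<in> grid N \<Longrightarrow> norm (e l I) \<le> 1"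
    and g1: "\<And>i I. I \<in> midpoints N i \<Longrightarrow> norm (grad_h N (e l) i I) \<le> 1" and I: "I \<in> grid N"
  shows "norm (nl l I) \<le> MM * (norm (e l I) + (\<Sum>i\<in>UNIV. norm (avg_grad_h N (e l) i I)))"
proof -
  have wl: "w l = Y l - e l" by (simp add: e_def)
  have w1: "norm (w l I) \<le> B + 1"
    using norm_triangle_ineq4[of "Y l I" "e l I"] Y_bound[OF l I] e1[OF I] by (simp add: wl)
  have wg: "norm (grad_h N (w l) i J) \<le> B + 1" if "J \<in> midpoints N i" for i J
    unfolding wl grad_h_diff
    using norm_triangle_ineq4[of "grad_h N (Y l) i J" "grad_h N (e l) i J"] Y_grad[OF l that] g1[OF that] by linarith
  have Yg: "norm (grad_h N (Y l) i J) \<le> B + 1" if "J \<in> midpoints N i" for i J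
    using Y_grad[OF l that] by linarith
  have Y1: "norm (Y l I) \<le> B + 1" using Y_bound[OF l I] by linarith
  have "norm (N_h \<alpha> \<beta> f N (Y l) I - N_h \<alpha> \<beta> f N (w l) I)
      \<le> MM * (norm (Y l I - w l I) + (\<Sum>i\<in>UNIV. norm (avg_grad_h N (Y l - w l) i I)))"
    unfolding MM_def
  proof (rule N_h_lipschitz)
    show "norm (avg_grad_h N (Y l) i I) \<le> B + 1" for i by (rule avg_grad_le[OF Yg I])
    show "norm (avg_grad_h N (w l) i I) \<le> B + 1" for i by (rule avg_grad_le[OF wg I])
  qed (use pos fF[OF I] Y1 w1 in auto)
  then show ?thesis by (simp only: nl_def e_def fun_diff_apply)
qed

lemma nl_norm2:
  assumes "l \<in> {1..4}" "\<And>I. I \<in> grid N \<Longrightarrow> norm (e l I) \<le> 1"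
    and "\<And>i I. I \<in> midpoints N i \<Longrightarrow> norm (grad_h N (e l) i I) \<le> 1"
  shows "norm2_h N (nl l) \<le> LL * (norm2_h N (e l) + gn (e l))"
  unfolding LL_def by (intro norm2_h_pointwise_bound nl_pointwise assms MM0)

text \<open>Passing from the dual norm to the \<open>L^2\<close> norm costs a factor
  \<open>N\<close>, and \<open>k \<le> C2 h\<close> pays for it. The resulting order
  \<open>h^2\<close>, without an extra \<open>k\<close>, is too weak for the energy balance but
  adequate for the bootstrap.\<close>

lemma \<rho>_norm2: "j \<in> {2..4} \<Longrightarrow> norm2_h N (\<rho> j) \<le> R * (1 + 2 * real CARD('d)) * C2 * h\<^sup>2"
proof -
  assume j: "j \<in> {2..4}"
  have "norm2_h N (\<rho> j) \<le> R * k * h\<^sup>2 * (1 + 2 * real CARD('d)) * real N"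
    using pos k0 by (intro dual_bound_norm2[OF N _ \<rho>_dual[OF j]]) auto
  also have "\<dots> = R * (1 + 2 * real CARD('d)) * h * k"
    using N by (simp add: power2_eq_square field_simps)
  also have "\<dots> \<le> R * (1 + 2 * real CARD('d)) * h * (C2 * h)"
    using kC2 pos by (intro mult_left_mono) auto
  finally show ?thesis by (simp add: power2_eq_square mult_ac)
qed

section \<open>The bootstrap for the stage errors\<close>

lemmas norm2_simps = nrm_triangle[unfolded nrm_inner_h] nrm_scale[unfolded nrm_inner_h]
  nrm_diff[unfolded nrm_inner_h] ip_Cauchy_Schwarz[unfolded nrm_inner_h]

lemma coeff_bounds: "0 < c_a21 c" "c_a21 c \<le> 1" "0 < c_a31 c" "c_a31 c \<le> 1" "0 < c_a32 c" "c_a32 c \<le> 1"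
  "\<bar>c_s32 c\<bar> \<le> 1" "0 < c_s33 c" "c_s33 c \<le> 1" "0 < c_a42 c" "c_a42 c \<le> 1" "0 < c_a43 c" "c_a43 c \<le> 1"
  "0 < c_b2 c" "c_b2 c \<le> 1" "0 < c_b3 c" "c_b3 c \<le> 1" "0 < c_b4 c" "c_b4 c \<le> 1"
  using scheme_coeffs_bounds[OF coeffs, unfolded abs_less_iff] by (simp_all add: abs_le_iff)

text \<open>Turns the positive powers of \<open>h\<close> in the pointwise bounds into a threshold
  \<open>\<eta>\<close>. It stays a parameter because the end value of the step calls for stages
  smaller than 1.\<close>

lemma stage_small:
  assumes j: "j \<in> {2..4}" and \<gamma>: "\<gamma> > 0" and eq: "e j + \<gamma> *\<^sub>R X (e j) = z"
    and z: "norm2_h N z \<le> Z * h\<^sup>2" and Z: "Z \<ge> 0" and \<eta>: "\<eta> \<ge> 0"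
    and sm: "(Z\<^sup>2 + 2 * Z\<^sup>2 / (\<gamma> * \<beta> * C1 * sqrt (\<gamma> * \<beta> * C1))) * sqrt h \<le> \<eta>\<^sup>2"
  shows "norm2_h N (X (e j)) \<le> Z / \<gamma> * h\<^sup>2"
    "norm2_h N (e j) \<le> Z * (1 + 1 / sqrt (\<gamma> * \<beta>)) * h\<^sup>2" "sqrt k * gn (e j) \<le> Z * (1 + 1 / sqrt (\<gamma> * \<beta>)) * h\<^sup>2"
    "\<And>I. I \<in> grid N \<Longrightarrow> norm (e j I) \<le> \<eta>" "\<And>i I. I \<in> midpoints N i \<Longrightarrow> norm (grad_h N (e j) i I) \<le> \<eta>"
proof -
  have j4: "j \<in> {1..4}" using j by auto
  note S = stage_bounds[OF dim N \<gamma> pos(2,3) kC1 e_neumann[OF j4] eq[unfolded X_def] z Z]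
  show "norm2_h N (X (e j)) \<le> Z / \<gamma> * h\<^sup>2" using S(2) by (simp add: X_def)
  have sq: "sqrt (\<gamma> * \<beta>) > 0" using \<gamma> pos by simp
  have 1: "Z * h\<^sup>2 \<le> Z * (1 + 1 / sqrt (\<gamma> * \<beta>)) * h\<^sup>2"
    using Z sq mult_left_mono[of 1 "1 + 1 / sqrt (\<gamma> * \<beta>)" Z] by (intro mult_right_mono) auto
  show "norm2_h N (e j) \<le> Z * (1 + 1 / sqrt (\<gamma> * \<beta>)) * h\<^sup>2" using S(1) 1 by linarith
  have "Z / sqrt (\<gamma> * \<beta>) * h\<^sup>2 \<le> Z * (1 + 1 / sqrt (\<gamma> * \<beta>)) * h\<^sup>2"
    using Z by (intro mult_right_mono) (simp_all add: distrib_left)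
  then show "sqrt k * gn (e j) \<le> Z * (1 + 1 / sqrt (\<gamma> * \<beta>)) * h\<^sup>2" using S(3) by linarith
  define D sh where "D = 2 * Z\<^sup>2 / (\<gamma> * \<beta> * C1 * sqrt (\<gamma> * \<beta> * C1))" and "sh = sqrt h"
  have D0: "D \<ge> 0" using \<gamma> pos by (simp add: D_def)
  have sh0: "sh \<ge> 0" by (simp add: sh_def)
  have sm': "(Z\<^sup>2 + D) * sh \<le> \<eta>\<^sup>2" using sm by (simp only: D_def sh_def)
  \<comment> \<open>The squared values are of order \<open>h\<close>, the squared gradients of order
    \<open>sqrt h\<close>; this inequality lets one smallness condition serve both.\<close>
  have hs: "h \<le> sh" unfolding sh_def by (rule le_sqrt_self) (use h in auto)
  have "0 \<le> Z\<^sup>2 * sh" "0 \<le> D * sh" using sh0 D0 by simp_all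
  moreover have "Z\<^sup>2 * h \<le> Z\<^sup>2 * sh" by (rule mult_left_mono[OF hs]) simp
  ultimately have a: "Z\<^sup>2 * h \<le> \<eta>\<^sup>2" and b: "D * sh \<le> \<eta>\<^sup>2"
    using sm' unfolding distrib_right by linarith+
  show "norm (e j I) \<le> \<eta>" if "I \<in> grid N" for I
    by (rule power2_le_imp_le[OF order_trans[OF S(4)[OF that] a] \<eta>])
  show "norm (grad_h N (e j) i I) \<le> \<eta>" if "I \<in> midpoints N i" for i I
    by (rule power2_le_imp_le[OF order_trans[OF S(5)[OF that, folded D_def sh_def] b] \<eta>])
qed

lemma nl_small:
  assumes "l \<in> {1..4}" "\<And>I. I \<in> grid N \<Longrightarrow> norm (e l I) \<le> 1"
    and "\<And>i I. I \<in> midpoints N i \<Longrightarrow> norm (grad_h N (e l) i I) \<le> 1"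
    and x: "norm2_h N (e l) \<le> A * h\<^sup>2" and y: "sqrt k * gn (e l) \<le> A * h\<^sup>2" and a: "0 \<le> a" "a \<le> 1"
  shows "norm2_h N (k *\<^sub>R (a *\<^sub>R nl l)) \<le> 2 * LL * A * h\<^sup>2"
proof -
  have "k * norm2_h N (nl l) \<le> k * (LL * (norm2_h N (e l) + gn (e l)))"
    using nl_norm2[OF assms(1-3)] k0 by (intro mult_left_mono) auto
  also have "\<dots> = LL * (k * norm2_h N (e l) + k * gn (e l))" by (simp add: algebra_simps)
  also have "\<dots> \<le> LL * (A * h\<^sup>2 + A * h\<^sup>2)"
  proof (intro mult_left_mono add_mono LL0)
    show "k * norm2_h N (e l) \<le> A * h\<^sup>2"
      using x k1 k0 mult_right_mono[OF k1, of "norm2_h N (e l)"] by simp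
    have "k * gn (e l) \<le> sqrt k * gn (e l)"
      using k0 k1 by (intro mult_right_mono real_le_rsqrt) (auto simp: power2_eq_square mult_left_le)
    then show "k * gn (e l) \<le> A * h\<^sup>2" using y by linarith
  qed
  finally have 1: "k * norm2_h N (nl l) \<le> 2 * LL * A * h\<^sup>2" by (simp add: algebra_simps)
  have "norm2_h N (k *\<^sub>R (a *\<^sub>R nl l)) = a * (k * norm2_h N (nl l))"
    using k0 a by (simp add: norm2_simps(2))
  also have "\<dots> \<le> 1 * (k * norm2_h N (nl l))" using a k0 by (intro mult_right_mono) auto
  finally show ?thesis using 1 by linarith
qed

text \<open>The explicit tableau is strictly lower triangular, so the nonlinear terms in a stage
  come from earlier stages, whose smallness makes the Lipschitz bound applicable. The gradient of
  \<open>e 1\<close> has to be assumed: the starting error is not the solution of an implicit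
  equation of this step. Constants appear as equations so that they can be fixed before the
  mesh.\<close>

lemma all_stages_small:
  assumes A1: "norm2_h N (e 1) \<le> A1 * h\<^sup>2" "sqrt k * gn (e 1) \<le> A1 * h\<^sup>2" "A1 \<ge> 0" "A1\<^sup>2 * h \<le> 1"
    and g1: "\<And>i I. I \<in> midpoints N i \<Longrightarrow> norm (grad_h N (e 1) i I) \<le> 1"
    and \<rho>0: "\<rho>0 = R * (1 + 2 * real CARD('d)) * C2"
    and Z2: "Z2 = A1 + 2 * LL * A1 + \<rho>0" and A2: "A2 = Z2 * (1 + 1 / sqrt (c_a21 c * \<beta>))"
    and Z3: "Z3 = A1 + 2 * LL * A1 + 2 * LL * A2 + \<rho>0 + Z2 / c_a21 c" and A3: "A3 = Z3 * (1 + 1 / sqrt (c_s33 c * \<beta>))"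
    and Z4: "Z4 = A1 + 2 * LL * A2 + 2 * LL * A3 + \<rho>0 + Z2 / c_a21 c + Z3 / c_s33 c"
    and \<eta>: "0 \<le> \<eta>" "\<eta> \<le> 1"
    and sm2: "(Z2\<^sup>2 + 2 * Z2\<^sup>2 / (c_a21 c * \<beta> * C1 * sqrt (c_a21 c * \<beta> * C1))) * sqrt h \<le> \<eta>\<^sup>2"
    and sm3: "(Z3\<^sup>2 + 2 * Z3\<^sup>2 / (c_s33 c * \<beta> * C1 * sqrt (c_s33 c * \<beta> * C1))) * sqrt h \<le> \<eta>\<^sup>2"
    and sm4: "(Z4\<^sup>2 + 2 * Z4\<^sup>2 / (c_b4 c * \<beta> * C1 * sqrt (c_b4 c * \<beta> * C1))) * sqrt h \<le> \<eta>\<^sup>2"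
  shows "I \<in> grid N \<Longrightarrow> norm (e 1 I) \<le> 1"
    and "j \<in> {2..4} \<Longrightarrow> I \<in> grid N \<Longrightarrow> norm (e j I) \<le> \<eta>"
    and "j \<in> {2..4} \<Longrightarrow> I' \<in> midpoints N i \<Longrightarrow> norm (grad_h N (e j) i I') \<le> \<eta>"
proof -
  note cb = coeff_bounds
  have e1: "norm (e 1 I) \<le> 1" if I: "I \<in> grid N" for I
  proof -
    have "(norm (e 1 I))\<^sup>2 \<le> real N ^ CARD('d) * (norm2_h N (e 1))\<^sup>2" by (rule sup_le_norm2_h[OF N I])
    also have "\<dots> \<le> real N ^ 3 * (A1 * h\<^sup>2)\<^sup>2"
      using A1(1) N dim by (intro mult_mono power_increasing power_mono) auto
    also have "\<dots> = A1\<^sup>2 * h" using N by (simp add: power_mult_distrib field_simps eval_nat_numeral)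
    also have "\<dots> \<le> 1\<^sup>2" using A1(4) by simp
    finally show ?thesis by (rule power2_le_imp_le) simp
  qed
  have \<rho>00: "\<rho>0 \<ge> 0" using pos by (simp add: \<rho>0)
  have Z20: "Z2 \<ge> 0" using A1(3) LL0 \<rho>00 by (simp add: Z2)
  have A20: "A2 \<ge> 0" using Z20 cb(1) pos by (simp add: A2)
  have Z30: "Z3 \<ge> 0" using A1(3) LL0 \<rho>00 A20 Z20 cb by (simp add: Z3)
  have A30: "A3 \<ge> 0" using Z30 cb pos by (simp add: A3)
  have Z40: "Z4 \<ge> 0" using A1(3) LL0 \<rho>00 A20 Z20 A30 Z30 cb by (simp add: Z4)
  have \<rho>b: "norm2_h N (\<rho> j) \<le> \<rho>0 * h\<^sup>2" if "j \<in> {2..4}" for j using \<rho>_norm2[OF that] by (simp add: \<rho>0)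
  have n1: "norm2_h N (k *\<^sub>R (a *\<^sub>R nl 1)) \<le> 2 * LL * A1 * h\<^sup>2" if "0 \<le> a" "a \<le> 1" for a
    by (rule nl_small[OF _ e1 g1 A1(1,2) that]) auto
  have "norm2_h N f2 = norm2_h N (k *\<^sub>R (c_a21 c *\<^sub>R nl 1) + \<rho> 2)"
    by (rule norm2_h_cong) (rule f2_grid)
  also have "\<dots> \<le> 2 * LL * A1 * h\<^sup>2 + \<rho>0 * h\<^sup>2"
    by (intro order_trans[OF norm2_simps(1)] add_mono n1 \<rho>b) (use cb in auto)
  finally have f2: "norm2_h N f2 \<le> 2 * LL * A1 * h\<^sup>2 + \<rho>0 * h\<^sup>2" .
  have z2: "norm2_h N (e 1 + f2) \<le> Z2 * h\<^sup>2"
    using norm2_simps(1)[of "e 1" f2] f2 A1(1) by (simp add: Z2 algebra_simps)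
  have q2: "e 2 + c_a21 c *\<^sub>R X (e 2) = e 1 + f2" by (simp add: f2_def)
  note S2 = stage_small[OF _ cb(1) q2 z2 Z20 \<eta>(1) sm2]
  have e2: "norm (e 2 I) \<le> 1" if "I \<in> grid N" for I using S2(4)[OF _ that] \<eta> by force
  have g2: "norm (grad_h N (e 2) i I) \<le> 1" if "I \<in> midpoints N i" for i I using S2(5)[OF _ that] \<eta> by force
  have n2: "norm2_h N (k *\<^sub>R (a *\<^sub>R nl 2)) \<le> 2 * LL * A2 * h\<^sup>2" if "0 \<le> a" "a \<le> 1" for a
    by (rule nl_small[OF _ e2 g2 _ _ that]) (use S2(2,3) in \<open>auto simp: A2\<close>)
  have X2: "norm2_h N (X (e 2)) \<le> Z2 / c_a21 c * h\<^sup>2" by (rule S2(1)) simp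
  have tX: "norm2_h N (a *\<^sub>R X u) \<le> norm2_h N (X u)" if "\<bar>a\<bar> \<le> 1" for a u
    using mult_right_mono[OF that, of "norm2_h N (X u)"] by (simp add: norm2_simps(2))
  have "norm2_h N f3 = norm2_h N (k *\<^sub>R (c_a31 c *\<^sub>R nl 1) + k *\<^sub>R (c_a32 c *\<^sub>R nl 2) + \<rho> 3)"
    by (rule norm2_h_cong) (use f3_grid in \<open>auto simp: scaleR_add_right\<close>)
  also have "\<dots> \<le> 2 * LL * A1 * h\<^sup>2 + 2 * LL * A2 * h\<^sup>2 + \<rho>0 * h\<^sup>2"
    by (intro order_trans[OF norm2_simps(1)] add_mono n1 n2 \<rho>b) (use cb in auto)
  finally have f3: "norm2_h N f3 \<le> 2 * LL * A1 * h\<^sup>2 + 2 * LL * A2 * h\<^sup>2 + \<rho>0 * h\<^sup>2" .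
  have z3: "norm2_h N (e 1 + f3 - c_s32 c *\<^sub>R X (e 2)) \<le> Z3 * h\<^sup>2"
  proof -
    have "norm2_h N (e 1 + f3 - c_s32 c *\<^sub>R X (e 2)) \<le> norm2_h N (e 1) + norm2_h N f3 + norm2_h N (X (e 2))"
      by (intro order_trans[OF norm2_simps(3)] add_mono norm2_simps(1) tX cb)
    then show ?thesis using f3 A1(1) X2 by (simp add: Z3 algebra_simps)
  qed
  have q3: "e 3 + c_s33 c *\<^sub>R X (e 3) = e 1 + f3 - c_s32 c *\<^sub>R X (e 2)" by (simp add: f3_def)
  note S3 = stage_small[OF _ cb(8) q3 z3 Z30 \<eta>(1) sm3]
  have e3: "norm (e 3 I) \<le> 1" if "I \<in> grid N" for I using S3(4)[OF _ that] \<eta> by force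
  have g3: "norm (grad_h N (e 3) i I) \<le> 1" if "I \<in> midpoints N i" for i I using S3(5)[OF _ that] \<eta> by force
  have n3: "norm2_h N (k *\<^sub>R (a *\<^sub>R nl 3)) \<le> 2 * LL * A3 * h\<^sup>2" if "0 \<le> a" "a \<le> 1" for a
    by (rule nl_small[OF _ e3 g3 _ _ that]) (use S3(2,3) in \<open>auto simp: A3\<close>)
  have X3: "norm2_h N (X (e 3)) \<le> Z3 / c_s33 c * h\<^sup>2" by (rule S3(1)) simp
  have "norm2_h N f4 = norm2_h N (k *\<^sub>R (c_a42 c *\<^sub>R nl 2) + k *\<^sub>R (c_a43 c *\<^sub>R nl 3) + \<rho> 4)"
    by (rule norm2_h_cong) (use f4_grid in \<open>auto simp: scaleR_add_right\<close>)
  also have "\<dots> \<le> 2 * LL * A2 * h\<^sup>2 + 2 * LL * A3 * h\<^sup>2 + \<rho>0 * h\<^sup>2"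
    by (intro order_trans[OF norm2_simps(1)] add_mono n2 n3 \<rho>b) (use cb in auto)
  finally have f4: "norm2_h N f4 \<le> 2 * LL * A2 * h\<^sup>2 + 2 * LL * A3 * h\<^sup>2 + \<rho>0 * h\<^sup>2" .
  have z4: "norm2_h N (e 1 + f4 - c_b2 c *\<^sub>R X (e 2) - c_b3 c *\<^sub>R X (e 3)) \<le> Z4 * h\<^sup>2"
  proof -
    have "norm2_h N (e 1 + f4 - c_b2 c *\<^sub>R X (e 2) - c_b3 c *\<^sub>R X (e 3))
        \<le> norm2_h N (e 1) + norm2_h N f4 + norm2_h N (X (e 2)) + norm2_h N (X (e 3))"
      by (intro order_trans[OF norm2_simps(3)] add_mono norm2_simps(1) tX) (use cb in auto)
    then show ?thesis using f4 A1(1) X2 X3 by (simp add: Z4 algebra_simps)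
  qed
  have q4: "e 4 + c_b4 c *\<^sub>R X (e 4) = e 1 + f4 - c_b2 c *\<^sub>R X (e 2) - c_b3 c *\<^sub>R X (e 3)" by (simp add: f4_def)
  note S4 = stage_small[OF _ cb(18) q4 z4 Z40 \<eta>(1) sm4]
  have j234: "j = 2 \<or> j = 3 \<or> j = 4" if "j \<in> {2..4}" for j :: nat using that by auto
  show "norm (e 1 I) \<le> 1" if "I \<in> grid N" by (rule e1[OF that])
  show "norm (e j I) \<le> \<eta>" if "j \<in> {2..4}" "I \<in> grid N"
    using j234[OF that(1)] S2(4)[OF _ that(2)] S3(4)[OF _ that(2)] S4(4)[OF _ that(2)] by auto
  show "norm (grad_h N (e j) i I') \<le> \<eta>" if "j \<in> {2..4}" "I' \<in> midpoints N i"
    using j234[OF that(1)] S2(5)[OF _ that(2)] S3(5)[OF _ that(2)] S4(5)[OF _ that(2)] by auto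
qed

lemma m5_pointwise:
  assumes \<eta>: "0 \<le> \<eta>" "\<eta> \<le> 1"
    and e: "\<And>j I. j \<in> {2..4} \<Longrightarrow> I \<in> grid N \<Longrightarrow> norm (e j I) \<le> \<eta>"
    and g: "\<And>j i I. j \<in> {2..4} \<Longrightarrow> I \<in> midpoints N i \<Longrightarrow> norm (grad_h N (e j) i I) \<le> \<eta>"
    and I: "I \<in> grid N"
  shows "norm (m5 I) \<le> 3 * (MM * (1 + real CARD('d)) * \<eta>)"
proof -
  have n: "norm (nl l I) \<le> MM * (1 + real CARD('d)) * \<eta>" if l: "l \<in> {2..4}" for l
  proof -
    have "norm (nl l I) \<le> MM * (norm (e l I) + (\<Sum>i\<in>UNIV. norm (avg_grad_h N (e l) i I)))"
      by (rule nl_pointwise)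
        (use l I in \<open>auto intro: order_trans[OF e[OF l] \<eta>(2)] order_trans[OF g[OF l] \<eta>(2)]\<close>)
    also have "\<dots> \<le> MM * (\<eta> + (\<Sum>i\<in>(UNIV::'d set). \<eta>))"
      by (intro mult_left_mono add_mono sum_mono avg_grad_le MM0 e[OF l I] g[OF l] I)
    finally show ?thesis by (simp add: algebra_simps)
  qed
  have t: "norm (a *\<^sub>R nl l I) \<le> MM * (1 + real CARD('d)) * \<eta>" if "\<bar>a\<bar> \<le> 1" "l \<in> {2..4}" for a l
    using mult_right_mono[OF that(1), of "norm (nl l I)"] n[OF that(2)] by simp
  have "norm (m5 I) \<le> norm ((c_b2 c - c_a42 c) *\<^sub>R nl 2 I) + norm ((c_b3 c - c_a43 c) *\<^sub>R nl 3 I) + norm (c_b4 c *\<^sub>R nl 4 I)"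
    unfolding m5_def plus_fun_apply scaleR_fun_apply by (intro norm_triangle_le add_right_mono norm_triangle_ineq)
  also have "\<dots> \<le> MM * (1 + real CARD('d)) * \<eta> + MM * (1 + real CARD('d)) * \<eta> + MM * (1 + real CARD('d)) * \<eta>"
    by (intro add_mono t) (use coeff_bounds in \<open>auto simp: abs_le_iff\<close>)
  finally show ?thesis by linarith
qed

text \<open>The gradient of the explicit difference \<open>f5\<close> is estimated by
  \<open>2 N\<close> times its maximum, which is of order \<open>k\<close>; since
  \<open>k N \<le> C2\<close> this is bounded but not small by itself. Smallness is supplied by the
  factor \<open>\<eta>\<close> inherited from stages 2 to 4.\<close>

lemma final_gradient:
  assumes \<eta>: "0 \<le> \<eta>" "\<eta> \<le> 1"
    and e: "\<And>j I. j \<in> {2..4} \<Longrightarrow> I \<in> grid N \<Longrightarrow> norm (e j I) \<le> \<eta>"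
    and g: "\<And>j i I. j \<in> {2..4} \<Longrightarrow> I \<in> midpoints N i \<Longrightarrow> norm (grad_h N (e j) i I) \<le> \<eta>"
    and I: "I \<in> midpoints N i"
  shows "norm (grad_h N e5 i I) \<le> \<eta> + 2 * C2 * (3 * (MM * (1 + real CARD('d)) * \<eta>) + R * h\<^sup>2)"
proof -
  let ?Q = "3 * (MM * (1 + real CARD('d)) * \<eta>) + R * h\<^sup>2"
  have Q0: "?Q \<ge> 0" using MM0 \<eta> pos by simp
  have sup: "norm (f5 J) \<le> k * ?Q" if J: "J \<in> grid N" for J
  proof -
    have "norm (f5 J) \<le> norm (k *\<^sub>R m5 J) + norm (f5 J - k *\<^sub>R m5 J)" by (metis add.commute diff_add_cancel norm_triangle_ineq)
    also have "\<dots> \<le> k * (3 * (MM * (1 + real CARD('d)) * \<eta>)) + R * k * h\<^sup>2"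
    proof (rule add_mono)
      show "norm (k *\<^sub>R m5 J) \<le> k * (3 * (MM * (1 + real CARD('d)) * \<eta>))"
        using mult_left_mono[OF m5_pointwise[OF \<eta> e g J], of k] k0 by (simp only: norm_scaleR abs_of_pos less_imp_le)
    qed (rule f5_grid[OF J])
    finally show ?thesis by (simp add: algebra_simps)
  qed
  have "norm (grad_h N f5 i I) \<le> 2 * real N * (k * ?Q)"
    by (rule grad_h_le_sup[OF f5_neumann I sup]) (use k0 Q0 in auto)
  also have "\<dots> \<le> 2 * real N * ((C2 * h) * ?Q)"
    using kC2 Q0 by (intro mult_left_mono mult_right_mono) auto
  also have "\<dots> = 2 * C2 * ?Q" using N by simp
  finally have f: "norm (grad_h N f5 i I) \<le> 2 * C2 * ?Q" .
  have "e5 = e 4 + f5" by (simp add: f5_def)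
  then have "norm (grad_h N e5 i I) \<le> norm (grad_h N (e 4) i I) + norm (grad_h N f5 i I)"
    by (simp add: grad_h_add norm_triangle_ineq)
  then show ?thesis using g[of 4 I i] I f by simp
qed

section \<open>The energy balance of one step\<close>

lemma X_form: "discrete_neumann N z \<Longrightarrow> inner_h N (X z) z = k * \<beta> * (gn z)\<^sup>2"
  by (simp add: X_def ip_expand inner_lap_h grad_norm2_h_square)

lemma gn_add_le:
  fixes u u' :: "'d gridfun"
  assumes u: "discrete_neumann N u" and u': "discrete_neumann N u'"
  shows "(gn (u + u'))\<^sup>2 \<le> 2 * (gn u)\<^sup>2 + 2 * (gn u')\<^sup>2"
proof -
  have S: "u \<in> {u. discrete_neumann N u}" "u' \<in> {u. discrete_neumann N u}" using u u' by auto
  have "0 \<le> inner_h N (X (u - u')) (u - u')" by (intro X_nonneg S_closed S)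
  then have "inner_h N (X (u + u')) (u + u') \<le> 2 * inner_h N (X u) u + 2 * inner_h N (X u') u'"
    by (simp add: ip_expand X_simps)
  moreover have "discrete_neumann N (u + u')" using S_closed(1)[OF S] by simp
  ultimately have "(k * \<beta>) * (gn (u + u'))\<^sup>2 \<le> (k * \<beta>) * (2 * (gn u)\<^sup>2 + 2 * (gn u')\<^sup>2)"
    using X_form u u' by (simp add: algebra_simps)
  then show ?thesis using k0 pos by simp
qed

lemma energy_step:
  fixes c0 C \<theta> \<eta> :: real
  assumes sup: "\<And>j I. j \<in> {1..4} \<Longrightarrow> I \<in> grid N \<Longrightarrow> norm (e j I) \<le> 1"
    and gsup: "\<And>j i I. j \<in> {1..4} \<Longrightarrow> I \<in> midpoints N i \<Longrightarrow> norm (grad_h N (e j) i I) \<le> 1"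
    and en: "\<And>F. \<forall>u\<in>{e 2, e 3, e 4}. \<forall>g\<in>{f2, f3, f4}. \<bar>inner_h N u g\<bar> \<le> F \<Longrightarrow>
      inner_h N (e 4) (e 4) + c0 * ((\<Sum>u\<in>#{#e 2, e 3, e 4#}. inner_h N (X u) u)
        + (\<Sum>u\<in>#{#e 2, e 3, e 4#}. inner_h N (u - e 1) (u - e 1))) \<le> inner_h N (e 1) (e 1) + C * F"
    and c0: "c0 > 0" and C: "C \<ge> 0" and \<theta>0: "\<theta> > 0" and \<eta>0: "\<eta> > 0"
    and \<Lambda>2: "\<Lambda>2 = 27 * LL\<^sup>2 + 3 * R\<^sup>2" and P: "P = 8 * real CARD('d) * C2\<^sup>2"
    and \<Lambda>1: "\<Lambda>1 = 3 * LL + 9 * LL\<^sup>2 / (4 * \<eta>) + R\<^sup>2 / (4 * \<eta>) + 1 + R\<^sup>2 / 4"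
    and \<Lambda>3: "\<Lambda>3 = (C + 2) * \<Lambda>1 + \<Lambda>2 + \<theta> * P * \<Lambda>2"
    and \<theta>: "\<theta> * (2 + P * \<Lambda>2) \<le> c0 * \<beta> / 4"
    and \<eta>: "2 * (C + 2) * \<eta> \<le> c0 * \<beta> / 4" "2 * (C + 2) * \<eta> \<le> \<theta>"
    and k2: "\<Lambda>2 * k \<le> c0 * \<beta> / 4" and k3: "2 * k * \<Lambda>3 \<le> c0"
  shows "(norm2_h N e5)\<^sup>2 + \<theta> * (k * (gn e5)\<^sup>2)
    \<le> (1 + 7 * \<Lambda>3 * k) * (norm2_h N (e 1))\<^sup>2 + \<theta> * k * (gn (e 1))\<^sup>2 + \<Lambda>3 * k * h ^ 4"
proof -
  define x where "x j = norm2_h N (e j)" for j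
  define y where "y j = gn (e j)" for j
  define E where "E = sqrt ((x 1)\<^sup>2 + (x 2)\<^sup>2 + (x 3)\<^sup>2 + (x 4)\<^sup>2)"
  \<comment> \<open>Stage 1 is left out: the dissipation controls the gradients of stages 2 to 4
    only. \<open>G\<close> adds it back where explicit terms see it.\<close>
  define G' where "G' = sqrt ((y 2)\<^sup>2 + (y 3)\<^sup>2 + (y 4)\<^sup>2)"
  define G where "G = sqrt (G'\<^sup>2 + (y 1)\<^sup>2)"
  define H where "H = h\<^sup>2"
  \<comment> \<open>One bound for every pairing; the factor 3 is the largest number of nonlinear
    differences in a perturbation, reached by \<open>m5\<close>.\<close>
  define Pt where "Pt = 3 * k * LL * E * (E + G) + R * k * H * (E + G)"
  have x0: "x j \<ge> 0" and y0: "y j \<ge> 0" for j by (simp_all add: x_def y_def)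
  have E0: "E \<ge> 0" "G' \<ge> 0" "G \<ge> 0" by (simp_all add: E_def G'_def G_def)
  have H0: "H \<ge> 0" by (simp add: H_def)
  have E2: "E\<^sup>2 = (x 1)\<^sup>2 + (x 2)\<^sup>2 + (x 3)\<^sup>2 + (x 4)\<^sup>2" by (simp add: E_def)
  have G2': "G'\<^sup>2 = (y 2)\<^sup>2 + (y 3)\<^sup>2 + (y 4)\<^sup>2" by (simp add: G'_def)
  have G2: "G\<^sup>2 = G'\<^sup>2 + (y 1)\<^sup>2" by (simp add: G_def)
  have j4: "j = 1 \<or> j = 2 \<or> j = 3 \<or> j = 4" if "j \<in> {1..4}" for j :: nat using that by auto
  have xE: "x j \<le> E" if "j \<in> {1..4}" for j
    using j4[OF that] by (intro power2_le_imp_le[OF _ E0(1)]) (auto simp: E2 add_nonneg_nonneg)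
  have yG: "y j \<le> G" if "j \<in> {1..4}" for j
    using j4[OF that] by (intro power2_le_imp_le[OF _ E0(3)]) (auto simp: G2 G2')
  have yG': "y j \<le> G'" if "j \<in> {2..4}" for j
  proof -
    have "j = 2 \<or> j = 3 \<or> j = 4" using that by auto
    then show ?thesis by (intro power2_le_imp_le[OF _ E0(2)]) (auto simp: G2')
  qed
  have n: "norm2_h N (nl l) \<le> LL * (x l + y l)" if "l \<in> {1..4}" for l
    unfolding x_def y_def by (rule nl_norm2[OF that sup[OF that] gsup[OF that]])
  have nE: "norm2_h N (nl l) \<le> LL * (E + G)" if "l \<in> {1..4}" for l
    using n[OF that] mult_left_mono[OF add_mono[OF xE[OF that] yG[OF that]] LL0] by linarith
  have nE': "norm2_h N (nl l) \<le> LL * (E + G')" if "l \<in> {2..4}" for l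
  proof -
    have l: "l \<in> {1..4}" using that by auto
    show ?thesis using n[OF l] mult_left_mono[OF add_mono[OF xE[OF l] yG'[OF that]] LL0] by linarith
  qed
  have an: "norm2_h N (a *\<^sub>R nl l) \<le> norm2_h N (nl l)" if "\<bar>a\<bar> \<le> 1" for a l
    using mult_right_mono[OF that, of "norm2_h N (nl l)"] by (simp add: norm2_simps(2))
  have anE: "norm2_h N (a *\<^sub>R nl l) \<le> LL * (E + G)" if "l \<in> {1..4}" "\<bar>a\<bar> \<le> 1" for a l
    using an[OF that(2)] nE[OF that(1)] by (rule order_trans)
  have LEG: "0 \<le> LL * (E + G)" "0 \<le> LL * (E + G')" using LL0 E0 by simp_all
  note cb = coeff_bounds
  have RkH: "0 \<le> R * k * H" using pos k0 H0 by simp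
  have pair: "\<bar>inner_h N (e j) g\<bar> \<le> Pt"
    if j: "j \<in> {1..4}" and g: "\<And>I. I \<in> grid N \<Longrightarrow> g I = (k *\<^sub>R m + r) I"
      and m: "norm2_h N m \<le> 3 * (LL * (E + G))"
      and r: "\<bar>inner_h N r (e j)\<bar> \<le> R * k * h\<^sup>2 * (x j + y j)" for j g m r
  proof -
    have "inner_h N (e j) g = inner_h N (e j) (k *\<^sub>R m + r)" by (rule inner_h_cong) (rule g)
    also have "\<dots> = k * inner_h N (e j) m + inner_h N r (e j)" by (simp add: ip_expand ip_commute[of r])
    finally have eq: "inner_h N (e j) g = k * inner_h N (e j) m + inner_h N r (e j)" .
    have "\<bar>k * inner_h N (e j) m + inner_h N r (e j)\<bar> \<le> k * \<bar>inner_h N (e j) m\<bar> + \<bar>inner_h N r (e j)\<bar>"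
      using k0 abs_triangle_ineq[of "k * inner_h N (e j) m" "inner_h N r (e j)"] by (simp add: abs_mult)
    also have "\<dots> \<le> k * (E * (3 * (LL * (E + G)))) + R * k * H * (E + G)"
    proof (rule add_mono)
      have "\<bar>inner_h N (e j) m\<bar> \<le> x j * norm2_h N m" unfolding x_def by (rule norm2_simps(4))
      also have "\<dots> \<le> E * (3 * (LL * (E + G)))" by (rule mult_mono[OF xE[OF j] m E0(1)]) simp
      finally show "k * \<bar>inner_h N (e j) m\<bar> \<le> k * (E * (3 * (LL * (E + G))))" using k0 by (intro mult_left_mono) auto
      have "R * k * h\<^sup>2 * (x j + y j) \<le> R * k * H * (E + G)"
        unfolding H_def[symmetric] by (rule mult_left_mono[OF add_mono[OF xE[OF j] yG[OF j]] RkH])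
      then show "\<bar>inner_h N r (e j)\<bar> \<le> R * k * H * (E + G)" using r by linarith
    qed
    finally show ?thesis unfolding eq by (simp add: Pt_def mult_ac)
  qed
  have r: "\<bar>inner_h N (\<rho> l) (e j)\<bar> \<le> R * k * h\<^sup>2 * (x j + y j)" if "l \<in> {2..4}" "j \<in> {1..4}" for l j
    unfolding x_def y_def by (rule \<rho>_dual[OF that(1) e_neumann[OF that(2)]])
  have ea: "norm2_h N (u + u') \<le> a + b" if "norm2_h N u \<le> a" "norm2_h N u' \<le> b" for u u' :: "'d gridfun" and a b
    using norm2_simps(1)[of u u'] that by linarith
  have p2: "\<bar>inner_h N (e j) f2\<bar> \<le> Pt" if "j \<in> {1..4}" for j
    by (rule pair[OF that f2_grid _ r]) (use that anE[of 1 "c_a21 c"] LEG cb in auto)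
  have m3: "norm2_h N (c_a31 c *\<^sub>R nl 1 + c_a32 c *\<^sub>R nl 2) \<le> 3 * (LL * (E + G))"
  proof -
    have "norm2_h N (c_a31 c *\<^sub>R nl 1 + c_a32 c *\<^sub>R nl 2) \<le> LL * (E + G) + LL * (E + G)"
      by (intro ea anE) (use cb in auto)
    then show ?thesis using LEG by linarith
  qed
  have m4: "norm2_h N (c_a42 c *\<^sub>R nl 2 + c_a43 c *\<^sub>R nl 3) \<le> 3 * (LL * (E + G))"
  proof -
    have "norm2_h N (c_a42 c *\<^sub>R nl 2 + c_a43 c *\<^sub>R nl 3) \<le> LL * (E + G) + LL * (E + G)"
      by (intro ea anE) (use cb in auto)
    then show ?thesis using LEG by linarith
  qed
  have p3: "\<bar>inner_h N (e j) f3\<bar> \<le> Pt" if "j \<in> {1..4}" for j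
    by (rule pair[OF that f3_grid m3 r]) (use that in auto)
  have p4: "\<bar>inner_h N (e j) f4\<bar> \<le> Pt" if "j \<in> {1..4}" for j
    by (rule pair[OF that f4_grid m4 r]) (use that in auto)
  define r5 where "r5 = f5 - k *\<^sub>R m5"
  have r5: "norm2_h N r5 \<le> R * k * h\<^sup>2"
    by (rule norm2_h_le_sup[OF N]) (use f5_grid pos k0 in \<open>auto simp: r5_def\<close>)
  have cb5: "\<bar>c_b2 c - c_a42 c\<bar> \<le> 1" "\<bar>c_b3 c - c_a43 c\<bar> \<le> 1" "\<bar>c_b4 c\<bar> \<le> 1"
    using cb by (auto simp: abs_le_iff)
  have m5: "norm2_h N m5 \<le> 3 * (LL * (E + G))"
  proof -
    have "norm2_h N m5 \<le> LL * (E + G) + LL * (E + G) + LL * (E + G)"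
      unfolding m5_def by (intro ea anE cb5) auto
    then show ?thesis by linarith
  qed
  \<comment> \<open>\<open>nl 1\<close> does not occur in \<open>m5\<close>, so \<open>G'\<close>
    suffices. A contribution of \<open>y 1\<close> to the bounds on \<open>\<phi>\<close> and on the
    end gradient would carry no small factor \<open>\<eta>\<close> and could not be absorbed in
    \<open>\<theta> k (y 1)^2\<close>.\<close>
  have m5': "norm2_h N m5 \<le> 3 * (LL * (E + G'))"
  proof -
    have "norm2_h N m5 \<le> LL * (E + G') + LL * (E + G') + LL * (E + G')"
      unfolding m5_def by (intro ea order_trans[OF an nE'] cb5) auto
    then show ?thesis by linarith
  qed
  have p5: "\<bar>inner_h N (e 4) f5\<bar> \<le> Pt"
  proof (rule pair[of 4 f5 m5 r5])
    have "\<bar>inner_h N r5 (e 4)\<bar> \<le> norm2_h N r5 * x 4" unfolding x_def by (rule norm2_simps(4))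
    also have "\<dots> \<le> R * k * H * (x 4 + y 4)"
      using x0[of 4] y0[of 4] by (intro mult_mono r5[folded H_def] RkH) auto
    also have "\<dots> = R * k * h\<^sup>2 * (x 4 + y 4)" by (simp only: H_def)
    finally show "\<bar>inner_h N r5 (e 4)\<bar> \<le> R * k * h\<^sup>2 * (x 4 + y 4)" .
  qed (use m5 in \<open>auto simp: r5_def\<close>)
  define \<phi> where "\<phi> = (norm2_h N f5)\<^sup>2"
  have \<phi>: "\<phi> \<le> \<Lambda>2 * k\<^sup>2 * (E\<^sup>2 + G'\<^sup>2 + H\<^sup>2)"
  proof -
    have "norm2_h N (k *\<^sub>R m5) \<le> k * (3 * (LL * (E + G')))"
      using mult_left_mono[OF m5', of k] k0 by (simp add: norm2_simps(2))
    then have "norm2_h N (k *\<^sub>R m5 + r5) \<le> k * (3 * (LL * (E + G'))) + R * k * h\<^sup>2"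
      by (rule ea[OF _ r5])
    then have "norm2_h N f5 \<le> k * (3 * LL * E + 3 * LL * G' + R * H)"
      by (simp add: r5_def H_def algebra_simps)
    then have "\<phi> \<le> (k * (3 * LL * E + 3 * LL * G' + R * H))\<^sup>2"
      unfolding \<phi>_def by (intro power_mono) auto
    also have "\<dots> = k\<^sup>2 * (3 * LL * E + 3 * LL * G' + R * H)\<^sup>2" by (simp add: power_mult_distrib)
    also have "\<dots> \<le> k\<^sup>2 * (\<Lambda>2 * (E\<^sup>2 + G'\<^sup>2 + H\<^sup>2))"
    proof (rule mult_left_mono)
      have sq3: "(a + b + d)\<^sup>2 \<le> 3 * (a\<^sup>2 + b\<^sup>2 + d\<^sup>2)" for a b d :: real
      proof -
        have "0 \<le> (a - b)\<^sup>2 + (b - d)\<^sup>2 + (a - d)\<^sup>2" by simp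
        then show ?thesis by (simp add: power2_eq_square algebra_simps)
      qed
      have "(3 * LL * E + 3 * LL * G' + R * H)\<^sup>2 \<le> 3 * (9 * LL\<^sup>2 * E\<^sup>2 + 9 * LL\<^sup>2 * G'\<^sup>2 + R\<^sup>2 * H\<^sup>2)"
        using sq3[of "3 * LL * E" "3 * LL * G'" "R * H"] by (simp add: power_mult_distrib)
      moreover have "0 \<le> LL\<^sup>2 * H\<^sup>2" "0 \<le> R\<^sup>2 * E\<^sup>2" "0 \<le> R\<^sup>2 * G'\<^sup>2" by simp_all
      ultimately show "(3 * LL * E + 3 * LL * G' + R * H)\<^sup>2 \<le> \<Lambda>2 * (E\<^sup>2 + G'\<^sup>2 + H\<^sup>2)"
        unfolding \<Lambda>2 distrib_left distrib_right by linarith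
    qed simp
    finally show ?thesis by (simp add: mult_ac)
  qed
  have e5: "e5 = e 4 + f5" by (simp add: f5_def)
  define D where "D = (norm2_h N (e 2 - e 1))\<^sup>2 + (norm2_h N (e 3 - e 1))\<^sup>2 + (norm2_h N (e 4 - e 1))\<^sup>2"
  have x_dev: "(x j)\<^sup>2 \<le> 2 * (x 1)\<^sup>2 + 2 * (norm2_h N (e j - e 1))\<^sup>2" for j
  proof -
    have "x j \<le> x 1 + norm2_h N (e j - e 1)" using norm2_simps(1)[of "e 1" "e j - e 1"] by (simp add: x_def)
    then have "(x j)\<^sup>2 \<le> (x 1 + norm2_h N (e j - e 1))\<^sup>2" using x0 by (intro power_mono) auto
    also have "\<dots> \<le> 2 * (x 1)\<^sup>2 + 2 * (norm2_h N (e j - e 1))\<^sup>2"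
      using sum_squares_bound[of "x 1" "norm2_h N (e j - e 1)"] by (simp add: power2_sum)
    finally show ?thesis .
  qed
  \<comment> \<open>One unit from stage 1 itself and two from each of the other three stages give
    the 7.\<close>
  have E_le: "E\<^sup>2 \<le> 7 * (x 1)\<^sup>2 + 2 * D"
    using x_dev[of 2] x_dev[of 3] x_dev[of 4] by (simp add: E2 D_def)
  have "inner_h N (e 4) (e 4) + c0 * ((\<Sum>u\<in>#{#e 2, e 3, e 4#}. inner_h N (X u) u)
        + (\<Sum>u\<in>#{#e 2, e 3, e 4#}. inner_h N (u - e 1) (u - e 1))) \<le> inner_h N (e 1) (e 1) + C * Pt"
    by (rule en) (use p2 p3 p4 in auto)
  then have energy: "(x 4)\<^sup>2 + c0 * (k * \<beta> * G'\<^sup>2 + D) \<le> (x 1)\<^sup>2 + C * Pt"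
    by (simp add: x_def norm2_h_square D_def X_form e_neumann G2' y_def algebra_simps)
  have F: "Pt \<le> k * (2 * \<eta> * (G'\<^sup>2 + (y 1)\<^sup>2) + \<Lambda>1 * (E\<^sup>2 + H\<^sup>2))"
    unfolding Pt_def \<Lambda>1 G2[symmetric] using \<eta>0 k0 LL0 by (intro perturbation_young) auto
  have x5: "(norm2_h N e5)\<^sup>2 \<le> (x 4)\<^sup>2 + 2 * Pt + \<phi>"
  proof -
    have "(norm2_h N e5)\<^sup>2 = (x 4)\<^sup>2 + 2 * inner_h N (e 4) f5 + \<phi>"
      by (simp add: e5 x_def \<phi>_def norm2_h_square ip_expand ip_commute[of f5 "e 4"])
    then show ?thesis using p5 by (simp add: abs_le_iff)
  qed
  have y5: "k * (gn e5)\<^sup>2 \<le> 2 * k * G'\<^sup>2 + P * \<Lambda>2 * k * (E\<^sup>2 + G'\<^sup>2 + H\<^sup>2)"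
  proof -
    \<comment> \<open>The inverse inequality loses \<open>N^2\<close>, which the factor
      \<open>k^2\<close> in the bound for \<open>\<phi>\<close> compensates.\<close>
    have kN: "(k * real N)\<^sup>2 \<le> C2\<^sup>2"
      using kC2 N k0 by (intro power_mono) (auto simp: field_simps)
    have "(gn e5)\<^sup>2 \<le> 2 * (gn (e 4))\<^sup>2 + 2 * (gn f5)\<^sup>2"
      unfolding e5 by (intro gn_add_le e_neumann f5_neumann) simp
    also have "\<dots> \<le> 2 * (y 4)\<^sup>2 + 2 * (4 * real CARD('d) * (real N)\<^sup>2 * \<phi>)"
      unfolding y_def \<phi>_def by (rule add_left_mono, rule mult_left_mono[OF inverse_inequality[OF f5_neumann]]) simp
    also have "\<dots> \<le> 2 * G'\<^sup>2 + 2 * (4 * real CARD('d) * (real N)\<^sup>2 * (\<Lambda>2 * k\<^sup>2 * (E\<^sup>2 + G'\<^sup>2 + H\<^sup>2)))"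
      by (intro add_mono mult_left_mono[OF \<phi>] mult_left_mono) (auto simp: G2')
    also have "\<dots> = 2 * G'\<^sup>2 + (8 * real CARD('d) * \<Lambda>2 * (E\<^sup>2 + G'\<^sup>2 + H\<^sup>2)) * (k * real N)\<^sup>2"
      by (simp add: power_mult_distrib mult_ac)
    also have "\<dots> \<le> 2 * G'\<^sup>2 + (8 * real CARD('d) * \<Lambda>2 * (E\<^sup>2 + G'\<^sup>2 + H\<^sup>2)) * C2\<^sup>2"
      by (intro add_left_mono mult_left_mono kN) (simp add: \<Lambda>2)
    also have "\<dots> = 2 * G'\<^sup>2 + P * \<Lambda>2 * (E\<^sup>2 + G'\<^sup>2 + H\<^sup>2)" by (simp add: P mult_ac)
    finally have "k * (gn e5)\<^sup>2 \<le> k * (2 * G'\<^sup>2 + P * \<Lambda>2 * (E\<^sup>2 + G'\<^sup>2 + H\<^sup>2))"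
      using k0 by (intro mult_left_mono) auto
    then show ?thesis by (simp add: distrib_left mult_ac)
  qed
  have nn: "D \<ge> 0" "G'\<^sup>2 \<ge> 0" "H\<^sup>2 \<ge> 0" "E\<^sup>2 \<ge> 0" "(y 1)\<^sup>2 \<ge> 0" "\<Lambda>1 \<ge> 0" "\<Lambda>2 \<ge> 0" "P \<ge> 0"
    using LL0 \<eta>0 by (simp_all add: D_def \<Lambda>1 \<Lambda>2 P)
  have "(norm2_h N e5)\<^sup>2 + \<theta> * (k * (gn e5)\<^sup>2)
    \<le> (1 + 7 * ((C + 2) * \<Lambda>1 + \<Lambda>2 + \<theta> * P * \<Lambda>2) * k) * (x 1)\<^sup>2 + \<theta> * k * (y 1)\<^sup>2
      + ((C + 2) * \<Lambda>1 + \<Lambda>2 + \<theta> * P * \<Lambda>2) * k * H\<^sup>2"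
    by (rule lyapunov_step[OF nn(1,2) C less_imp_le[OF k0] nn(3,4,5,6,7,8) less_imp_le[OF \<theta>0] E_le energy F x5 \<phi> y5
          k1 \<theta> \<eta> less_imp_le[OF \<eta>0] k2 k3[unfolded \<Lambda>3]])
  then show ?thesis by (simp add: \<Lambda>3 x_def y_def H_def flip: power_mult)
qed

end

section \<open>Choice of constants and one-step stability\<close>

lemma le_divide_Suc: "x \<le> a / (m + 1) \<Longrightarrow> 0 \<le> m \<Longrightarrow> m * x + x \<le> (a :: real)"
  by (simp add: pos_le_divide_eq algebra_simps)

definition lyapunov :: "real \<Rightarrow> nat \<Rightarrow> real \<Rightarrow> ('d::finite) gridfun \<Rightarrow> real" where
  "lyapunov \<theta> N k u = (norm2_h N u)\<^sup>2 + \<theta> * (k * (grad_norm2_h N (grad_h N u))\<^sup>2)"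

text \<open>The gradient bound is carried along with the functional because it reproduces itself
  from one step to the next. The hypothesis with \<open>K\<close> is not reproduced here but
  restored by the Gronwall argument over the whole time interval.\<close>

definition one_step_stable ::
  "imex_coeffs \<Rightarrow> real \<Rightarrow> real \<Rightarrow> (real^'d::finite \<Rightarrow> real^3) \<Rightarrow> real \<Rightarrow> real \<Rightarrow> real \<Rightarrow> real \<Rightarrow> real \<Rightarrow>
   real \<Rightarrow> real \<Rightarrow> real \<Rightarrow> real \<Rightarrow> bool" where
  "one_step_stable c \<alpha> \<beta> f C1 C2 B R F \<theta> \<Lambda> K \<delta> \<longleftrightarrow> (\<forall>N k Y w v.
    N \<ge> 1 \<longrightarrow> 1 / real N < \<delta> \<longrightarrow> k < \<delta> \<longrightarrow> C1 * (1 / real N) \<le> k \<longrightarrow> k \<le> C2 * (1 / real N) \<longrightarrow>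
    (\<forall>I\<in>grid N. norm (f (grid_point N I)) \<le> F) \<longrightarrow>
    comparison c \<alpha> \<beta> f N k B R Y \<longrightarrow> imex_stages c \<alpha> \<beta> f N k (w 1) w \<longrightarrow> discrete_neumann N v \<longrightarrow>
    (\<forall>I\<in>grid N. v I = w 1 I
      + (\<Sum>j=1..4. (wt c j * k) *\<^sub>R N_h \<alpha> \<beta> f N (w j) I + (wt c j * k) *\<^sub>R L_h \<beta> N (w j) I)) \<longrightarrow>
    lyapunov \<theta> N k (Y 1 - w 1) \<le> K * (1 / real N) ^ 4 \<longrightarrow>
    (\<forall>i. \<forall>I\<in>midpoints N i. norm (grad_h N (Y 1 - w 1) i I) \<le> 1) \<longrightarrow>
    lyapunov \<theta> N k (Y 5 - v) \<le> (1 + \<Lambda> * k) * lyapunov \<theta> N k (Y 1 - w 1) + \<Lambda> * k * (1 / real N) ^ 4 \<and>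
    (\<forall>i. \<forall>I\<in>midpoints N i. norm (grad_h N (Y 5 - v) i I) \<le> 1))"

text \<open>The order of the quantifiers matters: \<open>\<theta>\<close> and \<open>\<Lambda>\<close> do not depend on the size \<open>K\<close> of the error.\<close>

lemma one_step_stability:
  fixes f :: "real^'d::finite \<Rightarrow> real^3"
  assumes dim: "CARD('d) \<le> 3" and coeffs: "scheme_coeffs c"
    and pos: "\<alpha> > 0" "\<beta> > 0" "C1 > 0" "C2 > 0" "B \<ge> 0" "R \<ge> 0" "F \<ge> 0"
  shows "\<exists>\<theta>>0. \<exists>\<Lambda>\<ge>0. \<forall>K\<ge>0. \<exists>\<delta>>0. one_step_stable c \<alpha> \<beta> f C1 C2 B R F \<theta> \<Lambda> K \<delta>"
proof -
  have est: "\<exists>c0>0. \<exists>C\<ge>0. \<forall>(ip :: 'd gridfun \<Rightarrow> 'd gridfun \<Rightarrow> real) X S e1 e2 e3 e4 f2 f3 f4 F.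
    dissipative ip X S \<longrightarrow> e2 \<in> S \<longrightarrow> e3 \<in> S \<longrightarrow> e4 \<in> S \<longrightarrow>
    e2 + c_a21 c *\<^sub>R X e2 = e1 + f2 \<longrightarrow>
    e3 + c_s32 c *\<^sub>R X e2 + c_s33 c *\<^sub>R X e3 = e1 + f3 \<longrightarrow>
    e4 + c_b2 c *\<^sub>R X e2 + c_b3 c *\<^sub>R X e3 + c_b4 c *\<^sub>R X e4 = e1 + f4 \<longrightarrow>
    (\<forall>e\<in>{e2, e3, e4}. \<forall>f\<in>{f2, f3, f4}. \<bar>ip e f\<bar> \<le> F) \<longrightarrow>
    ip e4 e4 + c0 * ((\<Sum>e\<in>#{#e2, e3, e4#}. ip (X e) e) + (\<Sum>e\<in>#{#e2, e3, e4#}. ip (e - e1) (e - e1)))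
      \<le> ip e1 e1 + C * F" (is "\<exists>c0>0. \<exists>C\<ge>0. ?Q c0 C")
    by (rule stage_energy_estimate[OF stage_energy_coeffs[OF coeffs]])
  then obtain c0 C where c0: "c0 > 0" and C: "C \<ge> 0" and Q: "?Q c0 C" by (elim exE conjE)
  note energy = Q[rule_format]
  let ?d = "real CARD('d)"
  define M where "M = \<beta> * (?d * (B + 1)\<^sup>2 + 2 * (B + 1)\<^sup>2) + 2 * \<alpha> * (B + 1) * F"
  define L where "L = M * (1 + ?d)"
  have M0: "M \<ge> 0" using pos by (simp add: M_def)
  have L0: "L \<ge> 0" using M0 by (simp add: L_def)
  define \<Lambda>2 where "\<Lambda>2 = 27 * L\<^sup>2 + 3 * R\<^sup>2"
  define P where "P = 8 * ?d * C2\<^sup>2"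
  have \<Lambda>20: "\<Lambda>2 \<ge> 0" and P0: "P \<ge> 0" by (simp_all add: \<Lambda>2_def P_def)
  define \<theta> where "\<theta> = c0 * \<beta> / 4 / (2 + P * \<Lambda>2)"
  have den: "2 + P * \<Lambda>2 > 0" using \<Lambda>20 P0 by (simp add: add_pos_nonneg)
  have \<theta>0: "\<theta> > 0" using c0 pos den by (simp add: \<theta>_def)
  \<comment> \<open>\<open>\<theta>\<close> is fixed first, as the largest value that spends a
    quarter of the dissipation; the Young parameter then has to fit both another quarter and
    \<open>\<theta>\<close>.\<close>
  define \<eta>e where "\<eta>e = min (c0 * \<beta> / 4) \<theta> / (2 * (C + 2))"
  have \<eta>e0: "\<eta>e > 0" using c0 pos \<theta>0 C by (simp add: \<eta>e_def)
  have \<eta>e: "2 * (C + 2) * \<eta>e \<le> c0 * \<beta> / 4" "2 * (C + 2) * \<eta>e \<le> \<theta>"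
    using C by (simp_all add: \<eta>e_def)
  define \<Lambda>1 where "\<Lambda>1 = 3 * L + 9 * L\<^sup>2 / (4 * \<eta>e) + R\<^sup>2 / (4 * \<eta>e) + 1 + R\<^sup>2 / 4"
  have \<Lambda>10: "\<Lambda>1 \<ge> 0" using L0 \<eta>e0 by (simp add: \<Lambda>1_def)
  define \<Lambda>3 where "\<Lambda>3 = (C + 2) * \<Lambda>1 + \<Lambda>2 + \<theta> * P * \<Lambda>2"
  have \<Lambda>30: "\<Lambda>3 \<ge> 0" using C \<Lambda>10 \<Lambda>20 P0 \<theta>0 by (simp add: \<Lambda>3_def)
  show ?thesis
  proof (rule exI[of _ \<theta>], intro conjI, rule \<theta>0, rule exI[of _ "7 * \<Lambda>3"], intro conjI allI impI)
    show "0 \<le> 7 * \<Lambda>3" using \<Lambda>30 by simp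
    fix K :: real assume K: "K \<ge> 0"
    define g s b where "g = c_a21 c" and "s = c_s33 c" and "b = c_b4 c"
    have gsb: "g > 0" "s > 0" "b > 0" using stage_energy_coeffs(1-3)[OF coeffs] by (simp_all add: g_def s_def b_def)
    \<comment> \<open>Converts a functional of at most \<open>K h^4\<close> into bounds of order
      \<open>h^2\<close>: \<open>sqrt K\<close> for the error and
      \<open>sqrt K / sqrt \<theta>\<close> for its gradient weighted with
      \<open>sqrt k\<close>.\<close>
    define A1 where "A1 = sqrt K * (1 + 1 / sqrt \<theta>)"
    define \<rho>0 where "\<rho>0 = R * (1 + 2 * ?d) * C2"
    define Z2 where "Z2 = A1 + 2 * L * A1 + \<rho>0"
    define A2 where "A2 = Z2 * (1 + 1 / sqrt (g * \<beta>))"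
    define Z3 where "Z3 = A1 + 2 * L * A1 + 2 * L * A2 + \<rho>0 + Z2 / g"
    define A3 where "A3 = Z3 * (1 + 1 / sqrt (s * \<beta>))"
    define Z4 where "Z4 = A1 + 2 * L * A2 + 2 * L * A3 + \<rho>0 + Z2 / g + Z3 / s"
    define T where "T Z \<gamma> = Z\<^sup>2 + 2 * Z\<^sup>2 / (\<gamma> * \<beta> * C1 * sqrt (\<gamma> * \<beta> * C1))" for Z \<gamma> :: real
    have T0: "T Z \<gamma> \<ge> 0" if "\<gamma> > 0" for Z \<gamma> using that pos by (simp add: T_def)
    define KB where "KB = T Z2 g + T Z3 s + T Z4 b"
    have KB0: "KB \<ge> 0" using T0 gsb by (simp add: KB_def)
    \<comment> \<open>Solves \<open>\<eta> (1 + 6 C2 M (1 + d)) = 1/2\<close>, so that stages and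
      explicit terms use half of the permitted end gradient; the term with \<open>R h^2\<close> gets
      the other half.\<close>
    define \<eta> where "\<eta> = 1 / (2 * (1 + 6 * C2 * (M * (1 + ?d))))"
    have q0: "6 * C2 * (M * (1 + ?d)) \<ge> 0" using pos M0 by simp
    have \<eta>0: "0 < \<eta>" "\<eta> \<le> 1" using q0 by (simp_all add: \<eta>_def field_simps add_nonneg_pos)
    have \<eta>q: "\<eta> * (1 + 6 * C2 * (M * (1 + ?d))) = 1 / 2" using q0 by (simp add: \<eta>_def)
    \<comment> \<open>In this order the entries ensure \<open>h, k \<le> 1\<close>,
      \<open>A1^2 h \<le> 1\<close>, \<open>KB sqrt h \<le> \<eta>^2\<close>,
      \<open>2 C2 R h^2 \<le> 1/2\<close>, and the two conditions on \<open>k\<close> in the energy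
      step. Adding 1 keeps the denominators positive.\<close>
    define \<delta> where "\<delta> = Min {1, 1 / (A1\<^sup>2 + 1), (\<eta>\<^sup>2 / (KB + 1))\<^sup>2, 1 / (4 * C2 * R + 1),
      c0 * \<beta> / 4 / (\<Lambda>2 + 1), c0 / (2 * \<Lambda>3 + 1)}"
    have \<delta>_le: "\<delta> \<le> 1" "\<delta> \<le> 1 / (A1\<^sup>2 + 1)" "\<delta> \<le> (\<eta>\<^sup>2 / (KB + 1))\<^sup>2" "\<delta> \<le> 1 / (4 * C2 * R + 1)"
      "\<delta> \<le> c0 * \<beta> / 4 / (\<Lambda>2 + 1)" "\<delta> \<le> c0 / (2 * \<Lambda>3 + 1)"
      unfolding \<delta>_def by (intro Min_le; simp)+
    have \<delta>0: "\<delta> > 0"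
    proof -
      have "A1\<^sup>2 + 1 > 0" "KB + 1 > 0" "4 * C2 * R + 1 > 0" "\<Lambda>2 + 1 > 0" "2 * \<Lambda>3 + 1 > 0"
        using KB0 pos \<Lambda>20 \<Lambda>30 by (simp_all add: add_nonneg_pos)
      then show ?thesis unfolding \<delta>_def using \<eta>0 c0 pos by simp
    qed
    show "\<exists>\<delta>>0. one_step_stable c \<alpha> \<beta> f C1 C2 B R F \<theta> (7 * \<Lambda>3) K \<delta>"
      unfolding one_step_stable_def
    proof (rule exI[of _ \<delta>], intro conjI \<delta>0, (intro allI impI)+)
      fix N k and Y w :: "nat \<Rightarrow> 'd gridfun" and v :: "'d gridfun"
      assume N: "N \<ge> 1" and hd: "1 / real N < \<delta>" and kd: "k < \<delta>" and kC1: "C1 * (1 / real N) \<le> k"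
        and kC2: "k \<le> C2 * (1 / real N)" and fF: "\<forall>I\<in>grid N. norm (f (grid_point N I)) \<le> F"
        and Y: "comparison c \<alpha> \<beta> f N k B R Y" and w: "imex_stages c \<alpha> \<beta> f N k (w 1) w"
        and v: "discrete_neumann N v"
        and v_eq: "\<forall>I\<in>grid N. v I = w 1 I
          + (\<Sum>j=1..4. (wt c j * k) *\<^sub>R N_h \<alpha> \<beta> f N (w j) I + (wt c j * k) *\<^sub>R L_h \<beta> N (w j) I)"
        and S1: "lyapunov \<theta> N k (Y 1 - w 1) \<le> K * (1 / real N) ^ 4"
        and g1: "\<forall>i. \<forall>I\<in>midpoints N i. norm (grad_h N (Y 1 - w 1) i I) \<le> 1"
      interpret I: imex_error_step c \<alpha> \<beta> f N k B R F C1 C2 Y w v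
        by unfold_locales (use dim coeffs pos N kd \<delta>_le(1) kC1 kC2 fF Y w v v_eq in auto)
      have MM: "I.MM = M" by (simp add: I.MM_def M_def)
      have LL: "I.LL = L" by (simp add: I.LL_def L_def MM)
      define h where "h = 1 / real N"
      have h: "h > 0" "h \<le> 1" and hd: "h < \<delta>" using N hd by (simp_all add: h_def)
      have k0: "k > 0" by (rule I.k0)
      let ?x1 = "norm2_h N (I.e 1)" and ?y1 = "grad_norm2_h N (grad_h N (I.e 1))"
      have ly: "?x1\<^sup>2 + \<theta> * (k * ?y1\<^sup>2) \<le> K * h ^ 4"
        using S1 by (simp add: lyapunov_def I.e_def h_def)
      have x1: "?x1 \<le> sqrt K * h\<^sup>2"
      proof (rule power2_le_imp_le)
        have "0 \<le> \<theta> * (k * ?y1\<^sup>2)" using \<theta>0 k0 by simp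
        then show "?x1\<^sup>2 \<le> (sqrt K * h\<^sup>2)\<^sup>2" using ly K by (simp add: power_mult_distrib flip: power_mult)
      qed (use K in simp)
      have y1: "sqrt k * ?y1 \<le> sqrt K / sqrt \<theta> * h\<^sup>2"
      proof (rule power2_le_imp_le)
        have "\<theta> * (k * ?y1\<^sup>2) \<le> K * h ^ 4" using ly zero_le_power2[of ?x1] by linarith
        then have "k * ?y1\<^sup>2 \<le> K / \<theta> * h ^ 4" using \<theta>0 by (simp add: field_simps)
        then show "(sqrt k * ?y1)\<^sup>2 \<le> (sqrt K / sqrt \<theta> * h\<^sup>2)\<^sup>2"
          using K k0 \<theta>0 by (simp add: power_mult_distrib power_divide flip: power_mult)
      qed (use K \<theta>0 in simp)
      have A1: "?x1 \<le> A1 * h\<^sup>2" "sqrt k * ?y1 \<le> A1 * h\<^sup>2"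
      proof -
        have "0 \<le> sqrt K * h\<^sup>2" "0 \<le> sqrt K / sqrt \<theta> * h\<^sup>2" using K \<theta>0 by simp_all
        moreover have "A1 * h\<^sup>2 = sqrt K * h\<^sup>2 + sqrt K / sqrt \<theta> * h\<^sup>2" by (simp add: A1_def algebra_simps)
        ultimately show "?x1 \<le> A1 * h\<^sup>2" "sqrt k * ?y1 \<le> A1 * h\<^sup>2" using x1 y1 by linarith+
      qed
      have A10: "A1 \<ge> 0" using K \<theta>0 by (simp add: A1_def)
      have A1h: "A1\<^sup>2 * h \<le> 1"
      proof -
        have "h \<le> 1 / (A1\<^sup>2 + 1)" using hd \<delta>_le(2) by linarith
        then have "A1\<^sup>2 * h + h \<le> 1" by (rule le_divide_Suc) simp
        then show ?thesis using h by linarith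
      qed
      have sh: "KB * sqrt h \<le> \<eta>\<^sup>2"
      proof -
        have "sqrt h \<le> sqrt ((\<eta>\<^sup>2 / (KB + 1))\<^sup>2)" using hd \<delta>_le(3) by (intro real_sqrt_le_mono) linarith
        then have "sqrt h \<le> \<eta>\<^sup>2 / (KB + 1)" using KB0 by simp
        then have "KB * sqrt h + sqrt h \<le> \<eta>\<^sup>2" using KB0 by (rule le_divide_Suc)
        moreover have "sqrt h \<ge> 0" using h by simp
        ultimately show ?thesis by linarith
      qed
      have Th: "T Z2 g * sqrt h \<le> \<eta>\<^sup>2" "T Z3 s * sqrt h \<le> \<eta>\<^sup>2" "T Z4 b * sqrt h \<le> \<eta>\<^sup>2"
      proof -
        have "0 \<le> T Z2 g * sqrt h" "0 \<le> T Z3 s * sqrt h" "0 \<le> T Z4 b * sqrt h" using T0 gsb h by simp_all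
        then show "T Z2 g * sqrt h \<le> \<eta>\<^sup>2" "T Z3 s * sqrt h \<le> \<eta>\<^sup>2" "T Z4 b * sqrt h \<le> \<eta>\<^sup>2"
          using sh unfolding KB_def distrib_right by linarith+
      qed
      have g1': "norm (grad_h N (I.e 1) i I) \<le> 1" if "I \<in> midpoints N i" for i I
        using g1 that by (simp add: I.e_def)
      have small1: "norm (I.e 1 J) \<le> 1" if "J \<in> grid N" for J
        by (rule I.all_stages_small(1)[of A1 \<rho>0 Z2 A2 Z3 A3 Z4 \<eta>, unfolded LL, folded g_def s_def b_def,
            folded T_def h_def, OF A1 A10 A1h _ \<rho>0_def Z2_def A2_def Z3_def A3_def Z4_def less_imp_le[OF \<eta>0(1)] \<eta>0(2) Th that]) (rule g1')
      have small2: "norm (I.e j J) \<le> \<eta>" if "j \<in> {2..4}" "J \<in> grid N" for j J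
        by (rule I.all_stages_small(2)[of A1 \<rho>0 Z2 A2 Z3 A3 Z4 \<eta>, unfolded LL, folded g_def s_def b_def,
            folded T_def h_def, OF A1 A10 A1h _ \<rho>0_def Z2_def A2_def Z3_def A3_def Z4_def less_imp_le[OF \<eta>0(1)] \<eta>0(2) Th that]) (rule g1')
      have small3: "norm (grad_h N (I.e j) i J) \<le> \<eta>" if "j \<in> {2..4}" "J \<in> midpoints N i" for j i J
        by (rule I.all_stages_small(3)[of A1 \<rho>0 Z2 A2 Z3 A3 Z4 \<eta>, unfolded LL, folded g_def s_def b_def,
            folded T_def h_def, OF A1 A10 A1h _ \<rho>0_def Z2_def A2_def Z3_def A3_def Z4_def less_imp_le[OF \<eta>0(1)] \<eta>0(2) Th that]) (rule g1')
      have split: "j = 1 \<or> j \<in> {2..4}" if "j \<in> {1..4}" for j :: nat using that by auto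
      have sup: "norm (I.e j I) \<le> 1" if "j \<in> {1..4}" "I \<in> grid N" for j I
        using split[OF that(1)] small1[OF that(2)] order_trans[OF small2[OF _ that(2)] \<eta>0(2)] by auto
      have gsup: "norm (grad_h N (I.e j) i I) \<le> 1" if "j \<in> {1..4}" "I \<in> midpoints N i" for j i I
        using split[OF that(1)] g1'[OF that(2)] order_trans[OF small3[OF _ that(2)] \<eta>0(2)] by auto
      have en: "inner_h N (I.e 4) (I.e 4) + c0 * ((\<Sum>u\<in>#{#I.e 2, I.e 3, I.e 4#}. inner_h N (I.X u) u)
        + (\<Sum>u\<in>#{#I.e 2, I.e 3, I.e 4#}. inner_h N (u - I.e 1) (u - I.e 1))) \<le> inner_h N (I.e 1) (I.e 1) + C * F'"
        if "\<forall>u\<in>{I.e 2, I.e 3, I.e 4}. \<forall>g\<in>{I.f2, I.f3, I.f4}. \<bar>inner_h N u g\<bar> \<le> F'" for F'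
        by (rule energy[where ?f2.0 = I.f2 and ?f3.0 = I.f3 and ?f4.0 = I.f4, OF I.dissipative_axioms I.e_S(2,3,4)],
            simp add: I.f2_def, simp add: I.f3_def, simp add: I.f4_def, rule that[rule_format], assumption+)
      have k2: "\<Lambda>2 * k \<le> c0 * \<beta> / 4"
      proof -
        have "k \<le> c0 * \<beta> / 4 / (\<Lambda>2 + 1)" using kd \<delta>_le(5) by linarith
        then have "\<Lambda>2 * k + k \<le> c0 * \<beta> / 4" using \<Lambda>20 by (rule le_divide_Suc)
        then show ?thesis using k0 by linarith
      qed
      have k3: "2 * k * \<Lambda>3 \<le> c0"
      proof -
        have "k \<le> c0 / (2 * \<Lambda>3 + 1)" using kd \<delta>_le(6) by linarith
        then have "2 * \<Lambda>3 * k + k \<le> c0" using \<Lambda>30 by (intro le_divide_Suc) auto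
        moreover have "2 * k * \<Lambda>3 = 2 * \<Lambda>3 * k" by simp
        ultimately show ?thesis using k0 by linarith
      qed
      have \<theta>': "\<theta> * (2 + P * \<Lambda>2) \<le> c0 * \<beta> / 4"
        by (rule eq_refl, rule nonzero_eq_divide_eq[THEN iffD1, OF _ \<theta>_def]) (use den in simp)
      note step = I.energy_step[of c0 C \<theta> \<eta>e, OF _ _ _ c0 C \<theta>0 \<eta>e0 \<Lambda>2_def[folded LL] P_def \<Lambda>1_def[folded LL] \<Lambda>3_def \<theta>' \<eta>e k2 k3, OF sup gsup en]
      have "lyapunov \<theta> N k (Y 5 - v) \<le> (1 + 7 * \<Lambda>3 * k) * lyapunov \<theta> N k (Y 1 - w 1) + 7 * \<Lambda>3 * k * (1 / real N) ^ 4"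
      proof -
        have Lk: "0 \<le> \<Lambda>3 * k" using \<Lambda>30 k0 by simp
        have "0 \<le> \<Lambda>3 * k * (\<theta> * k * ?y1\<^sup>2)" using Lk \<theta>0 k0 by simp
        moreover have "0 \<le> \<Lambda>3 * k * h ^ 4" using Lk h by simp
        ultimately have "(1 + 7 * \<Lambda>3 * k) * ?x1\<^sup>2 + \<theta> * k * ?y1\<^sup>2 + \<Lambda>3 * k * h ^ 4
          \<le> (1 + 7 * \<Lambda>3 * k) * (?x1\<^sup>2 + \<theta> * (k * ?y1\<^sup>2)) + 7 * \<Lambda>3 * k * h ^ 4"
          by (simp add: algebra_simps)
        then show ?thesis using step by (simp add: lyapunov_def I.e_def I.e5_def h_def)
      qed
      moreover have "norm (grad_h N (Y 5 - v) i I) \<le> 1" if "I \<in> midpoints N i" for i I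
      proof -
        have "norm (grad_h N I.e5 i I) \<le> \<eta> + 2 * C2 * (3 * (M * (1 + ?d) * \<eta>) + R * h\<^sup>2)"
          using I.final_gradient[OF less_imp_le[OF \<eta>0(1)] \<eta>0(2) small2 small3 that] by (simp add: MM h_def)
        also have "\<dots> = \<eta> * (1 + 6 * C2 * (M * (1 + ?d))) + 2 * C2 * R * h\<^sup>2" by (simp add: algebra_simps)
        also have "\<dots> \<le> 1 / 2 + 1 / 2"
        proof -
          have "h \<le> 1 / (4 * C2 * R + 1)" using hd \<delta>_le(4) by linarith
          then have "4 * C2 * R * h + h \<le> 1" using pos by (intro le_divide_Suc) auto
          then have "2 * C2 * R * h \<le> 1 / 2" using h by linarith
          moreover have "2 * C2 * R * h\<^sup>2 \<le> 2 * C2 * R * h"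
            using pos h by (intro mult_left_mono) (auto simp: power2_eq_square mult_left_le)
          ultimately show ?thesis using \<eta>q by linarith
        qed
        finally show ?thesis by (simp add: I.e5_def)
      qed
      ultimately show "lyapunov \<theta> N k (Y 5 - v) \<le> (1 + 7 * \<Lambda>3 * k) * lyapunov \<theta> N k (Y 1 - w 1) + 7 * \<Lambda>3 * k * (1 / real N) ^ 4 \<and>
        (\<forall>i. \<forall>I\<in>midpoints N i. norm (grad_h N (Y 5 - v) i I) \<le> 1)" by blast
    qed
  qed
qed


section \<open>Smooth functions on the closed cube\<close>

lemma Ck_on_cong: "Ck_on r S u \<Longrightarrow> (\<And>x. x \<in> S \<Longrightarrow> u x = v x) \<Longrightarrow> Ck_on r S v"
proof (cases r)
  case 0
  assume "Ck_on r S u" "\<And>x. x \<in> S \<Longrightarrow> u x = v x"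
  then show ?thesis using 0 continuous_on_cong[of S S u v] by simp
next
  case (Suc r')
  assume u: "Ck_on r S u" and eq: "\<And>x. x \<in> S \<Longrightarrow> u x = v x"
  then obtain u' where u': "\<forall>b\<in>Basis. Ck_on r' S (u' b)"
    "\<forall>x\<in>S. (u has_derivative (\<lambda>v. \<Sum>b\<in>Basis. (v \<bullet> b) *\<^sub>R u' b x)) (at x within S)"
    using Suc by auto
  have "\<forall>x\<in>S. (v has_derivative (\<lambda>v. \<Sum>b\<in>Basis. (v \<bullet> b) *\<^sub>R u' b x)) (at x within S)"
  proof
    fix x assume x: "x \<in> S"
    show "(v has_derivative (\<lambda>v. \<Sum>b\<in>Basis. (v \<bullet> b) *\<^sub>R u' b x)) (at x within S)"
      by (rule has_derivative_transform[OF x _ u'(2)[rule_format, OF x]]) (simp add: eq)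
  qed
  then show ?thesis using u'(1) Suc by auto
qed

lemma Ck_on_continuous: "Ck_on r S u \<Longrightarrow> continuous_on S u"
proof (cases r)
  case (Suc r')
  assume "Ck_on r S u"
  then obtain u' where "\<forall>x\<in>S. (u has_derivative (\<lambda>v. \<Sum>b\<in>Basis. (v \<bullet> b) *\<^sub>R u' b x)) (at x within S)"
    using Suc by auto
  then show ?thesis by (intro has_derivative_continuous_on) (erule (1) bspec)
qed simp

abbreviation cyl :: "real \<Rightarrow> ((real^'d::finite) \<times> real) set" where "cyl T \<equiv> Omega_bar \<times> {0..T}"

definition smooth :: "nat \<Rightarrow> real \<Rightarrow> (real^'d::finite \<Rightarrow> real \<Rightarrow> real^3) \<Rightarrow> bool" where
  "smooth r T U \<longleftrightarrow> Ck_on r (cyl T) (\<lambda>(x, t). U x t)"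

abbreviation sp :: "'d::finite \<Rightarrow> (real^'d \<Rightarrow> real \<Rightarrow> real^3) \<Rightarrow> real^'d \<Rightarrow> real \<Rightarrow> real^3" where
  "sp i U \<equiv> (\<lambda>x t. pd i (\<lambda>y. U y t) x)"

text \<open>One-sided at the boundary.\<close>

definition dir_deriv :: "'d::finite \<Rightarrow> (real^'d \<Rightarrow> real^3) \<Rightarrow> (real^'d \<Rightarrow> real^3) \<Rightarrow> bool" where
  "dir_deriv i u u1 \<longleftrightarrow> (\<forall>x\<in>Omega_bar. \<exists>L. (u has_derivative L) (at x within Omega_bar) \<and> L (axis i 1) = u1 x)"

lemma sum_Basis_vec_real:
  fixes F :: "real^'d::finite \<Rightarrow> 'b::real_vector"
  shows "(\<Sum>b\<in>Basis. F b) = (\<Sum>i\<in>UNIV. F (axis i 1))"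
proof -
  have B: "(Basis :: (real^'d) set) = (\<lambda>i. axis i 1) ` UNIV" by (auto simp: Basis_vec_def)
  have "inj (\<lambda>i :: 'd. axis i (1::real))" by (rule injI) (simp add: axis_eq_axis)
  from sum.reindex[OF this, of F] show ?thesis by (simp add: B)
qed

lemma One_cart [simp]: "(\<Sum>x\<in>Basis. (x :: real^'d::finite) $ i) = 1"
  by (simp add: sum_Basis_vec_real axis_def)

lemma Omega_bar_iff: "x \<in> Omega_bar \<longleftrightarrow> (\<forall>i. 0 \<le> x $ i \<and> x $ i \<le> 1)"
  by (simp add: mem_box_cart)

lemma Omega_iff: "x \<in> Omega \<longleftrightarrow> (\<forall>i. 0 < x $ i \<and> x $ i < 1)"
  by (simp add: mem_box_cart)

text \<open>The box has nonempty interior, so derivatives within it are unique at every point of the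
  closed cube, corners included.\<close>

lemma pd_eq:
  assumes "(u has_derivative L) (at x within Omega_bar)" "x \<in> Omega_bar"
  shows "pd i u x = L (axis i 1)"
proof -
  have "(u has_derivative frechet_derivative u (at x within Omega_bar)) (at x within Omega_bar)"
    using assms(1) frechet_derivative_works by (metis differentiable_def)
  then have "frechet_derivative u (at x within Omega_bar) = L"
    by (intro frechet_derivative_unique_within_closed_interval[OF _ assms(2) _ assms(1)]) simp_all
  then show ?thesis by (simp add: pd_def)
qed

text \<open>Restricting the joint derivative on the cylinder to slices of constant time or constant
  position identifies \<open>pd\<close> and \<open>dt\<close> with its components along basis
  vectors, which are smooth of one order less. Iteration then provides all mixed
  derivatives.\<close>

lemma smooth_derivatives:
  fixes U :: "real^'d::finite \<Rightarrow> real \<Rightarrow> real^3"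
  assumes T: "T > 0" and U: "smooth (Suc r) T U"
  shows "smooth r T (sp i U)" and "smooth r T (dt T U)"
    and "t \<in> {0..T} \<Longrightarrow> dir_deriv i (\<lambda>y. U y t) (\<lambda>y. sp i U y t)"
    and "x \<in> Omega_bar \<Longrightarrow> t \<in> {0..T} \<Longrightarrow> (U x has_vector_derivative dt T U x t) (at t within {0..T})"
proof -
  obtain u' where u': "\<And>b. b \<in> Basis \<Longrightarrow> Ck_on r (cyl T) (u' b)"
    and der: "\<And>z. z \<in> cyl T \<Longrightarrow> ((\<lambda>(x, t). U x t) has_derivative (\<lambda>v. \<Sum>b\<in>Basis. (v \<bullet> b) *\<^sub>R u' b z)) (at z within cyl T)"
    using U unfolding smooth_def by auto
  define D where "D z v = (\<Sum>b\<in>Basis. (v \<bullet> b) *\<^sub>R u' b z)" for z :: "(real^'d) \<times> real" and v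
  have Dz: "D z = (\<lambda>v. \<Sum>b\<in>Basis. (v \<bullet> b) *\<^sub>R u' b z)" for z by (simp add: D_def fun_eq_iff)
  have der': "((\<lambda>(x, t). U x t) has_derivative D (x, t)) (at (x, t) within A)"
    if "x \<in> Omega_bar" "t \<in> {0..T}" "A \<subseteq> cyl T" for x t A
    unfolding Dz by (rule has_derivative_subset[OF der that(3)]) (use that in simp)
  have spat: "((\<lambda>y. U y t) has_derivative (\<lambda>v. D (x, t) (v, 0))) (at x within Omega_bar)"
    if "x \<in> Omega_bar" "t \<in> {0..T}" for x t
  proof -
    have a: "((\<lambda>y. (y, t)) has_derivative (\<lambda>v. (v, 0))) (at x within Omega_bar)"
      by (auto intro!: derivative_eq_intros)
    have b: "((\<lambda>(x, t). U x t) has_derivative D (x, t)) (at (x, t) within (\<lambda>y. (y, t)) ` Omega_bar)"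
      by (rule der') (use that in auto)
    show ?thesis using has_derivative_in_compose[OF a b] by simp
  qed
  have temp: "(U x has_vector_derivative D (x, t) (0, 1)) (at t within {0..T})"
    if "x \<in> Omega_bar" "t \<in> {0..T}" for x t
  proof -
    have a: "((\<lambda>s. (x, s)) has_derivative (\<lambda>v. (0, v))) (at t within {0..T})"
      by (auto intro!: derivative_eq_intros)
    have b: "((\<lambda>(x, t). U x t) has_derivative D (x, t)) (at (x, t) within (\<lambda>s. (x, s)) ` {0..T})"
      by (rule der') (use that in auto)
    have "((\<lambda>s. U x s) has_derivative (\<lambda>v. D (x, t) (0, v))) (at t within {0..T})"
      using has_derivative_in_compose[OF a b] by simp
    moreover have "(\<lambda>v. D (x, t) (0, v)) = (\<lambda>v. v *\<^sub>R D (x, t) (0, 1))"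
    proof
      fix v :: real
      have "(0::real^'d, v) = v *\<^sub>R (0, 1)" by simp
      then show "D (x, t) (0, v) = v *\<^sub>R D (x, t) (0, 1)"
        unfolding D_def by (simp only: inner_scaleR_left scaleR_sum_right scaleR_scaleR)
    qed
    ultimately show ?thesis by (simp only: has_vector_derivative_def)
  qed
  have D1: "D z b = u' b z" if "b \<in> Basis" for z b
  proof -
    have "D z b = (\<Sum>b'\<in>Basis. (if b' = b then u' b' z else 0))"
      unfolding D_def by (rule sum.cong) (use that in \<open>auto simp: inner_Basis\<close>)
    then show ?thesis using that by simp
  qed
  have B1: "(axis i 1, 0) \<in> (Basis :: ((real^'d) \<times> real) set)" for i by (simp add: Basis_prod_def)
  have B2: "(0, 1) \<in> (Basis :: ((real^'d) \<times> real) set)" by (simp add: Basis_prod_def)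
  have pdD: "sp i U x t = u' (axis i 1, 0) (x, t)" if "x \<in> Omega_bar" "t \<in> {0..T}" for x t i
    using pd_eq[OF spat[OF that] that(1)] D1[OF B1] by simp
  have dtD: "dt T U x t = u' (0, 1) (x, t)" if "x \<in> Omega_bar" "t \<in> {0..T}" for x t
    unfolding dt_def using vector_derivative_within_closed_interval[OF T that(2) temp[OF that]] D1[OF B2] by simp
  show "smooth r T (sp i U)"
    unfolding smooth_def by (rule Ck_on_cong[OF u'[OF B1[of i]]]) (auto simp: pdD)
  show "smooth r T (dt T U)"
    unfolding smooth_def by (rule Ck_on_cong[OF u'[OF B2]]) (auto simp: dtD)
  show "dir_deriv i (\<lambda>y. U y t) (\<lambda>y. sp i U y t)" if "t \<in> {0..T}"
    unfolding dir_deriv_def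
  proof
    fix x :: "real^'d" assume x: "x \<in> Omega_bar"
    show "\<exists>L. ((\<lambda>y. U y t) has_derivative L) (at x within Omega_bar) \<and> L (axis i 1) = sp i U x t"
      using spat[OF x that] pd_eq[OF spat[OF x that] x] by auto
  qed
  show "(U x has_vector_derivative dt T U x t) (at t within {0..T})" if "x \<in> Omega_bar" "t \<in> {0..T}"
    using temp[OF that] dtD[OF that] D1[OF B2] by simp
qed

lemma smooth_bounded:
  fixes U :: "real^'d::finite \<Rightarrow> real \<Rightarrow> real^3"
  assumes "smooth r T U"
  shows "\<exists>B\<ge>0. \<forall>x\<in>Omega_bar. \<forall>t\<in>{0..T}. norm (U x t) \<le> B"
proof -
  have "compact (cyl T :: ((real^'d) \<times> real) set)" by (intro compact_Times compact_cbox compact_Icc)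
  moreover have "continuous_on (cyl T) (\<lambda>(x, t). U x t)" using assms Ck_on_continuous by (auto simp: smooth_def)
  ultimately have "bounded ((\<lambda>(x, t). U x t) ` cyl T)" by (metis compact_continuous_image compact_imp_bounded)
  then obtain B where "\<forall>z\<in>(\<lambda>(x, t). U x t) ` cyl T. norm z \<le> B" by (auto simp: bounded_iff)
  then have "norm (U x t) \<le> B" if "x \<in> Omega_bar" "t \<in> {0..T}" for x t
    using that imageI[of "(x, t)" "cyl T" "\<lambda>(x, t). U x t"] by simp
  then show ?thesis by (intro exI[of _ "max 0 B"]) (simp add: le_max_iff_disj)
qed

lemma smooth_bounded_family:
  fixes U :: "'i::finite \<Rightarrow> real^'d::finite \<Rightarrow> real \<Rightarrow> real^3"
  assumes "\<And>i. smooth r T (U i)"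
  shows "\<exists>B\<ge>0. \<forall>i. \<forall>x\<in>Omega_bar. \<forall>t\<in>{0..T}. norm (U i x t) \<le> B"
proof -
  obtain B where B: "\<And>i. B i \<ge> 0 \<and> (\<forall>x\<in>Omega_bar. \<forall>t\<in>{0..T}. norm (U i x t) \<le> B i)"
    using smooth_bounded[OF assms] by metis
  have le: "B i \<le> sum B UNIV" for i using B by (intro member_le_sum) auto
  have "norm (U i x t) \<le> sum B UNIV" if "x \<in> Omega_bar" "t \<in> {0..T}" for i x t
    using B[of i] that le[of i] by (meson order_trans)
  then show ?thesis using B by (intro exI[of _ "sum B UNIV"]) (auto simp: sum_nonneg)
qed

section \<open>Taylor remainders within convex sets\<close>

lemma taylor1:
  fixes G :: "real \<Rightarrow> 'b::real_normed_vector"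
  assumes S: "convex S" "s \<in> S" "t \<in> S"
    and 1: "\<And>\<tau>. \<tau> \<in> S \<Longrightarrow> (G has_vector_derivative G1 \<tau>) (at \<tau> within S)"
    and M: "\<And>\<tau>. \<tau> \<in> S \<Longrightarrow> norm (G1 \<tau>) \<le> M"
  shows "norm (G t - G s) \<le> M * \<bar>t - s\<bar>"
proof -
  have "norm (G t - G s) \<le> M * norm (t - s)"
  proof (rule differentiable_bound[OF S(1) _ _ S(3) S(2)])
    show "(G has_derivative (\<lambda>x. x *\<^sub>R G1 \<tau>)) (at \<tau> within S)" if "\<tau> \<in> S" for \<tau>
      using 1[OF that] by (simp add: has_vector_derivative_def)
    show "onorm (\<lambda>x. x *\<^sub>R G1 \<tau>) \<le> M" if "\<tau> \<in> S" for \<tau>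
      by (rule onorm_le) (simp add: mult.commute[of M] mult_left_mono M[OF that])
  qed
  then show ?thesis by simp
qed

text \<open>The mean value bound is applied to \<open>G\<close> minus its linear part, on the
  segment between \<open>s\<close> and \<open>t\<close> only, where the distance to \<open>s\<close>
  is at most \<open>|t - s|\<close>. This gives the factor \<open>M\<close> instead of the sharp
  \<open>M / 2\<close>, which only affects constants.\<close>

lemma taylor2:
  fixes G :: "real \<Rightarrow> 'b::real_normed_vector"
  assumes S: "convex S" "s \<in> S" "t \<in> S"
    and 1: "\<And>\<tau>. \<tau> \<in> S \<Longrightarrow> (G has_vector_derivative G1 \<tau>) (at \<tau> within S)"
    and 2: "\<And>\<tau>. \<tau> \<in> S \<Longrightarrow> (G1 has_vector_derivative G2 \<tau>) (at \<tau> within S)"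
    and M: "\<And>\<tau>. \<tau> \<in> S \<Longrightarrow> norm (G2 \<tau>) \<le> M"
  shows "norm (G t - G s - (t - s) *\<^sub>R G1 s) \<le> M * (t - s)\<^sup>2"
proof -
  define S' where "S' = closed_segment s t"
  have S': "S' \<subseteq> S" "convex S'" "s \<in> S'" "t \<in> S'"
    using S by (auto simp: S'_def closed_segment_subset)
  have len: "\<bar>\<tau> - s\<bar> \<le> \<bar>t - s\<bar>" if "\<tau> \<in> S'" for \<tau>
    using that by (auto simp: S'_def closed_segment_eq_real_ivl split: if_splits)
  have M0: "M \<ge> 0" using M[OF S(2)] norm_ge_zero order_trans by blast
  define H where "H \<tau> = G \<tau> - \<tau> *\<^sub>R G1 s" for \<tau>
  have "norm (H t - H s) \<le> (M * \<bar>t - s\<bar>) * \<bar>t - s\<bar>"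
  proof (rule taylor1[OF S'(2,3,4)])
    fix \<tau> assume \<tau>: "\<tau> \<in> S'"
    show "(H has_vector_derivative (G1 \<tau> - G1 s)) (at \<tau> within S')"
      unfolding H_def
      by (rule derivative_eq_intros has_vector_derivative_within_subset[OF 1] S'(1) subsetD[OF S'(1) \<tau>] refl)+ simp
    have "norm (G1 \<tau> - G1 s) \<le> M * \<bar>\<tau> - s\<bar>"
      by (rule taylor1[OF S(1,2) subsetD[OF S'(1) \<tau>] 2 M])
    also have "\<dots> \<le> M * \<bar>t - s\<bar>" using len[OF \<tau>] M0 by (rule mult_left_mono)
    finally show "norm (G1 \<tau> - G1 s) \<le> M * \<bar>t - s\<bar>" .
  qed
  moreover have "H t - H s = G t - G s - (t - s) *\<^sub>R G1 s" by (simp add: H_def algebra_simps)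
  ultimately show ?thesis by (simp add: power2_eq_square mult.assoc abs_mult_self_eq)
qed

lemma taylor3:
  fixes G :: "real \<Rightarrow> 'b::real_normed_vector"
  assumes S: "convex S" "s \<in> S" "t \<in> S"
    and 1: "\<And>\<tau>. \<tau> \<in> S \<Longrightarrow> (G has_vector_derivative G1 \<tau>) (at \<tau> within S)"
    and 2: "\<And>\<tau>. \<tau> \<in> S \<Longrightarrow> (G1 has_vector_derivative G2 \<tau>) (at \<tau> within S)"
    and 3: "\<And>\<tau>. \<tau> \<in> S \<Longrightarrow> (G2 has_vector_derivative G3 \<tau>) (at \<tau> within S)"
    and M: "\<And>\<tau>. \<tau> \<in> S \<Longrightarrow> norm (G3 \<tau>) \<le> M"
  shows "norm (G t - G s - (t - s) *\<^sub>R G1 s - ((t - s)\<^sup>2 / 2) *\<^sub>R G2 s) \<le> M * \<bar>t - s\<bar> ^ 3"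
proof -
  define S' where "S' = closed_segment s t"
  have S': "S' \<subseteq> S" "convex S'" "s \<in> S'" "t \<in> S'"
    using S by (auto simp: S'_def closed_segment_subset)
  have len: "\<bar>\<tau> - s\<bar> \<le> \<bar>t - s\<bar>" if "\<tau> \<in> S'" for \<tau>
    using that by (auto simp: S'_def closed_segment_eq_real_ivl split: if_splits)
  have M0: "M \<ge> 0" using M[OF S(2)] norm_ge_zero order_trans by blast
  define H where "H \<tau> = G \<tau> - \<tau> *\<^sub>R G1 s - ((\<tau> - s)\<^sup>2 / 2) *\<^sub>R G2 s" for \<tau>
  have "norm (H t - H s) \<le> (M * (t - s)\<^sup>2) * \<bar>t - s\<bar>"
  proof (rule taylor1[OF S'(2,3,4)])
    fix \<tau> assume \<tau>: "\<tau> \<in> S'"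
    show "(H has_vector_derivative (G1 \<tau> - G1 s - (\<tau> - s) *\<^sub>R G2 s)) (at \<tau> within S')"
    proof -
      have "((\<lambda>\<tau>. (\<tau> - s)\<^sup>2 / 2) has_field_derivative (\<tau> - s)) (at \<tau> within S')"
        by (auto intro!: derivative_eq_intros)
      from has_vector_derivative_scaleR[OF this has_vector_derivative_const[of "G2 s"]]
      have q: "((\<lambda>\<tau>. ((\<tau> - s)\<^sup>2 / 2) *\<^sub>R G2 s) has_vector_derivative (\<tau> - s) *\<^sub>R G2 s) (at \<tau> within S')"
        by simp
      have "((\<lambda>\<tau>. G \<tau> - \<tau> *\<^sub>R G1 s) has_vector_derivative (G1 \<tau> - G1 s)) (at \<tau> within S')"
        by (rule derivative_eq_intros has_vector_derivative_within_subset[OF 1] S'(1) subsetD[OF S'(1) \<tau>] refl)+ simp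
      then show ?thesis unfolding H_def by (rule has_vector_derivative_diff[OF _ q])
    qed
    have "norm (G1 \<tau> - G1 s - (\<tau> - s) *\<^sub>R G2 s) \<le> M * (\<tau> - s)\<^sup>2"
      by (rule taylor2[OF S(1,2) subsetD[OF S'(1) \<tau>] 2 3 M])
    also have "\<dots> \<le> M * (t - s)\<^sup>2" using len[OF \<tau>] M0 by (intro mult_left_mono) (simp_all add: abs_le_square_iff)
    finally show "norm (G1 \<tau> - G1 s - (\<tau> - s) *\<^sub>R G2 s) \<le> M * (t - s)\<^sup>2" .
  qed
  moreover have "H t - H s = G t - G s - (t - s) *\<^sub>R G1 s - ((t - s)\<^sup>2 / 2) *\<^sub>R G2 s" by (simp add: H_def algebra_simps)
  moreover have "(t - s)\<^sup>2 * \<bar>t - s\<bar> = \<bar>t - s\<bar> ^ 3"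
    by (simp add: power3_eq_cube power2_eq_square flip: abs_mult)
  ultimately show ?thesis by (simp add: mult.assoc)
qed


section \<open>Consistency\<close>

lemma dir_deriv_line:
  fixes z :: "real^'d::finite"
  assumes u: "dir_deriv i u u1" and line: "\<And>\<tau>. \<tau> \<in> S \<Longrightarrow> z + \<tau> *\<^sub>R axis i 1 \<in> Omega_bar" and \<tau>: "\<tau> \<in> S"
  shows "((\<lambda>\<tau>. u (z + \<tau> *\<^sub>R axis i 1)) has_vector_derivative u1 (z + \<tau> *\<^sub>R axis i 1)) (at \<tau> within S)"
proof -
  obtain L where L: "(u has_derivative L) (at (z + \<tau> *\<^sub>R axis i 1) within Omega_bar)" "L (axis i 1) = u1 (z + \<tau> *\<^sub>R axis i 1)"
    using u line[OF \<tau>] unfolding dir_deriv_def by blast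
  have a: "((\<lambda>\<tau>. z + \<tau> *\<^sub>R axis i (1::real)) has_derivative (\<lambda>h. h *\<^sub>R axis i 1)) (at \<tau> within S)"
    by (auto intro!: derivative_eq_intros)
  have b: "(u has_derivative L) (at (z + \<tau> *\<^sub>R axis i 1) within (\<lambda>\<tau>. z + \<tau> *\<^sub>R axis i 1) ` S)"
    by (rule has_derivative_subset[OF L(1)]) (use line in auto)
  have "L (h *\<^sub>R axis i 1) = h *\<^sub>R u1 (z + \<tau> *\<^sub>R axis i 1)" for h
    using linear_scale[OF has_derivative_linear[OF L(1)]] L(2) by simp
  then show ?thesis using has_derivative_in_compose[OF a b] by (simp add: has_vector_derivative_def)
qed

context
  fixes z :: "real^'d::finite" and i :: 'd and \<delta> :: real
  assumes \<delta>: "\<delta> \<ge> 0" and line: "\<And>\<tau>. \<tau> \<in> {-\<delta>..\<delta>} \<Longrightarrow> z + \<tau> *\<^sub>R axis i 1 \<in> Omega_bar"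
begin

lemma central_difference1:
  assumes "dir_deriv i u u1" and M: "\<And>x. x \<in> Omega_bar \<Longrightarrow> norm (u1 x) \<le> M"
  shows "norm (u (z + \<delta> *\<^sub>R axis i 1) - u (z - \<delta> *\<^sub>R axis i 1)) \<le> 2 * M * \<delta>"
proof -
  have "norm (u (z + \<delta> *\<^sub>R axis i 1) - u (z + (-\<delta>) *\<^sub>R axis i 1)) \<le> M * \<bar>\<delta> - (-\<delta>)\<bar>"
    by (rule taylor1[where G = "\<lambda>\<tau>. u (z + \<tau> *\<^sub>R axis i 1)", OF convex_real_interval(5) _ _ dir_deriv_line[OF assms(1) line] M[OF line]])
      (use \<delta> in auto)
  then show ?thesis using \<delta> by simp
qed

text \<open>The even terms of the two Taylor expansions cancel, which makes the remainder
  cubic.\<close>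

lemma central_difference3:
  assumes 1: "dir_deriv i u u1" and 2: "dir_deriv i u1 u2" and 3: "dir_deriv i u2 u3"
    and M: "\<And>x. x \<in> Omega_bar \<Longrightarrow> norm (u3 x) \<le> M"
  shows "norm (u (z + \<delta> *\<^sub>R axis i 1) - u (z - \<delta> *\<^sub>R axis i 1) - (2 * \<delta>) *\<^sub>R u1 z) \<le> 2 * M * \<delta> ^ 3"
proof -
  let ?G = "\<lambda>\<tau>. u (z + \<tau> *\<^sub>R axis i 1)"
  have t: "norm (?G t - ?G 0 - (t - 0) *\<^sub>R u1 (z + 0 *\<^sub>R axis i 1) - ((t - 0)\<^sup>2 / 2) *\<^sub>R u2 (z + 0 *\<^sub>R axis i 1)) \<le> M * \<bar>t - 0\<bar> ^ 3"
    if "t \<in> {-\<delta>..\<delta>}" for t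
    by (rule taylor3[OF convex_real_interval(5) _ that dir_deriv_line[OF 1 line] dir_deriv_line[OF 2 line]
          dir_deriv_line[OF 3 line] M[OF line]]) (use \<delta> in auto)
  let ?a = "u (z + \<delta> *\<^sub>R axis i 1) - u z - \<delta> *\<^sub>R u1 z - (\<delta>\<^sup>2 / 2) *\<^sub>R u2 z"
  let ?b = "u (z - \<delta> *\<^sub>R axis i 1) - u z + \<delta> *\<^sub>R u1 z - (\<delta>\<^sup>2 / 2) *\<^sub>R u2 z"
  have a: "norm ?a \<le> M * \<delta> ^ 3" using t[of \<delta>] \<delta> by simp
  have b: "norm ?b \<le> M * \<delta> ^ 3" using t[of "-\<delta>"] \<delta> by simp
  have "u (z + \<delta> *\<^sub>R axis i 1) - u (z - \<delta> *\<^sub>R axis i 1) - (2 * \<delta>) *\<^sub>R u1 z = ?a - ?b"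
    unfolding mult_2 scaleR_left_distrib by simp
  also have "norm \<dots> \<le> M * \<delta> ^ 3 + M * \<delta> ^ 3" by (rule order_trans[OF norm_triangle_ineq4 add_mono[OF a b]])
  finally show ?thesis by simp
qed

lemma central_mean:
  assumes 1: "dir_deriv i u u1" and 2: "dir_deriv i u1 u2"
    and M: "\<And>x. x \<in> Omega_bar \<Longrightarrow> norm (u2 x) \<le> M"
  shows "norm ((1/2) *\<^sub>R (u (z + \<delta> *\<^sub>R axis i 1) + u (z - \<delta> *\<^sub>R axis i 1)) - u z) \<le> M * \<delta>\<^sup>2"
proof -
  let ?G = "\<lambda>\<tau>. u (z + \<tau> *\<^sub>R axis i 1)"
  have t: "norm (?G t - ?G 0 - (t - 0) *\<^sub>R u1 (z + 0 *\<^sub>R axis i 1)) \<le> M * (t - 0)\<^sup>2" if "t \<in> {-\<delta>..\<delta>}" for t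
    by (rule taylor2[OF convex_real_interval(5) _ that dir_deriv_line[OF 1 line] dir_deriv_line[OF 2 line] M[OF line]])
      (use \<delta> in auto)
  let ?a = "u (z + \<delta> *\<^sub>R axis i 1) - u z - \<delta> *\<^sub>R u1 z"
  let ?b = "u (z - \<delta> *\<^sub>R axis i 1) - u z + \<delta> *\<^sub>R u1 z"
  have a: "norm ?a \<le> M * \<delta>\<^sup>2" using t[of \<delta>] \<delta> by simp
  have b: "norm ?b \<le> M * \<delta>\<^sup>2" using t[of "-\<delta>"] \<delta> by simp
  have "(1/2) *\<^sub>R (u (z + \<delta> *\<^sub>R axis i 1) + u (z - \<delta> *\<^sub>R axis i 1)) - u z = (1/2) *\<^sub>R (?a + ?b)"
  proof -
    have "?a + ?b = (u (z + \<delta> *\<^sub>R axis i 1) + u (z - \<delta> *\<^sub>R axis i 1)) - 2 *\<^sub>R u z" by (simp add: scaleR_2)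
    then show ?thesis by (simp only: scaleR_diff_right scaleR_scaleR) simp
  qed
  also have "norm \<dots> \<le> (1/2) * (norm ?a + norm ?b)" using norm_triangle_ineq[of ?a ?b] by simp
  also have "\<dots> \<le> M * \<delta>\<^sup>2" using a b by simp
  finally show ?thesis .
qed

end

text \<open>The place where \<open>grad_h\<close> in direction \<open>i\<close> lives: the centre of
  the cell face between \<open>I\<close> and its upper neighbour, on the boundary of the cube for
  \<open>I i = 0\<close> and \<open>I i = N\<close>.\<close>

definition face :: "nat \<Rightarrow> 'd::finite \<Rightarrow> ('d \<Rightarrow> nat) \<Rightarrow> real^'d" where
  "face N i I = (\<chi> j. if j = i then real (I j) / real N else (real (I j) - 1/2) / real N)"

context
  fixes N :: nat and h :: real
  assumes N: "N \<ge> 1" and h: "h = 1 / real N"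
begin

lemma h_pos: "h > 0" "h \<le> 1"
  using N by (simp_all add: h)

lemma grid_point_line:
  assumes I: "I \<in> grid N" and \<tau>: "\<tau> \<in> {- (h/2)..h/2}"
  shows "grid_point N I + \<tau> *\<^sub>R axis i 1 \<in> Omega_bar"
  unfolding Omega_bar_iff
proof
  fix j
  have "real (I j) \<ge> 1" "real (I j) \<le> real N" using I by (auto simp: grid_def)
  moreover have "\<bar>\<tau>\<bar> * real N \<le> 1 / 2" using \<tau> N by (auto simp: h abs_if field_simps)
  moreover have "\<bar>\<tau>\<bar> * real N = \<bar>\<tau> * real N\<bar>" by (simp add: abs_mult)
  ultimately show "0 \<le> (grid_point N I + \<tau> *\<^sub>R axis i 1) $ j \<and> (grid_point N I + \<tau> *\<^sub>R axis i 1) $ j \<le> 1"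
    using N by (auto simp: grid_point_def axis_def field_simps abs_le_iff)
qed

lemma grid_point_in: "I \<in> grid N \<Longrightarrow> grid_point N I \<in> Omega" "I \<in> grid N \<Longrightarrow> grid_point N I \<in> Omega_bar"
proof -
  assume I: "I \<in> grid N"
  have "0 < grid_point N I $ i \<and> grid_point N I $ i < 1" for i
  proof -
    have "real (I i) \<ge> 1" "real (I i) \<le> real N" using I by (auto simp: grid_def)
    then show ?thesis using N by (simp add: grid_point_def field_simps)
  qed
  then show "grid_point N I \<in> Omega" "grid_point N I \<in> Omega_bar"
    unfolding Omega_iff Omega_bar_iff by (auto intro: less_imp_le)
qed

lemma face_in: "I \<in> midpoints N i \<Longrightarrow> face N i I \<in> Omega_bar"
  unfolding Omega_bar_iff
proof
  fix j assume I: "I \<in> midpoints N i"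
  show "0 \<le> face N i I $ j \<and> face N i I $ j \<le> 1"
  proof (cases "j = i")
    case True
    then show ?thesis using I N by (simp add: face_def midpoints_def)
  next
    case False
    then have "real (I j) \<ge> 1" "real (I j) \<le> real N" using I by (auto simp: midpoints_def)
    then show ?thesis using False N by (simp add: face_def field_simps)
  qed
qed

lemma face_line:
  assumes I: "I \<in> midpoints N i" "I i \<noteq> 0" "I i \<noteq> N" and \<tau>: "\<tau> \<in> {- (h/2)..h/2}"
  shows "face N i I + \<tau> *\<^sub>R axis i 1 \<in> Omega_bar"
  unfolding Omega_bar_iff
proof
  fix j
  show "0 \<le> (face N i I + \<tau> *\<^sub>R axis i 1) $ j \<and> (face N i I + \<tau> *\<^sub>R axis i 1) $ j \<le> 1"
  proof (cases "j = i")
    case True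
    have "I i \<ge> 1" "I i + 1 \<le> N" using I by (auto simp: midpoints_def)
    then have "real (I i) \<ge> 1" "real (I i) + 1 \<le> real N" by linarith+
    moreover have "\<bar>\<tau>\<bar> * real N \<le> 1 / 2" using \<tau> N by (auto simp: h abs_if field_simps)
    moreover have "\<bar>\<tau>\<bar> * real N = \<bar>\<tau> * real N\<bar>" by (simp add: abs_mult)
    ultimately show ?thesis using True N by (auto simp: face_def field_simps abs_le_iff)
  next
    case False
    then show ?thesis using face_in[OF I(1)] by (simp add: Omega_bar_iff axis_def)
  qed
qed

lemma face_grid_point:
  assumes "I \<in> grid N"
  shows "face N i I = grid_point N I + (h/2) *\<^sub>R axis i 1"
    "face N i (I(i := I i - 1)) = grid_point N I - (h/2) *\<^sub>R axis i 1"
proof -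
  have "I i \<ge> 1" using assms by (simp add: grid_def)
  then show "face N i I = grid_point N I + (h/2) *\<^sub>R axis i 1"
    "face N i (I(i := I i - 1)) = grid_point N I - (h/2) *\<^sub>R axis i 1"
    using N by (auto simp: vec_eq_iff face_def grid_point_def axis_def h of_nat_diff field_simps)
qed

lemma P_h_grid: "I \<in> grid N \<Longrightarrow> P_h N u I = u (grid_point N I)"
  by (simp add: P_h_eq_clamp)

lemma P_h_neumann: "discrete_neumann N (P_h N u)"
  unfolding P_h_eq_clamp by (rule clamp_neumann[OF N])

lemma grad_P_h_interior:
  assumes I: "I \<in> midpoints N i" "I i \<noteq> 0" "I i \<noteq> N"
  shows "grad_h N (P_h N u) i I = real N *\<^sub>R (u (face N i I + (h/2) *\<^sub>R axis i 1) - u (face N i I - (h/2) *\<^sub>R axis i 1))"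
proof -
  have I0: "I \<in> grid N" by (rule midpoints_grid[OF I(1,2)])
  have "I i \<le> N" using I by (simp add: midpoints_def)
  then have I1: "I(i := I i + 1) \<in> grid N" using I by (intro grid_upd[OF I0]) auto
  have "(I(i := I i + 1))(i := (I(i := I i + 1)) i - 1) = I" by simp
  then have "face N i I = grid_point N (I(i := I i + 1)) - (h/2) *\<^sub>R axis i 1"
    using face_grid_point(2)[OF I1, of i] by simp
  then have "grid_point N (I(i := I i + 1)) = face N i I + (h/2) *\<^sub>R axis i 1" by simp
  moreover have "grid_point N I = face N i I - (h/2) *\<^sub>R axis i 1" using face_grid_point(1)[OF I0, of i] by simp
  ultimately show ?thesis by (simp only: grad_h_def P_h_grid[OF I0] P_h_grid[OF I1])
qed

text \<open>Covers functions that violate the Neumann condition as well: at boundary midpoints the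
  quotient is 0 by the choice of ghost values in \<open>P_h\<close>. This is used for the
  corrections in the comparison stages.\<close>

lemma grad_P_h_bound:
  assumes u: "dir_deriv i u u1" and M: "\<And>x. x \<in> Omega_bar \<Longrightarrow> norm (u1 x) \<le> M" and I: "I \<in> midpoints N i"
  shows "norm (grad_h N (P_h N u) i I) \<le> M"
proof (cases "I i = 0 \<or> I i = N")
  case True
  have "0 \<le> M" using M[OF face_in[OF I]] norm_ge_zero order_trans by blast
  then show ?thesis using neumann_grad_zero[OF P_h_neumann I True] by simp
next
  case False
  have "norm (u (face N i I + (h/2) *\<^sub>R axis i 1) - u (face N i I - (h/2) *\<^sub>R axis i 1)) \<le> 2 * M * (h/2)"
    by (rule central_difference1[OF _ face_line[OF I] u M]) (use False h_pos in auto)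
  then have "real N * norm (u (face N i I + (h/2) *\<^sub>R axis i 1) - u (face N i I - (h/2) *\<^sub>R axis i 1)) \<le> real N * (2 * M * (h/2))"
    by (intro mult_left_mono) auto
  also have "\<dots> = M" using N by (simp add: h)
  finally show ?thesis using False by (simp add: grad_P_h_interior[OF I])
qed

text \<open>At boundary faces both the discrete and the exact flux are 0. That the error vanishes
  there exactly, not just up to \<open>h^2\<close>, is what the later summation by parts
  requires.\<close>

lemma flux_error:
  assumes 1: "dir_deriv i u u1" and 2: "dir_deriv i u1 u2" and 3: "dir_deriv i u2 u3"
    and M: "\<And>x. x \<in> Omega_bar \<Longrightarrow> norm (u3 x) \<le> M"
    and bc: "\<And>x. x \<in> Omega_bar \<Longrightarrow> x $ i = 0 \<or> x $ i = 1 \<Longrightarrow> u1 x = 0"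
    and I: "I \<in> midpoints N i"
  shows "norm (grad_h N (P_h N u) i I - u1 (face N i I)) \<le> M * h\<^sup>2"
    and "I i = 0 \<or> I i = N \<Longrightarrow> grad_h N (P_h N u) i I - u1 (face N i I) = 0"
proof -
  have M0: "0 \<le> M" using M[OF face_in[OF I]] norm_ge_zero order_trans by blast
  show b: "grad_h N (P_h N u) i I - u1 (face N i I) = 0" if "I i = 0 \<or> I i = N"
  proof -
    have "face N i I $ i = 0 \<or> face N i I $ i = 1" using that N by (auto simp: face_def)
    then show ?thesis using bc[OF face_in[OF I]] neumann_grad_zero[OF P_h_neumann I that] by simp
  qed
  show "norm (grad_h N (P_h N u) i I - u1 (face N i I)) \<le> M * h\<^sup>2"
  proof (cases "I i = 0 \<or> I i = N")
    case True
    then show ?thesis using b M0 by simp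
  next
    case False
    let ?D = "u (face N i I + (h/2) *\<^sub>R axis i 1) - u (face N i I - (h/2) *\<^sub>R axis i 1)"
    have "norm (?D - (2 * (h/2)) *\<^sub>R u1 (face N i I)) \<le> 2 * M * (h/2) ^ 3"
      by (rule central_difference3[OF _ face_line[OF I] 1 2 3 M]) (use False h_pos in auto)
    then have "real N * norm (?D - h *\<^sub>R u1 (face N i I)) \<le> real N * (2 * M * (h/2) ^ 3)"
      by (intro mult_left_mono) auto
    also have "\<dots> = M * h\<^sup>2 / 4" using N by (simp add: h power2_eq_square power3_eq_cube)
    also have "\<dots> \<le> M * h\<^sup>2" using M0 by simp
    finally have "norm (real N *\<^sub>R (?D - h *\<^sub>R u1 (face N i I))) \<le> M * h\<^sup>2" by simp
    moreover have "real N *\<^sub>R (?D - h *\<^sub>R u1 (face N i I)) = grad_h N (P_h N u) i I - u1 (face N i I)"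
      using False N by (simp add: grad_P_h_interior[OF I] scaleR_diff_right h)
    ultimately show ?thesis by simp
  qed
qed

text \<open>Going through the fluxes at the two faces, instead of expanding at neighbouring grid
  points, treats cells next to the boundary alike: their ghost values are not samples of a smooth
  function.\<close>

lemma avg_grad_error:
  assumes 1: "dir_deriv i u u1" and 2: "dir_deriv i u1 u2" and 3: "dir_deriv i u2 u3"
    and M: "\<And>x. x \<in> Omega_bar \<Longrightarrow> norm (u3 x) \<le> M"
    and bc: "\<And>x. x \<in> Omega_bar \<Longrightarrow> x $ i = 0 \<or> x $ i = 1 \<Longrightarrow> u1 x = 0"
    and I: "I \<in> grid N"
  shows "norm (avg_grad_h N (P_h N u) i I - u1 (grid_point N I)) \<le> 2 * M * h\<^sup>2"
proof -
  let ?J = "I(i := I i - 1)" and ?x = "grid_point N I"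
  have M0: "0 \<le> M" using M[OF grid_point_in(2)[OF I]] norm_ge_zero order_trans by blast
  have f: "norm (grad_h N (P_h N u) i I - u1 (face N i I)) \<le> M * h\<^sup>2"
    "norm (grad_h N (P_h N u) i ?J - u1 (face N i ?J)) \<le> M * h\<^sup>2"
    using flux_error(1)[OF 1 2 3 M bc] subsetD[OF grid_subset_midpoints I] grid_lower_midpoint[OF I] by auto
  have m: "norm ((1/2) *\<^sub>R (u1 (face N i I) + u1 (face N i ?J)) - u1 ?x) \<le> M * (h/2)\<^sup>2"
    unfolding face_grid_point[OF I]
    by (rule central_mean[OF _ grid_point_line[OF I] 2 3 M]) (use h_pos in auto)
  have "avg_grad_h N (P_h N u) i I - u1 ?x
      = (1/2) *\<^sub>R ((grad_h N (P_h N u) i I - u1 (face N i I)) + (grad_h N (P_h N u) i ?J - u1 (face N i ?J)))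
        + ((1/2) *\<^sub>R (u1 (face N i I) + u1 (face N i ?J)) - u1 ?x)"
    by (simp add: avg_grad_h_def algebra_simps)
  also have "norm \<dots> \<le> (1/2) * (M * h\<^sup>2 + M * h\<^sup>2) + M * (h/2)\<^sup>2"
  proof (rule order_trans[OF norm_triangle_ineq add_mono[OF _ m]])
    have half: "\<bar>1/2 :: real\<bar> = 1/2" by simp
    show "norm ((1/2) *\<^sub>R ((grad_h N (P_h N u) i I - u1 (face N i I)) + (grad_h N (P_h N u) i ?J - u1 (face N i ?J))))
        \<le> (1/2) * (M * h\<^sup>2 + M * h\<^sup>2)"
      unfolding norm_scaleR half by (intro mult_left_mono order_trans[OF norm_triangle_ineq add_mono[OF f]]) auto
  qed
  also have "\<dots> \<le> 2 * M * h\<^sup>2" using M0 by (simp add: power_divide)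
  finally show ?thesis .
qed

text \<open>In each direction the truncation error is the difference quotient of the flux error
  \<open>p\<close> plus a remainder \<open>r\<close> of order \<open>h^2\<close>. The quotient alone
  may be of order \<open>h\<close> near the boundary; as \<open>p\<close> vanishes at boundary
  faces, summation by parts shifts the difference onto \<open>g\<close>.\<close>

lemma lap_h_consistency:
  fixes u :: "real^'d::finite \<Rightarrow> real^3" and u1 u2 u3 u4 :: "'d \<Rightarrow> real^'d \<Rightarrow> real^3" and g :: "'d gridfun"
  assumes 1: "\<And>i. dir_deriv i u (u1 i)" and 2: "\<And>i. dir_deriv i (u1 i) (u2 i)"
    and 3: "\<And>i. dir_deriv i (u2 i) (u3 i)" and 4: "\<And>i. dir_deriv i (u3 i) (u4 i)"
    and M3: "\<And>i x. x \<in> Omega_bar \<Longrightarrow> norm (u3 i x) \<le> M" and M4: "\<And>i x. x \<in> Omega_bar \<Longrightarrow> norm (u4 i x) \<le> M"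
    and M0: "M \<ge> 0"
    and bc: "\<And>i x. x \<in> Omega_bar \<Longrightarrow> x $ i = 0 \<or> x $ i = 1 \<Longrightarrow> u1 i x = 0"
  shows "\<bar>inner_h N (\<lambda>I. lap_h N (P_h N u) I - (\<Sum>i\<in>UNIV. u2 i (grid_point N I))) g\<bar>
    \<le> real CARD('d) * M * h\<^sup>2 * (norm2_h N g + grad_norm2_h N (grad_h N g))"
proof -
  define p where "p i I = grad_h N (P_h N u) i I - u1 i (face N i I)" for i I
  define r where "r i I = real N *\<^sub>R (u1 i (face N i I) - u1 i (face N i (I(i := I i - 1)))) - u2 i (grid_point N I)" for i I
  have p: "norm (p i I) \<le> M * h\<^sup>2" "I i = 0 \<or> I i = N \<Longrightarrow> p i I = 0" if "I \<in> midpoints N i" for i I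
    using flux_error[OF 1 2 3 M3 bc that] by (simp_all add: p_def)
  have r: "norm (r i I) \<le> M * h\<^sup>2" if I: "I \<in> grid N" for i I
  proof -
    let ?x = "grid_point N I"
    let ?D = "u1 i (?x + (h/2) *\<^sub>R axis i 1) - u1 i (?x - (h/2) *\<^sub>R axis i 1)"
    have "norm (?D - (2 * (h/2)) *\<^sub>R u2 i ?x) \<le> 2 * M * (h/2) ^ 3"
      by (rule central_difference3[OF _ grid_point_line[OF I] 2 3 4 M4]) (use h_pos in auto)
    then have "real N * norm (?D - h *\<^sub>R u2 i ?x) \<le> real N * (2 * M * (h/2) ^ 3)"
      by (intro mult_left_mono) auto
    also have "\<dots> = M * h\<^sup>2 / 4" using N by (simp add: h power2_eq_square power3_eq_cube)
    also have "\<dots> \<le> M * h\<^sup>2" using M0 by simp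
    finally have "norm (real N *\<^sub>R (?D - h *\<^sub>R u2 i ?x)) \<le> M * h\<^sup>2" by simp
    moreover have "real N *\<^sub>R (?D - h *\<^sub>R u2 i ?x) = r i I"
      unfolding r_def face_grid_point[OF I] using N by (simp add: scaleR_diff_right h)
    ultimately show ?thesis by simp
  qed
  have sd: "second_diff N (P_h N u) i I - u2 i (grid_point N I) = real N *\<^sub>R (p i I - p i (I(i := I i - 1))) + r i I" for i I
    by (simp add: second_diff_def p_def r_def algebra_simps)
  have "(\<Sum>I\<in>grid N. (lap_h N (P_h N u) I - (\<Sum>i\<in>UNIV. u2 i (grid_point N I))) \<bullet> g I)
      = (\<Sum>I\<in>grid N. \<Sum>i\<in>UNIV. (second_diff N (P_h N u) i I - u2 i (grid_point N I)) \<bullet> g I)"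
    by (rule sum.cong[OF refl]) (simp add: lap_h_eq_sum inner_sum_left sum_subtractf inner_diff_left)
  also have "\<dots> = (\<Sum>i\<in>UNIV. \<Sum>I\<in>grid N. (real N *\<^sub>R (p i I - p i (I(i := I i - 1))) + r i I) \<bullet> g I)"
    unfolding sd by (rule sum.swap)
  also have "\<dots> = (\<Sum>i\<in>UNIV. (\<Sum>I\<in>grid N. r i I \<bullet> g I) - (\<Sum>I\<in>grid N. p i I \<bullet> grad_h N g i I))"
  proof (rule sum.cong[OF refl])
    fix i
    have "(\<Sum>I\<in>grid N. (real N *\<^sub>R (p i I - p i (I(i := I i - 1))) + r i I) \<bullet> g I)
        = real N * (\<Sum>I\<in>grid N. (p i I - p i (I(i := I i - 1))) \<bullet> g I) + (\<Sum>I\<in>grid N. r i I \<bullet> g I)"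
      by (simp add: inner_add_left sum.distrib sum_distrib_left)
    also have "(\<Sum>I\<in>grid N. (p i I - p i (I(i := I i - 1))) \<bullet> g I) = - (\<Sum>I\<in>midpoints N i. p i I \<bullet> (g (I(i := I i + 1)) - g I))"
      by (rule sum_by_parts) (rule p(2))
    also have "real N * - (\<Sum>I\<in>midpoints N i. p i I \<bullet> (g (I(i := I i + 1)) - g I)) = - (\<Sum>I\<in>midpoints N i. p i I \<bullet> grad_h N g i I)"
      by (simp add: sum_distrib_left grad_h_def)
    also have "(\<Sum>I\<in>midpoints N i. p i I \<bullet> grad_h N g i I) = (\<Sum>I\<in>grid N. p i I \<bullet> grad_h N g i I)"
    proof (rule sum.mono_neutral_right)
      show "\<forall>I\<in>midpoints N i - grid N. p i I \<bullet> grad_h N g i I = 0"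
      proof
        fix I assume I: "I \<in> midpoints N i - grid N"
        then have "I i = 0" using midpoints_grid[of I N i] by blast
        then show "p i I \<bullet> grad_h N g i I = 0" using p(2)[of I i] I by simp
      qed
    qed (simp_all add: grid_subset_midpoints)
    finally show "(\<Sum>I\<in>grid N. (real N *\<^sub>R (p i I - p i (I(i := I i - 1))) + r i I) \<bullet> g I)
        = (\<Sum>I\<in>grid N. r i I \<bullet> g I) - (\<Sum>I\<in>grid N. p i I \<bullet> grad_h N g i I)" by (simp add: fun_upd_def)
  qed
  finally have "inner_h N (\<lambda>I. lap_h N (P_h N u) I - (\<Sum>i\<in>UNIV. u2 i (grid_point N I))) g
      = (\<Sum>i\<in>UNIV. inner_h N (r i) g - inner_h N (p i) (grad_h N g i))"
    by (simp add: inner_h_def sum_distrib_left right_diff_distrib)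
  also have "\<bar>\<dots>\<bar> \<le> (\<Sum>i\<in>(UNIV::'d set). M * h\<^sup>2 * norm2_h N g + M * h\<^sup>2 * grad_norm2_h N (grad_h N g))"
  proof (rule order_trans[OF sum_abs], rule sum_mono)
    fix i
    note CS = semi_inner.ip_Cauchy_Schwarz[OF semi_inner_h, unfolded nrm_inner_h]
    have "\<bar>inner_h N (r i) g\<bar> \<le> norm2_h N (r i) * norm2_h N g" by (rule CS)
    also have "\<dots> \<le> M * h\<^sup>2 * norm2_h N g"
      by (intro mult_right_mono norm2_h_le_sup[OF N] r) (use M0 in auto)
    finally have 1: "\<bar>inner_h N (r i) g\<bar> \<le> M * h\<^sup>2 * norm2_h N g" .
    have pg: "norm (p i I) \<le> M * h\<^sup>2" if "I \<in> grid N" for I using p(1)[OF subsetD[OF grid_subset_midpoints that]] .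
    have "\<bar>inner_h N (p i) (grad_h N g i)\<bar> \<le> norm2_h N (p i) * norm2_h N (grad_h N g i)" by (rule CS)
    also have "\<dots> \<le> M * h\<^sup>2 * grad_norm2_h N (grad_h N g)"
    proof (rule mult_mono)
      show "norm2_h N (p i) \<le> M * h\<^sup>2" using M0 by (intro norm2_h_le_sup[OF N] pg) auto
      have "(\<Sum>I\<in>grid N. (norm (grad_h N g i I))\<^sup>2) \<le> (\<Sum>I\<in>midpoints N i. (norm (grad_h N g i I))\<^sup>2)"
        by (rule sum_mono2) (simp_all add: grid_subset_midpoints)
      also have "\<dots> \<le> (\<Sum>j\<in>UNIV. \<Sum>I\<in>midpoints N j. (norm (grad_h N g j I))\<^sup>2)"
        by (rule member_le_sum[where f = "\<lambda>j. \<Sum>I\<in>midpoints N j. (norm (grad_h N g j I))\<^sup>2"]) (simp_all add: sum_nonneg)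
      finally have "inner_h N (grad_h N g i) (grad_h N g i) \<le> grad_inner_h N (grad_h N g) (grad_h N g)"
        unfolding inner_h_def grad_inner_h_def power2_norm_eq_inner by (intro mult_left_mono) auto
      then show "norm2_h N (grad_h N g i) \<le> grad_norm2_h N (grad_h N g)"
        unfolding norm2_h_def grad_norm2_h_def by (rule real_sqrt_le_mono)
    qed (use M0 in auto)
    finally have 2: "\<bar>inner_h N (p i) (grad_h N g i)\<bar> \<le> M * h\<^sup>2 * grad_norm2_h N (grad_h N g)" .
    show "\<bar>inner_h N (r i) g - inner_h N (p i) (grad_h N g i)\<bar> \<le> M * h\<^sup>2 * norm2_h N g + M * h\<^sup>2 * grad_norm2_h N (grad_h N g)"
      using 1 2 abs_triangle_ineq4[of "inner_h N (r i) g" "inner_h N (p i) (grad_h N g i)"] by linarith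
  qed
  also have "\<dots> = real CARD('d) * M * h\<^sup>2 * (norm2_h N g + grad_norm2_h N (grad_h N g))"
    by (simp add: distrib_left mult_ac)
  finally show ?thesis .
qed

text \<open>Without a boundary condition on \<open>y\<close> one power of \<open>h\<close> is lost, but the dual norm stays bounded.\<close>

lemma lap_h_dual_bound:
  fixes y :: "real^'d::finite \<Rightarrow> real^3" and g :: "'d gridfun"
  assumes y: "\<And>i. dir_deriv i y (y1 i)" and M: "\<And>i x. x \<in> Omega_bar \<Longrightarrow> norm (y1 i x) \<le> M" and M0: "M \<ge> 0"
    and g: "discrete_neumann N g"
  shows "\<bar>inner_h N (lap_h N (P_h N y)) g\<bar> \<le> real CARD('d) * M * grad_norm2_h N (grad_h N g)"
proof -
  interpret dissipative "inner_h N :: 'd gridfun \<Rightarrow> 'd gridfun \<Rightarrow> real" "\<lambda>u. (- 1) *\<^sub>R lap_h N u" "{u. discrete_neumann N u}"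
    by (rule dissipative_h) simp
  let ?P = "P_h N y :: 'd gridfun"
  have "(grad_norm2_h N (grad_h N ?P))\<^sup>2 \<le> (real CARD('d) * M)\<^sup>2"
  proof -
    have "(grad_norm2_h N (grad_h N ?P))\<^sup>2 = (1 / real N) ^ CARD('d) * (\<Sum>i\<in>UNIV. \<Sum>I\<in>grid N. (norm (grad_h N ?P i I))\<^sup>2)"
      unfolding grad_norm2_h_square grad_inner_h_def power2_norm_eq_inner[symmetric]
      by (simp add: grad_sum_midpoints_grid[OF P_h_neumann])
    also have "\<dots> = (\<Sum>i\<in>UNIV. (norm2_h N (grad_h N ?P i))\<^sup>2)"
      by (simp add: norm2_h_square inner_h_def power2_norm_eq_inner sum_distrib_left)
    also have "\<dots> \<le> (\<Sum>i\<in>(UNIV::'d set). M\<^sup>2)"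
      by (intro sum_mono power_mono norm2_h_le_sup[OF N] grad_P_h_bound[OF y M] subsetD[OF grid_subset_midpoints] M0) auto
    also have "\<dots> = real CARD('d) * M\<^sup>2" by simp
    also have "\<dots> \<le> (real CARD('d) * real CARD('d)) * M\<^sup>2"
    proof (rule mult_right_mono)
      have "real CARD('d) \<ge> 1" by (simp add: Suc_le_eq)
      then show "real CARD('d) \<le> real CARD('d) * real CARD('d)" by simp
    qed simp
    finally show ?thesis by (simp add: power2_eq_square mult_ac)
  qed
  then have P: "grad_norm2_h N (grad_h N ?P) \<le> real CARD('d) * M" by (rule power2_le_imp_le) (use M0 in simp)
  have CS: "\<bar>grad_inner_h N (grad_h N ?P) (grad_h N g)\<bar> \<le> grad_norm2_h N (grad_h N ?P) * grad_norm2_h N (grad_h N g)"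
  proof -
    let ?A = "grad_inner_h N (grad_h N ?P) (grad_h N ?P)" and ?B = "grad_inner_h N (grad_h N g) (grad_h N g)"
      and ?C = "grad_inner_h N (grad_h N ?P) (grad_h N g)"
    \<comment> \<open>\<open>grad_inner_h\<close> pairs families of fluxes and is not an instance of
      \<open>semi_inner\<close>; its Cauchy-Schwarz inequality is derived from this nonnegative
      quadratic, an energy of the Neumann function \<open>?P + r g\<close>.\<close>
    have quad: "0 \<le> ?A + 2 * r * ?C + r\<^sup>2 * ?B" for r
    proof -
      have "discrete_neumann N (?P + r *\<^sub>R g)"
        using S_closed(1)[of ?P "r *\<^sub>R g"] S_closed(3)[of g r] P_h_neumann[of y] g by simp
      then have "0 \<le> inner_h N ((- 1) *\<^sub>R lap_h N (?P + r *\<^sub>R g)) (?P + r *\<^sub>R g)"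
        using X_nonneg by simp
      moreover have L: "lap_h N (?P + r *\<^sub>R g) = lap_h N ?P + r *\<^sub>R lap_h N g"
        using linear_add[OF linear_lap_h[of 1 N], of ?P "r *\<^sub>R g"] linear_scale[OF linear_lap_h[of 1 N], of r g] by simp
      ultimately show ?thesis
        unfolding L
        by (simp add: ip_expand inner_lap_h[OF P_h_neumann] inner_lap_h[OF g]
            grad_inner_h_commute[of N "grad_h N g" "grad_h N ?P"] power2_eq_square algebra_simps)
    qed
    have "?C\<^sup>2 \<le> ?A * ?B"
    proof (cases "?B = 0")
      case True
      have "?C = 0"
      proof (rule ccontr)
        assume nz: "?C \<noteq> 0"
        define r where "r = - (?A + 1) / (2 * ?C)"
        have "2 * r * ?C = - (?A + 1)" using nz by (simp add: r_def)
        then show False using quad[of r] True by simp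
      qed
      then show ?thesis using True by simp
    next
      case False
      then have B: "?B > 0" using grad_inner_h_nonneg[of N "grad_h N g"] by simp
      have "0 \<le> ?A + 2 * (- ?C / ?B) * ?C + (- ?C / ?B)\<^sup>2 * ?B" by (rule quad)
      then show ?thesis using B by (simp add: field_simps power2_eq_square)
    qed
    then have "sqrt (?C\<^sup>2) \<le> sqrt (?A * ?B)" by (rule real_sqrt_le_mono)
    then show ?thesis by (simp add: grad_norm2_h_def real_sqrt_mult)
  qed
  have "\<bar>inner_h N (lap_h N ?P) g\<bar> = \<bar>grad_inner_h N (grad_h N ?P) (grad_h N g)\<bar>"
    by (simp add: inner_lap_h[OF P_h_neumann])
  also have "\<dots> \<le> real CARD('d) * M * grad_norm2_h N (grad_h N g)"
    using CS mult_right_mono[OF P, of "grad_norm2_h N (grad_h N g)"] by simp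
  finally show ?thesis .
qed

text \<open>The cross product term is sampled exactly. The squared gradients differ by
  \<open>(a + b) (a - b)\<close> with \<open>a - b\<close> of order \<open>h^2\<close>, up to the
  boundary.\<close>

lemma N_h_consistency:
  fixes u :: "real^'d::finite \<Rightarrow> real^3" and u1 u2 u3 :: "'d \<Rightarrow> real^'d \<Rightarrow> real^3"
  assumes 1: "\<And>i. dir_deriv i u (u1 i)" and 2: "\<And>i. dir_deriv i (u1 i) (u2 i)"
    and 3: "\<And>i. dir_deriv i (u2 i) (u3 i)"
    and M: "\<And>x. x \<in> Omega_bar \<Longrightarrow> norm (u x) \<le> M" "\<And>i x. x \<in> Omega_bar \<Longrightarrow> norm (u1 i x) \<le> M"
      "\<And>i x. x \<in> Omega_bar \<Longrightarrow> norm (u3 i x) \<le> M" "M \<ge> 0"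
    and bc: "\<And>i x. x \<in> Omega_bar \<Longrightarrow> x $ i = 0 \<or> x $ i = 1 \<Longrightarrow> u1 i x = 0"
    and \<beta>: "\<beta> \<ge> 0" and I: "I \<in> grid N"
  defines "x \<equiv> grid_point N I"
  shows "norm (N_h \<alpha> \<beta> f N (P_h N u) I
      - (\<beta> *\<^sub>R ((\<Sum>i\<in>UNIV. (norm (u1 i x))\<^sup>2) *\<^sub>R u x) - \<alpha> *\<^sub>R cross3 (u x) (cross3 (u x) (f x))))
    \<le> 4 * \<beta> * real CARD('d) * M ^ 3 * h\<^sup>2"
proof -
  let ?a = "\<lambda>i. norm (avg_grad_h N (P_h N u) i I)" and ?b = "\<lambda>i. norm (u1 i x)"
  have x: "x \<in> Omega_bar" unfolding x_def by (rule grid_point_in(2)[OF I])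
  have d: "\<bar>(?a i)\<^sup>2 - (?b i)\<^sup>2\<bar> \<le> 4 * M\<^sup>2 * h\<^sup>2" for i
  proof -
    have ab: "\<bar>?a i - ?b i\<bar> \<le> 2 * M * h\<^sup>2"
      using norm_triangle_ineq3[of "avg_grad_h N (P_h N u) i I" "u1 i x"] avg_grad_error[OF 1 2 3 M(3) bc I, of i]
      by (simp add: x_def)
    have "?a i \<le> M" by (rule avg_grad_le[OF grad_P_h_bound[OF 1 M(2)] I])
    moreover have "?b i \<le> M" by (rule M(2)[OF x])
    ultimately have "?a i + ?b i \<le> 2 * M" by linarith
    from mult_mono[OF this ab] have "(?a i + ?b i) * \<bar>?a i - ?b i\<bar> \<le> (2 * M) * (2 * M * h\<^sup>2)"
      using M(4) by simp
    moreover have "\<bar>(?a i)\<^sup>2 - (?b i)\<^sup>2\<bar> = (?a i + ?b i) * \<bar>?a i - ?b i\<bar>"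
      by (simp add: power2_eq_square square_diff_square_factored abs_mult)
    ultimately show ?thesis by (simp add: power2_eq_square mult_ac)
  qed
  have "N_h \<alpha> \<beta> f N (P_h N u) I
      - (\<beta> *\<^sub>R ((\<Sum>i\<in>UNIV. (?b i)\<^sup>2) *\<^sub>R u x) - \<alpha> *\<^sub>R cross3 (u x) (cross3 (u x) (f x)))
      = \<beta> *\<^sub>R ((\<Sum>i\<in>UNIV. (?a i)\<^sup>2 - (?b i)\<^sup>2) *\<^sub>R u x)"
    by (simp add: N_h_def P_h_grid[OF I] x_def sum_subtractf algebra_simps)
  also have "norm \<dots> = \<beta> * (\<bar>\<Sum>i\<in>UNIV. (?a i)\<^sup>2 - (?b i)\<^sup>2\<bar> * norm (u x))" using \<beta> by (simp add: abs_mult)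
  also have "\<dots> \<le> \<beta> * ((\<Sum>i\<in>(UNIV::'d set). 4 * M\<^sup>2 * h\<^sup>2) * M)"
    by (intro mult_left_mono mult_mono order_trans[OF sum_abs] sum_mono d M(1)[OF x] \<beta> sum_nonneg) auto
  also have "\<dots> = 4 * \<beta> * real CARD('d) * M ^ 3 * h\<^sup>2" by (simp add: power2_eq_square power3_eq_cube)
  finally show ?thesis .
qed

end

section \<open>Derivatives of sphere-valued functions and the equation\<close>

lemma dir_deriv_inner_const:
  assumes u: "dir_deriv i u u1" and v: "dir_deriv i v v1"
    and c: "\<And>x. x \<in> Omega_bar \<Longrightarrow> u x \<bullet> v x = c" and x: "x \<in> Omega_bar"
  shows "u x \<bullet> v1 x + u1 x \<bullet> v x = 0"
proof -
  obtain L where L: "(u has_derivative L) (at x within Omega_bar)" "L (axis i 1) = u1 x"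
    using u x unfolding dir_deriv_def by blast
  obtain K where K: "(v has_derivative K) (at x within Omega_bar)" "K (axis i 1) = v1 x"
    using v x unfolding dir_deriv_def by blast
  have "((\<lambda>y. u y \<bullet> v y) has_derivative (\<lambda>w. u x \<bullet> K w + L w \<bullet> v x)) (at x within Omega_bar)"
    by (rule has_derivative_inner[OF L(1) K(1)])
  moreover have "((\<lambda>y. u y \<bullet> v y) has_derivative (\<lambda>w. 0)) (at x within Omega_bar)"
    by (rule has_derivative_transform[OF x _ has_derivative_const[of c]]) (simp add: c)
  ultimately have "(\<lambda>w. u x \<bullet> K w + L w \<bullet> v x) = (\<lambda>w. 0)"
    by (intro frechet_derivative_unique_within_closed_interval[OF _ x]) simp_all
  then show ?thesis by (metis L(2) K(2))
qed

lemma dir_deriv_add: "dir_deriv i u u1 \<Longrightarrow> dir_deriv i v v1 \<Longrightarrow> dir_deriv i (\<lambda>x. u x + v x) (\<lambda>x. u1 x + v1 x)"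
  unfolding dir_deriv_def
proof
  fix x :: "real^'a"
  assume u: "\<forall>x\<in>Omega_bar. \<exists>L. (u has_derivative L) (at x within Omega_bar) \<and> L (axis i 1) = u1 x"
    and v: "\<forall>x\<in>Omega_bar. \<exists>L. (v has_derivative L) (at x within Omega_bar) \<and> L (axis i 1) = v1 x"
    and x: "x \<in> Omega_bar"
  obtain L K where "(u has_derivative L) (at x within Omega_bar)" "L (axis i 1) = u1 x"
    "(v has_derivative K) (at x within Omega_bar)" "K (axis i 1) = v1 x" using u v x by blast
  then show "\<exists>L. ((\<lambda>x. u x + v x) has_derivative L) (at x within Omega_bar) \<and> L (axis i 1) = u1 x + v1 x"
    by (intro exI[of _ "\<lambda>w. L w + K w"]) (simp add: has_derivative_add)
qed

lemma dir_deriv_scale: "dir_deriv i u u1 \<Longrightarrow> dir_deriv i (\<lambda>x. r *\<^sub>R u x) (\<lambda>x. r *\<^sub>R u1 x)"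
  unfolding dir_deriv_def
proof
  fix x :: "real^'a"
  assume u: "\<forall>x\<in>Omega_bar. \<exists>L. (u has_derivative L) (at x within Omega_bar) \<and> L (axis i 1) = u1 x"
    and x: "x \<in> Omega_bar"
  obtain L where "(u has_derivative L) (at x within Omega_bar)" "L (axis i 1) = u1 x" using u x by blast
  then show "\<exists>L. ((\<lambda>x. r *\<^sub>R u x) has_derivative L) (at x within Omega_bar) \<and> L (axis i 1) = r *\<^sub>R u1 x"
    by (intro exI[of _ "\<lambda>w. r *\<^sub>R L w"]) (simp add: has_derivative_scaleR_right)
qed

lemma dir_deriv_zero: "dir_deriv i (\<lambda>x. 0) (\<lambda>x. 0)"
  unfolding dir_deriv_def by (auto intro!: exI[of _ "\<lambda>w. 0"])

lemma dir_deriv_sum: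
  "finite A \<Longrightarrow> (\<And>j. j \<in> A \<Longrightarrow> dir_deriv i (u j) (u1 j)) \<Longrightarrow> dir_deriv i (\<lambda>x. \<Sum>j\<in>A. u j x) (\<lambda>x. \<Sum>j\<in>A. u1 j x)"
  by (induction A rule: finite_induct) (auto intro: dir_deriv_add simp: dir_deriv_zero)

text \<open>On the sphere \<open>u \<bullet> \<Delta>u = - |\<nabla>u|\<^sup>2\<close>, which turns the equation into the form used by the scheme.\<close>

lemma landau_lifshitz_form:
  fixes u :: "real^'d::finite \<Rightarrow> real^3" and u1 u2 :: "'d \<Rightarrow> real^'d \<Rightarrow> real^3"
  assumes 1: "\<And>i. dir_deriv i u (u1 i)" and 2: "\<And>i. dir_deriv i (u1 i) (u2 i)"
    and sphere: "\<And>x. x \<in> Omega_bar \<Longrightarrow> norm (u x) = 1" and x: "x \<in> Omega_bar"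
  shows "- \<alpha> *\<^sub>R cross3 (u x) (cross3 (u x) (\<epsilon> *\<^sub>R (\<Sum>i\<in>UNIV. u2 i x) + w))
    = (\<alpha> * \<epsilon>) *\<^sub>R (\<Sum>i\<in>UNIV. u2 i x) + ((\<alpha> * \<epsilon>) *\<^sub>R ((\<Sum>i\<in>UNIV. (norm (u1 i x))\<^sup>2) *\<^sub>R u x)
      - \<alpha> *\<^sub>R cross3 (u x) (cross3 (u x) w))"
proof -
  have uu: "u y \<bullet> u y = 1" if "y \<in> Omega_bar" for y
    using sphere[OF that] by (simp add: norm_eq_1)
  have u1: "u y \<bullet> u1 i y = 0" if "y \<in> Omega_bar" for i y
    using dir_deriv_inner_const[OF 1 1 uu that] by (simp add: inner_commute)
  have u2: "u x \<bullet> u2 i x = - (norm (u1 i x))\<^sup>2" for i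
    using dir_deriv_inner_const[OF 1 2 u1 x, of i] by (simp add: power2_norm_eq_inner)
  have lag: "cross3 (u x) (cross3 (u x) v) = (u x \<bullet> v) *\<^sub>R u x - v" for v
    by (simp add: Lagrange uu[OF x])
  have "u x \<bullet> (\<Sum>i\<in>UNIV. u2 i x) = - (\<Sum>i\<in>UNIV. (norm (u1 i x))\<^sup>2)"
    by (simp add: inner_sum_right u2 sum_negf)
  then show ?thesis by (simp add: lag inner_add_right algebra_simps)
qed

text \<open>The three quadratic order conditions combine to a weighted sum of squared differences of
  the two abscissae equal to \<open>1/3 - 2/3 + 1/3 = 0\<close>. As the weights of stages 2 to 4 are
  positive, explicit and implicit abscissae agree, so every stage approximates the solution at a
  single time. The last one is 1 because the last implicit row consists of the weights.\<close>

lemma abscissae: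
  assumes c: "scheme_coeffs c"
  shows "j \<in> {1..4} \<Longrightarrow> abscissa (tabI c) j = abscissa (tabE c) j"
    and "abscissa (tabE c) 1 = 0" and "abscissa (tabE c) 4 = 1"
    and "j \<in> {1..4} \<Longrightarrow> 0 \<le> abscissa (tabE c) j \<and> abscissa (tabE c) j \<le> 1"
    and "(\<Sum>l=1..4. wt c l * abscissa (tabE c) l) = 1/2" and "(\<Sum>l=1..4. wt c l) = 1"
proof -
  let ?E = "abscissa (tabE c)" and ?I = "abscissa (tabI c)"
  note b = scheme_coeffs_bounds[OF c, unfolded abs_less_iff]
  have t: "third_order_conditions c" using c by (simp add: scheme_coeffs_def)
  show w1: "(\<Sum>l=1..4. wt c l) = 1" and "(\<Sum>l=1..4. wt c l * ?E l) = 1/2"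
    using t by (simp_all add: third_order_conditions_def)
  have EE: "(\<Sum>i=1..4. wt c i * ?E i * ?E i) = 1/3" and EI: "(\<Sum>i=1..4. wt c i * ?E i * ?I i) = 1/3"
    and II: "(\<Sum>i=1..4. wt c i * ?I i * ?I i) = 1/3"
    using t by (simp_all add: third_order_conditions_def)
  have "(\<Sum>i=1..4. wt c i * (?E i - ?I i)\<^sup>2)
      = (\<Sum>i=1..4. wt c i * ?E i * ?E i) - 2 * (\<Sum>i=1..4. wt c i * ?E i * ?I i) + (\<Sum>i=1..4. wt c i * ?I i * ?I i)"
    unfolding sum_1_4 by (simp add: power2_eq_square algebra_simps)
  also have "\<dots> = 0" unfolding EE EI II by simp
  finally have "wt c 2 * (?E 2 - ?I 2)\<^sup>2 + wt c 3 * (?E 3 - ?I 3)\<^sup>2 + wt c 4 * (?E 4 - ?I 4)\<^sup>2 = 0"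
    unfolding sum_1_4 by (simp add: tableau_values(33)[simplified])
  moreover have wpos: "wt c 2 > 0" "wt c 3 > 0" "wt c 4 > 0" using b by (simp_all add: tableau_values)
  ultimately have "(?E 2 - ?I 2)\<^sup>2 = 0" "(?E 3 - ?I 3)\<^sup>2 = 0" "(?E 4 - ?I 4)\<^sup>2 = 0"
  proof -
    assume s: "wt c 2 * (?E 2 - ?I 2)\<^sup>2 + wt c 3 * (?E 3 - ?I 3)\<^sup>2 + wt c 4 * (?E 4 - ?I 4)\<^sup>2 = 0"
    have "0 \<le> wt c 2 * (?E 2 - ?I 2)\<^sup>2" "0 \<le> wt c 3 * (?E 3 - ?I 3)\<^sup>2" "0 \<le> wt c 4 * (?E 4 - ?I 4)\<^sup>2"
      using wpos by simp_all
    then have "wt c 2 * (?E 2 - ?I 2)\<^sup>2 = 0" "wt c 3 * (?E 3 - ?I 3)\<^sup>2 = 0" "wt c 4 * (?E 4 - ?I 4)\<^sup>2 = 0"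
      using s by linarith+
    then show "(?E 2 - ?I 2)\<^sup>2 = 0" "(?E 3 - ?I 3)\<^sup>2 = 0" "(?E 4 - ?I 4)\<^sup>2 = 0" using wpos by simp_all
  qed
  then have eq: "?I 2 = ?E 2" "?I 3 = ?E 3" "?I 4 = ?E 4" by simp_all
  have v: "?E 1 = 0" "?I 1 = 0" "?E 2 = c_a21 c" "?E 3 = c_a31 c + c_a32 c" "?I 4 = c_b2 c + c_b3 c + c_b4 c"
    unfolding abscissa_def sum_1_4 by (simp_all only: tableau_values add_0_left add_0_right)
  show "?E 1 = 0" by (rule v(1))
  have "?I 4 = 1" using w1 unfolding v(5) sum_1_4 by (simp only: tableau_values)
  then show E4: "?E 4 = 1" using eq(3) by simp
  have j: "j = 1 \<or> j = 2 \<or> j = 3 \<or> j = 4" if "j \<in> {1..4}" using that by auto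
  show "?I j = ?E j" if "j \<in> {1..4}" using j[OF that] v(1,2) eq by metis
  have "0 \<le> ?E 2 \<and> ?E 2 \<le> 1" "0 \<le> ?E 3 \<and> ?E 3 \<le> 1" unfolding v(3,4) using b by auto
  then show "0 \<le> ?E j \<and> ?E j \<le> 1" if "j \<in> {1..4}" using j[OF that] v(1) E4 by auto
qed

lemma tableau_bounds:
  assumes c: "scheme_coeffs c" and "j \<in> {1..4}" "l \<in> {1..4}"
  shows "\<bar>tabE c j l\<bar> \<le> 1" "\<bar>tabI c j l\<bar> \<le> 1" "\<bar>wt c l - tabE c 4 l\<bar> \<le> 1"
proof -
  note b = scheme_coeffs_bounds[OF c, unfolded abs_less_iff]
  have j: "j = 1 \<or> j = 2 \<or> j = 3 \<or> j = 4" and l: "l = 1 \<or> l = 2 \<or> l = 3 \<or> l = 4" using assms by auto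
  have co: "\<bar>c_a21 c\<bar> \<le> 1" "\<bar>c_a31 c\<bar> \<le> 1" "\<bar>c_a32 c\<bar> \<le> 1" "\<bar>c_s32 c\<bar> \<le> 1" "\<bar>c_s33 c\<bar> \<le> 1" "\<bar>c_a42 c\<bar> \<le> 1"
    "\<bar>c_a43 c\<bar> \<le> 1" "\<bar>c_b2 c\<bar> \<le> 1" "\<bar>c_b3 c\<bar> \<le> 1" "\<bar>c_b4 c\<bar> \<le> 1" "\<bar>c_b2 c - c_a42 c\<bar> \<le> 1" "\<bar>c_b3 c - c_a43 c\<bar> \<le> 1"
    using b by (simp_all add: abs_le_iff)
  show "\<bar>tabE c j l\<bar> \<le> 1" using j l by (elim disjE) (simp_all only: tableau_values co abs_zero zero_le_one diff_zero)
  show "\<bar>tabI c j l\<bar> \<le> 1" using j l by (elim disjE) (simp_all only: tableau_values co abs_zero zero_le_one diff_zero)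
  show "\<bar>wt c l - tabE c 4 l\<bar> \<le> 1" using l by (elim disjE) (simp_all only: tableau_values co abs_zero zero_le_one diff_zero)
qed

lemma stage_expansion:
  fixes a c r :: "nat \<Rightarrow> real" and \<nu> :: "nat \<Rightarrow> real^3" and k :: real
  assumes "\<And>l. l \<in> {1..4} \<Longrightarrow> n l = Q + (c l * k) *\<^sub>R W + \<nu> l"
  shows "(\<Sum>l=1..4. (a l * k) *\<^sub>R n l)
    = (k * (\<Sum>l=1..4. a l)) *\<^sub>R Q + (k\<^sup>2 * (\<Sum>l=1..4. a l * c l)) *\<^sub>R W + k *\<^sub>R (\<Sum>l=1..4. a l *\<^sub>R \<nu> l)"
proof -
  have "(\<Sum>l=1..4. (a l * k) *\<^sub>R n l) = (\<Sum>l=1..4. (k * a l) *\<^sub>R Q + (k\<^sup>2 * (a l * c l)) *\<^sub>R W + k *\<^sub>R (a l *\<^sub>R \<nu> l))"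
    by (rule sum.cong[OF refl]) (simp add: assms algebra_simps power2_eq_square)
  then show ?thesis
    by (simp add: sum.distrib sum_distrib_left scaleR_sum_left scaleR_sum_right)
qed

lemma norm_sum_1_4_le:
  fixes a :: "nat \<Rightarrow> real" and \<nu> :: "nat \<Rightarrow> 'b::real_normed_vector"
  assumes "\<And>l. l \<in> {1..4} \<Longrightarrow> \<bar>a l\<bar> \<le> 1" "\<And>l. l \<in> {1..4} \<Longrightarrow> norm (\<nu> l) \<le> M"
  shows "norm (\<Sum>l=1..4. a l *\<^sub>R \<nu> l) \<le> 4 * M"
proof -
  have "norm (\<Sum>l=1..4. a l *\<^sub>R \<nu> l) \<le> (\<Sum>l=(1::nat)..4. M)"
  proof (rule sum_norm_le)
    fix l :: nat assume l: "l \<in> {1..4}"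
    have "\<bar>a l\<bar> * norm (\<nu> l) \<le> 1 * norm (\<nu> l)" by (intro mult_right_mono assms(1)[OF l]) simp
    then show "norm (a l *\<^sub>R \<nu> l) \<le> M" using assms(2)[OF l] by simp
  qed
  then show ?thesis by simp
qed

text \<open>
  With \<open>Q\<close> the reaction term and \<open>W\<close> its time derivative, the stages are
  \<open>\<Phi>(t + c\<^sub>j k) + k\<^sup>2 (p\<^sub>j \<Phi>\<^sub>t\<^sub>t + q\<^sub>j W)\<close> with \<open>p\<^sub>j = \<Sum> a\<^sup>I\<^sub>j\<^sub>l c\<^sub>l - c\<^sub>j\<^sup>2/2\<close> and \<open>q\<^sub>j = \<Sum> (a\<^sup>E\<^sub>j\<^sub>l - a\<^sup>I\<^sub>j\<^sub>l) c\<^sub>l\<close>; this cancels the terms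
  of order \<open>k\<^sup>2\<close> in the stage residuals.  \<open>W\<close> need not satisfy the Neumann condition.
\<close>

lemma comparison_exists:
  fixes c :: imex_coeffs and \<alpha> \<epsilon> T C2 F :: real and f :: "real^'d::finite \<Rightarrow> real^3" and \<Phi> :: "real^'d \<Rightarrow> real \<Rightarrow> real^3"
  assumes coeffs: "scheme_coeffs c" and pos: "\<alpha> > 0" "\<epsilon> > 0" "T > 0" "C2 > 0"
    and F: "\<And>x. x \<in> Omega_bar \<Longrightarrow> norm (f x) \<le> F"
    and sol: "exact_solution 4 \<alpha> \<epsilon> f T \<Phi>"
  shows "\<exists>B\<ge>0. \<exists>R\<ge>0. \<forall>N k n. N \<ge> 1 \<longrightarrow> 0 < k \<longrightarrow> k \<le> 1 \<longrightarrow> k \<le> C2 * (1 / real N) \<longrightarrow> real (Suc n) * k \<le> T \<longrightarrow>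
    (\<exists>Y. comparison c \<alpha> (\<alpha> * \<epsilon>) f N k B R Y \<and> Y 1 = P_h N (\<lambda>x. \<Phi> x (real n * k)) \<and>
      Y 5 = P_h N (\<lambda>x. \<Phi> x (real (Suc n) * k)))"
proof -
  define \<beta> where "\<beta> = \<alpha> * \<epsilon>"
  have \<beta>: "\<beta> > 0" using pos by (simp add: \<beta>_def)
  let ?d = "real CARD('d)"
  note SD = smooth_derivatives[OF pos(3)]
  define Ut where "Ut = dt T \<Phi>"
  define Utt where "Utt = dt T Ut"
  define Uttt where "Uttt = dt T Utt"
  define S1 where "S1 i = sp i \<Phi>" for i
  define S2 where "S2 i = sp i (S1 i)" for i
  define S3 where "S3 i = sp i (S2 i)" for i
  define S4 where "S4 i = sp i (S3 i)" for i
  define Dt where "Dt i = dt T (S2 i)" for i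
  define Dtt where "Dtt i = dt T (Dt i)" for i
  define X1 where "X1 j = sp j Utt" for j
  \<comment> \<open>Derivative in direction \<open>j\<close> of the time derivative of the second
    derivative in direction \<open>i\<close>. Together with \<open>S4\<close> and \<open>Dtt\<close>
    it exhausts the four orders of smoothness.\<close>
  define X2 where "X2 = (\<lambda>(j, i). sp j (Dt i))"
  have sU: "smooth 4 T \<Phi>" using sol by (simp add: exact_solution_def smooth_def)
  have n4: "4 = Suc 3" "3 = Suc 2" "2 = Suc 1" "1 = Suc 0" by simp_all
  have sUt: "smooth 3 T Ut" unfolding Ut_def using SD(2)[OF sU[unfolded n4(1)]] .
  have sUtt: "smooth 2 T Utt" unfolding Utt_def using SD(2)[OF sUt[unfolded n4(2)]] .
  have sUttt: "smooth 1 T Uttt" unfolding Uttt_def using SD(2)[OF sUtt[unfolded n4(3)]] .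
  have sS1: "smooth 3 T (S1 i)" for i unfolding S1_def using SD(1)[OF sU[unfolded n4(1)]] .
  have sS2: "smooth 2 T (S2 i)" for i unfolding S2_def using SD(1)[OF sS1[unfolded n4(2)]] .
  have sS3: "smooth 1 T (S3 i)" for i unfolding S3_def using SD(1)[OF sS2[unfolded n4(3)]] .
  have sS4: "smooth 0 T (S4 i)" for i unfolding S4_def using SD(1)[OF sS3[unfolded n4(4)]] .
  have sDt: "smooth 1 T (Dt i)" for i unfolding Dt_def using SD(2)[OF sS2[unfolded n4(3)]] .
  have sDtt: "smooth 0 T (Dtt i)" for i unfolding Dtt_def using SD(2)[OF sDt[unfolded n4(4)]] .
  have sX1: "smooth 1 T (X1 j)" for j unfolding X1_def using SD(1)[OF sUtt[unfolded n4(3)]] .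
  have sX2: "smooth 0 T (X2 ji)" for ji
    unfolding X2_def using SD(1)[OF sDt[unfolded n4(4)]] by (simp add: case_prod_beta)
  obtain b1 where b1: "b1 \<ge> 0" "\<forall>x\<in>Omega_bar. \<forall>t\<in>{0..T}. norm (\<Phi> x t) \<le> b1" using smooth_bounded[OF sU] by blast
  obtain b2 where b2: "b2 \<ge> 0" "\<forall>x\<in>Omega_bar. \<forall>t\<in>{0..T}. norm (Utt x t) \<le> b2" using smooth_bounded[OF sUtt] by blast
  obtain b3 where b3: "b3 \<ge> 0" "\<forall>x\<in>Omega_bar. \<forall>t\<in>{0..T}. norm (Uttt x t) \<le> b3" using smooth_bounded[OF sUttt] by blast
  obtain b4 where b4: "b4 \<ge> 0" "\<forall>i. \<forall>x\<in>Omega_bar. \<forall>t\<in>{0..T}. norm (S1 i x t) \<le> b4" using smooth_bounded_family[where U = S1, OF sS1] by blast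
  obtain b5 where b5: "b5 \<ge> 0" "\<forall>i. \<forall>x\<in>Omega_bar. \<forall>t\<in>{0..T}. norm (S3 i x t) \<le> b5" using smooth_bounded_family[where U = S3, OF sS3] by blast
  obtain b6 where b6: "b6 \<ge> 0" "\<forall>i. \<forall>x\<in>Omega_bar. \<forall>t\<in>{0..T}. norm (S4 i x t) \<le> b6" using smooth_bounded_family[where U = S4, OF sS4] by blast
  obtain b7 where b7: "b7 \<ge> 0" "\<forall>i. \<forall>x\<in>Omega_bar. \<forall>t\<in>{0..T}. norm (Dt i x t) \<le> b7" using smooth_bounded_family[where U = Dt, OF sDt] by blast
  obtain b8 where b8: "b8 \<ge> 0" "\<forall>i. \<forall>x\<in>Omega_bar. \<forall>t\<in>{0..T}. norm (Dtt i x t) \<le> b8" using smooth_bounded_family[where U = Dtt, OF sDtt] by blast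
  obtain b9 where b9: "b9 \<ge> 0" "\<forall>i. \<forall>x\<in>Omega_bar. \<forall>t\<in>{0..T}. norm (X1 i x t) \<le> b9" using smooth_bounded_family[where U = X1, OF sX1] by blast
  obtain b0 where b0: "b0 \<ge> 0" "\<forall>i. \<forall>x\<in>Omega_bar. \<forall>t\<in>{0..T}. norm (X2 i x t) \<le> b0" using smooth_bounded_family[where U = X2, OF sX2] by blast
  define b where "b = b1 + b2 + b3 + b4 + b5 + b6 + b7 + b8 + b9 + b0"
  have b_ge: "b \<ge> 0" "b1 \<le> b" "b2 \<le> b" "b3 \<le> b" "b4 \<le> b" "b5 \<le> b" "b6 \<le> b" "b7 \<le> b" "b8 \<le> b" "b9 \<le> b" "b0 \<le> b"
    using b1(1) b2(1) b3(1) b4(1) b5(1) b6(1) b7(1) b8(1) b9(1) b0(1) by (simp_all add: b_def)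
  have bd: "norm (\<Phi> x t) \<le> b" "norm (Utt x t) \<le> b" "norm (Uttt x t) \<le> b" "norm (S1 i x t) \<le> b"
    "norm (S3 i x t) \<le> b" "norm (S4 i x t) \<le> b" "norm (Dt i x t) \<le> b" "norm (Dtt i x t) \<le> b"
    "norm (X1 i x t) \<le> b" "norm (X2 ji x t) \<le> b" if "x \<in> Omega_bar" "t \<in> {0..T}" for x t i ji
    using b1(2) b2(2) b3(2) b4(2) b5(2) b6(2) b7(2) b8(2) b9(2) b0(2) b_ge that by (meson order_trans)+
  have dS: "dir_deriv i (\<lambda>y. \<Phi> y t) (\<lambda>y. S1 i y t)" "dir_deriv i (\<lambda>y. S1 i y t) (\<lambda>y. S2 i y t)"
    "dir_deriv i (\<lambda>y. S2 i y t) (\<lambda>y. S3 i y t)" "dir_deriv i (\<lambda>y. S3 i y t) (\<lambda>y. S4 i y t)"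
    "dir_deriv i (\<lambda>y. Utt y t) (\<lambda>y. X1 i y t)" "dir_deriv i (\<lambda>y. Dt l y t) (\<lambda>y. X2 (i, l) y t)"
    if "t \<in> {0..T}" for i l t
    unfolding S1_def S2_def S3_def S4_def X1_def X2_def prod.case
    using SD(3)[OF sU[unfolded n4(1)] that] SD(3)[OF sS1[unfolded n4(2)] that] SD(3)[OF sS2[unfolded n4(3)] that]
      SD(3)[OF sS3[unfolded n4(4)] that] SD(3)[OF sUtt[unfolded n4(3)] that] SD(3)[OF sDt[unfolded n4(4)] that]
    unfolding S1_def S2_def S3_def by auto
  have dT: "(\<Phi> x has_vector_derivative Ut x t) (at t within {0..T})"
    "(Ut x has_vector_derivative Utt x t) (at t within {0..T})"
    "(Utt x has_vector_derivative Uttt x t) (at t within {0..T})"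
    "(S2 i x has_vector_derivative Dt i x t) (at t within {0..T})"
    "(Dt i x has_vector_derivative Dtt i x t) (at t within {0..T})"
    if "x \<in> Omega_bar" "t \<in> {0..T}" for x t i
    unfolding Ut_def Utt_def Uttt_def Dt_def Dtt_def
    using SD(4)[OF sU[unfolded n4(1)] that] SD(4)[OF sUt[unfolded n4(2)] that] SD(4)[OF sUtt[unfolded n4(3)] that]
      SD(4)[OF sS2[unfolded n4(3)] that] SD(4)[OF sDt[unfolded n4(4)] that]
    unfolding Ut_def Utt_def Dt_def by auto
  have bc: "S1 i x t = 0" if "t \<in> {0..T}" "x \<in> Omega_bar" "x $ i = 0 \<or> x $ i = 1" for i x t
    using sol that unfolding exact_solution_def neumann_def S1_def by blast
  define lapl where "lapl x t = (\<Sum>i\<in>UNIV. S2 i x t)" for x t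
  define lapt where "lapt x t = (\<Sum>i\<in>UNIV. Dt i x t)" for x t
  have lap_eq: "lap (\<lambda>y. \<Phi> y t) x = lapl x t" for x t
    by (simp add: lap_def lapl_def S2_def S1_def)
  \<comment> \<open>By the equation this is the time derivative of \<open>Qf\<close> in the
    interior; in this form \<open>Qf\<close> need not be differentiated.\<close>
  define W where "W x t = Utt x t - \<beta> *\<^sub>R lapt x t" for x t
  define Qf where "Qf x t = \<beta> *\<^sub>R ((\<Sum>i\<in>UNIV. (norm (S1 i x t))\<^sup>2) *\<^sub>R \<Phi> x t) - \<alpha> *\<^sub>R cross3 (\<Phi> x t) (cross3 (\<Phi> x t) (f x))" for x t
  have pde: "Ut x t = \<beta> *\<^sub>R lapl x t + Qf x t" if x: "x \<in> Omega" and t: "t \<in> {0..T}" for x t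
  proof -
    have xb: "x \<in> Omega_bar" using x box_subset_cbox by blast
    have "Ut x t = - \<alpha> *\<^sub>R cross3 (\<Phi> x t) (cross3 (\<Phi> x t) (\<epsilon> *\<^sub>R lap (\<lambda>y. \<Phi> y t) x + f x))"
      using sol x t unfolding exact_solution_def Ut_def by blast
    also have "\<dots> = \<beta> *\<^sub>R lapl x t + Qf x t"
      unfolding lap_eq lapl_def Qf_def \<beta>_def
    proof (rule landau_lifshitz_form[OF dS(1,2)[OF t] _ xb])
      show "norm (\<Phi> y t) = 1" if "y \<in> Omega_bar" for y
        using sol that t unfolding exact_solution_def by blast
    qed
    finally show ?thesis .
  qed
  define ca where "ca = abscissa (tabE c)"
  define accE where "accE j = (\<Sum>l=1..4. tabE c j l * ca l)" for j
  define accI where "accI j = (\<Sum>l=1..4. tabI c j l * ca l)" for j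
  define p where "p j = accI j - (ca j)\<^sup>2 / 2" for j
  define q where "q j = accE j - accI j" for j
  define Kc where "Kc = (\<Sum>j=1..4. \<bar>p j\<bar> + \<bar>q j\<bar>)"
  have pq: "\<bar>p j\<bar> + \<bar>q j\<bar> \<le> Kc" if "j \<in> {1..4}" for j
    unfolding Kc_def using that by (intro member_le_sum) auto
  have Kc0: "Kc \<ge> 0" by (simp add: Kc_def sum_nonneg)
  have ca: "0 \<le> ca j" "ca j \<le> 1" if "j \<in> {1..4}" for j using abscissae(4)[OF coeffs that] by (simp_all add: ca_def)
  have ca14: "ca 1 = 0" "ca 4 = 1" using abscissae(2,3)[OF coeffs] by (simp_all add: ca_def)
  have sE: "(\<Sum>l=1..4. tabE c j l) = ca j" for j by (simp add: ca_def abscissa_def)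
  have sI: "(\<Sum>l=1..4. tabI c j l) = ca j" if "j \<in> {1..4}" for j
    using abscissae(1)[OF coeffs that] by (simp add: ca_def abscissa_def)
  define ys where "ys j x t = p j *\<^sub>R Utt x t + q j *\<^sub>R W x t" for j x t
  define yb where "yb = Kc * (b + \<beta> * (?d * b))"
  have yb0: "yb \<ge> 0" using Kc0 b_ge \<beta> by (simp add: yb_def)
  define ys1 where "ys1 j i x t = p j *\<^sub>R X1 i x t + q j *\<^sub>R (X1 i x t - \<beta> *\<^sub>R (\<Sum>l\<in>UNIV. X2 (i, l) x t))" for j i x t
  have comb: "norm (p j *\<^sub>R u + q j *\<^sub>R (u - \<beta> *\<^sub>R (\<Sum>l\<in>UNIV. z l))) \<le> yb"
    if "j \<in> {1..4}" "norm u \<le> b" "\<And>l. norm (z l) \<le> b" for j and u :: "real^3" and z :: "'d \<Rightarrow> real^3"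
  proof -
    have zs: "norm (\<Sum>l\<in>UNIV. z l) \<le> ?d * b"
      using sum_norm_bound[of UNIV z b] that(3) by simp
    have w: "norm (u - \<beta> *\<^sub>R (\<Sum>l\<in>UNIV. z l)) \<le> b + \<beta> * (?d * b)"
      using norm_triangle_ineq4[of u "\<beta> *\<^sub>R (\<Sum>l\<in>UNIV. z l)"] that(2) mult_left_mono[OF zs, of \<beta>] \<beta> by (simp only: norm_scaleR abs_of_pos) linarith
    have u: "norm u \<le> b + \<beta> * (?d * b)" using that(2) \<beta> b_ge by (simp add: add_increasing2)
    have "norm (p j *\<^sub>R u + q j *\<^sub>R (u - \<beta> *\<^sub>R (\<Sum>l\<in>UNIV. z l)))
        \<le> \<bar>p j\<bar> * (b + \<beta> * (?d * b)) + \<bar>q j\<bar> * (b + \<beta> * (?d * b))"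
      by (intro norm_triangle_le add_mono) (simp_all only: norm_scaleR, intro mult_left_mono u abs_ge_zero, intro mult_left_mono w abs_ge_zero)
    also have "\<dots> = (\<bar>p j\<bar> + \<bar>q j\<bar>) * (b + \<beta> * (?d * b))" by (simp add: distrib_right)
    also have "\<dots> \<le> yb" unfolding yb_def using pq[OF that(1)] \<beta> b_ge by (intro mult_right_mono) auto
    finally show ?thesis .
  qed
  have ys_1: "ys 1 x t = 0" for x t
  proof -
    have "accE 1 = 0" "accI 1 = 0" unfolding accE_def accI_def sum_1_4 by (simp_all only: tableau_values mult_zero_left add_0_left)
    then show ?thesis unfolding ys_def p_def q_def ca14 by simp
  qed
  have ys_b: "norm (ys j x t) \<le> yb" if "j \<in> {1..4}" "x \<in> Omega_bar" "t \<in> {0..T}" for j x t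
    unfolding ys_def W_def lapt_def by (rule comb[OF that(1) bd(2)[OF that(2,3)] bd(7)[OF that(2,3)]])
  have ys1_b: "norm (ys1 j i x t) \<le> yb" if "j \<in> {1..4}" "x \<in> Omega_bar" "t \<in> {0..T}" for j i x t
    unfolding ys1_def by (rule comb[OF that(1) bd(9)[OF that(2,3)] bd(10)[OF that(2,3)]])
  have ys_d: "dir_deriv i (\<lambda>x. ys j x t) (\<lambda>x. ys1 j i x t)" if t: "t \<in> {0..T}" for j i t
  proof -
    have "dir_deriv i (\<lambda>x. Utt x t + (- \<beta>) *\<^sub>R (\<Sum>l\<in>UNIV. Dt l x t)) (\<lambda>x. X1 i x t + (- \<beta>) *\<^sub>R (\<Sum>l\<in>UNIV. X2 (i, l) x t))"
      by (intro dir_deriv_add dir_deriv_scale dir_deriv_sum dS(5,6)[OF t]) simp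
    from dir_deriv_add[OF dir_deriv_scale[OF dS(5)[OF t, of i], where r = "p j"] dir_deriv_scale[OF this, where r = "q j"]]
    show ?thesis by (simp add: ys_def ys1_def W_def lapt_def)
  qed
  define B where "B = b + yb"
  have B0: "B \<ge> 0" using b_ge yb0 by (simp add: B_def)
  have F0: "F \<ge> 0"
  proof -
    have "(0 :: real^'d) \<in> Omega_bar" by (simp add: Omega_bar_iff)
    then show ?thesis using F norm_ge_zero order_trans by blast
  qed
  define MM where "MM = \<beta> * (?d * B\<^sup>2 + 2 * B\<^sup>2) + 2 * \<alpha> * B * F"
  have MM0: "MM \<ge> 0" using \<beta> pos B0 F0 by (simp add: MM_def)
  define Cn where "Cn = (MM * (yb + ?d * yb) + (b + \<beta> * (?d * b))) * C2\<^sup>2 + 4 * \<beta> * ?d * b ^ 3"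
  have Cn0: "Cn \<ge> 0" using MM0 yb0 b_ge \<beta> by (simp add: Cn_def)
  \<comment> \<open>The summands account, in order, for the time expansion of \<open>\<Phi>\<close>,
    the nonlinear terms, the time expansion of the Laplacian, its space discretization, and the
    Laplacian of the corrections.\<close>
  define R where "R = b * C2\<^sup>2 + 4 * Cn + 4 * (\<beta> * (?d * b)) * C2\<^sup>2 + 4 * \<beta> * (?d * b) + 4 * \<beta> * (?d * yb) * C2\<^sup>2"
  have R_ge: "4 * Cn \<le> R" and R0: "R \<ge> 0" using Cn0 b_ge yb0 \<beta> by (simp_all add: R_def)
  show ?thesis
  proof (rule exI[of _ B], intro conjI B0, rule exI[of _ R], intro conjI R0, (intro allI impI)+)
    fix N n :: nat and k :: real
    assume N: "N \<ge> 1" and k0: "0 < k" and k1: "k \<le> 1" and kC2: "k \<le> C2 * (1 / real N)" and nk: "real (Suc n) * k \<le> T"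
    define h where "h = 1 / real N"
    define t where "t = real n * k"
    define s where "s l = t + ca l * k" for l
    have h: "h > 0" "h \<le> 1" using N by (simp_all add: h_def)
    have kh: "k\<^sup>2 \<le> C2\<^sup>2 * h\<^sup>2"
      using power_mono[OF kC2, of 2] k0 by (simp add: h_def power_mult_distrib power_divide)
    have tk: "0 \<le> t" "t + k \<le> T" using nk k0 by (simp_all add: t_def distrib_right)
    have t: "t \<in> {0..T}" using tk k0 by simp
    have s: "s l \<in> {0..T}" and sd: "\<bar>s l - t\<bar> \<le> k" if "l \<in> {1..4}" for l
    proof -
      have "0 \<le> ca l * k" "ca l * k \<le> k" using ca[OF that] k0 by (simp_all add: mult_left_le_one_le)
      then show "s l \<in> {0..T}" "\<bar>s l - t\<bar> \<le> k" using tk by (simp_all add: s_def)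
    qed
    have s_diff: "s l - t = ca l * k" for l by (simp add: s_def)
    note gp = grid_point_in[OF N h_def]
    note hN = N h_def
    define Y where "Y j = (if j = 5 then P_h N (\<lambda>x. \<Phi> x (t + k)) else P_h N (\<lambda>x. \<Phi> x (s j) + k\<^sup>2 *\<^sub>R ys j x t))" for j :: nat
    have Yj: "Y j = P_h N (\<lambda>x. \<Phi> x (s j) + k\<^sup>2 *\<^sub>R ys j x t)" if "j \<in> {1..4}" for j using that by (auto simp: Y_def)
    have Yg: "Y j I = \<Phi> (grid_point N I) (s j) + k\<^sup>2 *\<^sub>R ys j (grid_point N I) t" if "j \<in> {1..4}" "I \<in> grid N" for j I
      by (simp add: Yj[OF that(1)] P_h_grid[OF hN that(2)])
    have k2: "k\<^sup>2 \<le> 1" using k0 k1 by (simp add: power_le_one)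
    have k2y: "norm (k\<^sup>2 *\<^sub>R z) \<le> yb" if "norm z \<le> yb" for z :: "real^3"
      using mult_right_mono[OF k2, of "norm z"] that by simp
    define rn where "rn l I = N_h \<alpha> \<beta> f N (Y l) I - (Qf (grid_point N I) t + (ca l * k) *\<^sub>R W (grid_point N I) t)" for l I
    define rl where "rl l x = lapl x (s l) - lapl x t - (ca l * k) *\<^sub>R lapt x t" for l x
    define ru where "ru j x = \<Phi> x (s j) - \<Phi> x t - (ca j * k) *\<^sub>R Ut x t - ((ca j * k)\<^sup>2 / 2) *\<^sub>R Utt x t" for j x
    define DD where "DD l I = lap_h N (P_h N (\<lambda>x. \<Phi> x (s l))) I - (\<Sum>i\<in>UNIV. S2 i (grid_point N I) (s l))" for l I
    define EE where "EE l = lap_h N (P_h N (\<lambda>x. ys l x t))" for l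
    have Ygrad: "norm (grad_h N (Y j) i I) \<le> B" if j: "j \<in> {1..4}" and I: "I \<in> midpoints N i" for j i I
      unfolding Yj[OF j]
    proof (rule grad_P_h_bound[OF hN _ _ I])
      show "dir_deriv i (\<lambda>x. \<Phi> x (s j) + k\<^sup>2 *\<^sub>R ys j x t) (\<lambda>x. S1 i x (s j) + k\<^sup>2 *\<^sub>R ys1 j i x t)"
        by (intro dir_deriv_add dir_deriv_scale dS(1)[OF s[OF j]] ys_d[OF t])
      show "norm (S1 i x (s j) + k\<^sup>2 *\<^sub>R ys1 j i x t) \<le> B" if "x \<in> Omega_bar" for x
        unfolding B_def by (intro norm_triangle_le add_mono bd(4)[OF that s[OF j]] k2y ys1_b[OF j that t])
    qed
    have Ybound: "norm (Y j I) \<le> B" if j: "j \<in> {1..4}" and I: "I \<in> grid N" for j I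
      unfolding Yg[OF j I] B_def
      by (intro norm_triangle_le add_mono bd(1)[OF gp(2)[OF I] s[OF j]] k2y ys_b[OF j gp(2)[OF I] t])
    have rl_b: "norm (rl l x) \<le> ?d * b * k\<^sup>2" if l: "l \<in> {1..4}" and x: "x \<in> Omega_bar" for l x
    proof -
      have "rl l x = (\<Sum>i\<in>UNIV. S2 i x (s l) - S2 i x t - (s l - t) *\<^sub>R Dt i x t)"
        by (simp add: rl_def lapl_def lapt_def s_diff sum_subtractf scaleR_sum_right)
      also have "norm \<dots> \<le> (\<Sum>i\<in>(UNIV::'d set). b * k\<^sup>2)"
      proof (rule sum_norm_le)
        fix i
        have "norm (S2 i x (s l) - S2 i x t - (s l - t) *\<^sub>R Dt i x t) \<le> b * (s l - t)\<^sup>2"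
          by (rule taylor2[OF convex_real_interval(5) t s[OF l] dT(4)[OF x] dT(5)[OF x] bd(8)[OF x]])
        also have "\<dots> \<le> b * k\<^sup>2" using sd[OF l] k0 b_ge by (intro mult_left_mono) (simp_all add: abs_le_square_iff[symmetric])
        finally show "norm (S2 i x (s l) - S2 i x t - (s l - t) *\<^sub>R Dt i x t) \<le> b * k\<^sup>2" .
      qed
      finally show ?thesis by simp
    qed
    have ru_b: "norm (ru j x) \<le> b * k ^ 3" if j: "j \<in> {1..4}" and x: "x \<in> Omega_bar" for j x
    proof -
      have "norm (\<Phi> x (s j) - \<Phi> x t - (s j - t) *\<^sub>R Ut x t - ((s j - t)\<^sup>2 / 2) *\<^sub>R Utt x t) \<le> b * \<bar>s j - t\<bar> ^ 3"
        by (rule taylor3[OF convex_real_interval(5) t s[OF j] dT(1)[OF x] dT(2)[OF x] dT(3)[OF x] bd(3)[OF x]])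
      also have "\<dots> \<le> b * k ^ 3" using sd[OF j] b_ge by (intro mult_left_mono power_mono) auto
      finally show ?thesis by (simp add: ru_def s_diff)
    qed
    have rn_b: "norm (rn l I) \<le> Cn * h\<^sup>2" if l: "l \<in> {1..4}" and I: "I \<in> grid N" for l I
    proof -
      let ?x = "grid_point N I" and ?P = "P_h N (\<lambda>x. \<Phi> x (s l))"
      have xb: "?x \<in> Omega_bar" and xo: "?x \<in> Omega" using gp I by auto
      have Pgrad: "norm (grad_h N ?P i J) \<le> B" if "J \<in> midpoints N i" for i J
      proof -
        have "norm (grad_h N ?P i J) \<le> b" by (rule grad_P_h_bound[OF hN dS(1)[OF s[OF l]] bd(4)[OF _ s[OF l]] that])
        then show ?thesis using yb0 by (simp add: B_def)
      qed
      have Pb: "norm (?P I) \<le> B"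
        using bd(1)[OF xb s[OF l]] yb0 by (simp add: P_h_grid[OF hN I] B_def)
      have YP: "Y l - ?P = P_h N (\<lambda>x. k\<^sup>2 *\<^sub>R ys l x t)"
        by (simp add: Yj[OF l] fun_eq_iff P_h_def)
      have YPg: "norm (grad_h N (Y l - ?P) i J) \<le> k\<^sup>2 * yb" if "J \<in> midpoints N i" for i J
        unfolding YP
      proof (rule grad_P_h_bound[OF hN dir_deriv_scale[OF ys_d[OF t]] _ that])
        show "norm (k\<^sup>2 *\<^sub>R ys1 l i x t) \<le> k\<^sup>2 * yb" if "x \<in> Omega_bar" for x
          using mult_left_mono[OF ys1_b[OF l that t], of "k\<^sup>2"] by simp
      qed
      have "norm (N_h \<alpha> \<beta> f N (Y l) I - N_h \<alpha> \<beta> f N ?P I)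
          \<le> MM * (norm (Y l I - ?P I) + (\<Sum>i\<in>UNIV. norm (avg_grad_h N (Y l - ?P) i I)))"
        unfolding MM_def
      proof (rule N_h_lipschitz)
        show "norm (avg_grad_h N (Y l) i I) \<le> B" for i by (rule avg_grad_le[OF Ygrad[OF l] I])
        show "norm (avg_grad_h N ?P i I) \<le> B" for i by (rule avg_grad_le[OF Pgrad I])
      qed (use pos \<beta> F[OF xb] Ybound[OF l I] Pb in auto)
      also have "\<dots> \<le> MM * (k\<^sup>2 * yb + (\<Sum>i\<in>(UNIV::'d set). k\<^sup>2 * yb))"
      proof (intro mult_left_mono MM0 add_mono sum_mono)
        have "Y l I - ?P I = k\<^sup>2 *\<^sub>R ys l ?x t" by (simp add: Yg[OF l I] P_h_grid[OF hN I])
        then show "norm (Y l I - ?P I) \<le> k\<^sup>2 * yb" using mult_left_mono[OF ys_b[OF l xb t], of "k\<^sup>2"] by simp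
        show "norm (avg_grad_h N (Y l - ?P) i I) \<le> k\<^sup>2 * yb" for i by (rule avg_grad_le[OF YPg I])
      qed
      finally have e1: "norm (N_h \<alpha> \<beta> f N (Y l) I - N_h \<alpha> \<beta> f N ?P I) \<le> MM * (yb + ?d * yb) * k\<^sup>2"
        by (simp add: algebra_simps)
      have e2: "norm (N_h \<alpha> \<beta> f N ?P I - Qf ?x (s l)) \<le> 4 * \<beta> * ?d * b ^ 3 * h\<^sup>2"
        unfolding Qf_def
        by (rule N_h_consistency[OF hN dS(1,2,3)[OF s[OF l]] bd(1)[OF _ s[OF l]] bd(4)[OF _ s[OF l]]
              bd(5)[OF _ s[OF l]] b_ge(1) bc[OF s[OF l]] less_imp_le[OF \<beta>] I])
      \<comment> \<open>The increment of \<open>Qf\<close> in time is evaluated through the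
        equation, as an increment of \<open>Ut\<close> minus one of the Laplacian. The equation
        holds at interior points, which all grid points are.\<close>
      have Qs: "Qf ?x (s l) = Ut ?x (s l) - \<beta> *\<^sub>R lapl ?x (s l)" and Qt: "Qf ?x t = Ut ?x t - \<beta> *\<^sub>R lapl ?x t"
        using pde[OF xo s[OF l]] pde[OF xo t] by simp_all
      have e3: "norm (Ut ?x (s l) - Ut ?x t - (ca l * k) *\<^sub>R Utt ?x t) \<le> b * k\<^sup>2"
      proof -
        have "norm (Ut ?x (s l) - Ut ?x t - (s l - t) *\<^sub>R Utt ?x t) \<le> b * (s l - t)\<^sup>2"
          by (rule taylor2[OF convex_real_interval(5) t s[OF l] dT(2)[OF xb] dT(3)[OF xb] bd(3)[OF xb]])
        also have "\<dots> \<le> b * k\<^sup>2" using sd[OF l] k0 b_ge by (intro mult_left_mono) (simp_all add: abs_le_square_iff[symmetric])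
        finally show ?thesis by (simp add: s_diff)
      qed
      have e4: "norm (\<beta> *\<^sub>R rl l ?x) \<le> \<beta> * (?d * b * k\<^sup>2)"
        using mult_left_mono[OF rl_b[OF l xb], of \<beta>] \<beta> by simp
      have "rn l I = (N_h \<alpha> \<beta> f N (Y l) I - N_h \<alpha> \<beta> f N ?P I) + (N_h \<alpha> \<beta> f N ?P I - Qf ?x (s l))
          + ((Ut ?x (s l) - Ut ?x t - (ca l * k) *\<^sub>R Utt ?x t) - \<beta> *\<^sub>R rl l ?x)"
        unfolding rn_def Qs Qt W_def rl_def by (simp add: algebra_simps)
      also have "norm \<dots> \<le> (MM * (yb + ?d * yb) * k\<^sup>2 + 4 * \<beta> * ?d * b ^ 3 * h\<^sup>2) + (b * k\<^sup>2 + \<beta> * (?d * b * k\<^sup>2))"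
        by (rule order_trans[OF norm_triangle_ineq add_mono[OF order_trans[OF norm_triangle_ineq add_mono[OF e1 e2]]
              order_trans[OF norm_triangle_ineq4 add_mono[OF e3 e4]]]])
      also have "\<dots> = (MM * (yb + ?d * yb) + (b + \<beta> * (?d * b))) * k\<^sup>2 + 4 * \<beta> * ?d * b ^ 3 * h\<^sup>2"
        by (simp add: algebra_simps)
      also have "\<dots> \<le> (MM * (yb + ?d * yb) + (b + \<beta> * (?d * b))) * (C2\<^sup>2 * h\<^sup>2) + 4 * \<beta> * ?d * b ^ 3 * h\<^sup>2"
        using MM0 yb0 b_ge \<beta> by (intro add_right_mono mult_left_mono kh) auto
      also have "\<dots> = Cn * h\<^sup>2" by (simp add: Cn_def algebra_simps)
      finally show ?thesis .
    qed
    have one: "(1::nat) \<in> {1..4}" by simp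
    \<comment> \<open>All explicit terms of orders \<open>k\<close> and \<open>k^2\<close> in the
      time expansion have cancelled. \<open>EE\<close> carries \<open>k^3\<close> because the
      corrections have the factor \<open>k^2\<close> and the Laplacian enters with another
      \<open>k\<close>.\<close>
    have res: "stage_residual c \<alpha> \<beta> f N k Y j I
        = (ru j (grid_point N I) - k *\<^sub>R (\<Sum>l=1..4. tabE c j l *\<^sub>R rn l I) - (k * \<beta>) *\<^sub>R (\<Sum>l=1..4. tabI c j l *\<^sub>R rl l (grid_point N I)))
          - (k * \<beta>) *\<^sub>R (\<Sum>l=1..4. tabI c j l *\<^sub>R DD l I) - (k ^ 3 * \<beta>) *\<^sub>R (\<Sum>l=1..4. tabI c j l *\<^sub>R EE l I)"
      if j: "j \<in> {1..4}" and I: "I \<in> grid N" for j I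
    proof -
      let ?x = "grid_point N I"
      have xo: "?x \<in> Omega" using gp I by auto
      have Y1: "Y 1 I = \<Phi> ?x t" using Yg[OF one I] unfolding ys_1 s_def ca14 by (simp only: mult_zero_left scaleR_zero_right add_0_right)
      have nE: "(\<Sum>l=1..4. (tabE c j l * k) *\<^sub>R N_h \<alpha> \<beta> f N (Y l) I)
          = (k * ca j) *\<^sub>R Qf ?x t + (k\<^sup>2 * accE j) *\<^sub>R W ?x t + k *\<^sub>R (\<Sum>l=1..4. tabE c j l *\<^sub>R rn l I)"
        unfolding sE[of j, symmetric] accE_def by (rule stage_expansion) (simp add: rn_def)
      have LY: "L_h \<beta> N (Y l) I = \<beta> *\<^sub>R lapl ?x t + (ca l * k) *\<^sub>R (\<beta> *\<^sub>R lapt ?x t)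
          + (\<beta> *\<^sub>R rl l ?x + \<beta> *\<^sub>R DD l I + (\<beta> * k\<^sup>2) *\<^sub>R EE l I)" if l: "l \<in> {1..4}" for l
      proof -
        have "Y l = P_h N (\<lambda>x. \<Phi> x (s l)) + k\<^sup>2 *\<^sub>R P_h N (\<lambda>x. ys l x t)"
          by (simp add: Yj[OF l] fun_eq_iff P_h_def)
        then have "lap_h N (Y l) I = lap_h N (P_h N (\<lambda>x. \<Phi> x (s l))) I + k\<^sup>2 *\<^sub>R EE l I"
          using linear_add[OF linear_lap_h[of 1 N], of "P_h N (\<lambda>x. \<Phi> x (s l))" "k\<^sup>2 *\<^sub>R P_h N (\<lambda>x. ys l x t)"]
            linear_scale[OF linear_lap_h[of 1 N], of "k\<^sup>2" "P_h N (\<lambda>x. ys l x t)"]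
          by (simp add: EE_def)
        then show ?thesis
          by (simp add: L_h_def DD_def rl_def lapl_def[symmetric] algebra_simps)
      qed
      have nI: "(\<Sum>l=1..4. (tabI c j l * k) *\<^sub>R L_h \<beta> N (Y l) I)
          = (k * ca j) *\<^sub>R (\<beta> *\<^sub>R lapl ?x t) + (k\<^sup>2 * accI j) *\<^sub>R (\<beta> *\<^sub>R lapt ?x t)
            + k *\<^sub>R (\<Sum>l=1..4. tabI c j l *\<^sub>R (\<beta> *\<^sub>R rl l ?x + \<beta> *\<^sub>R DD l I + (\<beta> * k\<^sup>2) *\<^sub>R EE l I))"
        unfolding sI[OF j, symmetric] accI_def by (rule stage_expansion) (rule LY)
      have split: "k *\<^sub>R (\<Sum>l=1..4. tabI c j l *\<^sub>R (\<beta> *\<^sub>R rl l ?x + \<beta> *\<^sub>R DD l I + (\<beta> * k\<^sup>2) *\<^sub>R EE l I))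
          = (k * \<beta>) *\<^sub>R (\<Sum>l=1..4. tabI c j l *\<^sub>R rl l ?x) + (k * \<beta>) *\<^sub>R (\<Sum>l=1..4. tabI c j l *\<^sub>R DD l I)
            + (k ^ 3 * \<beta>) *\<^sub>R (\<Sum>l=1..4. tabI c j l *\<^sub>R EE l I)"
        unfolding scaleR_add_right sum.distrib scaleR_sum_right scaleR_scaleR
        by (simp add: mult_ac power2_eq_square power3_eq_cube)
      have Q: "Qf ?x t = Ut ?x t - \<beta> *\<^sub>R lapl ?x t" using pde[OF xo t] by simp
      have Yd: "Y j I - Y 1 I = (ca j * k) *\<^sub>R Ut ?x t + ((ca j * k)\<^sup>2 / 2) *\<^sub>R Utt ?x t + ru j ?x
          + k\<^sup>2 *\<^sub>R ((accI j - (ca j)\<^sup>2 / 2) *\<^sub>R Utt ?x t + (accE j - accI j) *\<^sub>R W ?x t)"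
        unfolding Yg[OF j I] Y1 by (simp add: ru_def ys_def p_def q_def)
      have Wt: "\<beta> *\<^sub>R lapt ?x t = Utt ?x t - W ?x t" by (simp add: W_def)
      have main: "Y j I - Y 1 I = (k * ca j) *\<^sub>R Qf ?x t + (k\<^sup>2 * accE j) *\<^sub>R W ?x t
          + ((k * ca j) *\<^sub>R (\<beta> *\<^sub>R lapl ?x t) + (k\<^sup>2 * accI j) *\<^sub>R (\<beta> *\<^sub>R lapt ?x t)) + ru j ?x"
        unfolding Yd Q Wt by (simp add: power_mult_distrib algebra_simps)
      show ?thesis
        unfolding stage_residual_def sum.distrib nE nI split main by (simp add: algebra_simps)
    qed
    note ipx = semi_inner.ip_expand[OF semi_inner_h]
    have dual: "\<bar>inner_h N (stage_residual c \<alpha> \<beta> f N k Y j) g\<bar> \<le> R * k * h\<^sup>2 * (norm2_h N g + grad_norm2_h N (grad_h N g))"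
      if j: "j \<in> {2..4}" and g: "discrete_neumann N g" for j and g :: "'d gridfun"
    proof -
      have j4: "j \<in> {1..4}" using j by auto
      define x y where "x = norm2_h N g" and "y = grad_norm2_h N (grad_h N g)"
      have xy: "x \<ge> 0" "y \<ge> 0" by (simp_all add: x_def y_def)
      define rp where "rp I = ru j (grid_point N I) - k *\<^sub>R (\<Sum>l=1..4. tabE c j l *\<^sub>R rn l I)
          - (k * \<beta>) *\<^sub>R (\<Sum>l=1..4. tabI c j l *\<^sub>R rl l (grid_point N I))" for I
      have rp: "norm (rp I) \<le> b * k ^ 3 + k * (4 * (Cn * h\<^sup>2)) + k * \<beta> * (4 * (?d * b * k\<^sup>2))" if I: "I \<in> grid N" for I
      proof -
        have a: "norm (k *\<^sub>R (\<Sum>l=1..4. tabE c j l *\<^sub>R rn l I)) \<le> k * (4 * (Cn * h\<^sup>2))"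
          using mult_left_mono[OF norm_sum_1_4_le[of "tabE c j" "\<lambda>l. rn l I", OF tableau_bounds(1)[OF coeffs j4] rn_b[OF _ I]], of k] k0 by simp
        have b': "norm ((k * \<beta>) *\<^sub>R (\<Sum>l=1..4. tabI c j l *\<^sub>R rl l (grid_point N I))) \<le> k * \<beta> * (4 * (?d * b * k\<^sup>2))"
          using mult_left_mono[OF norm_sum_1_4_le[of "tabI c j" "\<lambda>l. rl l (grid_point N I)", OF tableau_bounds(2)[OF coeffs j4] rl_b[OF _ gp(2)[OF I]]], of "k * \<beta>"] k0 \<beta> by (simp add: abs_mult)
        show ?thesis unfolding rp_def
          by (rule order_trans[OF norm_triangle_ineq4 add_mono[OF order_trans[OF norm_triangle_ineq4 add_mono[OF ru_b[OF j4 gp(2)[OF I]] a]] b']])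
      qed
      have DDb: "\<bar>inner_h N (DD l) g\<bar> \<le> ?d * b * h\<^sup>2 * (x + y)" if l: "l \<in> {1..4}" for l
        unfolding DD_def x_def y_def
        by (rule lap_h_consistency[OF hN dS(1,2,3,4)[OF s[OF l]] bd(5)[OF _ s[OF l]] bd(6)[OF _ s[OF l]] b_ge(1) bc[OF s[OF l]]])
      have EEb: "\<bar>inner_h N (EE l) g\<bar> \<le> ?d * yb * y" if l: "l \<in> {1..4}" for l
        unfolding EE_def y_def by (rule lap_h_dual_bound[OF hN ys_d[OF t] ys1_b[OF l _ t] yb0 g])
      have s4: "\<bar>inner_h N (\<Sum>l=1..4. tabI c j l *\<^sub>R Z l) g\<bar> \<le> 4 * m"
        if "\<And>l. l \<in> {1..4} \<Longrightarrow> \<bar>inner_h N (Z l) g\<bar> \<le> m" for Z :: "nat \<Rightarrow> 'd gridfun" and m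
      proof -
        have "inner_h N (\<Sum>l=1..4. tabI c j l *\<^sub>R Z l) g = (\<Sum>l=1..4. tabI c j l *\<^sub>R inner_h N (Z l) g)"
          unfolding sum_1_4 by (simp add: ipx)
        then show ?thesis
          using norm_sum_1_4_le[of "tabI c j" "\<lambda>l. inner_h N (Z l) g" m] tableau_bounds(2)[OF coeffs j4] that by simp
      qed
      have comb_apply: "(\<Sum>l=1..4. a l *\<^sub>R Z l) I = (\<Sum>l=1..4. a l *\<^sub>R Z l I)"
        for a :: "nat \<Rightarrow> real" and Z :: "nat \<Rightarrow> 'd gridfun" and I
        unfolding sum_1_4 by simp
      have "inner_h N (stage_residual c \<alpha> \<beta> f N k Y j) g
          = inner_h N (rp - (k * \<beta>) *\<^sub>R (\<Sum>l=1..4. tabI c j l *\<^sub>R DD l) - (k ^ 3 * \<beta>) *\<^sub>R (\<Sum>l=1..4. tabI c j l *\<^sub>R EE l)) g"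
        unfolding inner_h_def
        by (rule arg_cong[where f = "\<lambda>z. (1 / real N) ^ CARD('d) * z"], rule sum.cong[OF refl])
          (simp only: fun_diff_apply scaleR_fun_apply comb_apply res[OF j4] rp_def)
      also have "\<dots> = inner_h N rp g - (k * \<beta>) * inner_h N (\<Sum>l=1..4. tabI c j l *\<^sub>R DD l) g
          - (k ^ 3 * \<beta>) * inner_h N (\<Sum>l=1..4. tabI c j l *\<^sub>R EE l) g"
        by (simp add: ipx)
      finally have eq: "inner_h N (stage_residual c \<alpha> \<beta> f N k Y j) g = inner_h N rp g
          - (k * \<beta>) * inner_h N (\<Sum>l=1..4. tabI c j l *\<^sub>R DD l) g - (k ^ 3 * \<beta>) * inner_h N (\<Sum>l=1..4. tabI c j l *\<^sub>R EE l) g" .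
      have t1: "\<bar>inner_h N rp g\<bar> \<le> (b * k ^ 3 + k * (4 * (Cn * h\<^sup>2)) + k * \<beta> * (4 * (?d * b * k\<^sup>2))) * x"
      proof -
        have "\<bar>inner_h N rp g\<bar> \<le> norm2_h N rp * x"
          unfolding x_def by (rule semi_inner.ip_Cauchy_Schwarz[OF semi_inner_h, unfolded nrm_inner_h])
        also have "\<dots> \<le> (b * k ^ 3 + k * (4 * (Cn * h\<^sup>2)) + k * \<beta> * (4 * (?d * b * k\<^sup>2))) * x"
          using k0 b_ge \<beta> Cn0 by (intro mult_right_mono xy norm2_h_le_sup[OF N] rp) auto
        finally show ?thesis .
      qed
      have t2: "\<bar>(k * \<beta>) * inner_h N (\<Sum>l=1..4. tabI c j l *\<^sub>R DD l) g\<bar> \<le> (k * \<beta>) * (4 * (?d * b * h\<^sup>2 * (x + y)))"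
        unfolding abs_mult[of "k * \<beta>"] using s4[of DD, OF DDb] k0 \<beta> by (simp add: mult_left_mono)
      have t3: "\<bar>(k ^ 3 * \<beta>) * inner_h N (\<Sum>l=1..4. tabI c j l *\<^sub>R EE l) g\<bar> \<le> (k ^ 3 * \<beta>) * (4 * (?d * yb * y))"
        unfolding abs_mult[of "k ^ 3 * \<beta>"] using s4[of EE, OF EEb] k0 \<beta> by (simp add: mult_left_mono)
      \<comment> \<open>The upper refinement bound trades two powers of \<open>k\<close> for
        \<open>h^2\<close>, which also makes up for the missing Neumann condition of the
        corrections: their Laplacians are merely bounded in the dual norm.\<close>
      have k3: "k ^ 3 \<le> k * (C2\<^sup>2 * h\<^sup>2)"
        using mult_left_mono[OF kh, of k] k0 by (simp add: power2_eq_square power3_eq_cube)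
      have "\<bar>inner_h N (stage_residual c \<alpha> \<beta> f N k Y j) g\<bar>
          \<le> (b * k ^ 3 + k * (4 * (Cn * h\<^sup>2)) + k * \<beta> * (4 * (?d * b * k\<^sup>2))) * x
            + (k * \<beta>) * (4 * (?d * b * h\<^sup>2 * (x + y))) + (k ^ 3 * \<beta>) * (4 * (?d * yb * y))"
        unfolding eq using t1 t2 t3 by linarith
      also have "\<dots> = (b * x) * k ^ 3 + 4 * Cn * k * h\<^sup>2 * x + (4 * (\<beta> * (?d * b)) * x) * k ^ 3
            + 4 * \<beta> * (?d * b) * k * h\<^sup>2 * (x + y) + (4 * \<beta> * (?d * yb) * y) * k ^ 3"
        by (simp add: power2_eq_square power3_eq_cube algebra_simps)
      also have "\<dots> \<le> (b * x) * (k * (C2\<^sup>2 * h\<^sup>2)) + 4 * Cn * k * h\<^sup>2 * x + (4 * (\<beta> * (?d * b)) * x) * (k * (C2\<^sup>2 * h\<^sup>2))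
            + 4 * \<beta> * (?d * b) * k * h\<^sup>2 * (x + y) + (4 * \<beta> * (?d * yb) * y) * (k * (C2\<^sup>2 * h\<^sup>2))"
        using xy b_ge \<beta> yb0 by (intro add_mono mult_left_mono k3 order_refl) auto
      also have "\<dots> \<le> R * k * h\<^sup>2 * (x + y)"
      proof -
        have kh0: "0 \<le> k * h\<^sup>2" using k0 by simp
        have "0 \<le> (b * C2\<^sup>2) * (k * h\<^sup>2 * y)" "0 \<le> Cn * (k * h\<^sup>2 * y)" "0 \<le> (\<beta> * (?d * b)) * C2\<^sup>2 * (k * h\<^sup>2 * y)"
          "0 \<le> (\<beta> * (?d * yb)) * C2\<^sup>2 * (k * h\<^sup>2 * x)"
          using kh0 xy b_ge \<beta> yb0 Cn0 k0 by simp_all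
        then show ?thesis by (simp add: R_def algebra_simps)
      qed
      finally show ?thesis by (simp add: x_def y_def)
    qed
    have final: "norm (Y 5 I - Y 4 I - k *\<^sub>R (\<Sum>l=1..4. (wt c l - tabE c 4 l) *\<^sub>R N_h \<alpha> \<beta> f N (Y l) I)) \<le> R * k * h\<^sup>2"
      if I: "I \<in> grid N" for I
    proof -
      let ?x = "grid_point N I"
      \<comment> \<open>With \<open>ca 4 = 1\<close> this gives \<open>p 4 = 0\<close>, so
        \<open>Y 5 - Y 4\<close> is the multiple \<open>k^2 (1/2 - accE 4)\<close> of
        \<open>W\<close>, exactly the second-order contribution of the explicit terms between stage
        4 and the end value.\<close>
      have AI4: "accI 4 = 1/2"
      proof -
        have "accI 4 = (\<Sum>l=1..4. wt c l * ca l)" unfolding accI_def sum_1_4 by (simp only: tableau_values)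
        then show ?thesis using abscissae(5)[OF coeffs] by (simp add: ca_def)
      qed
      have w0: "(\<Sum>l=1..4. wt c l - tabE c 4 l) = 0"
        unfolding sum_subtractf sE using abscissae(6)[OF coeffs] ca14 by simp
      have wc: "(\<Sum>l=1..4. (wt c l - tabE c 4 l) * ca l) = 1/2 - accE 4"
        unfolding left_diff_distrib sum_subtractf accE_def using abscissae(5)[OF coeffs] by (simp add: ca_def)
      have "k *\<^sub>R (\<Sum>l=1..4. (wt c l - tabE c 4 l) *\<^sub>R N_h \<alpha> \<beta> f N (Y l) I)
          = (\<Sum>l=1..4. ((wt c l - tabE c 4 l) * k) *\<^sub>R N_h \<alpha> \<beta> f N (Y l) I)"
        by (simp add: scaleR_sum_right mult.commute)
      also have "\<dots> = (k * 0) *\<^sub>R Qf ?x t + (k\<^sup>2 * (1/2 - accE 4)) *\<^sub>R W ?x t + k *\<^sub>R (\<Sum>l=1..4. (wt c l - tabE c 4 l) *\<^sub>R rn l I)"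
        unfolding w0[symmetric] wc[symmetric] by (rule stage_expansion) (simp add: rn_def)
      finally have n: "k *\<^sub>R (\<Sum>l=1..4. (wt c l - tabE c 4 l) *\<^sub>R N_h \<alpha> \<beta> f N (Y l) I)
          = (k\<^sup>2 * (1/2 - accE 4)) *\<^sub>R W ?x t + k *\<^sub>R (\<Sum>l=1..4. (wt c l - tabE c 4 l) *\<^sub>R rn l I)" by simp
      have "Y 5 I - Y 4 I = - (k\<^sup>2 *\<^sub>R ys 4 ?x t)"
        using Yg[of 4 I, unfolded s_def ca14] I by (simp add: Y_def P_h_grid[OF hN I])
      also have "\<dots> = (k\<^sup>2 * (1/2 - accE 4)) *\<^sub>R W ?x t"
        by (simp add: ys_def p_def q_def AI4 ca14 algebra_simps)
      finally have "Y 5 I - Y 4 I - k *\<^sub>R (\<Sum>l=1..4. (wt c l - tabE c 4 l) *\<^sub>R N_h \<alpha> \<beta> f N (Y l) I)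
          = - (k *\<^sub>R (\<Sum>l=1..4. (wt c l - tabE c 4 l) *\<^sub>R rn l I))"
        unfolding n by simp
      also have "norm \<dots> \<le> k * (4 * (Cn * h\<^sup>2))"
        using mult_left_mono[OF norm_sum_1_4_le[of "\<lambda>l. wt c l - tabE c 4 l" "\<lambda>l. rn l I", OF tableau_bounds(3)[OF coeffs _] rn_b[OF _ I]], of 4 k] k0 by simp
      also have "\<dots> \<le> R * k * h\<^sup>2"
        using mult_right_mono[OF R_ge, of "k * h\<^sup>2"] k0 by (simp add: mult_ac)
      finally show ?thesis .
    qed
    have neu: "discrete_neumann N (Y j)" for j unfolding Y_def by (auto intro: P_h_neumann[OF hN])
    have Y1: "Y 1 = P_h N (\<lambda>x. \<Phi> x t)" using Yj[OF one] unfolding ys_1 s_def ca14 by (simp only: mult_zero_left scaleR_zero_right add_0_right)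
    show "\<exists>Y. comparison c \<alpha> (\<alpha> * \<epsilon>) f N k B R Y \<and> Y 1 = P_h N (\<lambda>x. \<Phi> x (real n * k)) \<and>
      Y 5 = P_h N (\<lambda>x. \<Phi> x (real (Suc n) * k))"
    proof (intro exI[of _ Y] conjI)
      show "comparison c \<alpha> (\<alpha> * \<epsilon>) f N k B R Y"
        unfolding comparison_def \<beta>_def[symmetric] h_def[symmetric]
        using neu Ybound Ygrad dual final by blast
      show "Y 1 = P_h N (\<lambda>x. \<Phi> x (real n * k))" using Y1 by (simp add: t_def)
      show "Y 5 = P_h N (\<lambda>x. \<Phi> x (real (Suc n) * k))" by (simp add: Y_def t_def algebra_simps)
    qed
  qed
qed


section \<open>Convergence\<close>

lemma discrete_gronwall:
  fixes L :: "nat \<Rightarrow> real"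
  assumes step: "L (Suc n) \<le> (1 + x) * L n + y" and hyp: "L n \<le> (1 + x) ^ n * (A + real n * y)"
    and nonneg: "x \<ge> 0" "y \<ge> 0"
  shows "L (Suc n) \<le> (1 + x) ^ Suc n * (A + real (Suc n) * y)"
proof -
  have "(1 + x) * L n \<le> (1 + x) * ((1 + x) ^ n * (A + real n * y))"
    using nonneg by (intro mult_left_mono hyp) simp
  moreover have "1 * y \<le> (1 + x) ^ Suc n * y"
    using nonneg by (intro mult_right_mono one_le_power) simp_all
  moreover have "(1 + x) ^ Suc n * (A + real (Suc n) * y) = (1 + x) * ((1 + x) ^ n * (A + real n * y)) + (1 + x) ^ Suc n * y"
    by (simp add: algebra_simps)
  ultimately show ?thesis using step by linarith
qed

text \<open>Base case of the induction: the initial error solves no implicit equation, but its order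
  \<open>h^4\<close> survives two inverse inequalities. The maximum of \<open>u\<close> is at most
  \<open>A h^2\<close> since \<open>N^3 h^8 \<le> h^4\<close>, and its gradient at most
  \<open>2 A h\<close>.\<close>

lemma gradient_le_1:
  fixes u :: "('d::finite) gridfun"
  assumes N: "N \<ge> 1" and dim: "CARD('d) \<le> 3" and u: "discrete_neumann N u" and A: "A \<ge> 0"
    and small: "norm2_h N u \<le> A * (1 / real N) ^ 4" "2 * A * (1 / real N) \<le> 1" and I: "I \<in> midpoints N i"
  shows "norm (grad_h N u i I) \<le> 1"
proof -
  define h where "h = 1 / real N"
  have h: "0 < h" "h \<le> 1" "real N * h = 1" using N by (simp_all add: h_def)
  have "norm (u J) \<le> A * h\<^sup>2" if J: "J \<in> grid N" for J
  proof (rule power2_le_imp_le)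
    have "(norm (u J))\<^sup>2 \<le> real N ^ CARD('d) * (norm2_h N u)\<^sup>2" by (rule sup_le_norm2_h[OF N J])
    also have "\<dots> \<le> real N ^ 3 * (A * h ^ 4)\<^sup>2"
      using small(1) N dim by (intro mult_mono power_mono power_increasing) (simp_all add: h_def)
    also have "\<dots> = A\<^sup>2 * (real N * h) ^ 3 * h ^ 5" by (simp add: power_mult_distrib power_mult[symmetric] power_add[symmetric] mult_ac)
    also have "\<dots> \<le> A\<^sup>2 * h ^ 4" using h power_decreasing[of 4 5 h] by (simp add: mult_left_mono)
    finally show "(norm (u J))\<^sup>2 \<le> (A * h\<^sup>2)\<^sup>2" by (simp add: power_mult_distrib power_mult[symmetric])
  qed (use A in simp)
  then have "norm (grad_h N u i I) \<le> 2 * real N * (A * h\<^sup>2)" using A by (intro grad_h_le_sup[OF u I]) auto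
  also have "\<dots> = 2 * A * h * (real N * h)" by (simp add: power2_eq_square)
  also have "\<dots> \<le> 1" using h small(2) by (simp add: h_def[symmetric])
  finally show ?thesis .
qed

theorem convergence:
  fixes c :: imex_coeffs and \<alpha> \<epsilon> T C1 C2 F :: real and f :: "real^'d::finite \<Rightarrow> real^3"
    and m :: "nat \<Rightarrow> real \<Rightarrow> nat \<Rightarrow> 'd gridfun"
  assumes dim: "CARD('d) \<le> 3" and coeffs: "scheme_coeffs c"
    and pos: "\<alpha> > 0" "\<epsilon> > 0" "T > 0" "C1 > 0" "C2 > 0"
    and F: "F \<ge> 0" "\<And>x. x \<in> Omega_bar \<Longrightarrow> norm (f x) \<le> F"
    and sol: "exact_solution 4 \<alpha> \<epsilon> f T \<Phi>" and num: "numerical_solution c \<alpha> (\<alpha> * \<epsilon>) f m"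
    and init: "initial_error_h4 C1 C2 \<Phi> m"
  shows "\<exists>C>0. for_small C1 C2 (\<lambda>N k. \<forall>n\<le>nat \<lfloor>T / k\<rfloor>. error_h \<Phi> m N k n \<le> C * (1 / real N)\<^sup>2)"
proof -
  obtain B R where BR: "B \<ge> 0" "R \<ge> 0" and cmp: "\<And>N k n. N \<ge> 1 \<Longrightarrow> 0 < k \<Longrightarrow> k \<le> 1 \<Longrightarrow> k \<le> C2 * (1 / real N) \<Longrightarrow>
      real (Suc n) * k \<le> T \<Longrightarrow> \<exists>Y. comparison c \<alpha> (\<alpha> * \<epsilon>) f N k B R Y \<and>
        Y 1 = P_h N (\<lambda>x. \<Phi> x (real n * k)) \<and> Y 5 = P_h N (\<lambda>x. \<Phi> x (real (Suc n) * k))"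
    using comparison_exists[OF coeffs pos(1,2,3,5) F(2) sol] by metis
  have "\<alpha> * \<epsilon> > 0" using pos by simp
  from one_step_stability[OF dim coeffs pos(1) this pos(4,5) BR F(1), of f]
  obtain \<theta> \<Lambda> where \<theta>: "\<theta> > 0" and \<Lambda>: "\<Lambda> \<ge> 0"
    and stab: "\<And>K. K \<ge> 0 \<Longrightarrow> \<exists>\<delta>>0. one_step_stable c \<alpha> (\<alpha> * \<epsilon>) f C1 C2 B R F \<theta> \<Lambda> K \<delta>"
    by blast
  obtain K0 \<delta>0 where \<delta>0: "\<delta>0 > 0" and e0: "\<And>N k. N \<ge> 1 \<Longrightarrow> 1 / real N < \<delta>0 \<Longrightarrow> 0 < k \<Longrightarrow> k < \<delta>0 \<Longrightarrow>
      C1 * (1 / real N) \<le> k \<Longrightarrow> k \<le> C2 * (1 / real N) \<Longrightarrow> error_h \<Phi> m N k 0 \<le> K0 * (1 / real N) ^ 4"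
    using init unfolding initial_error_h4_def for_small_def by metis
  define A where "A = (1 + \<theta>) * K0\<^sup>2"
  \<comment> \<open>The Gronwall bound for the whole interval, fixed before the mesh restriction
    \<open>\<delta>1\<close> is drawn from it. This is not circular, because \<open>\<theta>\<close>
    and \<open>\<Lambda>\<close> were obtained before \<open>K\<close>.\<close>
  define K where "K = exp (\<Lambda> * T) * (A + \<Lambda> * T)"
  have A0: "A \<ge> 0" using \<theta> by (simp add: A_def)
  have K0: "K \<ge> 0" using A0 \<Lambda> pos by (simp add: K_def)
  obtain \<delta>1 where \<delta>1: "\<delta>1 > 0" and "one_step_stable c \<alpha> (\<alpha> * \<epsilon>) f C1 C2 B R F \<theta> \<Lambda> K \<delta>1" using stab[OF K0] by blast
  note stab1 = this(2)[unfolded one_step_stable_def, rule_format]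
  define \<delta> where "\<delta> = min (min \<delta>0 \<delta>1) (min 1 (1 / (2 * \<bar>K0\<bar> + 1)))"
  have \<delta>: "\<delta> > 0" using \<delta>0 \<delta>1 by (simp add: \<delta>_def)
  define C where "C = sqrt K + sqrt (K / \<theta>) + 1"
  have C0: "C > 0" using K0 \<theta> by (simp add: C_def add_nonneg_pos)
  have main: "error_h \<Phi> m N k n \<le> C * (1 / real N)\<^sup>2"
    if N: "N \<ge> 1" and small: "1 / real N < \<delta>" "k < \<delta>" and k0: "0 < k"
      and C1: "C1 * (1 / real N) \<le> k" and C2: "k \<le> C2 * (1 / real N)" and n: "n \<le> nat \<lfloor>T / k\<rfloor>" for N n k
  proof -
    define h where "h = 1 / real N"
    have h: "0 < h" "h \<le> 1" using N by (simp_all add: h_def)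
    define e where "e j = P_h N (\<lambda>x. \<Phi> x (real j * k)) - m N k j" for j
    define y where "y = \<Lambda> * k * h ^ 4"
    have e_err: "error_h \<Phi> m N k j = norm2_h N (e j) + sqrt (k * (grad_norm2_h N (grad_h N (e j)))\<^sup>2)" for j
      unfolding error_h_def energy_norm_h_def e_def fun_diff_def ..
    have \<delta>s: "1 / real N < \<delta>0" "k < \<delta>0" "1 / real N < \<delta>1" "k < \<delta>1" "k \<le> 1" "h < 1 / (2 * \<bar>K0\<bar> + 1)"
      using small unfolding \<delta>_def h_def by linarith+
    have err0: "norm2_h N (e 0) + sqrt (k * (grad_norm2_h N (grad_h N (e 0)))\<^sup>2) \<le> \<bar>K0\<bar> * h ^ 4"
    proof -
      have "error_h \<Phi> m N k 0 \<le> K0 * h ^ 4" unfolding h_def by (rule e0[OF N \<delta>s(1) k0 \<delta>s(2) C1 C2])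
      also have "\<dots> \<le> \<bar>K0\<bar> * h ^ 4" using h by (intro mult_right_mono) auto
      finally show ?thesis by (simp add: e_err)
    qed
    have sq0: "0 \<le> sqrt (k * (grad_norm2_h N (grad_h N (e 0)))\<^sup>2)" using k0 by simp
    have n0: "norm2_h N (e 0) \<le> \<bar>K0\<bar> * h ^ 4" using err0 sq0 by linarith
    have g0: "sqrt (k * (grad_norm2_h N (grad_h N (e 0)))\<^sup>2) \<le> \<bar>K0\<bar> * h ^ 4"
      using err0 norm2_h_nonneg[of N "e 0"] by linarith
    have h8: "(\<bar>K0\<bar> * h ^ 4)\<^sup>2 \<le> K0\<^sup>2 * h ^ 4"
      using h power_decreasing[of 4 8 h] by (simp add: power_mult_distrib power_mult[symmetric] mult_left_mono)
    have L0: "lyapunov \<theta> N k (e 0) \<le> A * h ^ 4"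
    proof -
      have "(norm2_h N (e 0))\<^sup>2 \<le> K0\<^sup>2 * h ^ 4" by (rule order_trans[OF power_mono[OF n0 norm2_h_nonneg] h8])
      moreover have "k * (grad_norm2_h N (grad_h N (e 0)))\<^sup>2 \<le> K0\<^sup>2 * h ^ 4"
        using order_trans[OF power_mono[OF g0 sq0] h8] k0 by simp
      ultimately have "lyapunov \<theta> N k (e 0) \<le> K0\<^sup>2 * h ^ 4 + \<theta> * (K0\<^sup>2 * h ^ 4)"
        unfolding lyapunov_def using \<theta> by (intro add_mono mult_left_mono) simp_all
      then show ?thesis by (simp add: A_def algebra_simps)
    qed
    have neu: "discrete_neumann N (e 0)"
    proof -
      have "discrete_neumann N (m N k 0)" using num N k0 by (simp add: numerical_solution_def)
      then show ?thesis using P_h_neumann[OF N refl, of "\<lambda>x. \<Phi> x (real 0 * k)"] by (simp add: e_def discrete_neumann_def)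
    qed
    have G0: "norm (grad_h N (e 0) i I) \<le> 1" if "I \<in> midpoints N i" for i I
    proof (rule gradient_le_1[OF N dim neu _ n0[unfolded h_def] _ that])
      show "2 * \<bar>K0\<bar> * (1 / real N) \<le> 1"
        using \<delta>s(6) h by (simp add: h_def[symmetric] field_simps)
    qed simp
    have y0: "y \<ge> 0" using \<Lambda> k0 h by (simp add: y_def)
    have bound: "(1 + \<Lambda> * k) ^ j * (A * h ^ 4 + real j * y) \<le> K * h ^ 4" if j: "real j * k \<le> T" for j
    proof -
      have "(1 + \<Lambda> * k) ^ j \<le> exp (\<Lambda> * k) ^ j" using \<Lambda> k0 by (intro power_mono exp_ge_add_one_self) simp
      also have "\<dots> = exp (\<Lambda> * (real j * k))" by (simp add: exp_of_nat_mult[symmetric] mult_ac)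
      also have "\<dots> \<le> exp (\<Lambda> * T)" using mult_left_mono[OF j \<Lambda>] by simp
      finally have p: "(1 + \<Lambda> * k) ^ j \<le> exp (\<Lambda> * T)" .
      have "real j * y = \<Lambda> * (real j * k) * h ^ 4" by (simp add: y_def)
      also have "\<dots> \<le> \<Lambda> * T * h ^ 4" using h by (intro mult_right_mono mult_left_mono j \<Lambda>) simp
      finally have q: "A * h ^ 4 + real j * y \<le> (A + \<Lambda> * T) * h ^ 4" by (simp add: distrib_right)
      show ?thesis unfolding K_def mult.assoc
        using A0 h y0 by (intro mult_mono p q) simp_all
    qed
    \<comment> \<open>Both statements are hypotheses of the next step: \<open>bound\<close> turns
      the first into \<open>K h^4\<close>, and the second is returned unchanged, so the same
      restriction on \<open>h\<close> and \<open>k\<close> works for all steps.\<close>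
    have ind: "lyapunov \<theta> N k (e j) \<le> (1 + \<Lambda> * k) ^ j * (A * h ^ 4 + real j * y) \<and>
        (\<forall>i. \<forall>I\<in>midpoints N i. norm (grad_h N (e j) i I) \<le> 1)" if "real j * k \<le> T" for j
      using that
    proof (induction j)
      case 0
      then show ?case using L0 G0 by simp
    next
      case (Suc j)
      have jk: "real j * k \<le> T" using Suc.prems k0 by (simp add: distrib_right)
      note IH = Suc.IH[OF jk]
      obtain Y where Y: "comparison c \<alpha> (\<alpha> * \<epsilon>) f N k B R Y" "Y 1 = P_h N (\<lambda>x. \<Phi> x (real j * k))"
        "Y 5 = P_h N (\<lambda>x. \<Phi> x (real (Suc j) * k))"
        using cmp[OF N k0 \<delta>s(5) C2 Suc.prems] by blast
      have "imex_step c \<alpha> (\<alpha> * \<epsilon>) f N k (m N k j) (m N k (Suc j))"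
        using num N k0 unfolding numerical_solution_def by blast
      then obtain w where w: "imex_stages c \<alpha> (\<alpha> * \<epsilon>) f N k (m N k j) w" and v: "discrete_neumann N (m N k (Suc j))"
        "\<And>I. I \<in> grid N \<Longrightarrow> m N k (Suc j) I = w 1 I + (\<Sum>j=1..4. (wt c j * k) *\<^sub>R N_h \<alpha> (\<alpha> * \<epsilon>) f N (w j) I + (wt c j * k) *\<^sub>R L_h (\<alpha> * \<epsilon>) N (w j) I)"
        unfolding imex_step_def by blast
      have w1: "w 1 = m N k j" using w by (simp only: imex_stages_def)
      have d1: "Y 1 - w 1 = e j" by (simp only: Y(2) w1 e_def)
      have d5: "Y 5 - m N k (Suc j) = e (Suc j)" by (simp only: Y(3) e_def)
      have Fb: "norm (f (grid_point N I)) \<le> F" if "I \<in> grid N" for I using that F(2) grid_point_in(2)[OF N refl] by blast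
      have LK: "lyapunov \<theta> N k (e j) \<le> K * (1 / real N) ^ 4"
        using IH bound[OF jk] unfolding h_def by linarith
      have "lyapunov \<theta> N k (e (Suc j)) \<le> (1 + \<Lambda> * k) * lyapunov \<theta> N k (e j) + \<Lambda> * k * (1 / real N) ^ 4 \<and>
          (\<forall>i. \<forall>I\<in>midpoints N i. norm (grad_h N (e (Suc j)) i I) \<le> 1)"
        by (rule stab1[OF N \<delta>s(3,4) C1 C2 _ Y(1) w[folded w1] v(1), unfolded d1 d5])
          (erule Fb v(2) conjunct2[OF IH, rule_format] | rule LK)+
      then have step: "lyapunov \<theta> N k (e (Suc j)) \<le> (1 + \<Lambda> * k) * lyapunov \<theta> N k (e j) + y"
        "\<forall>i. \<forall>I\<in>midpoints N i. norm (grad_h N (e (Suc j)) i I) \<le> 1" by (simp_all add: y_def h_def)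
      show ?case
        using discrete_gronwall[where L = "\<lambda>j. lyapunov \<theta> N k (e j)", OF step(1) conjunct1[OF IH] _ y0] step(2) \<Lambda> k0 by simp
    qed
    have "real n \<le> T / k" using n k0 pos by (simp add: le_nat_floor le_nat_iff le_floor_iff)
    then have nk: "real n * k \<le> T" using k0 by (simp add: field_simps)
    define p q where "p = norm2_h N (e n)" and "q = k * (grad_norm2_h N (grad_h N (e n)))\<^sup>2"
    have pq: "p \<ge> 0" "q \<ge> 0" using k0 by (simp_all add: p_def q_def)
    have "lyapunov \<theta> N k (e n) \<le> K * h ^ 4" using ind[OF nk] bound[OF nk] by linarith
    then have L: "p\<^sup>2 + \<theta> * q \<le> K * h ^ 4" by (simp add: lyapunov_def p_def q_def)
    have h4: "sqrt (h ^ 4) = h\<^sup>2" using h by (simp add: real_sqrt_power[symmetric] power_mult[symmetric] real_sqrt_unique)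
    have "0 \<le> \<theta> * q" using \<theta> pq by simp
    then have "p\<^sup>2 \<le> K * h ^ 4" using L by linarith
    then have "sqrt (p\<^sup>2) \<le> sqrt (K * h ^ 4)" by (rule real_sqrt_le_mono)
    then have p: "p \<le> sqrt K * h\<^sup>2" using pq h4 by (simp add: real_sqrt_mult)
    have "\<theta> * q \<le> K * h ^ 4" using L by (smt (verit) zero_le_power2)
    then have "q \<le> (K / \<theta>) * h ^ 4" using \<theta> by (simp add: field_simps)
    then have "sqrt q \<le> sqrt ((K / \<theta>) * h ^ 4)" by (rule real_sqrt_le_mono)
    then have q: "sqrt q \<le> sqrt (K / \<theta>) * h\<^sup>2" unfolding real_sqrt_mult h4 .
    have "error_h \<Phi> m N k n = p + sqrt q" by (simp add: e_err p_def q_def)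
    also have "\<dots> \<le> (sqrt K + sqrt (K / \<theta>)) * h\<^sup>2" using p q by (simp add: distrib_right)
    also have "\<dots> \<le> C * h\<^sup>2" unfolding C_def by (intro mult_right_mono) simp_all
    finally show ?thesis by (simp add: h_def)
  qed
  show ?thesis unfolding for_small_def using C0 \<delta> main by blast
qed

theorem theorem5p1:
  fixes c :: imex_coeffs
  assumes dim: "CARD('d::finite) \<in> {1, 2, 3}"
    and coeffs: "scheme_coeffs c"
  shows "\<exists>(r::nat) (C'::real \<Rightarrow> real).
    (\<forall>M>0. C' M > 0) \<and>
    (\<forall>(\<alpha>::real) (\<epsilon>::real) (T::real) (C1::real) (C2::real)
       (f :: real^'d \<Rightarrow> real^3) (\<Phi> :: real^'d \<Rightarrow> real \<Rightarrow> real^3)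
       (\<Phi>1 :: real^'d \<Rightarrow> real \<Rightarrow> real^3) (m :: nat \<Rightarrow> real \<Rightarrow> nat \<Rightarrow> 'd gridfun)
       (Cs::real) (M::real).
       \<alpha> > 0 \<longrightarrow> \<epsilon> > 0 \<longrightarrow> T > 0 \<longrightarrow> C1 > 0 \<longrightarrow> C2 > 0 \<longrightarrow>
       external_field f \<longrightarrow>
       exact_solution r \<alpha> \<epsilon> f T \<Phi> \<longrightarrow>
       correction \<alpha> (\<alpha> * \<epsilon>) f T \<Phi> \<Phi>1 \<longrightarrow>
       stage_gradient_bound c \<alpha> (\<alpha> * \<epsilon>) f T C1 C2 \<Phi> \<Phi>1 Cs \<longrightarrow>
       lipschitz_constant r c \<alpha> \<epsilon> f Cs (Cs + 1) M \<longrightarrow>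
       numerical_solution c \<alpha> (\<alpha> * \<epsilon>) f m \<longrightarrow>
       initial_error_h4 C1 C2 \<Phi> m \<longrightarrow>
       (\<exists>C>0. for_small C1 C2 (\<lambda>N k. k \<le> C' M * (1 / real N) \<longrightarrow>
          (\<forall>n\<in>{1..nat \<lfloor>T / k\<rfloor>}. error_h \<Phi> m N k n \<le> C * (k^3 + (1 / real N)^2)))))"
\<comment> \<open>Four orders of smoothness are what the comparison stages use. The ratio
  \<open>k / h\<close> enters the constants only through \<open>C1\<close> and \<open>C2\<close>,
  which makes the constant function 1 an admissible \<open>C'\<close>.\<close>
proof (rule exI[of _ 4], rule exI[of _ "\<lambda>_. 1"], intro conjI allI impI)
  fix \<alpha> \<epsilon> T C1 C2 :: real and f :: "real^'d \<Rightarrow> real^3" and \<Phi> \<Phi>1 :: "real^'d \<Rightarrow> real \<Rightarrow> real^3"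
    and m :: "nat \<Rightarrow> real \<Rightarrow> nat \<Rightarrow> 'd gridfun"
  assume pos: "\<alpha> > 0" "\<epsilon> > 0" "T > 0" "C1 > 0" "C2 > 0" and f: "external_field f"
    and sol: "exact_solution 4 \<alpha> \<epsilon> f T \<Phi>" and num: "numerical_solution c \<alpha> (\<alpha> * \<epsilon>) f m"
    and init: "initial_error_h4 C1 C2 \<Phi> m"
  have dim3: "CARD('d) \<le> 3" using dim by auto
  obtain C0 where C0: "\<And>x. x \<in> Omega_bar \<Longrightarrow> infnorm (f x) \<le> C0" using f unfolding external_field_def by blast
  define F where "F = sqrt (real DIM(real^3)) * \<bar>C0\<bar>"
  have F: "norm (f x) \<le> F" if "x \<in> Omega_bar" for x
  proof -
    have "norm (f x) \<le> sqrt (real DIM(real^3)) * infnorm (f x)" by (rule norm_le_infnorm)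
    also have "\<dots> \<le> F" unfolding F_def using C0[OF that] by (intro mult_left_mono) auto
    finally show ?thesis .
  qed
  have "F \<ge> 0" by (simp add: F_def)
  from convergence[OF dim3 coeffs pos this F sol num init]
  obtain C where C: "C > 0" and conv: "for_small C1 C2 (\<lambda>N k. \<forall>n\<le>nat \<lfloor>T / k\<rfloor>. error_h \<Phi> m N k n \<le> C * (1 / real N)\<^sup>2)"
    by blast
  then obtain \<delta> where \<delta>: "\<delta> > 0" "\<And>N k n. N \<ge> 1 \<Longrightarrow> 1 / real N < \<delta> \<Longrightarrow> 0 < k \<Longrightarrow> k < \<delta> \<Longrightarrow>
      C1 * (1 / real N) \<le> k \<Longrightarrow> k \<le> C2 * (1 / real N) \<Longrightarrow> n \<le> nat \<lfloor>T / k\<rfloor> \<Longrightarrow> error_h \<Phi> m N k n \<le> C * (1 / real N)\<^sup>2"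
    unfolding for_small_def by blast
  show "\<exists>C>0. for_small C1 C2 (\<lambda>N k. k \<le> 1 * (1 / real N) \<longrightarrow>
      (\<forall>n\<in>{1..nat \<lfloor>T / k\<rfloor>}. error_h \<Phi> m N k n \<le> C * (k^3 + (1 / real N)^2)))"
    unfolding for_small_def
  proof (rule exI[of _ C], rule conjI[OF C], rule exI[of _ \<delta>], rule conjI[OF \<delta>(1)], intro allI impI ballI)
    fix N n :: nat and k :: real
    assume k: "0 < k" "k < \<delta>" and N: "N \<ge> 1" "1 / real N < \<delta>" and "C1 * (1 / real N) \<le> k" "k \<le> C2 * (1 / real N)"
      and n: "n \<in> {1..nat \<lfloor>T / k\<rfloor>}"
    then have "error_h \<Phi> m N k n \<le> C * (1 / real N)\<^sup>2" by (intro \<delta>(2)) simp_all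
    also have "\<dots> \<le> C * (k ^ 3 + (1 / real N)\<^sup>2)" using C k by (intro mult_left_mono) simp_all
    finally show "error_h \<Phi> m N k n \<le> C * (k ^ 3 + (1 / real N)\<^sup>2)" .
  qed
qed simp

end
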